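(* Let $f:[0,1]\to[0,1]$ be a pm-map. Then there exist an at most countable family of pairs of basic and $\Omega$-basic sets $\{B_i\subset B'_i\}$ and a family of triples of solenoidal sets $\{S^{(\alpha)}\subset S^{(\alpha)}_\Omega\subset Q^{(\alpha)}\}_{\alpha\in A}$ such that: 1) $\Omega(f)=X_f\cup(\bigcup_\alpha S^{(\alpha)}_\Omega)\cup(\bigcup_iB'_i)$; 2) $\omega(f)=\overline{\mathrm{Per}\,f}=X_f\cup(\bigcup_\alpha S^{(\alpha)})\cup(\bigcup_iB_i)$; 3) $\mathrm{card}\,A\le\mathrm{card}\,C(f)$; 4) $S^{(\alpha)}=S^{(\alpha)}_p=S^{(\alpha)}_\omega$ for any $\alpha\in A$; 5) intersections in this decomposition are only possible between different basic or $\Omega$-basic sets; the intersection of any three such sets is empty and the intersection of any two is finite (intersections between a basic and an $\Omega$-basic set with the same subscript, and between solenoidal sets with the same superscript, are not taken into account); 6) there exist a finite number of pairwise disjoint subsets $\{D^i\}_{i=1}^k,\{F_j\}_{j=1}^l$ of $C(f)$, a finite collection of basic sets $\{\widetilde B_r\}_{r=1}^R$ and a finite collection of cycles of intervals $\{\mathrm{orb}\,K_j\}_{j=1}^l$ with the following properties: a) for any $i$, $1\le i\le k$, the family $G(D^i)$ is an infinite chain $B^i_1\succ B^i_2\succ\cdots$ of basic sets $B^i_n=B(\mathrm{orb}\,I^i_n,f)$ with periods $p^i_1<p^i_2<\cdots$, and $Q(D^i)=\bigcap_n\mathrm{orb}\,I^i_n$ is a solenoidal set with the corresponding group $H(p^i_1,p^i_2,\dots)$;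 b) $f|B^i_n$ is semiconjugate to a one-sided shift in a topological Markov chain and the semiconjugation is at most 2-to-1; c) if $i\ne j$, $B\in G(D^i)$, $\widehat B\in G(D^j)$, then neither $B\succ\widehat B$ nor $\widehat B\succ B$; d) all basic sets of $f$ are $\{\widetilde B_r\}_{r=1}^R\cup\bigcup_{i=1}^k\{B^i_n\}_{n=1}^\infty$; e) for any $j$, $1\le j\le l$, the cycle of intervals $\mathrm{orb}\,K_j$ has period $N_j$, there exists a unique solenoidal set $Q_j\subset\mathrm{orb}\,K_j$ (of the form $\bigcap\mathrm{orb}\,I_n$ for generating intervals $I_n$), $h(f|\mathrm{orb}\,K_j)=0$, $\mathrm{orb}\,K_j\cap C(f)=F_j\subset Q_j\subset\mathrm{orb}\,K_j$, and the group corresponding to $Q_j$ is $H(N_j,2N_j,4N_j,\dots)$; f) $\{Q(D^i)\}_{i=1}^k\cup\{Q_j\}_{j=1}^l=\{Q^{(\alpha)}\}_{\alpha\in A}$; g) there exists a countable set of pairwise disjoint cycles of intervals $\{\mathrm{orb}\,L_j\}$ (perhaps some of them degenerate) such that $C(f)\cap\mathrm{int}(\mathrm{orb}\,L_j)=\emptyset$ for all $j$ and $X_f\subset\bigcup_j\mathrm{orb}\,L_j$.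
   Context: A pm-map (piecewise-monotone map) is a continuous $f:[0,1]\to[0,1]$ for which there are $n\ge0$ and points $0=c_0<c_1<\dots<c_{n+1}=1$ such that, for each $0\le k\le n$, $f$ is (non-strictly) monotone on $[c_k,c_{k+1}]$ and $f[c_k,c_{k+1}]$ is not a point; $c_1,\dots,c_n$ are the turning points and $C(f)=\{c_1,\dots,c_n\}$. $\omega(x)$ is the set of limit points of the forward orbit of $x$; $\omega(f)=\bigcup_x\omega(x)$; $\mathrm{Per}\,f$ is the set of periodic points; $\Omega(f)$ is the set of non-wandering points; $h$ is topological entropy. A cycle is the orbit of a periodic point; $X_f$ is the union of all cycles that are maximal by inclusion among the limit sets $\omega(x)$. A closed interval $I$ is periodic of period $m$ if $I,fI,\dots,f^{m-1}I$ are pairwise disjoint and $f^mI=I$; then $\mathrm{orb}\,I=\bigcup_{i=0}^{m-1}f^iI$ is a cycle of intervals of period $m$. For a set $U$, $\mathrm{orb}\,U=\bigcup_{i\ge0}f^iU$. Solenoidal sets: generating intervals are periodic intervals $I_0\supset I_1\supset\cdots$ with periods $m_j\to\infty$; $Q=\bigcap_j\mathrm{orb}\,I_j$; closed invariant subsets of such $Q$ are called solenoidal. Put $S_p=Q\cap\overline{\mathrm{Per}\,f}$, $S_\omega=Q\cap\omega(f)$, $S_\Omega=Q\cap\Omega(f)$; $S$ is the unique set with $\omega(x)=S$ for all $x\in Q$. The superscript $(\alpha)$ refers to these sets for one $Q=Q^{(\alpha)}$. The group corresponding to $Q$ (obtained from generating intervals with periods $m_0,m_1,\dots$) is $H(m_0,m_1,\dots)=\{(r_0,r_1,\dots)\in\prod_j\mathbb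 Z_{m_j}:r_{j+1}\equiv r_j\pmod{m_j}\ \forall j\}$. Basic sets: with $M=\mathrm{orb}\,I$, the set $\{x\in M:\overline{\mathrm{orb}\,U}=M$ for every relative neighborhood $U$ of $x$ in $M\}$, if infinite, is called a basic set and denoted $B(\mathrm{orb}\,I,f)$; its period is the period of $I$. For a basic set $B=B(\mathrm{orb}\,I,f)$ let $A_B$ be the set of endpoints $x$ of intervals of $\mathrm{orb}\,I$ such that $x\in\Omega(f)$, there is $n\ge0$ with $f^nx\in B$, and if $m$ is the least such integer then $x,\dots,f^{m-1}x\notin\mathrm{int}(\mathrm{orb}\,I)$; the corresponding $\Omega$-basic set is $B'=B\cup A_B$, and $B'_i$ corresponds to $B_i$. Ordering: $B(\mathrm{orb}\,I_1,f)\succ B(\mathrm{orb}\,I_2,f)$ iff $\mathrm{orb}\,I_1\supset\mathrm{orb}\,I_2$. For $D\subset C(f)$, $G(D)$ is the family of all basic sets $B(\mathrm{orb}\,I,f)$ with $\mathrm{orb}\,I\cap C(f)=D$. A one-sided shift in a topological Markov chain is a one-sided shift of finite type given by a finite directed graph. A semiconjugation is a continuous surjective map intertwining the dynamics.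
   Formalization: The turning points c_k are required to be genuine (f is not monotone on [c_{k-1}, c_{k+1}]); without this, g) fails for f = id with C(f) = {1/2}. Every pm-map still has such points, and the theorem holds for every such choice of C(f). *)

theory Defs
  imports
    "HOL-Analysis.Analysis"
    "HOL-Number_Theory.Cong"
    "HOL-Algebra.Product_Groups"
begin

section \<open>Piecewise monotone maps\<close>

text \<open>
  An interval map is a function on all reals of which only the values on the unit interval matter;
  every notion below only looks at points of the unit interval.
\<close>

definition monotone_lap :: "(real \<Rightarrow> real) \<Rightarrow> real \<Rightarrow> real \<Rightarrow> bool" where
  "monotone_lap f a b \<longleftrightarrow> mono_on {a..b} f \<or> antimono_on {a..b} f"

definition pm_partition :: "(real \<Rightarrow> real) \<Rightarrow> nat \<Rightarrow> (nat \<Rightarrow> real) \<Rightarrow> bool" where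
  "pm_partition f n c \<longleftrightarrow>
     c 0 = 0 \<and> c (n + 1) = 1 \<and> (\<forall>k\<le>n. c k < c (k + 1)) \<and>
     (\<forall>k\<le>n. monotone_lap f (c k) (c (k + 1)) \<and> \<not> (\<exists>y. f ` {c k..c (k + 1)} = {y}))"

definition pm_map :: "(real \<Rightarrow> real) \<Rightarrow> bool" where
  "pm_map f \<longleftrightarrow>
     continuous_on {0..1} f \<and> f ` {0..1} \<subseteq> {0..1} \<and> (\<exists>n c. pm_partition f n c)"

text \<open>
  A point of a partition is a turning point only if \<open>f\<close> is not monotone across it. Every
  piecewise monotone map has a partition all of whose inner points are turning points. The set \<open>C\<close> need still not
  be unique: a turning point may be anywhere on a plateau where \<open>f\<close> takes an extremal value.
\<close>

definition turning_points :: "(real \<Rightarrow> real) \<Rightarrow> real set \<Rightarrow> bool" where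
  "turning_points f C \<longleftrightarrow>
     (\<exists>n c. pm_partition f n c \<and>
        (\<forall>k\<in>{1..n}. \<not> monotone_lap f (c (k - 1)) (c (k + 1))) \<and>
        C = c ` {1..n})"

lemma pm_map_has_turning_points:
  assumes "pm_map f"
  shows "\<exists>C. turning_points f C"
proof -
  define P where "P n \<longleftrightarrow> (\<exists>c. pm_partition f n c)" for n
  have "\<exists>n. P n"
    using assms by (auto simp: pm_map_def P_def)
  then obtain n where n: "P n" and least: "\<And>m. m < n \<Longrightarrow> \<not> P m"
    using exists_least_iff[of P] by blast
  obtain c where c: "pm_partition f n c"
    using n P_def by blast
  have "\<not> monotone_lap f (c (k - 1)) (c (k + 1))" if k: "k \<in> {1..n}" for k
  proof
    assume mono: "monotone_lap f (c (k - 1)) (c (k + 1))"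
    define d where "d i = (if i < k then c i else c (i + 1))" for i
    have less: "c i < c (i + 1)" if "i \<le> n" for i
      using c that by (auto simp: pm_partition_def)
    have lap: "monotone_lap f (c i) (c (i + 1))" if "i \<le> n" for i
      using c that by (auto simp: pm_partition_def)
    have npt: "\<not> (\<exists>y. f ` {c i..c (i + 1)} = {y})" if "i \<le> n" for i
      using c that by (auto simp: pm_partition_def)
    have "d i < d (i + 1) \<and> monotone_lap f (d i) (d (i + 1)) \<and>
            \<not> (\<exists>y. f ` {d i..d (i + 1)} = {y})" if i: "i \<le> n - 1" for i
    proof -
      consider "i + 1 < k" | "i + 1 = k" | "i \<ge> k" by linarith
      then show ?thesis
      proof cases
        case 1
        then have "d i = c i" "d (i + 1) = c (i + 1)"
          by (simp_all add: d_def)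
        then show ?thesis
          using less[of i] lap[of i] npt[of i] i by simp
      next
        case 2
        then have d: "d i = c (k - 1)" "d (i + 1) = c (k + 1)" and i_eq: "i = k - 1"
          by (auto simp: d_def)
        have l: "c (k - 1) < c k" "c k < c (k + 1)"
          using less[of "k - 1"] less[of k] k by auto
        have "\<not> (\<exists>y. f ` {c (k - 1)..c (k + 1)} = {y})"
        proof
          assume "\<exists>y. f ` {c (k - 1)..c (k + 1)} = {y}"
          then obtain y where y: "f ` {c (k - 1)..c (k + 1)} = {y}" ..
          have "f ` {c (k - 1)..c k} \<subseteq> f ` {c (k - 1)..c (k + 1)}"
            using l by (intro image_mono) auto
          moreover have "f ` {c (k - 1)..c k} \<noteq> {}"
            using l by simp
          ultimately have "f ` {c (k - 1)..c k} = {y}"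
            unfolding y by (simp add: subset_singleton_iff)
          moreover have "k - 1 \<le> n" "k - 1 + 1 = k"
            using k by auto
          ultimately show False
            using npt[of "k - 1"] by metis
        qed
        with l mono show ?thesis
          unfolding d by (intro conjI) simp_all
      next
        case 3
        then have "d i = c (i + 1)" "d (i + 1) = c (i + 1 + 1)"
          by (simp_all add: d_def)
        moreover have "i + 1 \<le> n"
          using i k by auto
        ultimately show ?thesis
          using less[of "i + 1"] lap[of "i + 1"] npt[of "i + 1"] by simp
      qed
    qed
    then have "pm_partition f (n - 1) d"
      using c k by (simp add: d_def pm_partition_def)
    then have "P (n - 1)"
      unfolding P_def by blast
    then show False
      using least[of "n - 1"] k by auto
  qed
  with c have "turning_points f (c ` {1..n})"
    unfolding turning_points_def by (intro exI[of _ n] exI[of _ c]) simp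
  then show ?thesis ..
qed


section \<open>Orbits, limit sets, entropy\<close>

definition orb :: "(real \<Rightarrow> real) \<Rightarrow> real set \<Rightarrow> real set" where
  "orb f U = (\<Union>i. (f ^^ i) ` U)"

text \<open>Limit points of the orbit as a sequence, so that a periodic point is in its own limit set.\<close>

definition omega_limit :: "(real \<Rightarrow> real) \<Rightarrow> real \<Rightarrow> real set" where
  "omega_limit f x =
     {y. \<exists>r :: nat \<Rightarrow> nat. strict_mono r \<and> (\<lambda>k. (f ^^ r k) x) \<longlonglongrightarrow> y}"

definition omega :: "(real \<Rightarrow> real) \<Rightarrow> real set" where
  "omega f = (\<Union>x\<in>{0..1}. omega_limit f x)"

definition Per :: "(real \<Rightarrow> real) \<Rightarrow> real set" where
  "Per f = {x \<in> {0..1}. \<exists>n\<ge>1. (f ^^ n) x = x}"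

definition nonwandering :: "(real \<Rightarrow> real) \<Rightarrow> real set" where
  "nonwandering f =
     {x \<in> {0..1}. \<forall>U. openin (top_of_set {0..1}) U \<and> x \<in> U \<longrightarrow>
        (\<exists>n\<ge>1. (f ^^ n) ` U \<inter> U \<noteq> {})}"

definition maximal_cycles :: "(real \<Rightarrow> real) \<Rightarrow> real set" where
  "maximal_cycles f =
     \<Union> {Z. (\<exists>p\<in>Per f. Z = orb f {p}) \<and>
           (\<forall>x\<in>{0..1}. Z \<subseteq> omega_limit f x \<longrightarrow> omega_limit f x = Z)}"

definition separated :: "(real \<Rightarrow> real) \<Rightarrow> nat \<Rightarrow> real \<Rightarrow> real set \<Rightarrow> bool" where
  "separated f n e E \<longleftrightarrow>
     (\<forall>x\<in>E. \<forall>y\<in>E. x \<noteq> y \<longrightarrow> (\<exists>i<n. dist ((f ^^ i) x) ((f ^^ i) y) > e))"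

text \<open>
  Topological entropy of the restriction of \<open>f\<close> to an invariant compact set \<open>X\<close>, in Bowen's form;
  the supremum over \<open>e\<close> is the limit as \<open>e\<close> tends to 0.
\<close>

definition entropy_on :: "(real \<Rightarrow> real) \<Rightarrow> real set \<Rightarrow> ereal" where
  "entropy_on f X =
     (SUP e\<in>{0<..}. limsup (\<lambda>n.
        (SUP E\<in>{E. finite E \<and> E \<subseteq> X \<and> separated f n e E}. ereal (ln (real (card E))))
          / ereal (real n)))"


section \<open>Periodic intervals and solenoidal sets\<close>

text \<open>
  Degenerate intervals are allowed here. A generating interval, or an interval whose orbit contains
  an infinite set, is never degenerate. For a periodic interval \<open>I\<close>, the set \<open>orb f I\<close> is the cycle of
  intervals of \<open>I\<close>.
\<close>

definition periodic_interval :: "(real \<Rightarrow> real) \<Rightarrow> real set \<Rightarrow> nat \<Rightarrow> bool" where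
  "periodic_interval f I m \<longleftrightarrow>
     (\<exists>a b. 0 \<le> a \<and> a \<le> b \<and> b \<le> 1 \<and> I = {a..b}) \<and> m \<ge> 1 \<and>
     disjoint_family_on (\<lambda>i. (f ^^ i) ` I) {..<m} \<and> (f ^^ m) ` I = I"

definition generating_intervals ::
  "(real \<Rightarrow> real) \<Rightarrow> (nat \<Rightarrow> real set) \<Rightarrow> (nat \<Rightarrow> nat) \<Rightarrow> bool" where
  "generating_intervals f I m \<longleftrightarrow>
     (\<forall>j. periodic_interval f (I j) (m j)) \<and> (\<forall>j. I (Suc j) \<subseteq> I j) \<and>
     filterlim m at_top sequentially"

text \<open>The sets called \<open>Q\<close>, i.e. the largest solenoidal sets.\<close>

definition solenoidal_Q :: "(real \<Rightarrow> real) \<Rightarrow> real set \<Rightarrow> bool" where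
  "solenoidal_Q f Q \<longleftrightarrow> (\<exists>I m. generating_intervals f I m \<and> Q = (\<Inter>j. orb f (I j)))"

definition H_group :: "(nat \<Rightarrow> nat) \<Rightarrow> (nat \<Rightarrow> int) monoid" where
  "H_group m =
     (product_group UNIV (\<lambda>j. integer_mod_group (m j)))
       \<lparr>carrier := {r \<in> carrier (product_group UNIV (\<lambda>j. integer_mod_group (m j))).
                     \<forall>j. [r (Suc j) = r j] (mod int (m j))}\<rparr>"

text \<open>
  One \<open>Q\<close> may have several systems of generating intervals, whose groups are isomorphic; \<open>G\<close>
  corresponds to \<open>Q\<close> if it is the group of one of them.
\<close>

definition corresponding_group ::
  "(real \<Rightarrow> real) \<Rightarrow> real set \<Rightarrow> (nat \<Rightarrow> int) monoid \<Rightarrow> bool" where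
  "corresponding_group f Q G \<longleftrightarrow>
     (\<exists>I m. generating_intervals f I m \<and> Q = (\<Inter>j. orb f (I j)) \<and> G = H_group m)"


section \<open>Basic sets\<close>

text \<open>The set \<open>B(M, f)\<close> for a cycle of intervals \<open>M\<close>; it is a basic set if it is infinite.\<close>

definition B_set :: "real set \<Rightarrow> (real \<Rightarrow> real) \<Rightarrow> real set" where
  "B_set M f =
     {x \<in> M. \<forall>U. openin (top_of_set M) U \<and> x \<in> U \<longrightarrow> closure (orb f U) = M}"

definition basic_set_of :: "(real \<Rightarrow> real) \<Rightarrow> real set \<Rightarrow> nat \<Rightarrow> real set \<Rightarrow> bool" where
  "basic_set_of f I m B \<longleftrightarrow>
     periodic_interval f I m \<and> B = B_set (orb f I) f \<and> infinite B"

definition basic_set :: "(real \<Rightarrow> real) \<Rightarrow> real set \<Rightarrow> bool" where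
  "basic_set f B \<longleftrightarrow> (\<exists>I m. basic_set_of f I m B)"

text \<open>
  The set \<open>A\<^sub>B\<close> for \<open>B = B(orb I, f)\<close>. The interior is taken in the real line, so 0 and 1 are
  never interior points of \<open>orb I\<close>.
\<close>

definition A_set :: "(real \<Rightarrow> real) \<Rightarrow> real set \<Rightarrow> real set \<Rightarrow> real set" where
  "A_set f I B =
     {x. (\<exists>i a b. (f ^^ i) ` I = {a..b} \<and> (x = a \<or> x = b)) \<and>
         x \<in> nonwandering f \<and>
         (\<exists>m. (f ^^ m) x \<in> B \<and> (\<forall>i<m. (f ^^ i) x \<notin> B) \<and>
              (\<forall>i<m. (f ^^ i) x \<notin> interior (orb f I)))}"

definition Omega_basic_set :: "(real \<Rightarrow> real) \<Rightarrow> real set \<Rightarrow> real set \<Rightarrow> bool" where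
  "Omega_basic_set f B B' \<longleftrightarrow> (\<exists>I m. basic_set_of f I m B \<and> B' = B \<union> A_set f I B)"

definition basic_succ :: "(real \<Rightarrow> real) \<Rightarrow> real set \<Rightarrow> real set \<Rightarrow> bool" where
  "basic_succ f B\<^sub>1 B\<^sub>2 \<longleftrightarrow>
     (\<exists>I\<^sub>1 m\<^sub>1 I\<^sub>2 m\<^sub>2. basic_set_of f I\<^sub>1 m\<^sub>1 B\<^sub>1 \<and> basic_set_of f I\<^sub>2 m\<^sub>2 B\<^sub>2 \<and>
        orb f I\<^sub>1 \<supseteq> orb f I\<^sub>2)"

definition G_family :: "(real \<Rightarrow> real) \<Rightarrow> real set \<Rightarrow> real set \<Rightarrow> real set set" where
  "G_family f C D = {B. \<exists>I m. basic_set_of f I m B \<and> orb f I \<inter> C = D}"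


section \<open>Topological Markov chains\<close>

text \<open>
  The vertex shift of the directed graph with edge set \<open>E\<close>. The function type carries the product
  topology of the discrete topology on its values.
\<close>

definition markov_chain :: "(nat \<times> nat) set \<Rightarrow> (nat \<Rightarrow> nat) set" where
  "markov_chain E = {s. \<forall>n. (s n, s (Suc n)) \<in> E}"

definition shift :: "(nat \<Rightarrow> nat) \<Rightarrow> (nat \<Rightarrow> nat)" where
  "shift s = (\<lambda>n. s (Suc n))"

definition semiconjugation ::
  "('a::topological_space \<Rightarrow> 'b::topological_space) \<Rightarrow>
   'a set \<Rightarrow> ('a \<Rightarrow> 'a) \<Rightarrow> 'b set \<Rightarrow> ('b \<Rightarrow> 'b) \<Rightarrow> bool" where
  "semiconjugation \<phi> X f Y g \<longleftrightarrow>
     f ` X \<subseteq> X \<and> g ` Y \<subseteq> Y \<and>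
     continuous_on X \<phi> \<and> \<phi> ` X = Y \<and> (\<forall>x\<in>X. \<phi> (f x) = g (\<phi> x))"

definition at_most_2_to_1 :: "('a \<Rightarrow> 'b) \<Rightarrow> 'a set \<Rightarrow> bool" where
  "at_most_2_to_1 \<phi> X \<longleftrightarrow> (\<forall>y. finite {x \<in> X. \<phi> x = y} \<and> card {x \<in> X. \<phi> x = y} \<le> 2)"

end

theory Submission
  imports Defs "HOL-Real_Asymp.Real_Asymp"
begin

text \<open>
A point is located by the cores \<open>\<Inter>k. closure ((f ^^ k) ` orb f U)\<close> of small neighborhoods or one-sided neighborhoods
(germs) \<open>U\<close> that return. Such a core is a cycle of intervals, and a decreasing sequence of cycles shrinks to a solenoidal set or to
a cycle \<open>M\<close>; in the second case some germ at the point has an orbit that is dense in \<open>M\<close>, and the germ belongs to a basic set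
because it has a homoclinic point. Cycles with basic sets and with the same trace on \<open>C\<close> are nested, so the basic sets with a given
trace are finitely many or form a chain that shrinks to a solenoidal set. A solenoidal set of another kind lies in a cycle all of whose
generating intervals, taken with end points in the set, double their periods; so the itineraries grow subexponentially.
The vertices of the graph in b) are the gaps of \<open>orb f (I (n + 1))\<close> in \<open>orb f (I n)\<close>.
\<close>

text \<open>Laps may contain plateaus, so an iterate can collapse a germ to a point. Dense germs are
  therefore pulled back instead of pushed forward: if an iterate covers a dense germ, some germ
  upstairs covers it and inherits the density of its orbit. The definition of
  \<open>B_set M f\<close> tests neighborhoods, while these arguments need a single side; that some
  side is dense uses that the set is infinite.

  Most facts about turning points come from one contradiction: if an orbit, sampled at equal time
  steps, stays at each phase in a set on which \<open>f\<close> is monotone, then an even iterate is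
  increasing along the samples and the limit set is finite (\<open>finite_omegaI\<close>).

  Components of a solenoidal set may be nondegenerate, so limit points cannot be read off from the
  generating intervals around them. What singles them out is that whole pieces shrink to them, and
  three nearby points of different pieces force this by squeezing the middle piece.

  Basic and solenoidal sets are kept apart by periodic points: every periodic interval contains one,
  a solenoidal set none.\<close>

notation iff (infixr "<->" 25)
lemmas pint_def = periodic_interval_def
lemmas gen_def = generating_intervals_def

locale interval_map =
fixes f::"real => real" assumes cont: "continuous_on {0..1} f" and maps: "f ` {0..1}<={0..1}"
begin

abbreviation "fn n \<equiv> f ^^ n"
abbreviation "pint \<equiv> periodic_interval f"
abbreviation "gen \<equiv> generating_intervals f"
abbreviation "om \<equiv> omega_limit f"
abbreviation "Orb \<equiv> orb f"
abbreviation "Cl A \<equiv> closure (orb f A)"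
abbreviation "QQ I \<equiv> INT n. orb f (I n)"
abbreviation "solen \<equiv> solenoidal_Q f"
abbreviation "Bs I \<equiv> B_set (orb f I) f"

section \<open>Iterates, images of intervals and forward orbits\<close>

lemma fpow_maps: "x:{0..1} ==> fn n x:{0..1}" by (induction n) (use maps in "auto simp del: atLeastAtMost_iff")

lemma fpow_unit: "A<={0..1} ==> fn n ` A<={0..1}" using fpow_maps by blast

lemma fpow_cont: "continuous_on {0..1} (fn n)"
proof (induction n)
case 0
thus ?case by (simp add: id_def)
next
case (Suc n)
have "continuous_on (fn n ` {0..1}) f" using cont fpow_unit[of "{0..1}" n] continuous_on_subset by blast
thus ?case using Suc continuous_on_compose by fastforce
qed

lemma fpow_cont': "A<={0..1} ==> continuous_on A (fn n)" using fpow_cont continuous_on_subset by blast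

lemma fpow_add: "fn (i + j) x = fn i (fn j x)" by (simp add: funpow_add)

lemma img_add: "fn i ` fn j ` A = fn (i + j) ` A" by (simp add: funpow_add image_comp)

lemma fpow_Suc_image: "f ` fn j ` A = (f ^^ Suc j) ` A" by (simp add: image_comp)

lemma fpow_mult_image: "fn n ` A = A ==> fn (k * n) ` A = A"
proof (induction k)
case (Suc k)
have "fn (Suc k * n) ` A = fn n ` fn (k * n) ` A" by (simp add: img_add)
thus ?case using Suc by simp
qed simp

lemma mult_fix: "fn n x = x ==> fn (k * n) x = x" using fpow_mult_image[of n "{x}" k] by auto

lemma fpow_mod_fix: assumes "fn n x = x" shows "fn k x = fn (k mod n) x"
proof -
have "fn k x = fn (k mod n + (k div n) * n) x" by simp
thus ?thesis unfolding fpow_add mult_fix[OF assms] .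
qed

lemma fpow_compact: "compact A ==> A<={0..1} ==> compact (fn n ` A)" using compact_continuous_image fpow_cont' by blast

lemma fpow_conn: "connected A ==> A<={0..1} ==> connected (fn n ` A)" using connected_continuous_image fpow_cont' by blast

lemma fpow_interval: assumes "0<=a" "a<=b" "b<=1" shows "EX c d. 0<=c & c<=d & d<=1 & fn n ` {a..b} = {c..d}"
proof -
have sub: "{a..b}<={0..1}" using assms by auto
obtain c d where cd: "fn n ` {a..b} = {c..d}" "c<=d" using continuous_image_closed_interval[OF assms(2) fpow_cont'[OF sub]] by blast
have "{c..d}<={0..1}" using fpow_unit[OF sub] cd by metis
thus ?thesis using cd by auto
qed

lemma fpow_closure: assumes "A<={0..1}" shows "fn n ` closure A = closure (fn n ` A)"
proof
have cl: "closure A<={0..1}" using assms closure_minimal by (metis closed_atLeastAtMost)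
hence "compact (closure A)" by (meson bounded_closed_interval bounded_subset closed_closure compact_eq_bounded_closed)
hence "closed (fn n ` closure A)" using fpow_compact[OF _ cl] compact_imp_closed by blast
thus "closure (fn n ` A)<=fn n ` closure A" by (meson closure_minimal closure_subset image_mono)
show "fn n ` closure A<=closure (fn n ` A)" using image_closure_subset[OF fpow_cont'[OF cl]] closure_subset by (metis closed_closure)
qed

lemma sub_orb: "U<=Orb U" unfolding orb_def by (auto intro!: exI[of _ 0])

lemma fpow_sub_orb: "fn k ` U<=Orb U" unfolding orb_def by blast

lemma in_orb_iff: "y:Orb U <-> (EX k. EX u:U. y = fn k u)" unfolding orb_def by auto

lemma orb_mono: "U<=V ==> Orb U<=Orb V" unfolding orb_def by blast

lemma orb_unit: "U<={0..1} ==> Orb U<={0..1}" unfolding orb_def using fpow_unit by blast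

lemma fpow_orb: "fn k ` Orb U = Orb (fn k ` U)" unfolding orb_def image_UN img_add by (simp add: add.commute)

lemma orb_fpow_le: "Orb (fn k ` U)<=Orb U" unfolding orb_def img_add by blast

lemma f_orb: "f ` Orb U<=Orb U" using fpow_orb[of 1] orb_fpow_le[of 1] by simp

lemma fpow_image_orb: "fn k ` Orb U<=Orb U" using fpow_orb orb_fpow_le by blast

lemma inv_fpow: "f ` M<=M ==> fn k ` M<=M" by (induction k) (auto simp: image_subset_iff)

lemma inv_fpow_eq: "f ` M = M ==> fn k ` M = M" using fpow_mult_image[of 1 M k] by simp

lemma orb_least: "U<=M ==> f ` M<=M ==> Orb U<=M" unfolding orb_def using inv_fpow by blast

lemma orb_orb: "V<=Orb U ==> Orb V<=Orb U" by (rule orb_least[OF _ f_orb])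

lemma cl_orb_least: "U<=M ==> f ` M<=M ==> closed M ==> Cl U<=M" by (rule closure_minimal[OF orb_least])

lemma closure_orb_unit: "U<={0..1} ==> Cl U<={0..1}" using orb_unit closure_minimal by (metis closed_atLeastAtMost)

lemma f_cl_orb: assumes "U<={0..1}" shows "fn k ` Cl U = Cl (fn k ` U)" by (simp only: fpow_closure[OF orb_unit[OF assms]] fpow_orb)

lemma f_cl_orb_sub: assumes "U<={0..1}" shows "f ` Cl U<=Cl U" using f_cl_orb[OF assms, of 1] closure_mono[OF orb_fpow_le[of 1 U]] by simp

lemma closure_orb_trans: assumes "U<={0..1}" "V<=Cl U" shows "Cl V<=Cl U" using cl_orb_least[OF assms(2) f_cl_orb_sub[OF assms(1)]] by simp

lemma compact_sub: "closed A ==> A<={0..1::real} ==> compact A" by (meson bounded_closed_interval bounded_subset compact_eq_bounded_closed)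

text \<open>For \<open>y\<close> in all the images, the fibres of \<open>fn k\<close> over
  \<open>y\<close> in the sets \<open>K n\<close> are nested nonempty compact sets, so they have a
  common point.\<close>

lemma fpow_INT_decreasing: assumes comp: "!!n. compact (K n)" and unit: "!!n. K n<={0..1}" and dec: "!!n. K (Suc n)<=K n"
shows "fn k ` (INT n. K n) = (INT n. fn k ` K n)"
proof
show "fn k ` (INT n. K n)<=(INT n. fn k ` K n)" by blast
show "(INT n. fn k ` K n)<=fn k ` (INT n. K n)"
proof
 fix y assume y: "y:(INT n. fn k ` K n)"
 define L where "L n = K n Int fn k -` {y}" for n
 have "compact (L n)" for n
 proof -
  have "closedin (top_of_set (K n)) (K n Int fn k -` {y})" using continuous_closedin_preimage[OF fpow_cont'[OF unit]] by auto
  thus ?thesis using comp closedin_compact L_def by metis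
 qed
 moreover have "L n~={}" for n using y unfolding L_def by blast
 moreover have "L n<=L m" if "m<=n" for m n using that lift_Suc_antimono_le[of K] dec unfolding L_def by blast
 ultimately have "(INT n. L n)~={}" by (rule compact_nest)
 thus "y:fn k ` (INT n. K n)" unfolding L_def by auto
qed
qed

section \<open>Limit sets\<close>

lemma om_iff:
"y:om x <-> (ALL e>0. ALL N. EX n>=N. abs (fn n x - y)<e)"
proof
assume "y:om x"
then obtain r where r: "strict_mono r" "(%k. (f ^^ r k) x) \<longlonglongrightarrow> y" unfolding omega_limit_def by blast
show "ALL e>0. ALL N. EX n>=N. abs (fn n x - y)<e"
proof (intro allI impI)
 fix e::real and N assume "e>0"
 then obtain k0 where "ALL k>=k0. abs ((f ^^ r k) x - y)<e" using r(2) unfolding LIMSEQ_iff by fastforce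
 hence "abs ((f ^^ r (max k0 N)) x - y)<e" by simp
 moreover have "r (max k0 N)>=N" using seq_suble[OF r(1), of "max k0 N"] by simp
 ultimately show "EX n>=N. abs (fn n x - y)<e" by blast
qed
next
assume *: "ALL e>0. ALL N. EX n>=N. abs (fn n x - y)<e"
have "EX r. ALL k. abs ((f ^^ r k) x - y)<1 / real (Suc k) & r k<r (Suc k)"
proof (rule dependent_nat_choice)
 show "EX n. abs (fn n x - y)<1 / real (Suc 0)" using *[rule_format, of 1] by auto
next
 fix n k
 show "EX m. abs (fn m x - y)<1 / real (Suc (Suc k)) & n<m" using *[rule_format, of "1 / real (Suc (Suc k))" "Suc n"] by auto
qed
then obtain r where r: "!!k. abs ((f ^^ r k) x - y)<1 / real (Suc k)" "!!k. r k<r (Suc k)" by blast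
have "strict_mono r" using r(2) strict_mono_Suc_iff by blast
moreover have "(%k. (f ^^ r k) x) \<longlonglongrightarrow> y"
proof -
 have "(%k. (f ^^ r k) x - y) \<longlonglongrightarrow> 0" by (rule Lim_null_comparison[OF _ LIMSEQ_inverse_real_of_nat])
    (use r(1) in "auto simp: eventually_sequentially inverse_eq_divide less_imp_le intro!: exI[of _ 0]")
 thus ?thesis by (simp add: LIM_zero_iff)
qed
ultimately show "y:om x" unfolding omega_limit_def by blast
qed

lemma omD: "y:om x ==> e>0 ==> EX n>=N. abs (fn n x - y)<e" using om_iff by blast

lemma om_fpow: "om (fn k x) = om x"
proof -
have "(ALL e>0. ALL N. EX n>=N. abs (fn n (fn k x) - y)<e) <-> (ALL e>0. ALL N. EX n>=N. abs (fn n x - y)<e)" for y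
proof (intro iffI allI impI)
 fix e::real and N
 assume "ALL e>0. ALL N. EX n>=N. abs (fn n (fn k x) - y)<e" "e>0"
 then obtain n where "n>=N" "abs (fn (n + k) x - y)<e" unfolding fpow_add by blast
 thus "EX n>=N. abs (fn n x - y)<e" by (intro exI[of _ "n + k"]) simp
next
 fix e::real and N
 assume "ALL e>0. ALL N. EX n>=N. abs (fn n x - y)<e" "e>0"
 then obtain n where "n>=N + k" "abs (fn n x - y)<e" by blast
 thus "EX n>=N. abs (fn n (fn k x) - y)<e" by (intro exI[of _ "n - k"]) (simp flip: fpow_add)
qed
thus ?thesis unfolding set_eq_iff om_iff by blast
qed

lemma om_subset_closed: assumes "closed M" "!!n. n>=N ==> fn n x:M" shows "om x<=M"
proof
fix y assume y: "y:om x"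
have "y:closure M" unfolding closure_approachable
proof (intro allI impI)
 fix e::real assume "e>0"
 then obtain n where "n>=N" "abs (fn n x - y)<e" using omD[OF y] by blast
 thus "EX z:M. dist z y<e" using assms(2) by (auto simp: dist_real_def)
qed
thus "y:M" using assms(1) by simp
qed

lemma om_unit: "x:{0..1} ==> om x<={0..1}" by (rule om_subset_closed[where N = 0]) (use fpow_maps in auto)

lemma om_least:
"closed M ==> f ` M<=M ==> fn k x:M ==> om x<=M" using om_subset_closed[of M 0 "fn k x"] inv_fpow[of M] om_fpow[of k x]
by (simp add: image_subset_iff)

text \<open>Nested form of the limit set; closedness, invariance and nonemptiness are read off from
  it.\<close>

lemma om_eq_INT:
"om x = (INT n. Cl {fn n x})"
proof -
have "(ALL e>0. EX n>=N. abs (fn n x - y)<e) <-> y:Cl {fn N x}" for y N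
proof -
 have "(EX n>=N. abs (fn n x - y)<e) <-> (EX z:Orb {fn N x}. dist z y<e)" for e unfolding orb_def dist_real_def
  by (auto simp flip: fpow_add simp: le_iff_add add.commute)
 thus ?thesis unfolding closure_approachable by blast
qed
thus ?thesis unfolding set_eq_iff om_iff by blast
qed

lemma om_closed: "closed (om x)" unfolding om_eq_INT by blast

lemma tail_dec:
"Cl {(f ^^ Suc n) x}<=Cl {fn n x}" using closure_mono[OF orb_fpow_le[of 1 "{fn n x}"]] by simp

lemma om_image: assumes "x:{0..1}" shows "f ` om x = om x"
proof -
define K where "K n = Cl {fn n x}" for n
have unit: "K n<={0..1}" for n unfolding K_def using closure_orb_unit[of "{fn n x}"] fpow_maps[OF assms] by blast
have comp: "compact (K n)" for n using compact_sub[OF _ unit] K_def by simp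
have dec: "K (Suc n)<=K n" for n unfolding K_def by (rule tail_dec)
have K1: "f ` K n = K (Suc n)" for n using f_cl_orb[of "{fn n x}" 1] fpow_maps[OF assms] unfolding K_def by simp
have "f ` (INT n. K n) = (INT n. f ` K n)" using fpow_INT_decreasing[of K 1] comp unit dec by simp
also have "... = (INT n. K (Suc n))" by (simp add: K1)
also have "... = (INT n. K n)" using dec by blast
finally show ?thesis unfolding om_eq_INT K_def .
qed

lemma om_nonempty: assumes "x:{0..1}" shows "om x~={}"
proof -
have "(INT n. Cl {fn n x})~={}"
proof (rule compact_nest)
 show "compact (Cl {fn n x})" for n using compact_sub closure_orb_unit[of "{fn n x}"] fpow_maps[OF assms] by blast
 show "Cl {fn n x}~={}" for n using sub_orb by fastforce
 show "Cl {fn n x}<=Cl {fn m x}" if "m<=n" for m n using lift_Suc_antimono_le[of "%n. Cl {fn n x}", OF tail_dec that] .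
qed
thus ?thesis unfolding om_eq_INT .
qed

lemma om_in_orb_closure: "x:{0..1} ==> y:om x ==> om y<=om x" using om_least[of "om x" 0 y] om_closed om_image by simp

lemma finite_orb: assumes "fn n p = p" "n>=1" shows "finite (Orb {p})"
proof -
have "Orb {p}<=(%i. fn i p) ` {..<n}"
proof
 fix y assume "y:Orb {p}"
 then obtain k where "y = fn k p" unfolding orb_def by auto
 hence "y = fn (k mod n) p" using fpow_mod_fix[OF assms(1)] by simp
 moreover have "k mod n<n" using assms(2) by simp
 ultimately show "y:(%i. fn i p) ` {..<n}" by blast
qed
thus ?thesis using finite_subset by blast
qed

lemma om_periodic: assumes "fn n p = p" "n>=1" shows "om p = Orb {p}"
proof
have "closed (Orb {p})" using finite_orb[OF assms] by (simp add: finite_imp_closed)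
thus "om p<=Orb {p}" using om_least[where M = "Orb {p}" and k = 0 and x = p, OF _ f_orb]
  sub_orb[of "{p}"] by auto
show "Orb {p}<=om p"
proof
 fix y assume "y:Orb {p}"
 then obtain i where i: "y = fn i p" unfolding orb_def by auto
 show "y:om p" unfolding om_iff
 proof (intro allI impI)
  fix e::real and N assume "e>0"
  have "fn (i + N * n) p = y" unfolding fpow_add mult_fix[OF assms(1)] i ..
  moreover have "i + N * n>=N" using assms(2) by (simp add: trans_le_add2)
  ultimately show "EX n>=N. abs (fn n p - y)<e" using `e > 0` by (intro exI[of _ "i + N * n"]) auto
 qed
qed
qed

lemma Per_orbit: "p:Per f ==> fn k p:Per f" unfolding Per_def using fpow_maps[of p k] by (auto simp flip: fpow_add) (metis add.commute fpow_add)

lemma finite_orbit_eventually_periodic: assumes "finite (Orb {x})" "x:{0..1}" shows "EX k. fn k x:Per f"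
proof -
have "~ inj (%i. fn i x)"
proof
 assume "inj (%i. fn i x)"
 hence "infinite (range (%i. fn i x))" by (simp add: finite_image_iff)
 moreover have "range (%i. fn i x) = Orb {x}" unfolding orb_def by auto
 ultimately show False using assms by simp
qed
then obtain i j where "i<j" "fn i x = fn j x" unfolding inj_def by (metis linorder_neqE_nat)
hence "fn (j - i) (fn i x) = fn i x" using fpow_add[of "j - i" i x] by simp
thus ?thesis using `i < j` fpow_maps[OF assms(2)] unfolding Per_def by (intro exI[of _ i]) (auto intro!: exI[of _ "j - i"])
qed

text \<open>A surjection of a finite set onto itself is injective, so an orbit in it that repeats a
  value returns to its starting point.\<close>

lemma finite_inv_Per: assumes "finite L" "f ` L = L" "L<={0..1}" shows "L<=Per f"
proof
fix p assume p: "p:L"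
have L: "fn n ` L = L" for n using inv_fpow_eq[OF assms(2)] .
have injn: "inj_on (fn n) L" for n by (rule eq_card_imp_inj_on) (use L assms in auto)
have "Orb {p}<=L" using orb_least[of "{p}" L] p assms by auto
hence fin: "finite (Orb {p})" using assms finite_subset by blast
have "~ inj (%i. fn i p)"
proof
 assume "inj (%i. fn i p)"
 hence "infinite (range (%i. fn i p))" by (simp add: finite_image_iff)
 moreover have "range (%i. fn i p) = Orb {p}" unfolding orb_def by auto
 ultimately show False using fin by simp
qed
then obtain i j where ij: "i<j" "fn i p = fn j p" unfolding inj_def by (metis linorder_neqE_nat)
hence "fn i p = fn i (fn (j - i) p)" using fpow_add[of i "j - i" p] by simp
moreover have "fn (j - i) p:L" using L p by blast
ultimately have "fn (j - i) p = p" using injn[of i] p unfolding inj_on_def by metis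
thus "p:Per f" unfolding Per_def using ij p assms(3) by (auto intro!: exI[of _ "j - i"])
qed

text \<open>Distinct limit points are at least \<open>d\<close> apart. Once the orbit stays within
  \<open>e\<close> of the limit set, uniform continuity determines which limit point is close to the
  next iterate, so the orbit of \<open>x\<close> shadows that of \<open>p\<close> forever.\<close>

lemma om_finite_cycle: assumes x: "x:{0..1}" and fin: "finite (om x)" and p: "p:om x" shows "om x = Orb {p}"
proof -
define L where "L = om x"
have Lu: "L<={0..1}" using om_unit[OF x] L_def by simp
have fL: "f ` L = L" using om_image[OF x] L_def by simp
have finL: "finite L" using fin L_def by simp
obtain d where d: "d>0" "!!u v. u:L ==> v:L ==> u~=v ==> d<=abs (u - v)"
proof -
 have "EX d>0. ALL u:L. ALL v:L. u~=v --> d<=abs (u - v)"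
 proof -
  define D where "D = insert 1 ((%(u, v). abs (u - v)) ` {(u, v). u:L & v:L & u~=v})"
  have "{(u, v). u:L & v:L & u~=v}<=L \<times> L" by auto
  hence "finite D" unfolding D_def using finL finite_subset by blast
  moreover have "ALL t:D. t>0" unfolding D_def by auto
  ultimately show ?thesis by (intro exI[of _ "Min D"]) (auto simp: D_def intro!: Min_le)
 qed
 thus ?thesis using that by blast
qed
have uc: "uniformly_continuous_on {0..1} f" using compact_uniformly_continuous[OF cont] by simp
then obtain e0 where e0: "e0>0" "!!u v. u:{0..1} ==> v:{0..1} ==> dist u v<e0 ==> dist (f u) (f v)<d / 2"
 unfolding uniformly_continuous_on_def using d(1) by (metis half_gt_zero)
define e where "e = min e0 (d / 2)"
have e: "e>0" using e0 d e_def by simp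
\<comment> \<open>If iterates at distance at least \<open>e\<close> from \<open>L\<close> recurred,
  compactness would give them an accumulation point, and it would lie in \<open>L\<close>.\<close>
have near: "EX N. ALL n>=N. EX u:L. abs (fn n x - u)<e"
proof (rule ccontr)
 assume "~ ?thesis"
 hence "ALL N. EX n>=N. ALL u:L. e<=abs (fn n x - u)" by (auto simp: not_less)
 then obtain r where r: "!!N. r N>=N" "!!N u. u:L ==> e<=abs ((f ^^ r N) x - u)" by metis
 have "ALL N. (f ^^ r N) x:{0..1}" using fpow_maps[OF x] by blast
 then obtain l s where l: "l:{0..1}" "strict_mono s" "((%N. (f ^^ r N) x) \<circ> s) \<longlonglongrightarrow> l"
  using compact_Icc[of 0 "1::real", unfolded compact_def, rule_format, of "%N. (f ^^ r N) x"] by blast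
 have "l:L" unfolding L_def om_iff
 proof (intro allI impI)
  fix e' :: real and N assume "e'>0"
  then obtain k0 where k0: "ALL k>=k0. abs ((f ^^ r (s k)) x - l)<e'" using LIMSEQ_D[OF l(3) `e' > 0`] by auto
  have "r (s (max k0 N))>=N" using r(1)[of "s (max k0 N)"] seq_suble[OF l(2), of "max k0 N"] by linarith
  thus "EX n>=N. abs (fn n x - l)<e'" using k0 by (meson max.cobounded1)
 qed
 obtain k0 where "ALL k>=k0. abs ((f ^^ r (s k)) x - l)<e" using LIMSEQ_D[OF l(3) e] by auto
 hence "abs ((f ^^ r (s k0)) x - l)<e" by simp
 thus False using r(2)[OF `l:L`, of "s k0"] by linarith
qed
then obtain N where N: "!!n. n>=N ==> EX u:L. abs (fn n x - u)<e" by blast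
have pL: "p:L" using p L_def by simp
obtain n0 where n0: "n0>=N" "abs (fn n0 x - p)<e" using omD[OF p e] by blast
have follow: "abs (fn (k + n0) x - fn k p)<e" for k
proof (induction k)
 case (Suc k)
 have pk: "fn k p:L" using inv_fpow_eq[OF fL, of k] pL by blast
 have "dist (f (fn (k + n0) x)) (f (fn k p))<d / 2" by (rule e0(2)) (use fpow_maps[OF x] pk Lu Suc e_def in "auto simp: dist_real_def")
 hence a: "abs (fn (Suc k + n0) x - f (fn k p))<d / 2" by (simp add: dist_real_def)
 obtain u where u: "u:L" "abs (fn (Suc k + n0) x - u)<e" using N[of "Suc k + n0"] n0 by auto
 have "abs (f (fn k p) - u)<d" using a u e_def by linarith
 hence "u = f (fn k p)" using d(2)[of "f (fn k p)" u] fL pk u by force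
 thus ?case using u by simp
qed (use n0 in simp)
have "L<=Orb {p}"
proof
 fix q assume q: "q:L"
 have "min e (d/2)>0" using e d by simp
 then obtain n where n: "n>=n0" "abs (fn n x - q)<d / 2" using omD[of q x "min e (d/2)" n0] q L_def by auto
 have "abs (fn n x - fn (n - n0) p)<e" using follow[of "n - n0"] n by simp
 hence "abs (fn (n - n0) p - q)<d" using n e_def by linarith
 moreover have "fn (n - n0) p:L" using inv_fpow_eq[OF fL] pL by blast
 ultimately have "q = fn (n - n0) p" using d(2) q by force
 thus "q:Orb {p}" unfolding orb_def by auto
qed
moreover have "Orb {p}<=L" using orb_least[of "{p}" L] pL fL by auto
ultimately show ?thesis using L_def by blast
qed

section \<open>Cycles of intervals\<close>

lemma pint_obtain: assumes "pint I m"
obtains a b where "0<=a" "a<=b" "b<=1" "I = {a..b}" using assms unfolding pint_def by blast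

lemma pint_unit: "pint I m ==> I<={0..1}" using pint_obtain by (metis atLeastatMost_subset_iff)

lemma pint_nonempty: "pint I m ==> I~={}" using pint_obtain by (metis atLeastatMost_empty_iff)

lemma pint_pos: "pint I m ==> m>=1" unfolding pint_def by blast

lemma pint_piece: assumes "pint I m" shows "EX a b. 0<=a & a<=b & b<=1 & fn i ` I = {a..b}" using pint_obtain[OF assms] fpow_interval by metis

lemma pint_return: "pint I m ==> fn (i + k * m) ` I = fn i ` I" unfolding pint_def img_add[symmetric] by (simp add: fpow_mult_image)

lemma pint_mod: assumes "pint I m" shows "fn i ` I = fn (i mod m) ` I" using pint_return[OF assms, of "i mod m" "i div m"] by simp

lemma pint_mod_less: "pint I m ==> i mod m<m" using pint_pos[of I m] by simp

lemma pint_orb: assumes "pint I m" shows "Orb I = (UN i<m. fn i ` I)"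
proof
show "Orb I<=(UN i<m. fn i ` I)" unfolding orb_def using pint_mod[OF assms] pint_mod_less[OF assms] by blast
show "(UN i<m. fn i ` I)<=Orb I" unfolding orb_def by blast
qed

lemma pint_compact: "pint I m ==> compact (fn i ` I)" using pint_piece by (metis compact_Icc)

lemma pint_conn: "pint I m ==> connected (fn i ` I)" using pint_piece by (metis connected_Icc)

lemma cyc_compact: "pint I m ==> compact (Orb I)" by (simp add: pint_orb pint_compact compact_UN)

lemma cyc_closed: "pint I m ==> closed (Orb I)" using cyc_compact compact_imp_closed by blast

lemma cyc_unit: "pint I m ==> Orb I<={0..1}" using pint_unit orb_unit by metis

lemma pint_f_orb: assumes "pint I m" shows "f ` Orb I = Orb I"
proof
show "f ` Orb I<=Orb I" by (rule f_orb)
have "Orb I<=(UN i. (f ^^ Suc i) ` I)"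
proof
 fix y assume "y:Orb I"
 then obtain i where "y:fn i ` I" unfolding orb_def by blast
 hence "y:fn (i + 1 * m) ` I" using pint_return[OF assms] by metis
 moreover have "i + 1 * m = Suc (i + m - 1)" using pint_pos[OF assms] by simp
 ultimately have "y:(f ^^ Suc (i + m - 1)) ` I" by metis
 thus "y:(UN i. (f ^^ Suc i) ` I)" by blast
qed
also have "...<=f ` Orb I" unfolding orb_def by auto
finally show "Orb I<=f ` Orb I" .
qed

lemma pint_fpow_orb: "pint I m ==> fn k ` Orb I = Orb I" using inv_fpow_eq[OF pint_f_orb] .

lemma pint_disjoint: assumes I: "pint I m" and ne: "fn i ` I Int fn j ` I~={}" shows "i mod m = j mod m"
proof (rule ccontr)
assume "i mod m~=j mod m"
moreover have "disjoint_family_on (%i. fn i ` I) {..<m}" using I unfolding pint_def by blast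
ultimately have "fn (i mod m) ` I Int fn (j mod m) ` I = {}" using pint_mod_less[OF I] unfolding disjoint_family_on_def by auto
thus False using ne pint_mod[OF I, of i] pint_mod[OF I, of j] by simp
qed

lemma pint_piece_eq: assumes "pint I m" "fn i ` I Int fn j ` I~={}" shows "fn i ` I = fn j ` I"
using pint_disjoint[OF assms] pint_mod[OF assms(1)] by metis

lemma pint_shift: assumes I: "pint I m" shows "pint (fn i ` I) m"
proof -
have "fn m ` I = I" using I unfolding pint_def by blast
hence ret: "fn m ` fn i ` I = fn i ` I" by (metis add.commute img_add)
have "fn j ` fn i ` I Int fn k ` fn i ` I = {}" if "j<m" "k<m" "j~=k" for j k
proof (rule ccontr)
 assume "fn j ` fn i ` I Int fn k ` fn i ` I~={}"
 hence "[j + i = k + i] (mod m)" unfolding cong_def using pint_disjoint[OF I] by (simp add: img_add)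
 hence "[j = k] (mod m)" using cong_add_rcancel_nat by blast
 thus False using that unfolding cong_def by simp
qed
thus ?thesis unfolding pint_def disjoint_family_on_def using pint_piece[OF I, of i] pint_pos[OF I] ret by auto
qed

lemma shift_orb: assumes I: "pint I m" shows "Orb (fn i ` I) = Orb I" using fpow_orb[of i I] pint_fpow_orb[OF I, of i] by simp

lemma pint_at: assumes "pint I m" "x:Orb I"
obtains J where "pint J m" "Orb J = Orb I" "x:J"
proof -
obtain i where "x:fn i ` I" using assms(2) unfolding orb_def by blast
thus ?thesis using that pint_shift[OF assms(1)] shift_orb[OF assms(1)] by metis
qed

text \<open>\<open>I\<close> and the union of the other pieces are disjoint closed sets that cover
  the cycle.\<close>

lemma pint_connected_subset: assumes I: "pint I m" and K: "connected K" "K<=Orb I" and x: "x:K" "x:I" shows "K<=I"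
proof (rule ccontr)
assume "~ K<=I"
define R where "R = (UN i:{1..<m}. fn i ` I)"
have split: "Orb I = I Un R"
proof -
 have "{..<m} = insert 0 {1..<m}" using pint_pos[OF I] by auto
 thus ?thesis unfolding pint_orb[OF I] R_def by simp
qed
have "closed R" unfolding R_def by (intro closed_UN) (auto intro: compact_imp_closed pint_compact[OF I])
moreover have "closed I" using pint_compact[OF I, of 0] compact_imp_closed by simp
moreover have "I Int R = {}"
proof -
 have "I Int fn i ` I = {}" if "i:{1..<m}" for i using pint_disjoint[OF I, of 0 i] that by auto
 thus ?thesis unfolding R_def by blast
qed
ultimately show False using connected_closedD[OF K(1), of I R] K(2) split x `~ K <= I` by blast
qed

lemma pint_nested: assumes I: "pint I m" and I': "pint I' m'" and sub: "Orb I'<=Orb I" and x: "x:I" "x:I'" shows "I'<=I"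
proof -
have "I'<=Orb I" using sub sub_orb by blast
moreover have "connected I'" using pint_conn[OF I', of 0] by simp
ultimately show ?thesis using pint_connected_subset[OF I] x by blast
qed

text \<open>The piece \<open>J\<close> of the larger cycle that contains \<open>I'\<close> meets its
  image at time \<open>m'\<close>, and images of \<open>J\<close> at times that are not congruent
  modulo \<open>m\<close> are disjoint.\<close>

lemma pint_nested_dvd: assumes I: "pint I m" and I': "pint I' m'" and sub: "Orb I'<=Orb I" shows "m dvd m'"
proof -
obtain x where x: "x:I'" using pint_nonempty[OF I'] by blast
hence "x:Orb I" using sub sub_orb by blast
then obtain J where J: "pint J m" "Orb J = Orb I" "x:J" using pint_at[OF I] by blast
have IJ: "I'<=J" using pint_nested[OF J(1) I'] J sub x by metis
have "fn m' ` I' = I'" using I' unfolding pint_def by blast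
hence "x:fn m' ` J" using IJ x by (metis image_mono subsetD)
hence "fn m' ` J Int fn 0 ` J~={}" using IJ x by auto
hence "m' mod m = 0" using pint_disjoint[OF J(1), of m' 0] by simp
thus ?thesis by blast
qed

lemma pint_nested_le: assumes "pint I m" "pint I' m'" "Orb I'<=Orb I" shows "m<=m'"
using dvd_imp_le[OF pint_nested_dvd[OF assms]] pint_pos[OF assms(2)] by simp

lemma pint_infinite_piece: assumes I: "pint I m" and inf: "infinite I" shows "infinite (fn i ` I)"
proof
assume "finite (fn i ` I)"
hence "finite (fn (m * i) ` I)"
proof -
 have "fn (m * i) ` I = fn ((m - 1) * i) ` fn i ` I"
 proof -
  have "(m - 1) * i + i = m * i" using pint_pos[OF I] by (cases m) auto
  thus ?thesis unfolding img_add by simp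
 qed
 thus ?thesis using \<open>finite (fn i ` I)\<close> by simp
qed
moreover have "fn (m * i) ` I = I" using pint_return[OF I, of 0 i] by (simp add: mult.commute)
ultimately show False using inf by simp
qed

lemma cyc_infinite: "pint I m ==> infinite (Orb I) <-> infinite I"
proof
assume I: "pint I m"
show "infinite I" if "infinite (Orb I)"
proof
 assume "finite I"
 hence "finite (Orb I)" unfolding pint_orb[OF I] by simp
 thus False using that by simp
qed
show "infinite (Orb I)" if "infinite I" using that sub_orb finite_subset by blast
qed

lemma infinite_Icc_iff': "infinite {a..b::real} <-> a<b" using infinite_Icc_iff by blast

lemma pint_nondegenerate: assumes I: "pint I m" and inf: "infinite (Orb I)"
obtains a b where "0<=a" "a<b" "b<=1" "fn i ` I = {a..b}"
proof -
obtain a b where ab: "0<=a" "a<=b" "b<=1" "fn i ` I = {a..b}" using pint_piece[OF I] by blast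
have "infinite {a..b}" using pint_infinite_piece[OF I] inf cyc_infinite[OF I] ab by metis
thus ?thesis using that ab infinite_Icc_iff' by metis
qed

lemma Icc_finite_boundary: "finite ({a..b::real} - interior {a..b})"
proof -
have "{a..b} - interior {a..b}<={a, b}" by (auto simp: interior_atLeastAtMost_real)
thus ?thesis by (rule finite_subset) simp
qed

lemma finite_boundary_UN: assumes "finite F" "!!A. A:F ==> EX a b. A = {a..b::real}" shows "finite (\<Union>F - interior (\<Union>F))"
proof -
have "\<Union>F - interior (\<Union>F)<=(UN A:F. A - interior A)" using interior_mono[of _ "\<Union>F"] by blast
moreover have "finite (UN A:F. A - interior A)" using assms Icc_finite_boundary by (metis finite_UN)
ultimately show ?thesis using finite_subset by blast
qed

lemma pint_bdry: assumes I: "pint I m" shows "finite (Orb I - interior (Orb I))"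
proof -
have "Orb I = \<Union>((%i. fn i ` I) ` {..<m})" by (simp add: pint_orb[OF I])
thus ?thesis using finite_boundary_UN[of "(%i. fn i ` I) ` {..<m}"] pint_piece[OF I]
 by (metis (no_types, lifting) finite_imageI finite_lessThan imageE)
qed

text \<open>Images of \<open>W\<close> may overlap before they return, so the pieces of the cycle
  are the connected components of the orbit of \<open>W\<close>. Each component is mapped into one
  component, and since \<open>f\<close> maps the orbit onto itself, onto it.\<close>

lemma cycle_of_returning_interval: assumes W: "connected W" "compact W" "W<={0..1}" "W~={}" and n: "n>=1" "fn n ` W = W"
shows "EX I m. pint I m & Orb I = Orb W"
proof -
define Y where "Y = Orb W"
have YU: "Y = (UN i<n. fn i ` W)"
proof
 show "Y<=(UN i<n. fn i ` W)"
 proof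
  fix y assume "y:Y"
  then obtain k where "y:fn k ` W" unfolding Y_def orb_def by blast
  moreover have "fn k ` W = fn (k mod n) ` fn (k div n * n) ` W" unfolding img_add by simp
  ultimately have "y:fn (k mod n) ` W" using fpow_mult_image[OF n(2)] by metis
  moreover have "k mod n<n" using n(1) by simp
  ultimately show "y:(UN i<n. fn i ` W)" by blast
 qed
 show "(UN i<n. fn i ` W)<=Y" unfolding Y_def orb_def by blast
qed
have Yc: "compact Y" unfolding YU using fpow_compact[OF W(2,3)] by (simp add: compact_UN)
have Yu: "Y<={0..1}" unfolding Y_def by (rule orb_unit[OF W(3)])
have fYs: "f ` Y<=Y" unfolding Y_def by (rule f_orb)
have fY: "f ` Y = Y"
proof
 have "Y<=f ` Y"
 proof
  fix y assume "y:Y"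
  then obtain k where "y:fn k ` W" unfolding Y_def orb_def by blast
  hence "y:fn k ` fn n ` W" using n(2) by simp
  hence "y:f ` fn (k + n - 1) ` W" unfolding img_add fpow_Suc_image using n(1) by simp
  thus "y:f ` Y" unfolding Y_def orb_def by blast
 qed
 thus "Y<=f ` Y" .
qed (rule fYs)
obtain w where w: "w:W" using W(4) by blast
define c where "c i = connected_component_set Y (fn i w)" for i
have wY: "fn i w:Y" for i unfolding Y_def orb_def using w by blast
have wc: "fn i w:c i" for i unfolding c_def using wY by simp
have cY: "c i<=Y" for i unfolding c_def by (rule connected_component_subset)
have cconn: "connected (c i)" for i unfolding c_def by simp
have ceq: "c i = c j" if "c i Int c j~={}" for i j using that connected_component_nonoverlap unfolding c_def by blast
have max: "K<=c i" if "connected K" "K<=Y" "K Int c i~={}" for K i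
proof -
 have "connected (K Un c i)" using that cconn by (simp add: connected_Un)
 moreover have "K Un c i<=Y" using that cY by blast
 ultimately show ?thesis using connected_component_maximal[of "fn i w" "K Un c i" Y] wc[of i] unfolding c_def by blast
qed
have fc: "f ` c i<=c (Suc i)" for i
proof (rule max)
 show "connected (f ` c i)" using fpow_conn[OF cconn, of i 1] cY Yu by force
 show "f ` c i<=Y" using cY fYs by blast
 show "f ` c i Int c (Suc i)~={}" using wc[of i] wc[of "Suc i"] by auto
qed
have cSuc: "c (Suc i) = c (Suc j)" if "c i = c j" for i j
proof (rule ceq)
 have "f ` c i<=c (Suc i)" "f ` c i<=c (Suc j)" "f ` c i~={}" using fc that wc[of i] by auto
 thus "c (Suc i) Int c (Suc j)~={}" by blast
qed
have cadd: "c (i + k) = c (j + k)" if "c i = c j" for i j k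
proof (induction k)
 case (Suc k)
 thus ?case using cSuc[of "i + k" "j + k"] by simp
qed (use that in simp)
have Wc: "fn i ` W<=c i" for i
proof (rule max)
 show "connected (fn i ` W)" by (rule fpow_conn[OF W(1,3)])
 show "fn i ` W<=Y" unfolding Y_def by (rule fpow_sub_orb)
 show "fn i ` W Int c i~={}" using w wc[of i] by blast
qed
have "c n = c 0"
proof (rule ceq)
 have "fn n w:W" using n(2) w by blast
 thus "c n Int c 0~={}" using Wc[of 0] wc[of n] by auto
qed
hence ex: "EX m. m>=1 & c m = c 0" using n(1) by blast
\<comment> \<open>The least period of the sequence \<open>c\<close>. Components at different times
  below \<open>m\<close> are disjoint, because a coincidence propagates forward to a return of
  \<open>c 0\<close> before time \<open>m\<close>.\<close>
define m where "m = (LEAST m. m>=1 & c m = c 0)"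
have m: "m>=1" "c m = c 0" unfolding m_def using LeastI_ex[OF ex] by auto
have least: "c k~=c 0" if "k>=1" "k<m" for k using not_less_Least[of k "%m. m>=1 & c m = c 0"] that m_def by blast
have neq: "c i~=c j" if "i<j" "j<m" for i j
proof
 assume "c i = c j"
 hence "c (i + (m - j)) = c (j + (m - j))" by (rule cadd)
 hence "c (i + (m - j)) = c 0" using that m by simp
 moreover have "1<=i + (m - j)" "i + (m - j)<m" using that by linarith+
 ultimately show False using least by blast
qed
have cm: "c (i + m) = c i" for i using cadd[OF m(2), of i] by (simp add: add.commute)
have cmk: "c (i + k * m) = c i" for i k
proof (induction k)
 case (Suc k)
 have "c (i + Suc k * m) = c ((i + k * m) + m)" by (simp add: algebra_simps)
 thus ?case using cm Suc by simp
qed simp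
have Ycov: "Y<=(UN i. c i)" unfolding Y_def orb_def using Wc by blast
have fceq: "f ` c i = c (Suc i)" for i
proof
 show "c (Suc i)<=f ` c i"
 proof
  fix y assume y: "y:c (Suc i)"
  hence "y:f ` Y" using cY fY by blast
  then obtain j z where z: "z:c j" "y = f z" using Ycov by blast
  hence "y:c (Suc j)" using fc[of j] by blast
  hence "c (Suc j) Int c (Suc i)~={}" using y by blast
  hence "c (Suc j) = c (Suc i)" by (rule ceq)
  hence "c (Suc j + (m - 1)) = c (Suc i + (m - 1))" by (rule cadd)
  hence "c (j + m) = c (i + m)" using m(1) by simp
  thus "y:f ` c i" using z cm by blast
 qed
qed (rule fc)
have fpc: "fn i ` c 0 = c i" for i
proof (induction i)
 case (Suc i)
 have "(f ^^ Suc i) ` c 0 = f ` fn i ` c 0" by (rule fpow_Suc_image[symmetric])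
 thus ?case using Suc fceq by simp
qed simp
have "compact (c 0)" unfolding c_def
 using Yc by (meson bounded_subset closed_connected_component compact_eq_bounded_closed connected_component_subset)
then obtain a b where ab: "c 0 = {a..b}" using cconn connected_compact_interval_1 by blast
have "a<=b" using ab wc[of 0] by auto
moreover have "{a..b}<={0..1}" using ab cY[of 0] Yu by blast
ultimately have "0<=a & a<=b & b<=1" by auto
moreover have "disjoint_family_on (%i. fn i ` c 0) {..<m}"
 unfolding disjoint_family_on_def fpc using ceq neq by (metis lessThan_iff linorder_neqE_nat)
ultimately have "pint (c 0) m" unfolding pint_def using ab m fpc by auto
moreover have "Orb (c 0) = Y" unfolding orb_def fpc using Ycov cY by blast
ultimately show ?thesis using Y_def by blast
qed

section \<open>The cycle generated by a returning interval\<close>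

text \<open>The closure of the orbit is forward invariant, so for \<open>U<={0..1}\<close> the
  intersection is decreasing. It discards what is transient: it contains every subset of
  \<open>Cl U\<close> that is covered by its own image (\<open>core_greatest\<close>).\<close>

definition core::"real set => real set" where
"core U = (INT k. fn k ` Cl U)"

lemma core_subset: "core U<=Cl U"
proof -
have "core U<=fn 0 ` Cl U" unfolding core_def by blast
thus ?thesis by simp
qed

lemma core_least: "U<=M ==> f ` M<=M ==> closed M ==> core U<=M" using core_subset cl_orb_least by (rule subset_trans)

lemma core_mono: assumes "U<=Cl V" "V<={0..1}" shows "core U<=core V"
proof -
have "Cl U<=Cl V" using closure_orb_trans[OF assms(2,1)] .
thus ?thesis unfolding core_def by blast
qed

lemma core_mono': "U<=V ==> V<={0..1} ==> core U<=core V" using core_mono sub_orb closure_subset by (meson subset_trans)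

lemma core_greatest: assumes "A<=Cl U" "A<=f ` A" shows "A<=core U"
proof -
have "A<=fn k ` A" for k
proof (induction k)
 case (Suc k)
 have "A<=fn k ` f ` A" using Suc assms(2) by (meson image_mono subset_trans)
 thus ?case by (simp add: image_comp funpow_swap1 comp_def)
qed simp
thus ?thesis unfolding core_def using assms(1) by blast
qed

lemma conn_INT: assumes "!!k::nat. is_interval (A k::real set)" shows "connected (INT k. A k)"
proof -
have "is_interval (INT k. A k)" unfolding is_interval_1
proof (intro ballI allI impI)
 fix a b x assume ab: "a:(INT k. A k)" "b:(INT k. A k)" "a<=x & x<=b"
 show "x:(INT k. A k)"
 proof
  fix k
  have "a:A k" "b:A k" using ab by simp_all
  thus "x:A k" using assms[of k] ab(3) unfolding is_interval_1 by blast
 qed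
qed
thus ?thesis by (simp add: is_interval_connected_1)
qed

lemma closure_UN_lessThan: "closure (UN i<n::nat. A i) = (UN i<n. closure (A i::real set))" by (induction n) (simp_all add: lessThan_Suc)

text \<open>As the \<open>n\<close>-th image of \<open>U\<close> meets \<open>U\<close>, consecutive
  images at the times \<open>k * n\<close> overlap. Their union is an interval that
  \<open>fn n\<close> maps into itself, and the whole orbit consists of \<open>n\<close> images of
  this interval.\<close>

lemma orb_returning: assumes U: "connected U" "U<={0..1}" and n: "n>=1" "fn n ` U Int U~={}"
defines "T \<equiv> (UN k. fn (k * n) ` U)" shows "connected T" "T<={0..1}" "T~={}" "fn n ` T<=T"
 "Orb U = (UN i<n. fn i ` T)"
 "Cl U = (UN i<n. fn i ` closure T)"
 "!!K. connected (UN k<=K. fn (k * n) ` U)"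
proof -
show TK: "connected (UN k<=K. fn (k * n) ` U)" for K
proof (induction K)
 case 0
 thus ?case using U by simp
next
 case (Suc K)
 obtain z u where z: "z:U" "u:U" "z = fn n u" using n(2) by blast
 have "fn (K * n) z = fn (Suc K * n) u" unfolding z(3) by (simp flip: fpow_add add: add.commute)
 hence "fn (K * n) z:fn (Suc K * n) ` U" using z(2) by blast
 moreover have "fn (K * n) z:(UN k<=K. fn (k * n) ` U)" using z(1) by blast
 ultimately have "fn (K * n) z:(UN k<=K. fn (k * n) ` U) Int fn (Suc K * n) ` U" by (intro IntI)
 hence ne: "(UN k<=K. fn (k * n) ` U) Int fn (Suc K * n) ` U~={}" by (metis empty_iff)
 have "(UN k<=Suc K. fn (k * n) ` U) = (UN k<=K. fn (k * n) ` U) Un fn (Suc K * n) ` U" unfolding atMost_Suc UN_insert by (rule Un_commute)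
 thus ?case using connected_Un[OF Suc fpow_conn[OF U] ne] by (simp only:)
qed
have Teq: "T = \<Union>(range (%K. UN k<=K. fn (k * n) ` U))" unfolding T_def by (intro equalityI subsetI) (auto intro: le_refl)
obtain u where u: "u:U" using n(2) by blast
show "connected T" unfolding Teq
proof (rule connected_Union)
 show "\<Inter> (range (%K. UN k<=K. fn (k * n) ` U))~={}" using u by (force intro!: exI[of _ u])
qed (use TK in auto)
show Tu: "T<={0..1}" unfolding T_def using fpow_unit[OF U(2)] by blast
show "T~={}" unfolding T_def using u by blast
show "fn n ` T<=T"
proof -
 have "fn n ` fn (k * n) ` U = fn (Suc k * n) ` U" for k unfolding img_add by simp
 thus ?thesis unfolding T_def image_UN by blast
qed
show orbT: "Orb U = (UN i<n. fn i ` T)"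
proof
 show "Orb U<=(UN i<n. fn i ` T)"
 proof
  fix y assume "y:Orb U"
  then obtain k where k: "y:fn k ` U" unfolding orb_def by blast
  have "fn k ` U = fn (k mod n) ` fn (k div n * n) ` U" unfolding img_add by simp
  hence "y:fn (k mod n) ` T" using k unfolding T_def by blast
  moreover have "k mod n<n" using n(1) by simp
  ultimately show "y:(UN i<n. fn i ` T)" by blast
 qed
 have "T<=Orb U" unfolding T_def orb_def by blast
 thus "(UN i<n. fn i ` T)<=Orb U" using fpow_image_orb by (meson UN_least image_mono subset_trans)
qed
show "Cl U = (UN i<n. fn i ` closure T)" unfolding orbT fpow_closure[OF Tu] by (rule closure_UN_lessThan)
qed

lemma closure_interval: assumes "connected T" "T<={0..1::real}" "T~={}" shows "EX a b. 0<=a & a<=b & b<=1 & closure T = {a..b}"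
proof -
have "connected (closure T)" using assms(1) by (rule connected_imp_connected_closure)
moreover have "closure T<={0..1}" using assms(2) closure_minimal by (metis closed_atLeastAtMost)
moreover from this have "compact (closure T)" by (rule compact_sub[OF closed_closure])
ultimately obtain a b where "closure T = {a..b}" using connected_compact_interval_1 by blast
moreover from this have "a<=b" using assms(3) by fastforce
ultimately show ?thesis using `closure T <= {0..1}` by auto
qed

text \<open>The closure \<open>V\<close> of the interval generated by \<open>U\<close> is mapped
  into itself by \<open>fn n\<close>. The intersection \<open>W\<close> of its images is an interval
  that \<open>fn n\<close> maps onto itself, and the core is the orbit of \<open>W\<close>.\<close>

lemma core_cycle: assumes U: "connected U" "U<={0..1}" and n: "n>=1" "fn n ` U Int U~={}" shows "EX I m. pint I m & Orb I = core U"
proof -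
define T where "T = (UN k. fn (k * n) ` U)"
note T = orb_returning[OF U n, folded T_def]
define V where "V = closure T"
obtain a b where ab: "0<=a" "a<=b" "b<=1" "V = {a..b}" using closure_interval[OF T(1-3)] V_def by blast
have Vu: "V<={0..1}" using ab by auto
define A where "A i k = fn (i + k * n) ` V" for i k
have fV: "fn n ` V<=V" unfolding V_def fpow_closure[OF T(2)] using T(4) by (rule closure_mono)
have Adec: "A i (Suc k)<=A i k" for i k
proof -
 have "A i (Suc k) = fn (i + k * n) ` fn n ` V" unfolding A_def img_add by (simp add: algebra_simps)
 thus ?thesis unfolding A_def using fV by (simp add: image_mono)
qed
have Acomp: "compact (A i k)" for i k unfolding A_def using fpow_compact[OF _ Vu] ab by simp
have Au: "A i k<={0..1}" for i k unfolding A_def using fpow_unit[OF Vu] .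
have Ale: "A i l<=A i k" if "k<=l" for i k l using lift_Suc_antimono_le[of "A i", OF Adec that] .
define W where "W = (INT k. A 0 k)"
have Ai: "fn i ` A 0 k = A i k" for i k unfolding A_def img_add by simp
have fW: "fn i ` W = (INT k. A i k)" for i unfolding W_def by (subst fpow_INT_decreasing) (use Acomp Au Adec Ai in auto)
have nW: "fn n ` W = W"
proof -
 have "A n k = A 0 (Suc k)" for k unfolding A_def by simp
 hence "fn n ` W = (INT k. A 0 (Suc k))" using fW[of n] by simp
 also have "... = W" unfolding W_def using Adec[of 0] by blast
 finally show ?thesis .
qed
have Wne: "W~={}" unfolding W_def
proof (rule compact_nest)
 show "A 0 k~={}" for k unfolding A_def using ab by simp
qed (use Acomp Ale in auto)
have Wint: "connected W"
proof -
 have "is_interval (A 0 k)" for k unfolding A_def is_interval_connected_1 using fpow_conn[of V] ab Vu by simp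
 thus ?thesis unfolding W_def by (rule conn_INT)
qed
have Wcomp: "compact W" unfolding W_def using Acomp by (intro compact_Inter) auto
have Wu: "W<={0..1}" unfolding W_def using Au by blast
have coreW: "core U = Orb W"
proof
 have A0: "A i (Suc k)<=fn k ` Cl U" if "i<n" for i k
 proof -
  have "A i (Suc k) = fn k ` fn (i + n + k * (n - 1)) ` V" unfolding A_def img_add using n(1) by (cases n) (simp_all add: algebra_simps)
  moreover have "fn j ` V<=Cl U" for j
  proof -
   have "T<=Orb U" unfolding T_def orb_def by blast
   hence "fn j ` T<=Orb U" using fpow_image_orb by (meson image_mono subset_trans)
   thus ?thesis unfolding V_def fpow_closure[OF T(2)] by (rule closure_mono)
  qed
  ultimately show ?thesis by (simp add: image_mono)
 qed
 show "Orb W<=core U"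
 proof -
  have "W<=A 0 (Suc 0)" unfolding W_def by (rule INT_lower) simp
  also have "...<=Cl U" using A0[of 0 0] n(1) by simp
  finally have "W<=Cl U" .
  hence "Orb W<=Cl U" by (rule orb_least) (rule f_cl_orb_sub[OF U(2)])
  moreover have "Orb W<=f ` Orb W"
  proof
   fix y assume "y:Orb W"
   then obtain k where "y:fn k ` W" unfolding orb_def by blast
   hence "y:fn k ` fn n ` W" using nW by simp
   hence "y:f ` fn (k + n - 1) ` W" unfolding img_add fpow_Suc_image using n(1) by simp
   thus "y:f ` Orb W" unfolding orb_def by blast
  qed
  ultimately show ?thesis by (rule core_greatest)
 qed
 show "core U<=Orb W"
 proof
  fix y assume y: "y:core U"
  have "EX i<n. y:A i k" for k
  proof -
   have "y:fn (k * n) ` Cl U" using y unfolding core_def by blast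
   thus ?thesis unfolding T(6) image_UN img_add A_def V_def by (auto simp: add.commute)
  qed
  then obtain g where g: "!!k. g k<n & y:A (g k) k" by metis
  \<comment> \<open>Every \<open>k\<close> has a residue \<open>i\<close> with
    \<open>y:A i k\<close>. One residue occurs infinitely often, and as \<open>A i\<close>
    decreases, it serves for all \<open>k\<close>.\<close>
  have "EX i<n. infinite {k. g k = i}"
  proof (rule ccontr)
   assume "~ ?thesis"
   hence "finite (UN i<n. {k. g k = i})" by blast
   moreover have "(UN i<n. {k. g k = i}) = UNIV" using g by auto
   ultimately show False by simp
  qed
  then obtain i where i: "i<n" "infinite {k. g k = i}" by blast
  have "y:A i k" for k
  proof -
   obtain l where "l>=k" "g l = i" using i(2) unfolding infinite_nat_iff_unbounded_le by blast
   thus ?thesis using g[of l] Ale[of k l i] by blast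
  qed
  hence "y:fn i ` W" unfolding fW by (rule INT_I)
  thus "y:Orb W" using fpow_sub_orb by (rule subsetD[rotated])
 qed
qed
show ?thesis unfolding coreW by (rule cycle_of_returning_interval[OF Wint Wcomp Wu Wne n(1) nW])
qed

lemma closure_orb_finite_boundary: assumes U: "connected U" "U<={0..1}" and n: "n>=1" "fn n ` U Int U~={}" shows "finite (Cl U - interior (Cl U))"
proof -
define T where "T = (UN k. fn (k * n) ` U)"
note T = orb_returning[OF U n, folded T_def]
obtain a b where ab: "0<=a" "a<=b" "b<=1" "closure T = {a..b}" using closure_interval[OF T(1-3)] by blast
have "Cl U = \<Union>((%i. fn i ` closure T) ` {..<n})" using T(6) by simp
thus ?thesis using finite_boundary_UN[of "(%i. fn i ` closure T) ` {..<n}"]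
  fpow_interval[OF ab(1-3)] ab(4) by (metis (no_types, lifting) finite_imageI finite_lessThan imageE)
qed

text \<open>\<open>Cl U\<close> is a finite union of closed intervals, the closures of images of
  \<open>T\<close>. Away from their end points, a point has points of the same image of
  \<open>T\<close> on both sides. Two such points already lie in a connected union of finitely many
  images of \<open>U\<close>, which turns density of the orbit into covering.\<close>

lemma returning_orb_covers: assumes U: "connected U" "U<={0..1}" and n: "n>=1" "fn n ` U Int U~={}"
shows "EX X. finite X & (ALL b:Cl U - X. EX K u v. u<b & b<v & {u..v}<=(UN k<=K. fn k ` U))"
proof -
define TK where "TK K = (UN k<=K. fn (k * n) ` U)" for K
define T where "T = (UN k. fn (k * n) ` U)"
note T = orb_returning[OF U n, folded T_def TK_def]
have "EX a b. fn i ` closure T = {a..b}" for i using closure_interval[OF T(1-3)] fpow_interval by metis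
then obtain a b where ab: "!!i. fn i ` closure T = {a i..b i}" by metis
define X where "X = (UN i<n. {a i, b i})"
have "EX K u v. u<y & y<v & {u..v}<=(UN k<=K. fn k ` U)" if y: "y:Cl U - X" for y
proof -
 obtain i where i: "i<n" "y:{a i..b i}" using y T(6) ab by auto
 have lt: "a i<y" "y<b i" using y i unfolding X_def by (auto simp: less_le)
 have cl: "closure (fn i ` T) = {a i..b i}" using fpow_closure[OF T(2)] ab by metis
 have 1: "EX u:fn i ` T. u<y"
 proof (rule ccontr)
  assume "~ ?thesis"
  hence "fn i ` T<={y..}" by force
  hence "closure (fn i ` T)<={y..}" by (rule closure_minimal) simp
  thus False using cl lt i by auto
 qed
 have 2: "EX v:fn i ` T. y<v"
 proof (rule ccontr)
  assume "~ ?thesis"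
  hence "fn i ` T<={..y}" by force
  hence "closure (fn i ` T)<={..y}" by (rule closure_minimal) simp
  thus False using cl lt i by auto
 qed
 obtain u v where uv: "u:fn i ` T" "u<y" "v:fn i ` T" "y<v" using 1 2 by blast
 obtain k1 where k1: "u:fn i ` fn (k1 * n) ` U" using uv(1) unfolding T_def by blast
 obtain k2 where k2: "v:fn i ` fn (k2 * n) ` U" using uv(3) unfolding T_def by blast
 define K where "K = max k1 k2"
 have uK: "u:fn i ` TK K" "v:fn i ` TK K" using k1 k2 unfolding TK_def K_def by (blast intro: max.cobounded1 max.cobounded2)+
 have TKu: "TK K<={0..1}" unfolding TK_def using fpow_unit[OF U(2)] by blast
 have "connected (fn i ` TK K)" using fpow_conn[OF T(7) TKu] .
 hence "{u..v}<=fn i ` TK K" using uK connected_contains_Icc by blast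
 also have "...<=(UN k<=i + K * n. fn k ` U)"
 proof
  fix z assume "z:fn i ` TK K"
  then obtain k where k: "k<=K" "z:fn (i + k * n) ` U" unfolding TK_def image_UN img_add by blast
  hence "i + k * n<=i + K * n" by simp
  thus "z:(UN k<=i + K * n. fn k ` U)" using k(2) by blast
 qed
 finally show ?thesis using uv by blast
qed
hence "ALL b:Cl U - X. EX K u v. u<b & b<v & {u..v}<=(UN k<=K. fn k ` U)" by (rule ballI)
moreover have "finite X" unfolding X_def by simp
ultimately show ?thesis by (intro exI[of _ X] conjI)
qed

section \<open>Decreasing sequences of cycles\<close>

text \<open>The periods of nested cycles are nondecreasing. If they are unbounded, the pieces around
  \<open>x\<close> are generating intervals; otherwise the periods are eventually constant, and the
  pieces around \<open>x\<close> shrink to an interval of that period.\<close>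

lemma decreasing_cycles: assumes I: "!!n. pint (I n) (m n)" and dec: "!!n. Orb (I (Suc n))<=Orb (I n)" and x: "!!n. x:Orb (I n)"
shows "solen (QQ I) | (EX K p. pint K p & Orb K = QQ I)"
proof -
have "EX J. pint J (m n) & Orb J = Orb (I n) & x:J" for n using pint_at[OF I x] by metis
then obtain J where J: "!!n. pint (J n) (m n)" "!!n. Orb (J n) = Orb (I n)" "!!n. x:J n" by metis
have Jdec: "J (Suc n)<=J n" for n using pint_nested[OF J(1)[of n] J(1)[of "Suc n"]] J(2,3) dec by metis
have mle: "m n<=m (Suc n)" for n using pint_nested_le[OF J(1)[of n] J(1)[of "Suc n"]] J(2) dec by metis
have mmono: "m k<=m n" if "k<=n" for k n using lift_Suc_mono_le[of m, OF mle that] .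
show ?thesis
proof (cases "ALL B. EX n. m n>=B")
 case True
 have "filterlim m at_top sequentially" unfolding filterlim_at_top eventually_sequentially
 proof
  fix B
  obtain n where "m n>=B" using True by blast
  thus "EX N. ALL k>=N. B<=m k" using mmono by (meson order_trans)
 qed
 hence "gen J m" unfolding gen_def using J Jdec by blast
 moreover have "(QQ I) = QQ J" using J(2) by simp
 ultimately show ?thesis unfolding solenoidal_Q_def by (intro disjI1 exI conjI)
next
 case False
 then obtain B where B: "!!n. m n<B" by (meson not_le)
 have "range m<={..<B}" using B by auto
 hence "finite (range m)" by (rule finite_subset) simp
 hence "Max (range m):range m" by (rule Max_in) simp
 then obtain N where N: "m N = Max (range m)" by (metis imageE)
 have mN: "m n = m N" if "n>=N" for n using mmono[OF that] Max_ge[OF `finite (range m)`, of "m n"] N by simp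
 define L where "L n = J (n + N)" for n
 define p where "p = m N"
 have L: "pint (L n) p" for n unfolding L_def p_def using J(1)[of "n + N"] mN[of "n + N"] by simp
 have Ldec: "L (Suc n)<=L n" for n unfolding L_def using Jdec by simp
 have Lle: "L n<=L k" if "k<=n" for k n using lift_Suc_antimono_le[of L, OF Ldec that] .
 have xL: "x:L n" for n unfolding L_def using J by simp
 define W where "W = (INT n. L n)"
 have Lcomp: "compact (L n)" for n using pint_compact[OF L, of 0] by simp
 have fW: "fn i ` W = (INT n. fn i ` L n)" for i unfolding W_def by (rule fpow_INT_decreasing) (use Lcomp Ldec pint_unit[OF L] in auto)
 have "is_interval (L n)" for n using pint_conn[OF L, of 0 n] is_interval_connected_1 by simp
 hence "connected W" unfolding W_def by (rule conn_INT)
 moreover have "compact W" unfolding W_def using Lcomp by (intro compact_Inter) auto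
 ultimately obtain a b where ab: "W = {a..b}" using connected_compact_interval_1 by blast
 have xW: "x:W" unfolding W_def using xL by blast
 have "{a..b}<={0..1}" using ab pint_unit[OF L, of 0] unfolding W_def by blast
 hence "EX a b. 0<=a & a<=b & b<=1 & W = {a..b}" using ab xW by (intro exI[of _ a] exI[of _ b]) auto
 moreover have "disjoint_family_on (%i. fn i ` W) {..<p}"
 proof -
  have "disjoint_family_on (%i. fn i ` L 0) {..<p}" using L unfolding pint_def by blast
  moreover have sub: "fn i ` W<=fn i ` L 0" for i unfolding W_def by blast
  have "A' Int B' = {}" if "A Int B = {}" "A'<=A" "B'<=B" for A B A' B' :: "real set" using that by blast
  ultimately show ?thesis unfolding disjoint_family_on_def using sub by (meson)
 qed
 moreover have "fn p ` W = W"
 proof -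
  have "fn p ` L n = L n" for n using L unfolding pint_def by blast
  thus ?thesis using fW[of p] unfolding W_def by simp
 qed
 ultimately have W: "pint W p" unfolding pint_def using pint_pos[OF L] by (intro conjI)
 have "Orb W = QQ L"
 proof
  show "Orb W<=QQ L" unfolding W_def by (intro INT_greatest orb_mono) blast
  show "(QQ L)<=Orb W"
  proof
   fix y assume y: "y:QQ L"
   then obtain i where i: "y:fn i ` L 0" unfolding orb_def by blast
   \<comment> \<open>Membership at level \<open>0\<close> fixes the index of the piece modulo
     \<open>p\<close>, and because the pieces are nested this index works at every level.\<close>
   have "y:fn i ` L n" for n
   proof -
    obtain j where j: "y:fn j ` L n" using y unfolding orb_def by blast
    hence "y:fn j ` L 0" using Lle[of 0 n] by blast
    hence "i mod p = j mod p" using pint_disjoint[OF L] i by blast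
    thus ?thesis using j pint_mod[OF L, of i n] pint_mod[OF L, of j n] by simp
   qed
   hence "y:fn i ` W" unfolding fW by (rule INT_I)
   thus "y:Orb W" using fpow_sub_orb by (rule subsetD[rotated])
  qed
 qed
 moreover have "(QQ L) = QQ I"
 proof -
  have ole: "Orb (I n)<=Orb (I k)" if "k<=n" for k n using lift_Suc_antimono_le[of "%n. Orb (I n)", OF dec that] .
  have "(QQ L)<=Orb (I k)" for k using ole[of k "k + N"] J(2)[of "k + N"] unfolding L_def by auto
  moreover have "Orb (L n) = Orb (I (n + N))" for n unfolding L_def by (rule J(2))
  ultimately show ?thesis by blast
 qed
 ultimately show ?thesis using W by metis
qed
qed

section \<open>Infinite limit sets\<close>

declare [[blast_depth_limit = 7]]

lemma pint_local: assumes J: "pint J m" and y: "y:J" shows "EX e>0. ball y e Int Orb J<=J"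
proof -
define R where "R = (UN i:{1..<m}. fn i ` J)"
have split: "Orb J = J Un R"
proof -
 have "{..<m} = insert 0 {1..<m}" using pint_pos[OF J] by auto
 thus ?thesis unfolding pint_orb[OF J] R_def by simp
qed
have cl: "closed R" unfolding R_def by (intro closed_UN) (auto intro: compact_imp_closed pint_compact[OF J])
have "y~:R"
proof
 assume "y:R"
 then obtain i where i: "i:{1..<m}" "y:fn i ` J" unfolding R_def by blast
 thus False using pint_disjoint[OF J, of 0 i] y by auto
qed
then obtain e where "e>0" "ball y e <= - R" using cl by (metis ComplI open_Compl open_contains_ball)
thus ?thesis using split by blast
qed

lemma omega_visits: assumes "x:{0..1}" "y:om x" "open V" "y:V" shows "EX n>=N. fn n x:V"
proof -
obtain e where e: "e>0" "ball y e<=V" using assms(3,4) open_contains_ball by blast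
obtain n where n: "n>=N" "abs (fn n x - y)<e" using omD[OF assms(2) e(1)] by blast
hence "fn n x:ball y e" by (simp add: dist_real_def abs_minus_commute)
thus ?thesis using n e by blast
qed

lemma visits_return: assumes "!!N. EX n>=N. fn n x:U" shows "EX n>=1. fn n ` U Int U~={}"
proof -
obtain a where a: "fn a x:U" using assms by blast
obtain b where b: "b>=Suc a" "fn b x:U" using assms by blast
have "fn (b - a) (fn a x) = fn b x" using b(1) by (simp flip: fpow_add)
hence "fn b x:fn (b - a) ` U" using a by (metis imageI)
thus ?thesis using b by (intro exI[of _ "b - a"]) auto
qed

lemma omega_subset_core: assumes x: "x:{0..1}" and U: "U<={0..1}" and v: "!!N. EX n>=N. fn n x:U" shows "om x<=core U"
proof -
have "om x<=fn k ` Cl U" for k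
proof -
 obtain a where a: "fn a x:U" using v by blast
 have cl: "closed (fn k ` Cl U)" using f_cl_orb[OF U, of k] by simp
 have "fn n x:fn k ` Cl U" if n: "n>=a + k" for n
 proof -
  have "fn n x = fn k (fn (n - k - a) (fn a x))" using n by (simp flip: fpow_add)
  moreover have "fn (n - k - a) (fn a x):Orb U" using a fpow_sub_orb by (metis imageI subsetD)
  ultimately show ?thesis using closure_subset by (metis imageI subsetD)
 qed
 thus ?thesis by (rule om_subset_closed[OF cl])
qed
thus ?thesis unfolding core_def by (intro INT_greatest)
qed

lemma core_visits_cycle: assumes x: "x:{0..1}" and U: "connected U" "U<={0..1}" and v: "!!N. EX n>=N. fn n x:U"
shows "EX I m. pint I m & Orb I = core U" using core_cycle[OF U] visits_return[OF v] by metis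

lemma infinite_interior: assumes "infinite L" "L<=M" "finite (M - interior M)" "finite X" shows "EX y:L. y:interior M & y~:X"
proof (rule ccontr)
assume "~ ?thesis"
hence "L<=(M - interior M) Un X" using assms(2) by blast
thus False using assms finite_subset by (meson finite_UnI)
qed

text \<open>Cycles have a finite boundary, so an infinite limit set has a point in the interior of
  both. The orbit returns to a ball around it that lies in both cycles, and the core of this ball is
  the smaller cycle.\<close>

lemma omega_cycles_directed: assumes x: "x:{0..1}" and inf: "infinite (om x)" and I: "pint I m" "om x<=Orb I" and J: "pint J k" "om x<=Orb J"
shows "EX K p. pint K p & om x<=Orb K & Orb K<=Orb I & Orb K<=Orb J"
proof -
obtain y where y: "y:om x" "y:interior (Orb I)" "y~:Orb J - interior (Orb J)"
 using infinite_interior[OF inf I(2) pint_bdry[OF I(1)] pint_bdry[OF J(1)]] by blast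
have yJ: "y:interior (Orb J)" using y J(2) by blast
have "open (interior (Orb I) Int interior (Orb J))" by (intro open_Int open_interior)
then obtain e where e: "e>0" "ball y e<=interior (Orb I) Int interior (Orb J)" using y(2) yJ open_contains_ball by (metis IntI)
have sub: "ball y e<=Orb I" "ball y e<=Orb J" using e interior_subset by fast+
have unit: "ball y e<={0..1}" using sub(1) cyc_unit[OF I(1)] by (rule subset_trans)
have v: "EX n>=N. fn n x:ball y e" for N using omega_visits[OF x y(1), of "ball y e"] e(1) by simp
obtain K p where K: "pint K p" "Orb K = core (ball y e)" using core_visits_cycle[OF x _ unit v] by auto
have "om x<=core (ball y e)" using omega_subset_core[OF x unit v] .
moreover have "core (ball y e)<=Orb I" "core (ball y e)<=Orb J" using core_least[OF sub(1) f_orb cyc_closed[OF I(1)]]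
  core_least[OF sub(2) f_orb cyc_closed[OF J(1)]] .
ultimately show ?thesis using K by metis
qed

lemma rational_intervals:
"EX U::nat => real set. (ALL j. open (U j) & connected (U j)) &
  (ALL V y. open V & y:V --> (EX j. y:U j & U j<=V))"
proof -
have c: "countable (\<rat> \<times> \<rat> :: (real \<times> real) set)" using countable_rat by blast
define F where "F j = (%(a, b). {a<..<b}) (from_nat_into (\<rat> \<times> \<rat> :: (real \<times> real) set) j)" for j
have "EX j. y:F j & F j<=V" if V: "open V" "y:V" for V y
proof -
 obtain e where e: "e>0" "ball y e<=V" using V open_contains_ball by blast
 obtain a where a: "a:\<rat>" "y - e<a" "a<y" using Rats_dense_in_real[of "y - e" y] e(1) by auto
 obtain b where b: "b:\<rat>" "y<b" "b<y + e" using Rats_dense_in_real[of y "y + e"] e(1) by auto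
 have "(a, b):\<rat> \<times> \<rat>" using a b by simp
 then obtain j where j: "from_nat_into (\<rat> \<times> \<rat>) j = (a, b)" using from_nat_into_surj[OF c] by blast
 hence "F j = {a<..<b}" unfolding F_def by simp
 moreover have "{a<..<b}<=ball y e" using a b by (auto simp: dist_real_def)
 ultimately show ?thesis using a b e by (intro exI[of _ j]) auto
qed
moreover have "open (F j) & connected (F j)" for j unfolding F_def by (auto split: prod.split)
ultimately show ?thesis by (intro exI[of _ F]) blast
qed

lemma openin_ball: assumes "openin (top_of_set M) V" "y:V" shows "EX e>0. ball y e Int M<=V"
proof -
obtain T where "open T" "V = M Int T" using assms(1) by (auto simp: openin_open)
thus ?thesis using assms(2) open_contains_ball[of T] by blast
qed

text \<open>Diagonal construction: cycles that contain the limit set are shrunk successively into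
  the core of each rational interval that meets it. Their intersection lies in all these cores, and
  if it is a cycle, this makes the orbits of neighborhoods of limit points dense in it.\<close>

theorem om_cases: assumes x: "x:{0..1}" and inf: "infinite (om x)" shows "(EX Q. solen Q & om x<=Q) |
    (EX I m B. basic_set_of f I m B & om x<=B)"
proof -
define L where "L = om x"
have Linf: "infinite L" using inf L_def by simp
obtain U0::"nat => real set" where U0: "!!j. open (U0 j)" "!!j. connected (U0 j)"
 "!!V y. open V ==> y:V ==> EX j. y:U0 j & U0 j<=V" using rational_intervals by metis
define U where "U j = U0 j Int {0..1}" for j
have Uu: "U j<={0..1}" for j unfolding U_def by blast
have Uconn: "connected (U j)" for j using U0(2)[of j] unfolding U_def by (simp add: is_interval_Int flip: is_interval_connected_1)
have Uv: "EX n>=N. fn n x:U j" if ne: "U0 j Int L~={}" for j N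
proof -
 obtain y where "y:U0 j" "y:L" using ne by blast
 then obtain n where "n>=N" "fn n x:U0 j" using omega_visits[OF x _ U0(1)] L_def by blast
 thus ?thesis unfolding U_def using fpow_maps[OF x] by blast
qed
have Ucore: "EX I m. pint I m & Orb I = core (U j)" if "U0 j Int L~={}" for j using core_visits_cycle[OF x Uconn Uu Uv[OF that]] .
have LU: "L<=core (U j)" if "U0 j Int L~={}" for j unfolding L_def using omega_subset_core[OF x Uu Uv[OF that]] .
define P where "P n Im <-> pint (fst Im) (snd Im) & L<=Orb (fst Im) &
  (U0 n Int L~={} --> Orb (fst Im)<=core (U n))" for n and Im::"real set \<times> nat"
have step: "EX Jk. P n Jk & Orb (fst Jk)<=Orb I" if I: "pint I m" "L<=Orb I" for I m n
proof (cases "U0 n Int L~={}")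
 case True
 obtain J k where J: "pint J k" "Orb J = core (U n)" using Ucore[OF True] by blast
 obtain K p where "pint K p" "L<=Orb K" "Orb K<=Orb I" "Orb K<=Orb J"
  using omega_cycles_directed[OF x inf I(1) _ J(1)] I(2) J(2) LU[OF True] L_def by metis
 thus ?thesis unfolding P_def using J(2) by (intro exI[of _ "(K, p)"]) simp
next
 case False
 thus ?thesis unfolding P_def using I by (intro exI[of _ "(I, m)"]) simp
qed
have v01: "!!N. EX n>=N. fn n x:{0..1}" using fpow_maps[OF x] by blast
obtain I0 m0 where I0: "pint I0 m0" "Orb I0 = core {0..1}" using core_visits_cycle[OF x connected_Icc _ v01] by auto
have L0: "L<=Orb I0" unfolding I0(2) L_def using omega_subset_core[OF x _ v01] by simp
have "EX g. ALL n. P n (g n) & Orb (fst (g (Suc n)))<=Orb (fst (g n))"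
proof (rule dependent_nat_choice)
 show "EX Im. P 0 Im" using step[OF I0(1) L0] by blast
 show "EX y. P (Suc n) y & Orb (fst y)<=Orb (fst Im)" if "P n Im" for Im n using step[of "fst Im" "snd Im"] that unfolding P_def by blast
qed
then obtain g where g: "!!n. P n (g n)" "!!n. Orb (fst (g (Suc n)))<=Orb (fst (g n))" by blast
define I where "I n = fst (g n)" for n
have I: "pint (I n) (snd (g n))" "L<=Orb (I n)"
 "U0 n Int L~={} ==> Orb (I n)<=core (U n)" for n using g(1)[of n] unfolding P_def I_def by auto
obtain y0 where y0: "y0:L" using Linf by fastforce
have LM: "L<=QQ I" using I(2) by blast
have "solen (QQ I) | (EX K p. pint K p & Orb K = QQ I)" by (rule decreasing_cycles[OF I(1)]) (use g(2) I(2) y0 in "auto simp: I_def")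
thus ?thesis
proof
 assume "solen (QQ I)"
 thus ?thesis using LM L_def by blast
next
 assume "EX K p. pint K p & Orb K = QQ I"
 then obtain K p where K: "pint K p" "Orb K = QQ I" by blast
 define M where "M = Orb K"
 have LM: "L<=M" using LM K M_def by simp
 have MU: "M<=core (U n)" if "U0 n Int L~={}" for n using I(3)[OF that] K(2) M_def by blast
 note Mu = cyc_unit[OF K(1), folded M_def]
 have fM: "f ` M<=M" unfolding M_def by (rule f_orb)
 note clM = cyc_closed[OF K(1), folded M_def]
 obtain N where N: "fn N x:M"
 proof -
  obtain y where y: "y:L" "y:interior M" using infinite_interior[OF Linf LM] pint_bdry[OF K(1)] M_def by (metis finite.emptyI)
  thus ?thesis using that omega_visits[OF x _ open_interior y(2), of 0] interior_subset L_def by blast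
 qed
 have tail: "fn n x:M" if "n>=N" for n
 proof -
  have "fn (n - N) (fn N x):M" using inv_fpow[OF fM] N by blast
  thus ?thesis using that by (simp flip: fpow_add)
 qed
 have "L<=B_set M f"
 proof
  fix y assume y: "y:L"
  have yM: "y:M" using y LM by blast
  obtain J where J: "pint J p" "Orb J = M" "y:J" using pint_at[OF K(1)] yM M_def by metis
  obtain e0 where e0: "e0>0" "ball y e0 Int M<=J" using pint_local[OF J(1,3)] J(2) by blast
  have "Cl V = M" if V: "openin (top_of_set M) V" "y:V" for V
  proof -
   have VM: "V<=M" using V(1) openin_imp_subset by blast
   obtain e where e: "e>0" "ball y e Int M<=V" using openin_ball[OF V] by blast
   \<comment> \<open>Restricting the ball to the piece around \<open>y\<close> makes the
     neighborhood connected, as \<open>core_visits_cycle\<close> requires.\<close>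
   define W where "W = ball y (min e e0) Int J"
   have JM: "J<=M" using J(2) sub_orb by blast
   have WV: "W<=V" unfolding W_def using e JM by auto
   have Wu: "W<={0..1}" using WV VM Mu by blast
   have Wc: "connected W" unfolding W_def
    using pint_conn[OF J(1), of 0] by (simp add: is_interval_Int is_interval_ball_real flip: is_interval_connected_1)
   have Wv: "EX n>=k. fn n x:W" for k
   proof -
    obtain n where n: "n>=max k N" "fn n x:ball y (min e e0)" using omega_visits[OF x, of y "ball y (min e e0)" "max k N"] y L_def e(1) e0(1) by auto
    have "fn n x:ball y e0 Int M" using n tail[of n] by auto
    hence "fn n x:W" unfolding W_def using n(2) e0(2) by blast
    thus ?thesis using n(1) by auto
   qed
   obtain T q where T: "pint T q" "Orb T = core W" using core_visits_cycle[OF x Wc Wu Wv] by blast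
   have LW: "L<=core W" unfolding L_def using omega_subset_core[OF x Wu Wv] .
   \<comment> \<open>The core of \<open>W\<close> has a limit point in its interior, hence contains
     a member of the base around it; and \<open>M\<close> lies in the core of that member.\<close>
   obtain z where z: "z:L" "z:interior (core W)" using infinite_interior[OF Linf LW] pint_bdry[OF T(1)] T(2) by (metis finite.emptyI)
   obtain j where j: "z:U0 j" "U0 j<=interior (core W)" using U0(3)[OF open_interior z(2)] by blast
   have "U0 j Int L~={}" using j z by blast
   hence "M<=core (U j)" by (rule MU)
   also have "core (U j)<=core W"
   proof (rule core_mono[OF _ Wu])
    show "U j<=Cl W" using j(2) interior_subset[of "core W"] core_subset[of W] unfolding U_def by blast
   qed
   also have "...<=Cl V" using core_subset[of W] closure_mono[OF orb_mono[OF WV]] by (rule subset_trans)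
   finally have "M<=Cl V" .
   moreover have "Cl V<=M" by (rule cl_orb_least[OF VM fM clM])
   ultimately show ?thesis by blast
  qed
  thus "y:B_set M f" unfolding B_set_def using yM by blast
 qed
 moreover from this have "infinite (B_set M f)" using Linf finite_subset by blast
 ultimately show ?thesis unfolding basic_set_of_def using K(1) M_def L_def by blast
qed
qed

end

section \<open>Germs of intervals and basic sets\<close>

text \<open>One-sided open neighborhoods: \<open>s\<close> is the side, \<open>1\<close> or \<open>-1\<close>.\<close>

definition ger::"real => real => real => real set" where
"ger x s e = {y. 0<s * (y - x) & s * (y - x)<e}"

definition side::"real => bool" where "side s <-> s = 1 | s = -1"

definition seg::"real => real => real => real set" where
"seg x s e = {y. 0<=s * (y - x) & s * (y - x)<=e}"

lemma side_simps [simp]: "side 1" "side (-1)" "side (- s) <-> side s" unfolding side_def by auto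

lemma ne_from_mem: "x:A ==> A~={}" by auto

lemma ger_1: "ger x 1 e = {x<..<x + e}" and ger_m1: "ger x (-1) e = {x - e<..<x}" unfolding ger_def by auto

lemma seg_1: "seg x 1 e = {x..x + e}" and seg_m1: "seg x (-1) e = {x - e..x}" unfolding seg_def by auto

lemma ger_open: "side s ==> open (ger x s e)" unfolding side_def using ger_1 ger_m1 by auto

lemma ger_connected: "side s ==> connected (ger x s e)" unfolding side_def using ger_1 ger_m1 by auto

lemma seg_connected: "side s ==> connected (seg x s e)" unfolding side_def using seg_1 seg_m1 by auto

lemma seg_compact: "side s ==> compact (seg x s e)" unfolding side_def using seg_1 seg_m1 by auto

lemma seg_Icc: "side s ==> EX a b. seg x s e = {a..b}" unfolding side_def using seg_1[of x e] seg_m1[of x e] by (elim disjE) auto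

lemma ger_mono: "e<=e' ==> ger x s e<=ger x s e'" unfolding ger_def by auto

lemma ger_nonempty: "side s ==> e>0 ==> ger x s e~={}" unfolding side_def using ger_1[of x e] ger_m1[of x e] by auto

lemma closure_ger: "side s ==> e>0 ==> closure (ger x s e) = seg x s e"
unfolding side_def using ger_1[of x e] ger_m1[of x e] seg_1[of x e] seg_m1[of x e] by auto

lemma ger_seg: "ger x s e<=seg x s e" unfolding ger_def seg_def by auto

lemma seg_ger: "seg x s e<=insert x (ger x s e')" if "side s" "e<e'" using that unfolding side_def seg_def ger_def by auto

lemma ger_ball: "side s ==> ger x s e<=ball x e" unfolding side_def ger_def by (auto simp: dist_real_def)

lemma ball_split: "e>0 ==> ball x e = insert x (ger x 1 e Un ger x (-1) e)" unfolding ger_1 ger_m1 by (auto simp: dist_real_def)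

lemma ball_split': "side s ==> e>0 ==> ball x e = insert x (ger x s e Un ger x (-s) e)"
using ball_split[of e x] unfolding side_def by (elim disjE) (simp_all only: minus_minus Un_commute)

lemma mem_ger_abs: "side s ==> y:ger x s e <-> abs (y - x)<e & 0<s * (y - x)" unfolding side_def ger_def by auto

lemma ger_points: "side s ==> 0<t ==> t<e ==> x + s * t:ger x s e" unfolding side_def ger_def by auto

lemma connected_contains_ger: assumes s: "side s" and A: "connected A" and fr: "!!e. e>0 ==> A Int ger x s e~={}" shows "EX e>0. ger x s e<=A"
proof -
obtain a where a: "a:A" "a:ger x s 1" using fr[of 1] by auto
define d where "d = s * (a - x)"
have d: "d>0" using a unfolding ger_def d_def by simp
have "ger x s d<=A"
proof
 fix y assume y: "y:ger x s d"
 hence "s * (y - x)>0" unfolding ger_def by simp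
 then obtain b where b: "b:A" "b:ger x s (s * (y - x))" using fr[of "s * (y - x)"] by auto
 consider "b<=y & y<=a" | "a<=y & y<=b" using s b(2) y unfolding side_def ger_def d_def by fastforce
 thus "y:A" using connected_contains_Icc[OF A] a(1) b(1) by cases (meson atLeastAtMost_iff subsetD)+
qed
thus ?thesis using d by blast
qed

lemma finite_UN_ger: assumes s: "side s" and A: "!!k. k:K ==> connected (A k)" and K: "finite K"
 and fr: "!!e. e>0 ==> (UN k:K. A k) Int ger x s e~={}" shows "EX k:K. EX e>0. ger x s e<=A k"
proof (rule ccontr)
assume no: "~ ?thesis"
have "EX e>0. A k Int ger x s e = {}" if k: "k:K" for k
proof (rule ccontr)
 assume "~ ?thesis"
 hence "EX e>0. ger x s e<=A k" using connected_contains_ger[OF s A[OF k]] by meson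
 thus False using no k by blast
qed
then obtain E where E: "!!k. k:K ==> E k>0 & A k Int ger x s (E k) = {}" by metis
define e where "e = Min (insert 1 (E ` K))"
have e: "e>0" unfolding e_def using K E by auto
have "e<=E k" if "k:K" for k unfolding e_def using K that by (intro Min_le) auto
hence "A k Int ger x s e = {}" if "k:K" for k using E[OF that] ger_mono[of e "E k" x s] that by blast
thus False using fr[OF e] by blast
qed

context interval_map
begin

text \<open>\<open>DG\<close> stands for dense germ. It replaces membership in
  \<open>B_set M f\<close>, which tests full neighborhoods in \<open>M\<close>, by a condition on a
  single side that can be transported to preimages.\<close>

definition DG::"real set => real => real => bool" where
"DG M x s <-> side s & (EX e0>0. ALL e. 0<e & e<=e0 --> ger x s e<=M & M<=Cl (ger x s e))"

lemma DG_side: "DG M x s ==> side s" unfolding DG_def by blast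

lemma DG_I: assumes "side s" "e0>0" "ger x s e0<=M" "!!e. 0<e ==> e<=e0 ==> M<=Cl (ger x s e)" shows "DG M x s"
unfolding DG_def using assms ger_mono by (meson subset_trans)

lemma DG_dense: assumes "DG M x s" "e>0" shows "M<=Cl (ger x s e)"
proof -
obtain e0 where e0: "e0>0" "!!e. 0<e ==> e<=e0 ==> M<=Cl (ger x s e)" using assms(1) unfolding DG_def by blast
have "M<=Cl (ger x s (min e e0))" using e0 assms(2) by simp
also have "...<=Cl (ger x s e)" by (intro closure_mono orb_mono ger_mono) simp
finally show ?thesis .
qed

lemma DG_small: assumes "DG M x s" "e>0" shows "EX e'>0. e'<=e & ger x s e'<=M"
proof -
obtain e0 where e0: "e0>0" "!!e. 0<e ==> e<=e0 ==> ger x s e<=M" using assms(1) unfolding DG_def by blast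
show ?thesis using e0 assms(2) by (intro exI[of _ "min e e0"]) auto
qed

lemma DG_mem: assumes "DG M x s" "closed M" shows "x:M"
proof -
obtain e where e: "e>0" "ger x s e<=M" using DG_small[OF assms(1), of 1] by auto
have "seg x s e<=M" using closure_minimal[OF e(2) assms(2)] closure_ger[OF DG_side[OF assms(1)] e(1)] by simp
moreover have "x:seg x s e" unfolding seg_def using e(1) by simp
ultimately show ?thesis by blast
qed

lemma DG_in_B: assumes d: "DG M x s" and M: "closed M" "f ` M<=M" shows "x:B_set M f"
proof -
have "Cl U = M" if U: "openin (top_of_set M) U" "x:U" for U
proof -
 obtain e where e: "e>0" "ball x e Int M<=U" using openin_ball[OF U] by blast
 obtain e' where e': "e'>0" "e'<=e" "ger x s e'<=M" using DG_small[OF d e(1)] by blast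
 have "ger x s e'<=ball x e" using ger_ball[OF DG_side[OF d], of x e'] e'(2) by auto
 hence "ger x s e'<=U" using e e' by blast
 hence "M<=Cl U" using DG_dense[OF d e'(1)] closure_mono orb_mono by (meson subset_trans)
 moreover have "Cl U<=M" by (rule cl_orb_least[OF openin_imp_subset[OF U(1)] M(2,1)])
 ultimately show ?thesis by blast
qed
thus ?thesis unfolding B_set_def using DG_mem[OF d M(1)] by blast
qed

text \<open>The \<open>k\<close>-th iterate maps the germ \<open>(b, t)\<close> over the germ \<open>(c, s)\<close>.\<close>

definition gimg::"nat => real => real => real => real => bool" where
"gimg k b t c s <-> fn k b = c & (ALL e>0. EX q>0. ger c s q<=fn k ` ger b t e)"

lemma gimgD: "gimg k b t c s ==> e>0 ==> EX q>0. ger c s q<=fn k ` ger b t e" unfolding gimg_def by blast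

text \<open>Preimages in \<open>J\<close> of points that tend to \<open>b\<close> within the germ
  accumulate at some \<open>y\<close> from some side \<open>s\<close>. Between \<open>y\<close> and
  such a preimage the iterate takes all values between \<open>b\<close> and the image, so small
  germs at \<open>y\<close> cover small germs at \<open>b\<close> and inherit the density of their
  orbits.\<close>

lemma DG_lift: assumes J: "J = {u..v}" "J<=M" "M<={0..1}" and d: "DG M b t" and e: "e>0" "ger b t e<=fn k ` J"
shows "EX y:J. EX s. DG M y s & gimg k y s b t & (EX e>0. ger y s e<=J)"
proof -
note t = DG_side[OF d]
\<comment> \<open>The summand \<open>2\<close> keeps every point, also the one for
  \<open>n = 0\<close>, strictly inside the germ of length \<open>e\<close>.\<close>
define T where "T n = b + t * (e / (real n + 2))" for n
have Tg: "T n:ger b t e" for n unfolding T_def by (rule ger_points[OF t]) (use e(1) in "auto simp: field_simps add_pos_nonneg")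
hence "EX y:J. fn k y = T n" for n using e(2) by (metis imageE subsetD)
then obtain Y where Y: "!!n. Y n:J" "!!n. fn k (Y n) = T n" by metis
have "compact J" using J(1) by simp
then obtain y r where y: "y:J" "strict_mono r" "(Y \<circ> r) \<longlonglongrightarrow> y" unfolding compact_def using Y(1) by metis
have Ju: "J<={0..1}" using J by blast
have Tlim: "T \<longlonglongrightarrow> b"
proof -
 have "(%n. e / (real n + 2)) \<longlonglongrightarrow> 0"
 proof (rule real_tendsto_sandwich[of "%_. 0" _ _ "%n. e / real n"])
  show "\<forall>\<^sub>F n in sequentially. e / (real n + 2)<=e / real n"
   using eventually_gt_at_top[of 0] by eventually_elim (use e(1) in "auto simp: field_simps")
  show "(%n. e / real n) \<longlonglongrightarrow> 0" by (rule lim_const_over_n)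
 qed (use e(1) in auto)
 hence "(%n. b + t * (e / (real n + 2))) \<longlonglongrightarrow> b + t * 0" by (intro tendsto_intros)
 thus ?thesis unfolding T_def by simp
qed
have fy: "fn k y = b"
proof -
 have "(fn k \<circ> (Y \<circ> r)) \<longlonglongrightarrow> fn k y"
  using fpow_cont'[OF Ju, of k] y(1,3) Y(1) unfolding continuous_on_sequentially by (auto simp: comp_def)
 moreover have "(fn k \<circ> (Y \<circ> r)) = T \<circ> r" using Y(2) by auto
 moreover have "(T \<circ> r) \<longlonglongrightarrow> b" using LIMSEQ_subseq_LIMSEQ[OF Tlim y(2)] .
 ultimately show ?thesis using LIMSEQ_unique by metis
qed
have Yne: "Y n~=y" for n using Y(2)[of n] fy Tg[of n] unfolding ger_def by auto
have "EX s. side s & (ALL e'>0. EX n. Y n:ger y s e')"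
proof (rule ccontr)
 assume "~ ?thesis"
 then obtain e1 e2 where e12: "e1>0" "!!n. Y n~:ger y 1 e1" "e2>0" "!!n. Y n~:ger y (-1) e2" by (metis side_simps(1,2))
 have "min e1 e2>0" using e12 by simp
 from LIMSEQ_D[OF y(3) this] obtain n where "abs (Y (r n) - y)<min e1 e2" by auto
 hence "Y (r n):ger y 1 e1 | Y (r n):ger y (-1) e2" using Yne[of "r n"] unfolding ger_def by auto
 thus False using e12 by blast
qed
then obtain s where s: "side s" "!!e'. e'>0 ==> EX n. Y n:ger y s e'" by blast
have "EX e1>0. ger y s e1<=J"
proof (rule connected_contains_ger[OF s(1)])
 show "connected J" using J(1) by simp
 show "J Int ger y s e'~={}" if "e'>0" for e' using s(2)[OF that] Y(1) by blast
qed
then obtain e1 where e1: "e1>0" "ger y s e1<=J" by blast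
have img: "EX q>0. ger b t q<=fn k ` ger y s e'" if e': "0<e'" "e'<=e1" for e'
proof -
 obtain n where n: "Y n:ger y s e'" using s(2)[OF e'(1)] by blast
 define c where "c = s * (Y n - y)"
 have c: "c>0" "c<e'" using n unfolding c_def ger_def by auto
 have sub: "seg y s c<=insert y (ger y s e')" by (rule seg_ger[OF s(1) c(2)])
 have segJ: "seg y s c<={0..1}" using sub e1(2) ger_mono[OF e'(2), of y s] y(1) Ju by blast
 have conn: "connected (fn k ` seg y s c)" by (rule fpow_conn[OF seg_connected[OF s(1)] segJ])
 have "y:seg y s c" "Y n:seg y s c" unfolding seg_def c_def using c unfolding c_def by auto
 hence bT: "b:fn k ` seg y s c" "T n:fn k ` seg y s c" using fy Y(2)[of n] by (metis imageI)+
 define q where "q = t * (T n - b)"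
 have q: "q>0" using Tg[of n] unfolding q_def ger_def by simp
 have "ger b t q<=fn k ` seg y s c"
 proof
  fix z assume z: "z:ger b t q"
  consider "b<=z & z<=T n" | "T n<=z & z<=b" using t z unfolding side_def ger_def q_def by fastforce
  thus "z:fn k ` seg y s c" using connected_contains_Icc[OF conn] bT by cases (meson atLeastAtMost_iff subsetD)+
 qed
 moreover have "b~:ger b t q" unfolding ger_def by simp
 ultimately show ?thesis using sub fy q by blast
qed
have "gimg k y s b t" unfolding gimg_def
proof (intro conjI allI impI)
 show "fn k y = b" by (rule fy)
 fix e' :: real assume "e'>0"
 then obtain q where "q>0" "ger b t q<=fn k ` ger y s (min e' e1)" using img[of "min e' e1"] e1(1) by auto
 moreover have "ger y s (min e' e1)<=ger y s e'" by (rule ger_mono) simp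
 ultimately show "EX q>0. ger b t q<=fn k ` ger y s e'" by (meson image_mono subset_trans)
qed
moreover have "DG M y s"
proof (rule DG_I[OF s(1) e1(1)])
 show "ger y s e1<=M" using e1 J(2) by blast
 fix e' assume e': "0<e'" "e'<=e1"
 obtain q where q: "q>0" "ger b t q<=fn k ` ger y s e'" using img[OF e'] by blast
 hence "Orb (ger b t q)<=Orb (ger y s e')" using orb_mono orb_fpow_le by (meson subset_trans)
 thus "M<=Cl (ger y s e')" using DG_dense[OF d q(1)] closure_mono by (meson subset_trans)
qed
ultimately show ?thesis using y(1) e1 by blast
qed

lemma DG_backward: assumes I: "pint I m" and d: "DG (Orb I) b t" shows "EX y s. DG (Orb I) y s & gimg k y s b t"
proof -
obtain e where e: "e>0" "ger b t e<=Orb I" using DG_small[OF d, of 1] by auto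
have eq: "Orb I = (UN i:{..<m}. fn k ` fn i ` I)"
proof -
 have "Orb I = fn k ` (UN i<m. fn i ` I)" using pint_fpow_orb[OF I] pint_orb[OF I] by simp
 thus ?thesis by (simp add: image_UN)
qed
have "EX i:{..<m}. EX e>0. ger b t e<=fn k ` fn i ` I"
proof (rule finite_UN_ger[OF DG_side[OF d]])
 show "connected (fn k ` fn i ` I)" for i using pint_conn[OF I, of "k + i"] by (simp only: img_add)
 show "(UN i:{..<m}. fn k ` fn i ` I) Int ger b t e'~={}" if "e'>0" for e'
 proof -
  have "ger b t (min e e')~={}" using ger_nonempty[OF DG_side[OF d]] e(1) that by simp
  moreover have "ger b t (min e e')<=ger b t e" "ger b t (min e e')<=ger b t e'" by (intro ger_mono; simp)+
  ultimately show ?thesis using e(2) unfolding eq[symmetric] by blast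
 qed
qed simp
then obtain i e' where i: "e'>0" "ger b t e'<=fn k ` fn i ` I" by blast
obtain u v where uv: "fn i ` I = {u..v}" using pint_piece[OF I, of i] by blast
show ?thesis using DG_lift[OF uv fpow_sub_orb cyc_unit[OF I] d i] by blast
qed

lemma DG_backward_chain: assumes I: "pint I m" and d: "DG (Orb I) b t"
shows "EX g. g 0 = b & (ALL n. f (g (Suc n)) = g n & g n:Bs I) & (ALL n. fn n (g n) = b)"
proof -
have "EX g. (ALL n. EX s. DG (Orb I) (g n) s) & g 0 = b & (ALL n. f (g (Suc n)) = g n)"
proof -
 have "EX g. ALL n. ((EX s. DG (Orb I) (g n) s) & (n = 0 --> g n = b)) & f (g (Suc n)) = g n"
 proof (rule dependent_nat_choice)
  show "EX x. (EX s. DG (Orb I) x s) & (0 = (0::nat) --> x = b)" using d by blast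
  fix x and n::nat assume "(EX s. DG (Orb I) x s) & (n = 0 --> x = b)"
  then obtain s where "DG (Orb I) x s" by blast
  thus "EX y. ((EX s. DG (Orb I) y s) & (Suc n = 0 --> y = b)) & f y = x"
  proof -
   obtain y s' where "DG (Orb I) y s'" "gimg 1 y s' x s" using DG_backward[OF I `DG (Orb I) x s`] by blast
   thus ?thesis unfolding gimg_def by (intro exI[of _ y]) auto
  qed
 qed
 thus ?thesis by metis
qed
then obtain g where g: "!!n. EX s. DG (Orb I) (g n) s" "g 0 = b" "!!n. f (g (Suc n)) = g n" by blast
have "g n:Bs I" for n using g(1)[of n] DG_in_B[OF _ cyc_closed[OF I] f_orb] by blast
moreover have "fn n (g n) = b" for n
proof (induction n)
 case (Suc n)
 thus ?case using g(3)[of n] by (simp add: funpow_swap1)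
qed (use g in simp)
ultimately show ?thesis using g by (intro exI[of _ g]) blast
qed

text \<open>If a backward orbit repeats a point, pushing the repetition forward to index
  \<open>0\<close> makes \<open>g 0\<close> periodic.\<close>

lemma chain_inj: assumes g: "!!n. f (g (Suc n)) = g n" and np: "!!n. n>=1 ==> fn n (g 0)~=g 0" shows "inj g"
proof (rule ccontr)
have down: "fn i (g (i + j)) = g j" for i j
proof (induction i)
 case (Suc i)
 thus ?case using g[of "i + j"] by (simp add: funpow_swap1)
qed simp
assume "~ inj g"
then obtain i j where ij: "i<j" "g i = g j" unfolding inj_def by (metis linorder_neqE_nat)
have "g 0 = fn i (g i)" using down[of i 0] by simp
also have "... = g (j - i)" using down[of i "j - i"] ij by simp
finally have "g 0 = g (j - i)" .
moreover have "fn (j - i) (g (j - i)) = g 0" using down[of "j - i" 0] by simp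
ultimately have "fn (j - i) (g 0) = g 0" by simp
thus False using np[of "j - i"] ij by simp
qed

lemma DG_nonper_inf: assumes I: "pint I m" and d: "DG (Orb I) x s" and x: "x~:Per f" shows "infinite (Bs I)"
proof -
obtain g where g: "g 0 = x" "!!n. f (g (Suc n)) = g n" "!!n. g n:Bs I" using DG_backward_chain[OF I d] by blast
have "x:{0..1}" using DG_mem[OF d cyc_closed[OF I]] cyc_unit[OF I] by blast
hence "fn n x~=x" if "n>=1" for n using x that unfolding Per_def by blast
hence "inj g" using chain_inj[of g] g(1,2) by simp
hence "infinite (range g)" by (simp add: finite_image_iff)
thus ?thesis using g(3) finite_subset by (metis image_subsetI)
qed

text \<open>As \<open>f\<close> maps \<open>M\<close> onto itself, the orbit of the first image of
  \<open>J\<close> is dense as well. It consists of positive iterates only, and it meets the open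
  set \<open>J\<close>.\<close>

lemma open_dense_returns: assumes M: "f ` M = M" "M<={0..1}" and J: "open J" "J~={}" "J<=M" and d: "M<=Cl J" shows "EX n>=1. fn n ` J Int J~={}"
proof -
have "J<={0..1}" using J M by blast
have "M<=f ` Cl J" using d M(1) by blast
also have "... = Cl (f ` J)" using f_cl_orb[OF `J <= {0..1}`, of 1] by simp
finally have "J<=Cl (f ` J)" using J(3) by blast
hence "J Int Orb (f ` J)~={}" using J(1,2) open_Int_closure_eq_empty[OF J(1)] by blast
then obtain k where "J Int fn k ` f ` J~={}" unfolding orb_def by blast
thus ?thesis using img_add[of k 1 J] by (intro exI[of _ "k + 1"]) auto
qed

text \<open>\<open>returning_orb_covers\<close> is applied to the first image of \<open>J\<close>,
  which makes the covering time positive. Of finitely many intervals that cover a neighborhood of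
  \<open>b\<close>, one contains a germ.\<close>

lemma dense_orb_covers_germs: assumes J: "connected J" "J<=M" and M: "f ` M = M" "M<={0..1}" "M<=Cl J" and n: "n>=1" "fn n ` J Int J~={}"
shows "EX X. finite X & (ALL b:M - X. ALL t. side t --> (EX k>=1. EX e>0. ger b t e<=fn k ` J))"
proof -
have Ju: "J<={0..1}" using J M by blast
have c: "connected (f ` J)" using fpow_conn[OF J(1) Ju, of 1] by simp
have u: "f ` J<={0..1}" using fpow_unit[OF Ju, of 1] by simp
have r: "fn n ` f ` J Int f ` J~={}"
proof -
 obtain x where x: "x:J" "fn n x:J" using n(2) by blast
 have "f (fn n x) = fn n (f x)" by (simp add: funpow_swap1)
 thus ?thesis using x by (metis disjoint_iff imageI)
qed
have d: "M<=Cl (f ` J)"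
proof -
 have "M<=f ` Cl J" using M(1,3) by blast
 thus ?thesis using f_cl_orb[OF Ju, of 1] by simp
qed
obtain X where X: "finite X & (ALL b:Cl (f ` J) - X.
  EX K u v. u<b & b<v & {u..v}<=(UN k<=K. fn k ` f ` J))" using returning_orb_covers[OF c u n(1) r] by (rule exE)
have "ALL b:M - X. ALL t. side t --> (EX k>=1. EX e>0. ger b t e<=fn k ` J)"
proof (intro ballI allI impI)
 fix b t assume b: "b:M - X" and t: "side t"
 have "b:Cl (f ` J) - X" using b d by blast
 from bspec[OF conjunct2[OF X] this]
 obtain K u v where uv: "u<b" "b<v" "{u..v}<=(UN k<=K. fn k ` f ` J)" by blast
 have "EX k:{..K}. EX e>0. ger b t e<=fn k ` f ` J"
 proof (rule finite_UN_ger[OF t])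
  show "connected (fn k ` f ` J)" for k by (rule fpow_conn[OF c u])
  show "(UN k:{..K}. fn k ` f ` J) Int ger b t e~={}" if e: "e>0" for e
  proof -
   define e' where "e' = min e (min (b - u) (v - b))"
   have e': "e'>0" using e uv unfolding e'_def by simp
   have "ger b t e'<=ball b e'" by (rule ger_ball[OF t])
   also have "ball b e'<={u..v}" unfolding e'_def by (auto simp: dist_real_def)
   finally have "ger b t e'<=(UN k:{..K}. fn k ` f ` J)" using uv(3) by simp
   moreover have "ger b t e'<=ger b t e" unfolding e'_def by (rule ger_mono) simp
   moreover obtain z where "z:ger b t e'" using ger_nonempty[OF t e', of b] by blast
   ultimately have "z:(UN k:{..K}. fn k ` f ` J) Int ger b t e" by (meson IntI subsetD)
   thus ?thesis by (rule ne_from_mem)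
  qed
 qed simp
 then obtain k e where ke: "e>0" "ger b t e<=fn k ` f ` J" by blast
 have "fn k ` f ` J = fn (k + 1) ` J" using img_add[of k 1 J] by simp
 hence "ger b t e<=fn (k + 1) ` J" using ke(2) by (simp only:)
 moreover have "1<=k + 1" by simp
 ultimately show "EX k>=1. EX e>0. ger b t e<=fn k ` J" using ke(1) by blast
qed
thus ?thesis using conjunct1[OF X] by (intro exI[of _ X] conjI)
qed

lemma DG_covers: assumes M: "f ` M = M" "M<={0..1}" and s: "side s" and e: "e>0" and J: "ger b s e<=M" "M<=Cl (ger b s e)"
obtains X where "finite X" "!!c t. c:M - X ==> side t ==> EX k>=1. EX e'>0. ger c t e'<=fn k ` ger b s e"
proof -
obtain n where n: "n>=1" "fn n ` ger b s e Int ger b s e~={}" using open_dense_returns[OF M ger_open[OF s] ger_nonempty[OF s e] J] by blast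
show thesis using dense_orb_covers_germs[OF ger_connected[OF s] J(1) M J(2) n] by (elim exE conjE) (rule that, auto)
qed

lemma not_DG: assumes "~ DG M x s" "side s" "e0>0" "ger x s e0<=M" shows "EX e>0. e<=e0 & ~ M<=Cl (ger x s e)"
using DG_I[OF assms(2-4)] assms(1) by blast

text \<open>A germ that avoids the finitely many boundary points is connected, so it does not cross
  the boundary.\<close>

lemma inner_or_outer: assumes M: "finite (M - interior M)" "closed M" and s: "side s" shows "(EX e>0. ger x s e<=M) | (EX e>0. ger x s e Int M = {})"
proof -
have "EX e>0. ger x s e Int (M - interior M) = {}"
proof -
 have "finite (insert 1 ((%y. abs (y - x)) ` (M - interior M - {x})))" using M(1) by simp
 moreover define e where "e = Min (insert 1 ((%y. abs (y - x)) ` (M - interior M - {x})))"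
 ultimately have "e>0" by auto
 moreover have "y~:ger x s e" if "y:M - interior M" for y
 proof
  assume y: "y:ger x s e"
  hence "y~=x" unfolding ger_def by auto
  hence "e<=abs (y - x)" unfolding e_def using M(1) that by (intro Min_le) auto
  thus False using y mem_ger_abs[OF s] by auto
 qed
 ultimately show ?thesis by blast
qed
then obtain e where e: "e>0" "ger x s e Int (M - interior M) = {}" by blast
show ?thesis
proof (cases "ger x s e Int M = {}")
 case True
 thus ?thesis using e by blast
next
 case False
 have "ger x s e<=interior M"
 proof -
  have cov: "ger x s e<=interior M Un - M" using e by blast
  have dis: "interior M Int - M Int ger x s e = {}" using interior_subset[of M] by blast
  have "interior M Int ger x s e = {} | - M Int ger x s e = {}"
   by (rule connectedD[OF ger_connected[OF s] open_interior open_Compl[OF M(2)] dis cov])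
  thus ?thesis using False cov by blast
 qed
 thus ?thesis using e interior_subset by blast
qed
qed

section \<open>Basic sets are perfect and consist of limits of periodic points\<close>

lemma B_sub: "B_set M f<=M" unfolding B_set_def by blast

lemma B_setD: assumes "x:B_set M f" "open V" "x:V" shows "Cl (M Int V) = M"
proof -
have "x:M" using assms(1) B_sub by blast
moreover have "openin (top_of_set M) (M Int V)" using assms(2) by (auto simp: openin_open)
ultimately show ?thesis using assms unfolding B_set_def by blast
qed

lemma B_setI: assumes "x:M" "closed M" "f ` M<=M" "!!e. e>0 ==> M<=Cl (M Int ball x e)" shows "x:B_set M f"
proof -
have "Cl U = M" if U: "openin (top_of_set M) U" "x:U" for U
proof
 obtain e where e: "e>0" "ball x e Int M<=U" using openin_ball[OF U] by blast
 have "M Int ball x e<=U" using e by blast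
 hence "Cl (M Int ball x e)<=Cl U" by (intro closure_mono orb_mono)
 thus "M<=Cl U" using assms(4)[OF e(1)] by (meson subset_trans)
 show "Cl U<=M" by (rule cl_orb_least[OF openin_imp_subset[OF U(1)] assms(3,2)])
qed
thus ?thesis unfolding B_set_def using assms(1) by blast
qed

lemma B_set_closed: assumes M: "closed M" "f ` M<=M" shows "closed (B_set M f)" unfolding closed_sequential_limits
proof (intro allI impI)
fix X l assume X: "(ALL n. X n:B_set M f) & X \<longlonglongrightarrow> l"
have "ALL n. X n:M" using X B_sub by blast
hence lM: "l:M" using M(1) X unfolding closed_sequential_limits by blast
show "l:B_set M f"
proof (rule B_setI[OF lM M])
 fix e::real assume "e>0"
 then obtain n where "dist (X n) l<e" using X by (meson lim_sequentially order_refl)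
 hence "X n:ball l e" by (simp add: dist_commute)
 thus "M<=Cl (M Int ball l e)" using B_setD[of "X n" M "ball l e"] X by auto
qed
qed

lemma B_set_invariant: assumes I: "pint I m" and x: "x:Bs I" shows "f x:Bs I"
proof -
define M where "M = Orb I"
note fM = pint_f_orb[OF I, folded M_def]
note cl = cyc_closed[OF I, folded M_def]
note Mu = cyc_unit[OF I, folded M_def]
have xM: "x:M" using x B_sub M_def by blast
have "f x:B_set M f"
proof (rule B_setI[OF _ cl])
 show "f x:M" using xM fM by blast
 show "f ` M<=M" using fM by simp
 fix e::real assume "e>0"
 have "continuous_on M f" using fpow_cont'[OF Mu, of 1] by simp
 then obtain d where d: "d>0" "!!y. y:M ==> dist y x<d ==> dist (f y) (f x)<e" using xM `e > 0` unfolding continuous_on_iff by meson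
 have sub: "f ` (M Int ball x d)<=M Int ball (f x) e" using d(2) fM by (auto simp: dist_commute)
 have u: "M Int ball x d<={0..1}" using Mu by blast
 have "Cl (M Int ball x d) = M" using B_setD[of x M "ball x d"] x d(1) M_def by simp
 hence "M = Cl (f ` (M Int ball x d))" using f_cl_orb[OF u, of 1] fM by simp
 also have "...<=Cl (M Int ball (f x) e)" by (intro closure_mono orb_mono sub)
 finally show "M<=Cl (M Int ball (f x) e)" .
qed
thus ?thesis unfolding M_def .
qed

lemma B_set_infinite_orb: "infinite (B_set M f) ==> infinite M" using B_sub finite_subset by blast

text \<open>A neighborhood of \<open>b\<close> inside \<open>N\<close> has its orbit trapped in
  \<open>N\<close>, although this orbit is dense in \<open>M\<close>. This keeps a basic set out of
  the interior of every cycle that does not contain its own cycle.\<close>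

lemma B_interior_inv: assumes b: "b:B_set M f" and N: "b:interior N" "closed N" "f ` N<=N" shows "M<=N"
proof -
have "Cl (M Int interior N) = M" using B_setD[OF b open_interior N(1)] .
moreover have "Cl (M Int interior N)<=N" by (rule cl_orb_least) (use N interior_subset in auto)
ultimately show ?thesis by simp
qed

text \<open>If no side of \<open>b\<close> had a dense orbit, the closures of the orbits of the two sides would be finite
 unions of intervals and the basic set would lie in their boundaries.\<close>

lemma basic_DG_exists: assumes I: "pint I m" and inf: "infinite (Bs I)" and b: "b:Bs I" shows "EX s. DG (Orb I) b s"
proof (rule ccontr)
assume no: "~ ?thesis"
define M where "M = Orb I"
note fM = pint_f_orb[OF I, folded M_def]
have fM': "f ` M<=M" using fM by simp
note cl = cyc_closed[OF I, folded M_def]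
note Mu = cyc_unit[OF I, folded M_def]
note bd = pint_bdry[OF I, folded M_def]
have bM: "b:M" using b B_sub M_def by blast
have noDG: "~ DG M b s" for s using no M_def by blast
have small: "EX e>0. e<=e0 & ger b s e<=M & Cl (ger b s e)~=M"
 if s: "side s" and e0: "e0>0" "ger b s e0<=M" for s e0
proof -
 obtain e where e: "e>0" "e<=e0" "~ M<=Cl (ger b s e)" using not_DG[OF noDG s e0] by blast
 thus ?thesis using e0(2) ger_mono[OF e(2), of b s] by blast
qed
have cl_ger: "b:Cl (ger b s e)" if "side s" "e>0" for s e
proof -
 have "b:closure (ger b s e)" using closure_ger[OF that, of b] that(2) unfolding seg_def by simp
 thus ?thesis using closure_mono[OF sub_orb] by blast
qed
\<comment> \<open>If one side of \<open>b\<close> left \<open>M\<close>, the other side together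
  with \<open>b\<close> would be a neighborhood of \<open>b\<close> in \<open>M\<close> and would
  have a dense orbit; if both sides left \<open>M\<close>, the cycle would be finite.\<close>
have inner: "EX e>0. ger b s e<=M" if s: "side s" for s
proof (rule ccontr)
 assume "~ ?thesis"
 then obtain e1 where e1: "e1>0" "ger b s e1 Int M = {}" using inner_or_outer[OF bd cl s] by blast
 have s': "side (-s)" using s by simp
 have "EX e>0. ger b (-s) e<=M"
 proof (rule ccontr)
  assume "~ ?thesis"
  then obtain e2 where e2: "e2>0" "ger b (-s) e2 Int M = {}" using inner_or_outer[OF bd cl s'] by blast
  define e where "e = min e1 e2"
  have e: "e>0" "ger b s e<=ger b s e1" "ger b (-s) e<=ger b (-s) e2" unfolding e_def using e1 e2 by (auto intro!: ger_mono)
  have Mb: "M Int ball b e = {b}" using ball_split'[OF s e(1), of b] e e1 e2 bM by auto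
  hence "b:interior (- (M - {b}))" using e(1) by (intro interiorI[of "ball b e"]) auto
  have fin: "finite J" if J: "pint J m" "Orb J = M" "b:J" for J
  proof (rule ccontr)
   assume "infinite J"
   then obtain u v where uv: "u<v" "J = {u..v}"
    using pint_nondegenerate[OF J(1), of 0] cyc_infinite[OF J(1)] by (metis funpow_0 image_cong image_ident)
   have JM: "J<=M" using J(2) sub_orb by blast
   define c where "c = (if b<v then min v (b + e/2) else max u (b - e/2))"
   have "c:J" "c:ball b e" "c~=b" using uv J(3) e(1) unfolding c_def by (auto simp: dist_real_def)
   thus False using Mb JM by blast
  qed
  obtain J where "pint J m" "Orb J = M" "b:J" using pint_at[OF I] bM M_def by metis
  hence "finite M" using fin cyc_infinite by metis
  thus False using inf B_set_infinite_orb M_def by blast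
 qed
 then obtain e0 where e0: "e0>0" "ger b (-s) e0<=M" by blast
 obtain e2 where e2: "e2>0" "e2<=e0" "ger b (-s) e2<=M" "Cl (ger b (-s) e2)~=M" using small[OF s' e0] by blast
 define e where "e = min e1 e2"
 have e: "e>0" "ger b s e<=ger b s e1" "ger b (-s) e<=ger b (-s) e2" unfolding e_def using e1 e2 by (auto intro!: ger_mono)
 have "M Int ball b e<=Cl (ger b (-s) e2)"
 proof -
  have "M Int ball b e<=insert b (ger b (-s) e2)" using ball_split'[OF s e(1), of b] e e1 by auto
  thus ?thesis using cl_ger[OF s' e2(1)] closure_mono[OF sub_orb, of "ger b (-s) e2"]
    closure_subset[of "ger b (-s) e2"] by blast
 qed
 hence "Cl (M Int ball b e)<=Cl (ger b (-s) e2)" by (rule closure_orb_trans[rotated]) (use e2(3) Mu in blast)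
 moreover have "Cl (M Int ball b e) = M" using B_setD[of b M "ball b e"] b e(1) M_def by simp
 moreover have "Cl (ger b (-s) e2)<=M" by (rule cl_orb_least[OF e2(3) fM' cl])
 ultimately show False using e2(4) by blast
qed
define N where "N s e = Cl (ger b s e)" for s e
have "EX e>0. ger b s e<=M & N s e~=M" if s: "side s" for s using inner[OF s] small[OF s] unfolding N_def by blast
then obtain E where E: "!!s. side s ==> E s>0 & ger b s (E s)<=M & N s (E s)~=M" by metis
have NM: "N s e<=M" if "side s" "e<=E s" for s e
 unfolding N_def by (rule cl_orb_least[OF _ fM' cl]) (use E[OF that(1)] ger_mono[OF that(2), of b s] in blast)
have cover: "M = N s e Un N (-s) e'" if s: "side s" and e: "0<e" "e<=E s" "0<e'" "e'<=E (-s)" for s e e'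
proof
 have s': "side (-s)" using s by simp
 define d where "d = min e e'"
 have d: "d>0" "ger b s d<=ger b s e" "ger b (-s) d<=ger b (-s) e'" unfolding d_def using e by (auto intro!: ger_mono)
 have bN: "b:N s e" unfolding N_def by (rule cl_ger[OF s e(1)])
 have gN: "ger b s e<=N s e" "ger b (-s) e'<=N (-s) e'" unfolding N_def using sub_orb closure_subset by (meson subset_trans)+
 have "M Int ball b d<=N s e Un N (-s) e'" unfolding ball_split'[OF s d(1), of b] using d gN bN by auto
 moreover have u: "ger b s e<={0..1}" "ger b (-s) e'<={0..1}"
  using E[OF s] E[OF s'] Mu ger_mono[OF e(2), of b s] ger_mono[OF e(4), of b "-s"] by blast+
 have "f ` (N s e Un N (-s) e')<=N s e Un N (-s) e'" unfolding image_Un N_def using f_cl_orb_sub[OF u(1)] f_cl_orb_sub[OF u(2)] by blast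
 moreover have "closed (N s e Un N (-s) e')" unfolding N_def by (intro closed_Un closed_closure)
 ultimately have "Cl (M Int ball b d)<=N s e Un N (-s) e'" by (rule cl_orb_least)
 moreover have "Cl (M Int ball b d) = M" using B_setD[of b M "ball b d"] b d(1) M_def by simp
 ultimately show "M<=N s e Un N (-s) e'" by simp
 show "N s e Un N (-s) e'<=M" using NM[OF s e(2)] NM[OF s' e(4)] by blast
qed
have fin: "finite (N s (E s) - interior (N s (E s)))" if s: "side s" for s
proof -
 have s': "side (-s)" using s by simp
 have u: "ger b s (E s)<={0..1}" "ger b (-s) (E (-s))<={0..1}" using E[OF s] E[OF s'] Mu by blast+
 define O' where "O' = ger b s (E s) - N (-s) (E (-s))"
 \<comment> \<open>An empty \<open>O'\<close> would put the closed orbit of side \<open>s\<close>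
   inside that of the other side, which would then be all of \<open>M\<close>.\<close>
 have "O'~={}"
 proof
  assume "O' = {}"
  hence sub: "ger b s (E s)<=N (-s) (E (-s))" unfolding O'_def by blast
  have "N s (E s)<=N (-s) (E (-s))" using closure_orb_trans[OF u(2)] sub unfolding N_def by blast
  moreover have "M = N s (E s) Un N (-s) (E (-s))" by (rule cover[OF s]) (use E[OF s] E[OF s'] in auto)
  ultimately show False using E[OF s'] by blast
 qed
 moreover have "open O'" unfolding O'_def N_def by (intro open_Diff ger_open[OF s] closed_closure)
 \<comment> \<open>Points of \<open>O'\<close> have preimages in \<open>M\<close>, but none in the
   invariant closed orbit of the other side. So they are limits of positive iterates of the germ,
   which therefore returns to itself and has an orbit closure with finite boundary.\<close>
 moreover have "O'<=Cl (f ` ger b s (E s))"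
 proof -
  have M: "M = N s (E s) Un N (-s) (E (-s))" by (rule cover[OF s]) (use E[OF s] E[OF s'] in auto)
  have "O'<=f ` M" unfolding fM O'_def using E[OF s] by blast
  also have "... = f ` N s (E s) Un f ` N (-s) (E (-s))" using arg_cong[OF M, of "(`) f"] by (simp only: image_Un)
  also have "...<=f ` N s (E s) Un N (-s) (E (-s))" using f_cl_orb_sub[OF u(2)] unfolding N_def by blast
  finally have "O'<=f ` N s (E s)" unfolding O'_def by blast
  thus ?thesis using f_cl_orb[OF u(1), of 1] unfolding N_def by simp
 qed
 ultimately have "O' Int Orb (f ` ger b s (E s))~={}" using open_Int_closure_eq_empty[of O'] by blast
 then obtain z k where z: "z:ger b s (E s)" "z:fn k ` f ` ger b s (E s)" unfolding orb_def O'_def by blast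
 have "z:fn (k + 1) ` ger b s (E s)" using z(2) img_add[of k 1] by auto
 hence "fn (k + 1) ` ger b s (E s) Int ger b s (E s)~={}" using z(1) by blast
 thus ?thesis unfolding N_def by (rule closure_orb_finite_boundary[OF ger_connected[OF s] u(1), rotated]) simp
qed
have out: "b'~:interior (N s (E s))" if "b':B_set M f" "side s" for b' s
proof
 assume "b':interior (N s (E s))"
 hence "M<=N s (E s)" using B_interior_inv[OF that(1), of "N s (E s)"] f_cl_orb_sub[of "ger b s (E s)"]
   E[OF that(2)] Mu unfolding N_def by (meson closed_closure subset_trans)
 thus False using E[OF that(2)] NM[OF that(2), of "E s"] by blast
qed
have "M = N 1 (E 1) Un N (-1) (E (-1))" using cover[of 1 "E 1" "E (-1)"] E[of 1] E[of "-1"] by simp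
hence "B_set M f<=(N 1 (E 1) - interior (N 1 (E 1))) Un (N (-1) (E (-1)) - interior (N (-1) (E (-1))))"
 using B_sub[of M] out[of _ 1] out[of _ "-1"] by auto
hence "finite (B_set M f)" using fin[of 1] fin[of "-1"] finite_subset by (meson finite_UnI side_simps(1,2))
thus False using inf M_def by simp
qed

text \<open>If the germ contains no point of the basic set, a point of that set outside the finite
  set \<open>X\<close> lifts to a point of the set in the closed germ, which can only be
  \<open>b\<close>; so it lies on the forward orbit of \<open>b\<close>. A backward orbit of
  \<open>b\<close> then meets the forward orbit, and \<open>b\<close> would be periodic although its
  orbit is infinite.\<close>

lemma basic_perfect: assumes I: "pint I m" and inf: "infinite (Bs I)" and d: "DG (Orb I) b s" and e: "e>0" shows "EX b':Bs I. b':ger b s e"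
proof (rule ccontr)
assume no: "~ ?thesis"
define M where "M = Orb I"
note fM = pint_f_orb[OF I, folded M_def]
note Mu = cyc_unit[OF I, folded M_def]
note s = DG_side[OF d]
obtain e1 where e1: "e1>0" "e1<=e" "ger b s e1<=M" using DG_small[OF d e] M_def by blast
define J where "J = ger b s (e1/2)"
have segJ: "seg b s (e1/2)<=insert b (ger b s e1)" by (rule seg_ger[OF s]) (use e1 in simp)
have JM: "J<=M" using e1(3) ger_mono[of "e1/2" e1 b s] e1(1) unfolding J_def by auto
have dJ: "M<=Cl J" unfolding J_def M_def by (rule DG_dense[OF d]) (use e1 in simp)
obtain X where X: "finite X" "!!b t. b:M - X ==> side t ==> EX k>=1. EX e>0. ger b t e<=fn k ` J"
 using DG_covers[OF fM Mu s _ JM[unfolded J_def]] dJ e1 unfolding J_def by auto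
obtain u v where uv: "seg b s (e1/2) = {u..v}" using seg_Icc[OF s] by blast
have bM: "b:M" using DG_mem[OF d cyc_closed[OF I]] M_def by simp
have segM: "seg b s (e1/2)<=M" using segJ e1(3) bM by blast
have all: "b':Orb {b}" if b': "b':B_set M f" "b'~:X" for b'
proof -
 obtain t where t: "DG M b' t" using basic_DG_exists[OF I inf] b'(1) M_def by blast
 have "b':M - X" using b' B_sub by blast
 then obtain k e' where k: "e'>0" "ger b' t e'<=fn k ` J" using X(2)[OF _ DG_side[OF t]] by blast
 have cov: "ger b' t e'<=fn k ` seg b s (e1/2)" using k(2) ger_seg[of b s "e1/2"] unfolding J_def by (meson image_mono subset_trans)
 obtain y r where y: "y:seg b s (e1/2)" "fn k y = b'" "DG M y r" using DG_lift[OF uv segM Mu t k(1) cov] unfolding gimg_def by blast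
 have "y:B_set M f" using DG_in_B[OF y(3)] cyc_closed[OF I] fM M_def by simp
 moreover have "y~:ger b s e1" using no `y:B_set M f` ger_mono[OF e1(2), of b s] M_def by blast
 ultimately have "y = b" using y(1) segJ by blast
 thus ?thesis using y(2) unfolding orb_def by auto
qed
have BM: "infinite (B_set M f)" using inf M_def by simp
have "B_set M f<=X Un Orb {b}" using all by blast
hence inf_orb: "infinite (Orb {b})" using BM X(1) finite_subset by (meson finite_UnI)
obtain g where g: "g 0 = b" "!!n. f (g (Suc n)) = g n" "!!n. g n:B_set M f" "!!n. fn n (g n) = b" using DG_backward_chain[OF I d] M_def by metis
have np: "fn n b~=b" if "n>=1" for n using finite_orb[of n b] that inf_orb by blast
have "inj g" by (rule chain_inj) (use g np in auto)
hence "infinite (g ` {1..})" using infinite_Ici by (metis finite_imageD inj_on_subset subset_UNIV)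
hence "~ g ` {1..}<=X" using X(1) finite_subset by blast
then obtain i where i: "i>=1" "g i~:X" by auto
then obtain k where "g i = fn k b" using all[OF g(3)] unfolding orb_def by blast
hence "fn (i + k) b = b" using g(4)[of i] fpow_add by metis
thus False using np[of "i + k"] i(1) by simp
qed

lemma basic_germ_infinite: assumes I: "pint I m" and inf: "infinite (Bs I)" and d: "DG (Orb I) b s" and e: "e>0" shows "infinite (Bs I Int ger b s e)"
proof
assume fin: "finite (Bs I Int ger b s e)" (is "finite ?F")
note s = DG_side[OF d]
define e' where "e' = Min (insert e ((%y. abs (y - b)) ` ?F))"
have "e'>0" unfolding e'_def using fin e by (auto simp: ger_def)
then obtain b' where b': "b':Bs I" "b':ger b s e'" using basic_perfect[OF I inf d] by blast
have "e'<=e" unfolding e'_def using fin by (intro Min_le) auto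
hence "b':?F" using b' ger_mono[of e' e b s] by blast
hence "e'<=abs (b' - b)" unfolding e'_def using fin by (intro Min_le) auto
thus False using b'(2) mem_ger_abs[OF s] by auto
qed

lemma basic_near_infinite: assumes I: "pint I m" and inf: "infinite (Bs I)" and b: "b:Bs I" "open V" "b:V" shows "infinite (Bs I Int V)"
proof -
obtain s where s: "DG (Orb I) b s" using basic_DG_exists[OF I inf b(1)] by blast
obtain e where e: "e>0" "ball b e<=V" using b open_contains_ball by blast
have "infinite (Bs I Int ger b s e)" by (rule basic_germ_infinite[OF I inf s e(1)])
moreover have "Bs I Int ger b s e<=Bs I Int V" using ger_ball[OF DG_side[OF s], of b e] e(2) by blast
ultimately show ?thesis using finite_subset by blast
qed

text \<open>A returning germ on which \<open>f\<close> is constant is mapped to a single periodic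
  orbit, and this finite orbit would be dense in the infinite cycle. So there are no plateaus next
  to a dense germ.\<close>

lemma DG_not_constant: assumes I: "pint I m" and inf: "infinite (Orb I)" and d: "DG (Orb I) x s" and e: "e>0" shows "EX y:ger x s e. f y~=f x"
proof (rule ccontr)
assume "~ ?thesis"
hence const: "f y = f x" if "y:ger x s e" for y using that by blast
define M where "M = Orb I"
note fM = pint_f_orb[OF I, folded M_def]
note Mu = cyc_unit[OF I, folded M_def]
note s = DG_side[OF d]
obtain e1 where e1: "e1>0" "e1<=e" "ger x s e1<=M" using DG_small[OF d e] M_def by blast
define J where "J = ger x s e1"
have Jf: "f y = f x" if "y:J" for y using const that ger_mono[OF e1(2), of x s] unfolding J_def by blast
have dJ: "M<=Cl J" unfolding J_def M_def by (rule DG_dense[OF d e1(1)])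
have "J~={}" unfolding J_def by (rule ger_nonempty[OF s e1(1)])
then obtain n where n: "n>=1" "fn n ` J Int J~={}" using open_dense_returns[OF fM Mu _ _ _ dJ] ger_open[OF s] e1(3) J_def by blast
obtain z where z: "z:J" "fn n z:J" using n(2) by blast
have Jn: "fn n y = fn n x" if "y:J" for y using Jf[OF that] n(1) by (cases n) (auto simp: funpow_swap1)
define p where "p = fn n z"
have "fn n p = p" unfolding p_def using Jn[OF z(1)] Jn[OF z(2)] by simp
hence fin: "finite (Orb {p})" by (rule finite_orb[OF _ n(1)])
have "f ` J<={f p}" using Jf z unfolding p_def by auto
hence "Orb (f ` J)<=Orb {p}" using orb_mono[of "f ` J" "{f p}"] orb_fpow_le[of 1 "{p}"] by auto
hence "finite (Orb (f ` J))" using fin finite_subset by blast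
moreover have "M<=f ` Cl J" using dJ fM by blast
moreover have "f ` Cl J = Cl (f ` J)" using f_cl_orb[of J 1] e1(3) Mu unfolding J_def by auto
ultimately show False using inf M_def by (simp add: finite_imp_closed finite_subset)
qed

section \<open>Periodic points in basic sets\<close>

lemma connected_zero: assumes "connected J" "continuous_on J g" "x:J" "y:J" "g x<=(0::real)" "0<=g y" shows "EX z:J. g z = 0"
proof -
have "connected (g ` J)" using assms by (simp add: connected_continuous_image)
hence "{g x..g y}<=g ` J" using assms connected_contains_Icc by blast
hence "0:g ` J" using assms by auto
thus ?thesis by (metis imageE)
qed

text \<open>If the sign changed from \<open>k\<close> to \<open>k + 1\<close>, then
  \<open>fn (k * n)\<close> would displace \<open>x\<close> and \<open>fn n x\<close> in opposite
  directions and have a fixed point between them. Only these two points have to lie in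
  \<open>J\<close>, not the later iterates.\<close>

lemma same_direction: assumes J: "connected J" "J<={0..1}" "J Int Per f = {}" and s: "side s" and n: "n>=1"
 and x: "x:J" "fn n x:J" "0<s * (fn n x - x)" and k: "k>=1" shows "0<s * (fn (k * n) x - x)" using k
proof (induction k rule: nat_induct_at_least)
case base
thus ?case using x by simp
next
case (Suc k)
define g where "g z = s * (fn (k * n) z - z)" for z
show ?case
proof (rule ccontr)
 assume "~ ?thesis"
 hence le: "s * (fn (Suc k * n) x - x)<=0" by simp
 have eq: "fn (Suc k * n) x = fn (k * n) (fn n x)" by (simp flip: fpow_add add: add.commute)
 have "g (fn n x) = s * (fn (Suc k * n) x - x) - s * (fn n x - x)" unfolding g_def eq by (simp add: algebra_simps)
 hence "g (fn n x)<=0" using le x(3) by simp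
 moreover have "0<=g x" using Suc g_def by simp
 moreover have "continuous_on J g" unfolding g_def using fpow_cont'[OF J(2), of "k * n"] by (intro continuous_intros)
 ultimately obtain z where z: "z:J" "g z = 0" using connected_zero[OF J(1) _ x(2,1)] by blast
 hence "fn (k * n) z = z" using s unfolding g_def side_def by auto
 moreover have "k * n>=1" using Suc n by simp
 ultimately show False using z(1) J unfolding Per_def by blast
qed
qed

lemma opposite_directions_periodic: assumes J: "connected J" "J<={0..1}" and s: "side s" and n: "n>=1" "k>=1"
 and x: "x:J" "fn n x:J" "0<s * (fn n x - x)" and y: "y:J" "fn k y:J" "s * (fn k y - y)<0" shows "J Int Per f~={}"
proof
assume no: "J Int Per f = {}"
have 1: "0<s * (fn (k * n) x - x)" by (rule same_direction[OF J no s n(1) x n(2)])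
have s': "side (-s)" using s by simp
have 2: "0<(-s) * (fn (n * k) y - y)" by (rule same_direction[OF J no s' n(2) y(1,2) _ n(1)]) (use y(3) in simp)
define g where "g z = s * (fn (k * n) z - z)" for z
have "continuous_on J g" unfolding g_def using fpow_cont'[OF J(2), of "k * n"] by (intro continuous_intros)
moreover have "g y<=0" using 2 unfolding g_def by (simp add: mult.commute)
moreover have "0<=g x" using 1 unfolding g_def by simp
ultimately obtain z where z: "z:J" "g z = 0" using connected_zero[OF J(1) _ y(1) x(1)] by blast
hence "fn (k * n) z = z" using s unfolding g_def side_def by auto
moreover have "k * n>=1" using n by simp
ultimately show False using z(1) J no unfolding Per_def by blast
qed

lemma basic_subset_closure_Per: assumes I: "pint I m" and inf: "infinite (Bs I)" shows "Bs I<=closure (Per f)"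
proof
define M where "M = Orb I"
note Mu = cyc_unit[OF I, folded M_def]
fix b assume b: "b:Bs I"
obtain s where d: "DG M b s" using basic_DG_exists[OF I inf b] M_def by blast
note s = DG_side[OF d]
show "b:closure (Per f)" unfolding closure_approachable
proof (intro allI impI)
 fix e::real assume "e>0"
 then obtain e1 where e1: "e1>0" "e1<=e" "ger b s e1<=M" using DG_small[OF d] by blast
 define J where "J = ger b s e1"
 have Jc: "connected J" "J<={0..1}" unfolding J_def using ger_connected[OF s] e1(3) Mu by auto
 have "infinite (B_set M f Int J)" unfolding M_def J_def using basic_germ_infinite[OF I inf _ e1(1)] d M_def by blast
 hence "B_set M f Int J~={}" by (rule infinite_imp_nonempty)
 then obtain b1 where b1: "b1:B_set M f Int J" by blast
 have "infinite (B_set M f Int J - {b1})" using `infinite (B_set M f Int J)` by simp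
 hence "B_set M f Int J - {b1}~={}" by (rule infinite_imp_nonempty)
 then obtain b2 where b2: "b2:B_set M f Int J" "b2~=b1" by blast
 obtain t1 where t1: "DG M b1 t1" using basic_DG_exists[OF I inf, of b1] b1 M_def by blast
 obtain t2 where t2: "DG M b2 t2" using basic_DG_exists[OF I inf, of b2] b2 M_def by blast
 have "open J" unfolding J_def by (rule ger_open[OF s])
 then obtain d1 where d1: "d1>0" "ball b1 d1<=J" using b1 open_contains_ball by blast
 obtain d2 where d2: "d2>0" "ball b2 d2<=J" using b2 `open J` open_contains_ball by blast
 \<comment> \<open>Half the distance of \<open>b1\<close> and \<open>b2\<close> keeps the two germs
   apart, so that an iterate from \<open>V1\<close> to \<open>V2\<close> moves its point in one
   direction and an iterate from \<open>V2\<close> to \<open>V1\<close> in the other.\<close>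
 define dd where "dd = min (min d1 d2) (abs (b1 - b2) / 2)"
 have dd: "dd>0" unfolding dd_def using d1 d2 b2 by simp
 define V1 where "V1 = ger b1 t1 dd"
 define V2 where "V2 = ger b2 t2 dd"
 have V1: "V1<=ball b1 dd" unfolding V1_def by (rule ger_ball[OF DG_side[OF t1]])
 have V2: "V2<=ball b2 dd" unfolding V2_def by (rule ger_ball[OF DG_side[OF t2]])
 have "ball b1 dd<=ball b1 d1" "ball b2 dd<=ball b2 d2" unfolding dd_def by (intro subset_ball; simp)+
 hence sub: "V1<=J" "V2<=J" using V1 V2 d1 d2 by (meson subset_trans)+
 have hit: "EX x:ger c r dd. EX k. fn k x:ger c' r' dd" if "DG M c r" "DG M c' r'" "ger c' r' dd<=J" for c r c' r'
 proof -
  have "ger c' r' dd<=Cl (ger c r dd)" using DG_dense[OF that(1) dd] that(3) e1(3) unfolding J_def by blast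
  hence "ger c' r' dd Int Cl (ger c r dd)~={}" using ger_nonempty[OF DG_side[OF that(2)] dd, of c'] by (simp add: inf.absorb1)
  hence "ger c' r' dd Int Orb (ger c r dd)~={}" using open_Int_closure_eq_empty[OF ger_open[OF DG_side[OF that(2)]]] by simp
  thus ?thesis unfolding orb_def by blast
 qed
 obtain x k where x: "x:V1" "fn k x:V2" using hit[OF t1 t2] sub(2) V1_def V2_def by blast
 obtain y l where y: "y:V2" "fn l y:V1" using hit[OF t2 t1] sub(1) V1_def V2_def by blast
 define r where "r = (if b1<b2 then 1 else -1::real)"
 have r: "side r" unfolding r_def by simp
 have sep: "0<r * (v2 - v1)" if "v1:V1" "v2:V2" for v1 v2
 proof -
  have "abs (v1 - b1)<dd" "abs (v2 - b2)<dd" using that V1 V2 by (auto simp: dist_real_def)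
  moreover have "dd<=abs (b1 - b2) / 2" unfolding dd_def by (rule min.cobounded2)
  ultimately show ?thesis unfolding r_def using b2(2) by (auto simp: field_simps abs_if split: if_splits)
 qed
 have "k>=1" using sep[OF x] x sep[of x x] by (cases k) auto
 moreover have "l>=1" using sep[OF y(2,1)] y sep[of y y] by (cases l) auto
 moreover have "0<r * (fn k x - x)" using sep x by blast
 moreover have "r * (fn l y - y)<0" using sep[OF y(2,1)] by (simp add: algebra_simps)
 ultimately have "J Int Per f~={}" using opposite_directions_periodic[OF Jc r] x y sub by blast
 then obtain p where "p:J" "p:Per f" by blast
 moreover have "J<=ball b e" using ger_ball[OF s, of b e1] e1(2) unfolding J_def by auto
 ultimately have "p:ball b e" by blast
 hence "dist p b<e" by (simp only: mem_ball dist_commute)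
 thus "EX y:Per f. dist y b<e" using `p:Per f` by blast
qed
qed

section \<open>A limit set that contains a basic set\<close>

text \<open>The points of \<open>C 0\<close> that obey the first \<open>k\<close> conditions form
  nested compact sets; they are nonempty because every point of \<open>C k\<close> is reached by one
  of them.\<close>

lemma realize_orbit:
fixes C::"nat => real set" and n::"nat => nat"
assumes C: "!!i. compact (C i)" "!!i. C i<={0..1}" "C 0~={}" and cov: "!!i. C (Suc i)<=(f ^^ n i) ` C i" and ne: "!!i. C i~={}"
shows "EX x:C 0. ALL i. fn (SUM j<i. n j) x:C i"
proof -
define t where "t i = (SUM j<i. n j)" for i
have t: "t 0 = 0" "t (Suc i) = n i + t i" for i unfolding t_def by (simp_all add: add.commute)
define D where "D k = {x:C 0. ALL i<=k. (f ^^ t i) x:C i}" for k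
have surj: "C k<=(f ^^ t k) ` D k" for k
proof (induction k)
 case 0
 thus ?case unfolding D_def using t by auto
next
 case (Suc k)
 show ?case
 proof
  fix c assume c: "c:C (Suc k)"
  then obtain c' where c': "c':C k" "c = (f ^^ n k) c'" using cov[of k] by blast
  then obtain d where d: "d:D k" "c' = (f ^^ t k) d" using Suc by blast
  have cd: "c = (f ^^ t (Suc k)) d" unfolding c' d t fpow_add ..
  moreover have "d:D (Suc k)" using d(1) c cd unfolding D_def by (auto simp: le_Suc_eq)
  ultimately show "c:(f ^^ t (Suc k)) ` D (Suc k)" by blast
 qed
qed
have "(INT k. D k)~={}"
proof (rule compact_nest)
 show "D k~={}" for k using surj[of k] ne[of k] by blast
 show "D k<=D l" if "l<=k" for l k unfolding D_def using that by auto
 show "compact (D k)" for k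
 proof -
  have "closedin (top_of_set (C 0)) (C 0 Int (f ^^ t i) -` C i)" for i
   using continuous_closedin_preimage[OF fpow_cont'[OF C(2)] compact_imp_closed[OF C(1)]] .
  hence "closedin (top_of_set (C 0)) (INT i:{..k}. C 0 Int (f ^^ t i) -` C i)" by (intro closedin_INT) auto
  moreover have "D k = (INT i:{..k}. C 0 Int (f ^^ t i) -` C i)" unfolding D_def by auto
  ultimately show ?thesis using C(1) closedin_compact by metis
 qed
qed
then obtain x where "!!k. x:D k" by blast
thus ?thesis unfolding D_def t_def by blast
qed

text \<open>Closed dense germs are chosen such that an iterate of each covers the next and every
  member of a countable base that meets the basic set is visited infinitely often. A point that
  follows these germs has the whole basic set in its limit set.\<close>

lemma basic_subset_omega_limit: assumes I: "pint I m" and inf: "infinite (Bs I)" shows "EX x:{0..1}. Bs I<=om x"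
proof -
define M where "M = Orb I"
define B where "B = B_set M f"
note fM = pint_f_orb[OF I, folded M_def]
note Mu = cyc_unit[OF I, folded M_def]
have Binf: "infinite B" using inf M_def B_def by simp
obtain U::"nat => real set" where U: "!!j. open (U j)" "!!V y. open V ==> y:V ==> EX j. y:U j & U j<=V" using rational_intervals by metis
define P where "P z <-> (case z of (b, s, e) => DG M b s & e>0 & seg b s e<=M)" for z
define S where "S z = (case z of (b, s, e) => seg b s e)" for z
\<comment> \<open>Decoding \<open>i\<close> as a pair makes every index of the base recur for
  infinitely many \<open>i\<close>.\<close>
define R where "R i z z' <-> (EX k>=1. S z'<=fn k ` S z) &
  (U (fst (prod_decode i)) Int B~={} --> S z'<=U (fst (prod_decode i)))" for i z z'
have step: "EX z'. P z' & R i z z'" if Pz: "P z" for i z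
proof -
 obtain b s e where z: "z = (b, s, e)" "DG M b s" "e>0" "seg b s e<=M" using Pz unfolding P_def by (cases z) auto
 note s = DG_side[OF z(2)]
 define J where "J = ger b s e"
 have JM: "J<=M" unfolding J_def using ger_seg z(4) by blast
 have dJ: "M<=Cl J" unfolding J_def by (rule DG_dense[OF z(2,3)])
 obtain X where X: "finite X" "!!b t. b:M - X ==> side t ==> EX k>=1. EX e>0. ger b t e<=fn k ` J"
  using DG_covers[OF fM Mu s z(3) JM[unfolded J_def]] dJ unfolding J_def by auto
 define V where "V = (if U (fst (prod_decode i)) Int B~={} then U (fst (prod_decode i)) else UNIV)"
 have V: "open V" "B Int V~={}" unfolding V_def using U(1) Binf by auto
 have "infinite (B Int V)" using basic_near_infinite[OF I inf] V M_def B_def by blast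
 then obtain b' where b': "b':B" "b':V" "b'~:X" using X(1) finite_subset[of "B Int V" X] by blast
 obtain t where t: "DG M b' t" using basic_DG_exists[OF I inf] b'(1) M_def B_def by blast
 have b'M: "b':M" using b'(1) B_sub B_def by blast
 hence "b':M - X" using b'(3) by blast
 then obtain k d where k: "k>=1" "d>0" "ger b' t d<=fn k ` J" using X(2)[OF _ DG_side[OF t]] by blast
 obtain r where r: "r>0" "ball b' r<=V" using V(1) b'(2) open_contains_ball by blast
 obtain q where q: "q>0" "q<=min d r" "ger b' t q<=M" using DG_small[OF t, of "min d r"] k(2) r(1) by auto
 define e' where "e' = q / 2"
 have e': "e'>0" "e'<q" unfolding e'_def using q by auto
 have sg: "seg b' t e'<=insert b' (ger b' t q)" by (rule seg_ger[OF DG_side[OF t] e'(2)])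
 have sV: "seg b' t e'<=V"
 proof -
  have "ger b' t q<=ball b' r" using ger_ball[OF DG_side[OF t], of b' q] q(2) by auto
  thus ?thesis using sg r b'(2) by blast
 qed
 have Ju: "J<={0..1}" using JM Mu by blast
 have "ger b' t e'<=fn k ` J" using k(3) ger_mono[of e' d b' t] e' q(2) by auto
 hence "closure (ger b' t e')<=fn k ` closure J" using fpow_closure[OF Ju] closure_mono by metis
 hence "seg b' t e'<=fn k ` seg b s e" using closure_ger[OF DG_side[OF t] e'(1)] closure_ger[OF s z(3)] J_def by simp
 moreover have "P (b', t, e')" unfolding P_def using t e'(1) sg q(3) b'M by auto
 moreover have "U (fst (prod_decode i)) Int B~={} --> seg b' t e'<=U (fst (prod_decode i))" using sV unfolding V_def by presburger
 ultimately show ?thesis unfolding R_def S_def z(1) using k(1) by (intro exI[of _ "(b', t, e')"]) auto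
qed
have "EX z. P z"
proof -
 obtain b where b: "b:B" using Binf by fastforce
 obtain t where t: "DG M b t" using basic_DG_exists[OF I inf] b M_def B_def by blast
 obtain q where q: "q>0" "ger b t q<=M" using DG_small[OF t, of 1] by auto
 have "seg b t (q/2)<=insert b (ger b t q)" by (rule seg_ger[OF DG_side[OF t]]) (use q in simp)
 hence "P (b, t, q/2)" unfolding P_def using t q b B_sub B_def by auto
 thus ?thesis by blast
qed
hence "EX z. ALL i. P (z i) & R i (z i) (z (Suc i))" using step by (intro dependent_nat_choice) auto
then obtain z where z: "!!i. P (z i)" "!!i. R i (z i) (z (Suc i))" by blast
define C where "C i = S (z i)" for i
have Cp: "compact (C i) & C i<={0..1} & C i~={}" for i
proof -
 obtain b s e where zi: "z i = (b, s, e)" "DG M b s" "e>0" "seg b s e<=M" using z(1)[of i] unfolding P_def by (cases "z i") auto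
 have "b:seg b s e" unfolding seg_def using zi(3) by simp
 thus ?thesis unfolding C_def S_def zi(1) using seg_compact[OF DG_side[OF zi(2)]] zi(4) Mu by auto
qed
have "EX k>=1. C (Suc i)<=fn k ` C i" for i using z(2)[of i] unfolding R_def C_def by blast
then obtain n where n: "!!i. n i>=1" "!!i. C (Suc i)<=(f ^^ n i) ` C i" by metis
obtain x where x: "x:C 0" "!!i. fn (SUM j<i. n j) x:C i" using realize_orbit[of C n] Cp n(2) by blast
have tm: "i<=(SUM j<i. n j)" for i
proof (induction i)
 case (Suc i)
 thus ?case using n(1)[of i] by simp
qed simp
have "B<=om x"
proof
 fix y assume y: "y:B"
 show "y:om x" unfolding om_iff
 proof (intro allI impI)
  fix e::real and N assume "e>0"
  then obtain j where j: "y:U j" "U j<=ball y e" using U(2)[of "ball y e" y] by auto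
  define i where "i = prod_encode (j, N)"
  have "C (Suc i)<=U j" using z(2)[of i] y j(1) unfolding R_def C_def i_def by auto
  hence "fn (SUM j<Suc i. n j) x:ball y e" using x(2)[of "Suc i"] j(2) by blast
  moreover have "N<=(SUM j<Suc i. n j)" using le_prod_encode_2[of N j] tm[of "Suc i"] unfolding i_def by linarith
  ultimately show "EX n>=N. abs (fn n x - y)<e" by (intro exI[of _ "SUM j<Suc i. n j"]) (auto simp: dist_real_def abs_minus_commute)
 qed
qed
thus ?thesis using x(1) Cp[of 0] unfolding B_def M_def by blast
qed

end

section \<open>Piecewise monotone maps\<close>

text \<open>\<open>lap\<close> and \<open>turn\<close> retain of a partition that \<open>f\<close>
  is monotone between turning points and has a weak extremum at each of them. The latter makes the
  relation \<open>sim\<close> below transitive.\<close>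

locale pm_system = interval_map +
fixes C::"real set" assumes finC: "finite C" and lap: "!!u v. 0<=u ==> u<=v ==> v<=1 ==> {u<..<v} Int C = {} ==> monotone_lap f u v"
 and turn: "!!c u v. c:C ==> 0<=u ==> u<c ==> c<v ==> v<=1 ==> {u<..<c} Int C = {} ==> {c<..<v} Int C = {} ==>
  (f u<=f c & f v<=f c) | (f c<=f u & f c<=f v)"
begin

text \<open>Germ monotonicity: as the point leaves \<open>x\<close> in direction \<open>s\<close>,
  its image weakly recedes from \<open>fn k x\<close> in direction \<open>s'\<close>. Where
  \<open>fn k\<close> is constant, both directions qualify.\<close>

definition GM::"nat => real => real => real => real => bool" where
"GM k x s s' e <-> side s & side s' & e>0 & seg x s e<={0..1} &
  (ALL y z. 0<=y & y<=z & z<=e -->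
   0<=s' * (fn k (x + s * y) - fn k x) &
   s' * (fn k (x + s * y) - fn k x)<=s' * (fn k (x + s * z) - fn k x))"

lemma GM_D: assumes "GM k x s s' e" "0<=y" "y<=z" "z<=e" shows "0<=s' * (fn k (x + s * y) - fn k x)"
 "s' * (fn k (x + s * y) - fn k x)<=s' * (fn k (x + s * z) - fn k x)" using assms unfolding GM_def by blast+

lemma GM_seg: "GM k x s s' e ==> seg x s e<={0..1}" unfolding GM_def by blast

lemma seg_points: "side s ==> 0<=t ==> t<=e ==> x + s * t:seg x s e" unfolding side_def seg_def by auto

lemma seg_coord: assumes "side s" "y:seg x s e" shows "EX t. 0<=t & t<=e & y = x + s * t"
using assms unfolding side_def seg_def by (intro exI[of _ "s * (y - x)"]) auto

lemma ger_coord: assumes "side s" "y:ger x s e" shows "EX t. 0<t & t<e & y = x + s * t"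
using assms unfolding side_def ger_def by (intro exI[of _ "s * (y - x)"]) auto

lemma seg_mono: "e<=e' ==> seg x s e<=seg x s e'" unfolding seg_def by auto

lemma GM_less: assumes g: "GM k x s s' e" and e': "0<e'" "e'<=e" shows "GM k x s s' e'" unfolding GM_def
proof (intro conjI allI impI)
show "side s" "side s'" "0<e'" using g e' unfolding GM_def by auto
show "seg x s e'<={0..1}" using GM_seg[OF g] seg_mono[OF e'(2), of x s] by (rule subset_trans[rotated])
fix y z assume "0<=y & y<=z & z<=e'"
hence "0<=y" "y<=z" "z<=e" using e' by auto
thus "0<=s' * (fn k (x + s * y) - fn k x)"
 "s' * (fn k (x + s * y) - fn k x)<=s' * (fn k (x + s * z) - fn k x)" by (rule GM_D[OF g])+
qed

lemma small_gap: "EX r>0. ALL s. side s --> ger x s r Int C = {}"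
proof -
define r where "r = Min (insert 1 ((%c. abs (c - x)) ` (C - {x})))"
have fin: "finite (insert 1 ((%c. abs (c - x)) ` (C - {x})))" using finC by simp
have "r>0" unfolding r_def using fin by auto
moreover have "c~:ger x s r" if "c:C" "side s" for c s
proof
 assume c: "c:ger x s r"
 hence "c~=x" unfolding ger_def by auto
 hence "r<=abs (c - x)" unfolding r_def using fin that by (intro Min_le) auto
 thus False using c mem_ger_abs[OF that(2)] by auto
qed
ultimately show ?thesis by blast
qed

lemma small_monotone: assumes x: "x:{0..1}" and s: "side s"
shows "EX r>0. EX t. side t & (ALL p q. p:{0..1} & q:{0..1} & 0<=s * (p - x) & s * (p - x)<=s * (q - x) & s * (q - x)<r -->
  0<=t * (f p - f x) & t * (f p - f x)<=t * (f q - f x))"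
proof -
obtain r where r: "r>0" "ger x s r Int C = {}" using small_gap[of x] s by blast
define u where "u = (if s = 1 then x else max 0 (x - r))"
define v where "v = (if s = 1 then min 1 (x + r) else x)"
have uv: "0<=u" "u<=v" "v<=1" using x r(1) unfolding u_def v_def by auto
have "{u<..<v}<=ger x s r" using s unfolding u_def v_def side_def ger_def by auto
hence "monotone_lap f u v" using lap[OF uv] r(2) by blast
hence mono: "mono_on {u..v} f | antimono_on {u..v} f" unfolding monotone_lap_def .
have mem: "p:{u..v}" if "p:{0..1}" "0<=s * (p - x)" "s * (p - x)<r" for p using that s unfolding u_def v_def side_def by auto
have xm: "x:{u..v}" using x r(1) unfolding u_def v_def by auto
define t where "t = (if mono_on {u..v} f then s else -s)"
have t: "side t" using s unfolding t_def by simp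
have "0<=t * (f p - f x) & t * (f p - f x)<=t * (f q - f x)"
 if pq: "p:{0..1}" "q:{0..1}" "0<=s * (p - x)" "s * (p - x)<=s * (q - x)" "s * (q - x)<r" for p q
proof -
 have m: "p:{u..v}" "q:{u..v}" using mem pq by auto
 show ?thesis
 proof (cases "mono_on {u..v} f")
  case True
  hence le: "f a<=f b" if "a:{u..v}" "b:{u..v}" "a<=b" for a b using that by (simp add: monotone_on_def)
  from s consider "s = 1" "x<=p" "p<=q" | "s = -1" "p<=x" "q<=p" using pq unfolding side_def by auto
  thus ?thesis using le[OF xm m(1)] le[OF m(1,2)] le[OF m(1) xm] le[OF m(2,1)] True unfolding t_def by cases auto
 next
  case False
  hence "antimono_on {u..v} f" using mono by blast
  hence le: "f b<=f a" if "a:{u..v}" "b:{u..v}" "a<=b" for a b using that by (simp add: monotone_on_def)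
  from s consider "s = 1" "x<=p" "p<=q" | "s = -1" "p<=x" "q<=p" using pq unfolding side_def by auto
  thus ?thesis using le[OF xm m(1)] le[OF m(1,2)] le[OF m(1) xm] le[OF m(2,1)] False unfolding t_def by cases auto
 qed
qed
thus ?thesis using r(1) t by blast
qed

lemma germ_continuity: assumes s: "side s" and u: "seg x s e0<={0..1}" "e0>0" and r: "r>0"
shows "EX e>0. e<=e0 & (ALL y. 0<=y & y<=e --> abs (fn k (x + s * y) - fn k x)<r)"
proof -
have xs: "x:seg x s e0" unfolding seg_def using u(2) by simp
have "continuous_on (seg x s e0) (fn k)" by (rule fpow_cont'[OF u(1)])
then obtain d where d: "d>0" "!!y. y:seg x s e0 ==> dist y x<d ==> dist (fn k y) (fn k x)<r" using xs r unfolding continuous_on_iff by meson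
have "abs (fn k (x + s * y) - fn k x)<r" if "0<=y" "y<=min e0 (d/2)" for y
proof -
 have "x + s * y:seg x s e0" by (rule seg_points[OF s]) (use that in auto)
 moreover have "dist (x + s * y) x<d" using s that d(1) unfolding side_def dist_real_def by auto
 ultimately show ?thesis using d(2) by (simp add: dist_real_def)
qed
thus ?thesis using u(2) d(1) by (intro exI[of _ "min e0 (d/2)"]) auto
qed

text \<open>Induction on \<open>k\<close>: by continuity a shorter germ is mapped into a one-sided
  neighborhood of \<open>fn k x\<close> without turning points, on which the next step is
  monotone.\<close>

lemma GM_exists: assumes s: "side s" and u: "seg x s e0<={0..1}" "e0>0" shows "EX e>0. e<=e0 & (EX s'. GM k x s s' e)"
proof (induction k)
case 0
have "GM 0 x s s e0" unfolding GM_def using s u unfolding side_def by auto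
thus ?case using u(2) by blast
next
case (Suc k)
then obtain e s' where e: "e>0" "e<=e0" "GM k x s s' e" by blast
have xs: "x:seg x s e0" unfolding seg_def using u(2) by simp
have xk: "fn k x:{0..1}" using fpow_maps u(1) xs by blast
have s': "side s'" using e(3) unfolding GM_def by blast
obtain r t where r: "r>0" "side t" "!!p q. p:{0..1} ==> q:{0..1} ==> 0<=s' * (p - fn k x) ==>
  s' * (p - fn k x)<=s' * (q - fn k x) ==> s' * (q - fn k x)<r ==>
  0<=t * (f p - f (fn k x)) & t * (f p - f (fn k x))<=t * (f q - f (fn k x))" using small_monotone[OF xk s'] by blast
obtain e1 where e1: "e1>0" "e1<=e" "!!y. 0<=y ==> y<=e1 ==> abs (fn k (x + s * y) - fn k x)<r"
 using germ_continuity[OF s GM_seg[OF e(3)] e(1) r(1), of k] by blast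
have "GM (Suc k) x s t e1" unfolding GM_def
proof (intro conjI allI impI)
 show "side s" "side t" "e1>0" using s r e1 by auto
 show u1: "seg x s e1<={0..1}" using e(3) seg_mono[OF e1(2), of x s] unfolding GM_def by blast
 fix y z assume yz: "0<=y & y<=z & z<=e1"
 have "x + s * y:seg x s e1" "x + s * z:seg x s e1" using yz by (intro seg_points[OF s]; simp)+
 hence pq: "fn k (x + s * y):{0..1}" "fn k (x + s * z):{0..1}" using fpow_maps u1 by blast+
 have mon: "0<=s' * (fn k (x + s * y) - fn k x)"
  "s' * (fn k (x + s * y) - fn k x)<=s' * (fn k (x + s * z) - fn k x)" using GM_D[OF e(3)] yz e1(2) by auto
 have "s' * (fn k (x + s * z) - fn k x)<r" using e1(3)[of z] yz s' unfolding side_def by (auto simp: abs_if split: if_splits)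
 from r(3)[OF pq mon this]
 show "0<=t * ((f ^^ Suc k) (x + s * y) - (f ^^ Suc k) x)"
  "t * ((f ^^ Suc k) (x + s * y) - (f ^^ Suc k) x)<=t * ((f ^^ Suc k) (x + s * z) - (f ^^ Suc k) x)" by simp_all
qed
thus ?case using e1 e by (intro exI[of _ e1]) auto
qed

lemma GM_image: assumes g: "GM k x s s' e" and r: "r>0" shows "EX d>0. d<=e & fn k ` seg x s d<=insert (fn k x) (ger (fn k x) s' r)"
proof -
have s: "side s" "side s'" "seg x s e<={0..1}" "e>0" using g unfolding GM_def by auto
obtain d where d: "d>0" "d<=e" "!!y. 0<=y ==> y<=d ==> abs (fn k (x + s * y) - fn k x)<r" using germ_continuity[OF s(1,3,4) r] by blast
have "fn k y:insert (fn k x) (ger (fn k x) s' r)" if y: "y:seg x s d" for y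
proof -
 obtain t where t: "0<=t" "t<=d" "y = x + s * t" using seg_coord[OF s(1) y] by blast
 have "abs (fn k y - fn k x)<r" using d(3)[OF t(1,2)] t(3) by simp
 moreover have "0<=s' * (fn k y - fn k x)" using g t d(2) unfolding GM_def by auto
 moreover have "0 = s' * (fn k y - fn k x) ==> fn k y = fn k x" using s(2) unfolding side_def by auto
 ultimately show ?thesis unfolding insert_iff mem_ger_abs[OF s(2)] less_le by blast
qed
thus ?thesis using d by blast
qed

lemma GM_covers: assumes g: "GM k x s s' e" and d: "0<d" "d<=e" and y: "y:seg x s d" "fn k y~=fn k x"
shows "EX q>0. ger (fn k x) s' q<=fn k ` ger x s d"
proof -
have s: "side s" "side s'" "seg x s e<={0..1}" "e>0" using g unfolding GM_def by auto
obtain t where t: "0<=t" "t<=d" "y = x + s * t" using seg_coord[OF s(1) y(1)] by blast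
define q where "q = s' * (fn k y - fn k x)"
have "0<=q" using g t d(2) unfolding GM_def q_def by auto
moreover have "q~=0" unfolding q_def using y(2) s(2) unfolding side_def by auto
ultimately have q: "q>0" by simp
have sg: "seg x s t<={0..1}" using s(3) seg_mono[of t e x s] t d by auto
have conn: "connected (fn k ` seg x s t)" by (rule fpow_conn[OF seg_connected[OF s(1)] sg])
have "x:seg x s t" "y:seg x s t" unfolding t(3) using t(1) s(1) unfolding seg_def side_def by auto
hence ends: "fn k x:fn k ` seg x s t" "fn k y:fn k ` seg x s t" by blast+
have "ger (fn k x) s' q<=fn k ` ger x s d"
proof
 fix z assume z: "z:ger (fn k x) s' q"
 consider "fn k x<=z & z<=fn k y" | "fn k y<=z & z<=fn k x" using s(2) z unfolding side_def ger_def q_def by fastforce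
 hence "z:fn k ` seg x s t" using connected_contains_Icc[OF conn] ends by cases (meson atLeastAtMost_iff subsetD)+
 then obtain w where w: "w:seg x s t" "z = fn k w" by blast
 have "w~=x" "w~=y" using z w(2) unfolding ger_def q_def by auto
 hence "w:ger x s d" using w(1) t d s(1) unfolding seg_def ger_def side_def by auto
 thus "z:fn k ` ger x s d" using w(2) by blast
qed
thus ?thesis using q by blast
qed

text \<open>A monotone iterate keeps the image of a short germ on one side of
  \<open>c\<close>.\<close>

lemma gimg_unique: assumes u: "seg b t e0<={0..1}" "e0>0" and t: "side t" "side s1" "side s2" and 1: "gimg k b t c s1" "gimg k b t c s2"
shows "s1 = s2"
proof -
obtain e s' where e: "e>0" "GM k b t s' e" using GM_exists[OF t(1) u] by blast
have s': "side s'" using e(2) unfolding GM_def by blast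
have c: "fn k b = c" using 1 unfolding gimg_def by blast
obtain d where d: "d>0" "fn k ` seg b t d<=insert c (ger c s' 1)" using GM_image[OF e(2), of 1] c by auto
have "s = s'" if s: "side s" "gimg k b t c s" for s
proof -
 obtain q where q: "q>0" "ger c s q<=fn k ` ger b t d" using gimgD[OF s(2) d(1)] by blast
 hence "ger c s q<=insert c (ger c s' 1)" using d(2) ger_seg by blast
 moreover have "c + s * (q/2):ger c s q" by (rule ger_points[OF s(1)]) (use q in auto)
 ultimately have "c + s * (q/2):insert c (ger c s' 1)" by blast
 thus ?thesis using s(1) s' q(1) unfolding side_def ger_def by auto
qed
thus ?thesis using 1 t by blast
qed

lemma DG_seg_unit: assumes I: "pint I m" and d: "DG (Orb I) b t" shows "EX e>0. seg b t e<=Orb I"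
proof -
obtain e where e: "e>0" "ger b t e<=Orb I" using DG_small[OF d, of 1] by auto
have "seg b t e<=Orb I" using closure_minimal[OF e(2) cyc_closed[OF I]] closure_ger[OF DG_side[OF d] e(1)] by simp
thus ?thesis using e by blast
qed

text \<open>If \<open>Bs I\<close> is finite, there are only finitely many dense germs. Each is
  covered by one of them, and each covers at most one; so the choice of a preimage is an injection
  of a finite set into itself, and \<open>gimg k\<close> permutes the dense germs.\<close>

lemma gimg_inj: assumes I: "pint I m" and fin: "finite (Bs I)"
shows "(DG (Orb I) b1 t1 & DG (Orb I) b2 t2 & DG (Orb I) c s & gimg k b1 t1 c s & gimg k b2 t2 c s --> b1 = b2 & t1 = t2)
 & (DG (Orb I) b1 t1 --> (EX c s. DG (Orb I) c s & gimg k b1 t1 c s))"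
proof -
define D where "D = {(b, t). DG (Orb I) b t}"
have "D<=Bs I \<times> {1, -1}"
proof
 fix p assume "p:D"
 hence "DG (Orb I) (fst p) (snd p)" unfolding D_def by auto
 hence "fst p:Bs I" "side (snd p)" using DG_in_B[OF _ cyc_closed[OF I] f_orb] DG_side by blast+
 thus "p:Bs I \<times> {1, -1}" unfolding side_def by (simp add: mem_Times_iff)
qed
hence finD: "finite D" using fin finite_subset by blast
define G where "G p q <-> gimg k (fst p) (snd p) (fst q) (snd q)" for p q
have func: "q = q'" if pq: "p:D" "q:D" "q':D" "G p q" "G p q'" for p q q'
proof -
 have dp: "DG (Orb I) (fst p) (snd p)" using pq(1) unfolding D_def by auto
 have sq: "side (snd q)" "side (snd q')" using pq(2,3) DG_side unfolding D_def by auto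
 obtain e where e: "e>0" "seg (fst p) (snd p) e<=Orb I" using DG_seg_unit[OF I dp] by blast
 have f: "fst q = fst q'" using pq(4,5) unfolding G_def gimg_def by simp
 have "snd q = snd q'" by (rule gimg_unique[OF _ e(1) DG_side[OF dp] sq])
    (use e(2) cyc_unit[OF I] pq(4,5) f in "auto simp: G_def")
 thus ?thesis using f by (simp add: prod_eq_iff)
qed
have "EX p:D. G p q" if q: "q:D" for q
proof -
 have "DG (Orb I) (fst q) (snd q)" using q unfolding D_def by auto
 then obtain y s where "DG (Orb I) y s" "gimg k y s (fst q) (snd q)" using DG_backward[OF I] by blast
 thus ?thesis unfolding D_def G_def by (intro bexI[of _ "(y, s)"]) auto
qed
then obtain pre where pre: "!!q. q:D ==> pre q:D & G (pre q) q" by metis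
have "inj_on pre D" unfolding inj_on_def using func pre by metis
moreover have "pre ` D<=D" using pre by blast
ultimately have surj: "pre ` D = D" using finD by (simp add: endo_inj_surj)
have inj: "p = p'" if p: "p:D" "p':D" "q:D" "G p q" "G p' q" for p p' q
proof -
 obtain a where a: "a:D" "p = pre a" using p(1) surj by blast
 obtain b where b: "b:D" "p' = pre b" using p(2) surj by blast
 have "a = q" using func[OF p(1) a(1) p(3) _ p(4)] pre[OF a(1)] a(2) by simp
 moreover have "b = q" using func[OF p(2) b(1) p(3) _ p(5)] pre[OF b(1)] b(2) by simp
 ultimately show ?thesis using a b by simp
qed
have tot: "EX q:D. G p q" if "p:D" for p
proof -
 obtain a where a: "a:D" "p = pre a" using `p:D` surj by blast
 thus ?thesis using pre[OF a(1)] by (intro bexI[of _ a]) simp_all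
qed
show ?thesis
proof (intro conjI impI)
 assume a: "DG (Orb I) b1 t1 & DG (Orb I) b2 t2 & DG (Orb I) c s & gimg k b1 t1 c s & gimg k b2 t2 c s"
 have "(b1, t1) = (b2, t2)" by (rule inj[of _ _ "(c, s)"]) (use a in "auto simp: D_def G_def")
 thus "b1 = b2" "t1 = t2" by auto
next
 assume "DG (Orb I) b1 t1"
 hence "(b1, t1):D" unfolding D_def by simp
 then obtain q where "q:D" "G (b1, t1) q" using tot by blast
 thus "EX c s. DG (Orb I) c s & gimg k b1 t1 c s" unfolding D_def G_def by (intro exI[of _ "fst q"] exI[of _ "snd q"]) auto
qed
qed

text \<open>Let \<open>u\<close> be the first point on the way from \<open>p\<close> to
  \<open>w\<close> that \<open>fn k\<close> maps to \<open>b\<close>. The images up to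
  \<open>u\<close> cover a germ at \<open>b\<close> on side \<open>t\<close>, so a dense germ
  between \<open>p\<close> and \<open>u\<close> lies over it. It must sit at \<open>u\<close>, on
  the side that faces \<open>p\<close>.\<close>

lemma first_hit: assumes I: "pint I m" and d: "DG (Orb I) b t" and r: "side r" and pw: "0<r * (w - p)" "seg p r (r * (w - p))<=Orb I"
 and hp: "0<t * (fn k p - b)" and hw: "t * (fn k w - b)<=0" shows "EX u. u:seg p r (r * (w - p)) & u~=p & DG (Orb I) u (-r) & gimg k u (-r) b t"
proof -
define L where "L = r * (w - p)"
define F where "F y = t * (fn k (p + r * y) - b)" for y
have t: "side t" by (rule DG_side[OF d])
have L: "L>0" using pw L_def by simp
have seg01: "seg p r L<={0..1}" using pw(2) cyc_unit[OF I] unfolding L_def by blast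
have w: "w = p + r * L" unfolding L_def using r unfolding side_def by auto
have cont: "continuous_on {0..L} F" unfolding F_def
proof (intro continuous_intros)
 show "continuous_on {0..L} (%y. fn k (p + r * y))"
 proof (rule continuous_on_compose2[OF fpow_cont'[OF seg01, of k]])
  show "(%y. p + r * y) ` {0..L}<=seg p r L" using seg_points[OF r] by auto
 qed (intro continuous_intros)
qed
define Z where "Z = {y:{0..L}. F y<=0}"
have "Z = {0..L} Int F -` {..0}" unfolding Z_def by auto
hence "closed Z" using continuous_closed_preimage[OF cont] by simp
moreover have "Z<={0..L}" unfolding Z_def by blast
ultimately have "compact Z" by (meson bounded_closed_interval bounded_subset compact_eq_bounded_closed)
moreover have "Z~={}" using hw L unfolding Z_def F_def w by (auto intro!: exI[of _ L])
ultimately obtain y0 where y0: "y0:Z" "!!y. y:Z ==> y0<=y" using compact_attains_inf by metis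
have F0: "F 0>0" unfolding F_def using hp by simp
have y0L: "0<y0" "y0<=L" using y0(1) F0 unfolding Z_def by (auto simp: less_le)
have pos: "F y>0" if "0<=y" "y<y0" for y using y0(2)[of y] that y0L unfolding Z_def by force
have Fy0: "F y0 = 0"
proof -
 have "continuous_on {0..y0} F" using cont by (rule continuous_on_subset) (use y0L in auto)
 moreover have "F y0<=0" using y0(1) unfolding Z_def by simp
 ultimately obtain y where "y:{0..y0}" "F y = 0" using connected_zero[OF connected_Icc[of 0 y0], of F y0 0] F0 y0L by auto
 thus ?thesis using pos[of y] by (cases "y = y0") auto
qed
define J where "J = seg p r y0"
obtain u v where uv: "J = {u..v}" using seg_Icc[OF r] J_def by blast
have JM: "J<=Orb I" using pw(2) seg_mono[OF y0L(2), of p r] unfolding J_def L_def by blast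
have J01: "J<={0..1}" using JM cyc_unit[OF I] by blast
define q where "q = t * (fn k p - b)"
have q: "q>0" using hp q_def by simp
have "ger b t q<=fn k ` J"
proof
 fix z assume z: "z:ger b t q"
 have conn: "connected (fn k ` J)" by (rule fpow_conn[OF _ J01]) (simp add: uv)
 have "p:J" "p + r * y0:J" unfolding J_def using seg_points[OF r, of 0 y0 p] seg_points[OF r, of y0 y0 p] y0L(1) by simp_all
 moreover have "fn k (p + r * y0) = b" using Fy0 t unfolding F_def side_def by auto
 ultimately have "fn k p:fn k ` J" "b:fn k ` J" by (metis imageI)+
 moreover consider "b<=z & z<=fn k p" | "fn k p<=z & z<=b" using t z unfolding side_def ger_def q_def by fastforce
 ultimately show "z:fn k ` J" using connected_contains_Icc[OF conn] by cases (meson atLeastAtMost_iff subsetD)+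
qed
then obtain x s where x: "x:J" "DG (Orb I) x s" "gimg k x s b t" "EX e>0. ger x s e<=J" using DG_lift[OF uv JM cyc_unit[OF I] d q, of k] by blast
obtain y where y: "0<=y" "y<=y0" "x = p + r * y" using seg_coord[OF r x(1)[unfolded J_def]] by blast
have "F y = 0" using x(3) unfolding gimg_def F_def y(3) by simp
hence yy: "y = y0" using pos[of y] y by (cases "y = y0") auto
obtain e where e: "e>0" "ger x s e<=J" using x(4) by blast
have "x + s * (e/2):J" using ger_points[OF DG_side[OF x(2)], of "e/2" e x] e by auto
hence "s = -r" using r DG_side[OF x(2)] e(1) unfolding J_def seg_def y(3) yy side_def by auto
moreover have "x~=p" using y(3) yy y0L r unfolding side_def by auto
moreover have "x:seg p r L" using x(1) seg_mono[OF y0L(2), of p r] unfolding J_def by blast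
ultimately show ?thesis using x(2,3) unfolding L_def by blast
qed

text \<open>A homoclinic point \<open>z\<close> of a periodic dense germ: if the basic set were finite, the images of \<open>y\<close> under
 the iterate that returns \<open>z\<close> to \<open>y\<close> would move away from \<open>z\<close> monotonically, although \<open>y\<close> is periodic.\<close>

lemma homoclinic_infinite: assumes I: "pint I m" and d: "DG (Orb I) y r" and y: "y:Per f" and x: "x:Orb I" "x~:Per f" "fn k x = y"
shows "infinite (Bs I)"
proof
assume fin: "finite (Bs I)"
define M where "M = Orb I"
note fM = pint_f_orb[OF I, folded M_def]
note Mu = cyc_unit[OF I, folded M_def]
note r = DG_side[OF d]
obtain e0 where e0: "e0>0" "seg y r e0<=M" using DG_seg_unit[OF I d] M_def by blast
obtain e1 where e1: "e1>0" "!!b. b:B_set M f ==> b:seg y r e1 ==> b = y"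
proof -
 define e1 where "e1 = Min (insert 1 ((%c. abs (c - y)) ` (B_set M f - {y}))) / 2"
 have fin': "finite (insert 1 ((%c. abs (c - y)) ` (B_set M f - {y})))" using fin M_def by simp
 have "Min (insert 1 ((%c. abs (c - y)) ` (B_set M f - {y})))>0" using fin' by auto
 moreover have "b = y" if b: "b:B_set M f" "b:seg y r e1" for b
 proof (rule ccontr)
  assume "b~=y"
  hence "2 * e1<=abs (b - y)" unfolding e1_def using fin' b(1) by simp
  moreover have "abs (b - y)<=e1" using b(2) r unfolding seg_def side_def by auto
  ultimately show False using `b ~= y` by auto
 qed
 ultimately show ?thesis using that[of e1] unfolding e1_def by auto
qed
define e where "e = min e0 e1"
have e: "e>0" "seg y r e<=M" unfolding e_def using e0 e1(1) seg_mono[of "min e0 e1" e0 y r] by auto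
have eB: "b = y" if "b:B_set M f" "b:seg y r e" for b using e1(2)[OF that(1)] that(2) seg_mono[of e e1 y r] unfolding e_def by auto
define J where "J = ger y r e"
have JM: "J<=M" unfolding J_def using ger_seg e(2) by blast
have Ju: "J<={0..1}" using JM Mu by blast
have dJ: "M<=Cl J" unfolding J_def M_def by (rule DG_dense[OF d e(1)])
obtain X where X: "finite X" "!!b t. b:M - X ==> side t ==> EX k>=1. EX e>0. ger b t e<=fn k ` J"
 using DG_covers[OF fM Mu r e(1) JM[unfolded J_def]] dJ unfolding J_def by auto
\<comment> \<open>A backward orbit of the nonperiodic point \<open>x\<close> is infinite, so one of
  its points avoids \<open>X\<close> and is covered by the small germ at \<open>y\<close>. This
  yields \<open>z\<close> in the closed germ whose orbit leads through \<open>x\<close> back to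
  \<open>y\<close>.\<close>
have "EX g. ALL n. (g n:M & (n = 0 --> g n = x)) & f (g (Suc n)) = g n"
proof (rule dependent_nat_choice)
 show "EX a. a:M & (0 = (0::nat) --> a = x)" using x(1) M_def by blast
 fix a and n::nat assume "a:M & (n = 0 --> a = x)"
 then obtain b where "b:M" "f b = a" using fM by (metis imageE)
 thus "EX b. (b:M & (Suc n = 0 --> b = x)) & f b = a" by auto
qed
then obtain g where g: "!!n. g n:M" "g 0 = x" "!!n. f (g (Suc n)) = g n" by metis
have gx: "fn n (g n) = x" for n
proof (induction n)
 case (Suc n)
 thus ?case using g(3)[of n] by (simp add: funpow_swap1)
qed (use g in simp)
have xu: "x:{0..1}" using x(1) Mu M_def by blast
have np: "fn n x~=x" if "n>=1" for n using x(2) xu that unfolding Per_def by blast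
have "inj g" by (rule chain_inj) (use g np in auto)
hence "infinite (range g)" by (simp add: finite_image_iff)
hence "~ range g<=X" using X(1) finite_subset by blast
then obtain i where i: "g i~:X" by auto
hence "g i:M - X" using g(1) by blast
then obtain k' e' where k': "e'>0" "ger (g i) 1 e'<=fn k' ` J" using X(2)[of "g i" 1] by auto
have "g i:closure (ger (g i) 1 e')" using closure_ger[of 1 e' "g i"] k'(1) by (simp add: seg_def)
also have "...<=fn k' ` closure J" unfolding fpow_closure[OF Ju] by (rule closure_mono[OF k'(2)])
also have "closure J = seg y r e" unfolding J_def by (rule closure_ger[OF r e(1)])
finally have "EX z:seg y r e. fn k' z = g i" by (metis imageE)
then obtain z where z: "z:seg y r e" "fn k' z = g i" by blast
define jj where "jj = k + (i + k')"
have hz: "fn jj z = y" unfolding jj_def fpow_add z(2) gx x(3) ..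
have zx: "fn (i + k') z = x" unfolding fpow_add z(2) gx ..
have zy: "z~=y" using zx x(2) Per_orbit[OF y, of "i + k'"] by blast
define yy where "yy n = fn (jj * n) y" for n
have ySuc: "yy (Suc n) = fn jj (yy n)" for n unfolding yy_def by (simp flip: fpow_add)
note inj = gimg_inj[OF I fin, folded M_def]
\<comment> \<open>Any other position of \<open>q\<close>, or another side of the image germ, would
  produce by \<open>first_hit\<close> a second dense germ over the image germ at \<open>q\<close> or
  one over the germ at \<open>p\<close>; injectivity excludes the former, the assumption
  \<open>no\<close> the latter.\<close>
have step: "0<r * (p - q) & gimg jj p r q r & DG M q r"
 if p: "DG M p r" "0<r * (w - p)" "seg p r (r * (w - p))<=M" "fn jj w = p" "fn jj p = q"
  and no: "!!u. u:seg p r (r * (w - p)) ==> u~=p ==> DG M u (-r) ==> gimg jj u (-r) p r ==> False" for p q w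
proof -
 obtain c t where ct: "DG M c t" "gimg jj p r c t" using conjunct2[OF inj[of p r jj]] p(1) by blast
 have c: "c = q" using ct(2) p(5) unfolding gimg_def by simp
 note t = DG_side[OF ct(1)]
 define L where "L = r * (w - p)"
 have hit: "EX u. u:seg p r L & u~=p & DG M u (-r) & gimg jj u (-r) b t'"
  if b: "DG M b t'" "p':seg p r L" "p'~=w" "0<t' * (fn jj p' - b)" "t' * (p - b)<=0" for b t' p'
 proof -
  have pos: "0<r * (w - p')" "r * (w - p')<=L" using b(2,3) r unfolding seg_def L_def side_def by auto
  have sub: "seg p' r (r * (w - p'))<=seg p r L" using b(2) r unfolding seg_def L_def side_def by auto
  obtain u where u: "u:seg p' r (r * (w - p'))" "u~=p'" "DG M u (-r)" "gimg jj u (-r) b t'"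
   using first_hit[OF I _ r pos(1), folded M_def, of b t' jj] b(1,4,5) sub p(3,4) unfolding L_def by auto
  have "u~=p" using u(1,2) b(2) r unfolding seg_def side_def by auto
  thus ?thesis using u sub by blast
 qed
 have opp: "~ (DG M u (-r) & gimg jj u (-r) q t)" for u using inj[of u "-r" p r q t] ct p(1) c r unfolding side_def by auto
 have near: "EX p'. p':seg p r L & p'~=w & fn jj p':ger q t ee" if ee: "ee>0" for ee
 proof -
  have Lp: "L>0" using p(2) L_def by simp
  obtain a where a: "a>0" "ger q t a<=fn jj ` ger p r L" using gimgD[OF ct(2) Lp] c by blast
  have "q + t * (min a ee / 2):ger q t a" "q + t * (min a ee / 2):ger q t ee" using a(1) ee by (intro ger_points[OF t]; simp)+
  then obtain p' where "p':ger p r L" "fn jj p':ger q t ee" using a(2) by (metis imageE subsetD)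
  thus ?thesis using ger_seg unfolding L_def by (intro exI[of _ p']) (auto simp: ger_def seg_def)
 qed
 have "~ 0<r * (q - p)"
 proof
  assume "0<r * (q - p)"
  moreover have "p:seg p r L" "p~=w" using p(2) unfolding seg_def L_def by auto
  ultimately show False using hit[OF p(1), of p] no p(5) unfolding L_def by auto
 qed
 moreover have "q~=p"
 proof
  assume qp: "q = p"
  obtain p' where p': "p':seg p r L" "p'~=w" "fn jj p':ger q t 1" using near[of 1] by auto
  hence pos: "0<t * (fn jj p' - q)" unfolding ger_def by simp
  obtain u where u: "u:seg p r L" "u~=p" "DG M u (-r)" "gimg jj u (-r) q t" using hit[OF _ p'(1,2) pos] ct(1) c qp by auto
  thus False using opp by blast
 qed
 ultimately have qlt: "0<r * (p - q)" using r unfolding side_def by auto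
 have "t = r"
 proof (rule ccontr)
  assume "t~=r"
  hence tr: "t = -r" using t r unfolding side_def by auto
  obtain p' where p': "p':seg p r L" "p'~=w" "fn jj p':ger q t 1" using near[of 1] by auto
  hence pos: "0<t * (fn jj p' - q)" unfolding ger_def by simp
  obtain u where u: "u:seg p r L" "u~=p" "DG M u (-r)" "gimg jj u (-r) q t" using hit[OF _ p'(1,2) pos] ct(1) c qlt tr by auto
  thus False using opp by blast
 qed
 thus ?thesis using qlt ct c by simp
qed
have yy0: "yy 0 = y" unfolding yy_def by simp
\<comment> \<open>\<open>w\<close> is \<open>z\<close> at the start and later the preceding point of
  the orbit of \<open>y\<close>, which \<open>fn jj\<close> maps to the current one; so
  \<open>step\<close> applies again and again.\<close>
have "EX w. DG M (yy n) r & 0<r * (w - yy n) & seg (yy n) r (r * (w - yy n))<=M & fn jj w = yy n &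
  (ALL u. u:seg (yy n) r (r * (w - yy n)) & u~=yy n & DG M u (-r) --> ~ gimg jj u (-r) (yy n) r)" for n
proof (induction n)
 case 0
 have L: "r * (z - y)<=e" "0<r * (z - y)" using z(1) zy r unfolding seg_def side_def by auto
 have sub: "seg y r (r * (z - y))<=seg y r e" by (rule seg_mono[OF L(1)])
 have "~ gimg jj u (-r) y r" if "u:seg y r (r * (z - y))" "u~=y" "DG M u (-r)" for u
  using eB[of u] that sub DG_in_B[OF that(3)] cyc_closed[OF I] fM M_def by auto
 thus ?case unfolding yy0 using d L(2) sub e(2) hz M_def by (intro exI[of _ z]) auto
next
 case (Suc n)
 then obtain w where w: "DG M (yy n) r" "0<r * (w - yy n)" "seg (yy n) r (r * (w - yy n))<=M" "fn jj w = yy n"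
  "!!u. u:seg (yy n) r (r * (w - yy n)) ==> u~=yy n ==> DG M u (-r) ==> ~ gimg jj u (-r) (yy n) r" by blast
 have st: "0<r * (yy n - yy (Suc n))" "gimg jj (yy n) r (yy (Suc n)) r" "DG M (yy (Suc n)) r" using step[OF w(1-4) ySuc[symmetric]] w(5) by blast+
 have "seg (yy (Suc n)) r (r * (yy n - yy (Suc n)))<=M"
 proof -
  define S where "S = seg (yy n) r (r * (w - yy n))"
  have conn: "connected (fn jj ` S)" unfolding S_def by (rule fpow_conn[OF seg_connected[OF r]]) (use w(3) Mu in blast)
  have "yy n:S" "w:S" unfolding S_def seg_def using w(2) by auto
  hence ends: "yy (Suc n):fn jj ` S" "yy n:fn jj ` S" using w(4) ySuc by (metis imageI)+
  have "seg (yy (Suc n)) r (r * (yy n - yy (Suc n)))<=fn jj ` S"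
  proof
   fix a assume a: "a:seg (yy (Suc n)) r (r * (yy n - yy (Suc n)))"
   consider "yy (Suc n)<=a & a<=yy n" | "yy n<=a & a<=yy (Suc n)" using r a unfolding side_def seg_def by fastforce
   thus "a:fn jj ` S" using connected_contains_Icc[OF conn] ends by cases (meson atLeastAtMost_iff subsetD)+
  qed
  also have "...<=fn jj ` M" using w(3) unfolding S_def by blast
  also have "... = M" using inv_fpow_eq[OF fM] .
  finally show ?thesis .
 qed
 moreover have "~ gimg jj u (-r) (yy (Suc n)) r" if "DG M u (-r)" for u
  using inj[of u "-r" "yy n" r "yy (Suc n)" r jj] that st w(1) r unfolding side_def by auto
 ultimately show ?case using st ySuc by (intro exI[of _ "yy n"]) auto
qed
hence dec: "0<r * (yy n - yy (Suc n))" for n using step[OF _ _ _ _ ySuc[symmetric]] by metis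
have "0<r * (yy 0 - yy (Suc n))" for n
proof (induction n)
 case (Suc n)
 thus ?case using dec[of "Suc n"] by (simp add: right_diff_distrib)
qed (rule dec)
moreover obtain N where N: "N>=1" "fn N y = y" using y unfolding Per_def by blast
moreover have "yy N = y" unfolding yy_def using mult_fix[OF N(2)] by simp
ultimately show False using yy0 by (metis One_nat_def Suc_le_D diff_self mult_zero_right less_irrefl)
qed

section \<open>Nonwandering points\<close>

text \<open>By continuity, each of the finitely many positive iterates before time \<open>N\<close>
  moves a whole neighborhood of the nonperiodic point \<open>x\<close> away from
  \<open>x\<close>.\<close>

lemma nonwandering_late: assumes x: "x:nonwandering f" "x~:Per f" and e: "e>0" shows "EX n>=N. EX y:{0..1}. abs (y - x)<e & abs (fn n y - x)<e"
proof -
have xu: "x:{0..1}" using x unfolding nonwandering_def by blast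
have "EX d>0. ALL i<N. i>=1 --> (ALL y:{0..1}. abs (y - x)<d --> abs (fn i y - x)>=d)" for N
proof (induction N)
 case 0
 thus ?case by (intro exI[of _ 1]) auto
next
 case (Suc N)
 then obtain d where d: "d>0" "!!i y. i<N ==> i>=1 ==> y:{0..1} ==> abs (y - x)<d ==> abs (fn i y - x)>=d" by blast
 show ?case
 proof (cases "N>=1")
  case True
  have ne: "fn N x~=x" using x(2) xu True unfolding Per_def by blast
  define r where "r = abs (fn N x - x) / 2"
  have r: "r>0" using ne r_def by simp
  obtain d' where d': "d'>0" "!!y. y:{0..1} ==> dist y x<d' ==> dist (fn N y) (fn N x)<r"
   using fpow_cont[of N] xu r unfolding continuous_on_iff by meson
  define m where "m = min d (min d' r)"
  have "abs (fn i y - x)>=m" if i: "i<Suc N" "i>=1" "y:{0..1}" "abs (y - x)<m" for i y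
  proof (cases "i = N")
   case True
   have "abs (fn N y - fn N x)<r" using d'(2)[OF i(3)] i(4) unfolding m_def by (simp add: dist_real_def)
   hence "abs (fn N y - x)>=r" unfolding r_def by (auto simp: abs_if split: if_splits)
   thus ?thesis using True unfolding m_def by auto
  next
   case False
   thus ?thesis using d(2)[of i y] i unfolding m_def by auto
  qed
  moreover have "m>0" unfolding m_def using d d' r by simp
  ultimately show ?thesis by blast
 next
  case False
  thus ?thesis using d(1) by (intro exI[of _ d]) auto
 qed
qed
from this[of N] obtain d where d: "d>0" "!!i y. i<N ==> i>=1 ==> y:{0..1} ==> abs (y - x)<d ==> abs (fn i y - x)>=d" by blast
define U where "U = ball x (min d e) Int {0..1}"
have "openin (top_of_set {0..1}) U" unfolding U_def by (auto simp: openin_open)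
moreover have "x:U" unfolding U_def using xu d(1) e by simp
ultimately obtain n where n: "n>=1" "fn n ` U Int U~={}" using x(1) unfolding nonwandering_def by blast
then obtain y where y: "y:U" "fn n y:U" by blast
have b: "y:{0..1}" "abs (y - x)<min d e" "abs (fn n y - x)<min d e" using y unfolding U_def by (auto simp: dist_real_def abs_minus_commute)
have "n>=N"
proof (rule ccontr)
 assume "~ n>=N"
 thus False using d(2)[of n y] n b by auto
qed
moreover have "abs (y - x)<e" "abs (fn n y - x)<e" using b by auto
ultimately show ?thesis using b(1) by blast
qed

lemma in_core_of_limits: assumes U: "U<={0..1}" and l: "!!k. x:closure (fn k ` Orb U)" shows "x:core U"
unfolding core_def fpow_closure[OF orb_unit[OF U]] using l by blast

lemma piece_germ: assumes I: "pint I m" and inf: "infinite (Orb I)" and x: "x:Orb I" shows "EX t e. side t & e>0 & ger x t e<=Orb I"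
proof -
obtain J where J: "pint J m" "Orb J = Orb I" "x:J" using pint_at[OF I x] by metis
have "infinite (Orb J)" using J(2) inf by simp
then obtain a b where ab: "a<b" "fn 0 ` J = {a..b}" using pint_nondegenerate[OF J(1)] by metis
have JM: "{a..b}<=Orb I" using ab J(2) sub_orb[of J] by simp
have xab: "a<=x" "x<=b" using J(3) ab(2) by auto
show ?thesis
proof (cases "x<b")
 case True
 have "ger x 1 (b - x)<={a..b}" using xab unfolding ger_1 by auto
 thus ?thesis using JM True by (intro exI[of _ 1] exI[of _ "b - x"]) auto
next
 case False
 have "ger x (-1) (b - a)<={a..b}" using xab False unfolding ger_m1 by auto
 thus ?thesis using JM ab(1) by (intro exI[of _ "-1"] exI[of _ "b - a"]) auto
qed
qed

definition in_solenoid::"real => bool" where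
"in_solenoid x <-> (EX Q. solen Q & x:Q)"

definition in_basic::"real => bool" where
"in_basic x <-> (EX I m. pint I m & infinite (Bs I) & x:Bs I)"

text \<open>The cores of the shrinking germs are cycles through \<open>x\<close>. If they do not
  shrink to a solenoidal set, they shrink to a cycle \<open>M\<close>, and \<open>opp\<close> forces
  \<open>M\<close> to extend to side \<open>s\<close> of \<open>x\<close>. So the germ is dense in
  \<open>M\<close>, and as \<open>x\<close> is not periodic, \<open>B_set M f\<close> is
  infinite.\<close>

lemma good_germ: assumes x: "x:{0..1}" "x~:Per f" and s: "side s" and e0: "e0>0" "ger x s e0<={0..1}"
 and ret: "!!e. 0<e ==> e<=e0 ==> (EX n>=1. fn n ` ger x s e Int ger x s e~={}) & x:core (ger x s e)"
 and opp: "!!e. e>0 ==> ~ ger x (-s) e<=Cl (ger x s e0)" shows "in_solenoid x | in_basic x"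
proof -
define E where "E n = e0 / real (Suc n)" for n
have E: "0<E n" "E n<=e0" "E (Suc n)<=E n" for n unfolding E_def using e0(1) by (auto simp: field_simps)
have gu: "ger x s (E n)<={0..1}" for n using e0(2) ger_mono[OF E(2), of x s] by blast
have "EX I m. pint I m & Orb I = core (ger x s (E n))" for n using ret[OF E(1,2), of n] core_cycle[OF ger_connected[OF s] gu] by blast
then obtain I m where I: "!!n. pint (I n) (m n)" "!!n. Orb (I n) = core (ger x s (E n))" by metis
have dec: "core (ger x s (E (Suc n)))<=core (ger x s (E n))" for n by (rule core_mono'[OF ger_mono[OF E(3)] gu])
have xc: "x:core (ger x s (E n))" for n using ret[OF E(1,2)] by blast
have "solen (QQ I) | (EX K p. pint K p & Orb K = QQ I)" by (rule decreasing_cycles[OF I(1)]) (use dec xc I(2) in auto)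
thus ?thesis
proof
 assume "solen (QQ I)"
 thus ?thesis using xc I(2) unfolding in_solenoid_def by (intro disjI1 exI[of _ "QQ I"]) auto
next
 assume "EX K p. pint K p & Orb K = QQ I"
 then obtain K p where K: "pint K p" "Orb K = QQ I" by blast
 define M where "M = Orb K"
 have MC: "M<=core (ger x s (E n))" for n unfolding M_def K(2) using I(2) by blast
 have xM: "x:M" unfolding M_def K(2) using I(2) xc by simp
 have inf: "infinite M"
 proof
  assume "finite M"
  hence "M<=Per f" using finite_inv_Per[of M] pint_f_orb[OF K(1)] cyc_unit[OF K(1)] M_def by simp
  thus False using xM x(2) by blast
 qed
 obtain t e1 where t: "side t" "e1>0" "ger x t e1<=M" using piece_germ[OF K(1)] inf xM M_def by blast
 have "t = s"
 proof (rule ccontr)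
  assume "t~=s"
  hence ts: "t = -s" using t(1) s unfolding side_def by auto
  have "M<=Cl (ger x s (E 0))" using MC[of 0] core_subset by (rule subset_trans)
  moreover have "E 0 = e0" unfolding E_def by simp
  ultimately show False using opp[OF t(2)] t(3) ts by auto
 qed
 hence sM: "ger x s e1<=M" using t(3) by simp
 have d: "DG M x s"
 proof (rule DG_I[OF s t(2) sM])
  fix e assume e: "0<e" "e<=e1"
  obtain n where "e0 / e<real (Suc n)" using reals_Archimedean2[of "e0 / e"] by (metis less_trans lessI of_nat_less_iff)
  hence "E n<=e" unfolding E_def using e(1) by (simp add: field_simps)
  hence "Cl (ger x s (E n))<=Cl (ger x s e)" by (intro closure_mono orb_mono ger_mono)
  thus "M<=Cl (ger x s e)" using MC[of n] core_subset by (meson subset_trans)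
 qed
 have "infinite (B_set M f)" unfolding M_def by (rule DG_nonper_inf[OF K(1) _ x(2)]) (use d M_def in simp)
 moreover have "x:B_set M f" using DG_in_B[OF d] cyc_closed[OF K(1)] f_orb M_def by blast
 ultimately show ?thesis unfolding in_basic_def M_def using K(1) by blast
qed
qed

text \<open>The trapped or repelling side of a periodic point \<open>z\<close> outside of the cycle of intervals.\<close>

lemma trapped_contradiction: assumes I: "pint I m" and inf: "infinite (Orb I)"
 and z: "fn r z = z" "r>=1" and t: "side t" and u: "seg z t e0<={0..1}" "e0>0"
 and trap: "!!d. d>0 ==> EX c>0. c<=d & c<=e0 & fn r ` seg z t c<=seg z t c & Orb I<=Cl (seg z t c)" shows False
proof -
have fin: "finite (Orb {z})" by (rule finite_orb[OF z])
hence "~ Orb I<=Orb {z}" using inf finite_subset by blast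
then obtain y where y: "y:Orb I" "y~:Orb {z}" by blast
have "closed (Orb {z})" using fin finite_imp_closed by blast
then obtain rho where rho: "rho>0" "ball y rho <= - Orb {z}" using y(2) by (metis ComplI open_Compl open_contains_ball)
have "EX d>0. d<=e0 & (ALL i<k. ALL w. 0<=w & w<=d --> abs (fn i (z + t * w) - fn i z)<rho / 2)" for k
proof (induction k)
 case 0
 thus ?case using u(2) by (intro exI[of _ e0]) auto
next
 case (Suc k)
 then obtain d where d: "d>0" "d<=e0" "!!i w. i<k ==> 0<=w ==> w<=d ==> abs (fn i (z + t * w) - fn i z)<rho / 2" by blast
 have "rho / 2>0" using rho by simp
 then obtain d' where d': "d'>0" "d'<=e0" "!!w. 0<=w ==> w<=d' ==> abs (fn k (z + t * w) - fn k z)<rho / 2"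
  using germ_continuity[OF t u, of _ k] by meson
 show ?case using d d' by (intro exI[of _ "min d d'"]) (auto simp: less_Suc_eq)
qed
from this[of r] obtain d where d: "d>0" "d<=e0" "!!i w. i<r ==> 0<=w ==> w<=d ==> abs (fn i (z + t * w) - fn i z)<rho / 2" by blast
obtain c where c: "c>0" "c<=d" "fn r ` seg z t c<=seg z t c" "Orb I<=Cl (seg z t c)" using trap[OF d(1)] by blast
have ret: "fn (k * r) ` seg z t c<=seg z t c" for k
proof (induction k)
 case (Suc k)
 have "fn (Suc k * r) ` seg z t c = fn r ` fn (k * r) ` seg z t c" by (simp add: img_add)
 also have "...<=fn r ` seg z t c" using Suc by (rule image_mono)
 finally show ?case using c(3) by blast
qed simp
have far: "rho / 2<=dist w y" if w: "w:Orb (seg z t c)" for w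
proof -
 obtain k v where k: "v:seg z t c" "w = fn k v" using w unfolding in_orb_iff by blast
 define v' where "v' = fn (k div r * r) v"
 have "v':seg z t c" using ret[of "k div r"] k(1) unfolding v'_def by blast
 then obtain a where a: "0<=a" "a<=c" "v' = z + t * a" using seg_coord[OF t] by blast
 have "w = fn (k mod r + k div r * r) v" using k(2) by simp
 hence w': "w = fn (k mod r) v'" unfolding fpow_add v'_def .
 have "k mod r<r" using z(2) by simp
 hence "abs (w - fn (k mod r) z)<rho / 2" using d(3)[of "k mod r" a] a c(2) w' by simp
 moreover have "fn (k mod r) z~:ball y rho" using rho(2) fpow_sub_orb[of "k mod r" "{z}"] by auto
 ultimately show ?thesis unfolding mem_ball dist_real_def by linarith
qed
have "y:Cl (seg z t c)" using y(1) c(4) by blast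
then obtain w where "w:Orb (seg z t c)" "dist w y<rho / 2" using rho(1) by (metis closure_approachable half_gt_zero)
thus False using far by fastforce
qed

text \<open>As \<open>fn r\<close> pushes the points of the germ away from \<open>z\<close>, each of
  them has a backward orbit under \<open>fn r\<close> in the germ that tends to \<open>z\<close>. So
  the germ is covered by its own image and by the iterates of any shorter germ.\<close>

lemma repelling_in_core: assumes z: "fn r z = z" "r>=1" and g: "GM r z t t e0" and rep: "!!a. 0<a ==> a<=e0 ==> a<t * (fn r (z + t * a) - z)"
 and U: "U<={0..1}" and q: "q>0" "ger z t q<=Cl U" shows "ger z t e0<=core U"
proof -
have t: "side t" and u: "seg z t e0<={0..1}" and e0: "e0>0" using g unfolding GM_def by auto
define G where "G = ger z t e0"
define F where "F a = t * (fn r (z + t * a) - z)" for a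
have contF: "continuous_on {0..e0} F" unfolding F_def
proof (intro continuous_intros)
 show "continuous_on {0..e0} (%y. fn r (z + t * y))"
 proof (rule continuous_on_compose2[OF fpow_cont'[OF u, of r]])
  show "(%y. z + t * y) ` {0..e0}<=seg z t e0" using seg_points[OF t] by auto
 qed (intro continuous_intros)
qed
have F0: "F 0 = 0" unfolding F_def using z(1) by simp
have FI: "fn r (z + t * a) = z + t * F a" for a using t unfolding F_def side_def by auto
have pull: "EX b. 0<b & b<a & F b = a" if a: "0<a" "a<=e0" for a
proof -
 have "continuous_on {0..a} (%b. F b - a)" by (intro continuous_intros continuous_on_subset[OF contF]) (use a in auto)
 moreover have "F a>a" using rep[OF a] F_def by simp
 ultimately obtain b where b: "b:{0..a}" "F b - a = 0" using connected_zero[OF connected_Icc[of 0 a], of "%b. F b - a" 0 a] F0 a by auto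
 hence "b~=0" "b~=a" using F0 a `F a > a` by auto
 thus ?thesis using b by (intro exI[of _ b]) auto
qed
have cover: "EX j. z + t * a:fn (j * r) ` ger z t q" if a: "0<a" "a<e0" for a
proof -
 have "EX b. ALL j. (0<b j & b j<e0 & (j = 0 --> b j = a)) & b (Suc j)<b j & F (b (Suc j)) = b j"
 proof (rule dependent_nat_choice)
  show "EX b. 0<b & b<e0 & (0 = (0::nat) --> b = a)" using a by blast
  fix b and j::nat assume b: "0<b & b<e0 & (j = 0 --> b = a)"
  then obtain b' where "0<b'" "b'<b" "F b' = b" using pull[of b] by auto
  thus "EX b'. (0<b' & b'<e0 & (Suc j = 0 --> b' = a)) & b'<b & F b' = b" using b by auto
 qed
 then obtain b where b: "!!j. 0<b j" "!!j. b j<e0" "b 0 = a" "!!j. b (Suc j)<b j" "!!j. F (b (Suc j)) = b j" by metis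
 have "decseq b" using b(4) by (simp add: decseq_Suc_iff less_imp_le)
 moreover have "ALL i. 0<=b i" using b(1) less_imp_le by blast
 ultimately obtain l where l: "b \<longlonglongrightarrow> l" "ALL i. l<=b i" using decseq_convergent by metis
 have l0: "0<=l" using LIMSEQ_le_const[OF l(1)] b(1) less_imp_le by blast
 have le0: "l<=e0" using l(2) b(2) by (meson less_imp_le order_trans)
 have "(%j. b (Suc j)) \<longlonglongrightarrow> l" using l(1) LIMSEQ_Suc by blast
 hence "(%j. F (b (Suc j))) \<longlonglongrightarrow> F l"
  using continuous_on_tendsto_compose[OF contF, of "%j. b (Suc j)" l sequentially] l0 le0 b(1,2) by (auto simp: less_imp_le)
 hence "F l = l" using b(5) l(1) LIMSEQ_unique by simp
 hence "l = 0" using rep[of l] l0 le0 unfolding F_def by (cases "l = 0") auto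
 then obtain j where j: "b j<q" using l(1) q(1) by (metis (no_types, lifting) eventually_sequentially order_refl order_tendstoD(2))
 have "fn (j * r) (z + t * b j) = z + t * a" for j
 proof (induction j)
  case (Suc j)
  have "fn (Suc j * r) (z + t * b (Suc j)) = fn (j * r) (fn r (z + t * b (Suc j)))" by (simp flip: fpow_add add: add.commute)
  thus ?case using Suc FI b(5) by simp
 qed (use b(3) in simp)
 moreover have "z + t * b j:ger z t q" by (rule ger_points[OF t b(1) j])
 ultimately show ?thesis by (metis imageI)
qed
define A where "A = Orb G"
have Gq: "G<=Cl U"
proof
 fix y assume "y:G"
 then obtain a where a: "0<a" "a<e0" "y = z + t * a" using ger_coord[OF t] unfolding G_def by blast
 obtain j where "y:fn (j * r) ` ger z t q" using cover[OF a(1,2)] a(3) by blast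
 moreover have "fn (j * r) ` ger z t q<=Cl U" using inv_fpow[OF f_cl_orb_sub[OF U]] q(2) by (meson image_mono subset_trans)
 ultimately show "y:Cl U" by blast
qed
have "A<=Cl U" unfolding A_def by (rule orb_least[OF Gq f_cl_orb_sub[OF U]])
moreover have "A<=f ` A"
proof
 have Gr: "G<=fn r ` G"
 proof
  fix y assume "y:G"
  then obtain a where a: "0<a" "a<e0" "y = z + t * a" using ger_coord[OF t] unfolding G_def by blast
  obtain b where b: "0<b" "b<a" "F b = a" using pull[of a] a by auto
  have "z + t * b:G" unfolding G_def by (rule ger_points[OF t b(1)]) (use b a in simp)
  moreover have "fn r (z + t * b) = y" using FI b(3) a(3) by simp
  ultimately show "y:fn r ` G" by (metis imageI)
 qed
 fix y assume "y:A"
 then obtain k where "y:fn k ` G" unfolding A_def orb_def by blast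
 hence "y:fn k ` fn r ` G" using Gr by (meson image_mono subsetD)
 hence "y:f ` fn (k + r - 1) ` G" unfolding img_add fpow_Suc_image using z(2) by simp
 thus "y:f ` A" unfolding A_def orb_def by blast
qed
ultimately have "A<=core U" by (rule core_greatest)
thus ?thesis using sub_orb unfolding A_def G_def by blast
qed

text \<open>The end points that come from \<open>A_set\<close>. Beyond membership it records that
  the outer side \<open>-s\<close> of \<open>x\<close> enters the cycle after \<open>k\<close>
  steps, from which \<open>closure_Per_cases\<close> infers that periodic points do not accumulate
  at \<open>x\<close> from outside.\<close>

definition omega_exceptional::"real => bool" where
"omega_exceptional x <-> (EX I m s k e. pint I m & infinite (Bs I) &
  x:A_set f I (Bs I) & side s & e>0 & ger x s e<=Orb I &
  (ALL e'>0. ~ ger x (-s) e'<=Orb I) & fn k ` (ger x (-s) e Int {0..1})<=Orb I)"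

text \<open>The outer side of an end point \<open>x\<close> of a cycle of intervals whose orbit is dense in the cycle must
 enter the cycle.\<close>

lemma outer_germ_enters: assumes I: "pint I m" and inf: "infinite (Orb I)" and x: "x:Orb I" and t: "side t" and e0: "e0>0" "seg x t e0<={0..1}"
 and dense: "!!e k. 0<e ==> Orb I<=Cl (fn k ` (ger x t e Int {0..1}))"
 and core: "!!e A. 0<e ==> e<=e0 ==> (!!e'. 0<e' ==> e'<=e ==> A<=core (ball x e' Int {0..1})) ==> A<=Orb I"
shows "EX k e. e>0 & fn k ` ger x t e<=Orb I"
proof (rule ccontr)
assume no: "~ ?thesis"
define M where "M = Orb I"
have never: "~ fn k ` ger x t e<=M" if "e>0" for k e using no that M_def by blast
note Mu = cyc_unit[OF I, folded M_def]
have fM: "fn k ` M = M" for k unfolding M_def by (rule pint_fpow_orb[OF I])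
note cl = cyc_closed[OF I, folded M_def]
note bdfin = pint_bdry[OF I, folded M_def]
have orbM: "fn k x:M" for k using fM x M_def by blast
have GMx: "EX e>0. e<=e0 & (EX t'. GM k x t t' e)" for k by (rule GM_exists[OF t e0(2,1)])
have notin: "~ ger (fn k x) t' d<=M" if g: "GM k x t t' e" and d: "d>0" for k t' e d
proof
 assume s: "ger (fn k x) t' d<=M"
 obtain d' where d': "d'>0" "fn k ` seg x t d'<=insert (fn k x) (ger (fn k x) t' d)" using GM_image[OF g d] by blast
 have "fn k ` ger x t d'<=fn k ` seg x t d'" by (intro image_mono ger_seg)
 also have "...<=M" using d'(2) s orbM[of k] by (meson insert_subset subset_trans)
 finally have "fn k ` ger x t d'<=M" .
 thus False using never[OF d'(1)] by blast
qed
\<comment> \<open>An iterate of \<open>x\<close> in the interior would carry an outer germ of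
  \<open>x\<close> into \<open>M\<close>. So the orbit of \<open>x\<close> stays in the finite
  boundary and runs into a periodic point \<open>z\<close>.\<close>
have bd: "fn k x~:interior M" for k
proof
 assume i: "fn k x:interior M"
 obtain d where d: "d>0" "ball (fn k x) d<=M" using i mem_interior by blast
 obtain e t' where g: "GM k x t t' e" using GMx by blast
 hence "side t'" unfolding GM_def by blast
 hence "ger (fn k x) t' d<=M" using d(2) ger_ball by blast
 thus False using notin[OF g d(1)] by blast
qed
have "Orb {x}<=M - interior M" using orbM bd unfolding orb_def by auto
hence "finite (Orb {x})" using bdfin finite_subset by blast
then obtain a where a: "fn a x:Per f" using finite_orbit_eventually_periodic x Mu M_def by blast
define z where "z = fn a x"
obtain r where r: "r>=1" "fn r z = z" using a unfolding z_def Per_def by blast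
have zM: "z:M" unfolding z_def by (rule orbM)
obtain ea ta where ga: "ea>0" "ea<=e0" "GM a x t ta ea" using GMx by blast
have ta: "side ta" using ga(3) unfolding GM_def by blast
have out: "~ ger z ta d<=M" if "d>0" for d using notin[OF ga(3) that] unfolding z_def .
then obtain d0 where d0: "d0>0" "ger z ta d0 Int M = {}" using inner_or_outer[OF bdfin cl ta, of z] by blast
obtain tb where tb: "side tb" "EX e>0. ger z tb e<=M" using piece_germ[OF I inf, of z] zM M_def by blast
hence inner: "EX e>0. ger z (-ta) e<=M" using out ta unfolding side_def by auto
have nonconst: "EX q>0. ger z ta q<=fn a ` ger x t e" if e: "0<e" "e<=ea" for e
proof -
 obtain y where y: "y:ger x t e" "fn a y~:M" using never[OF e(1)] by blast
 hence "fn a y~=fn a x" using zM z_def by auto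
 thus ?thesis using GM_covers[OF ga(3) e, of y] y(1) ger_seg unfolding z_def by blast
qed
have segz: "EX e1>0. seg z ta e1<={0..1}"
proof -
 obtain q where q: "q>0" "ger z ta q<=fn a ` ger x t ea" using nonconst[OF ga(1)] by blast
 have "ger x t ea<={0..1}" using GM_seg[OF ga(3)] ger_seg by blast
 hence "ger z ta q<={0..1}" using q(2) fpow_unit by (meson subset_trans)
 hence "closure (ger z ta q)<={0..1}" by (rule closure_minimal) simp
 thus ?thesis using closure_ger[OF ta q(1)] q(1) by auto
qed
then obtain e1 where e1: "e1>0" "seg z ta e1<={0..1}" by blast
obtain eh th where gh: "eh>0" "eh<=e1" "GM r z ta th eh" using GM_exists[OF ta e1(2,1), of r] by blast
have th: "side th" using gh(3) unfolding GM_def by blast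
\<comment> \<open>\<open>ta\<close> is the side of \<open>z\<close> to which the outer germ of
  \<open>x\<close> is mapped, and it is outer as well. If \<open>fn r\<close> flipped it to the
  inner side, the outer germ of \<open>x\<close> would enter \<open>M\<close> after
  \<open>r + a\<close> steps.\<close>
have "th = ta"
proof (rule ccontr)
 assume "th~=ta"
 hence th': "th = -ta" using ta th unfolding side_def by auto
 obtain ei where ei: "ei>0" "ger z (-ta) ei<=M" using inner by blast
 obtain d where d: "d>0" "fn r ` seg z ta d<=insert z (ger z (-ta) ei)" using GM_image[OF gh(3) ei(1)] r(2) th' by auto
 obtain d' where d': "d'>0" "fn a ` seg x t d'<=insert z (ger z ta d)" using GM_image[OF ga(3) d(1)] unfolding z_def by blast
 have "insert z (ger z ta d)<=seg z ta d" using d(1) ger_seg[of z ta d] unfolding seg_def by auto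
 hence "fn r ` fn a ` seg x t d'<=insert z (ger z (-ta) ei)" using d'(2) d(2) by blast
 hence "fn (r + a) ` ger x t d'<=M" unfolding img_add using ger_seg[of x t d'] ei(2) zM by blast
 thus False using never[OF d'(1)] by blast
qed
hence gh': "GM r z ta ta eh" using gh(3) by simp
define F where "F w = ta * (fn r (z + ta * w) - z)" for w
show False
\<comment> \<open>Either \<open>fn r\<close> repels the outer side of \<open>z\<close>, which then
  lies in all the cores and hence in \<open>M\<close>; or it maps arbitrarily short closed germs
  into themselves, and this traps an orbit that should be dense in \<open>M\<close>.\<close>
proof (cases "EX d>0. d<=eh & (ALL w. 0<w & w<=d --> w<F w)")
 case True
 then obtain d where d: "d>0" "d<=eh" "!!w. 0<w ==> w<=d ==> w<F w" by blast
 have gd: "GM r z ta ta d" by (rule GM_less[OF gh' d(1,2)])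
 have "ger z ta d<=core (ball x e Int {0..1})" if e: "0<e" "e<=ea" for e
 proof -
  obtain q where q: "q>0" "ger z ta q<=fn a ` ger x t e" using nonconst[OF e] by blast
  have "ger x t e<=ball x e Int {0..1}" using ger_ball[OF t, of x e] ger_seg[of x t e] seg_mono[OF e(2), of x t] GM_seg[OF ga(3)] by blast
  hence "fn a ` ger x t e<=Orb (ball x e Int {0..1})" using fpow_sub_orb[of a "ball x e Int {0..1}"] by (meson image_mono subset_trans)
  hence q2: "ger z ta q<=Cl (ball x e Int {0..1})" using q(2) closure_subset by (meson subset_trans)
  show ?thesis by (rule repelling_in_core[OF r(2,1) gd _ _ q(1) q2]) (use d(3) in "auto simp: F_def")
 qed
 hence "ger z ta d<=M" unfolding M_def using core[of ea "ger z ta d"] ga by blast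
 thus False using out[OF d(1)] by blast
next
 case False
 have "EX c>0. c<=d & c<=eh & fn r ` seg z ta c<=seg z ta c & Orb I<=Cl (seg z ta c)"
  if d: "d>0" for d
 proof -
  have "min d eh>0" "min d eh<=eh" using d gh(1) by auto
  hence "~ (ALL w. 0<w & w<=min d eh --> w<F w)" using False by blast
  then obtain c where c: "0<c" "c<=min d eh" "F c<=c" by (meson not_le)
  have inv: "fn r ` seg z ta c<=seg z ta c"
  proof
   fix y assume "y:fn r ` seg z ta c"
   then obtain w where w: "w:seg z ta c" "y = fn r w" by blast
   then obtain b where b: "0<=b" "b<=c" "w = z + ta * b" using seg_coord[OF ta] by blast
   have "0<=F b" "F b<=F c" using GM_D[OF gh' b(1,2)] c(2) r(2) unfolding F_def by auto
   thus "y:seg z ta c" using c(3) unfolding seg_def w(2) b(3) F_def by auto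
  qed
  obtain d' where d': "d'>0" "d'<=ea" "fn a ` seg x t d'<=insert z (ger z ta c)" using GM_image[OF ga(3) c(1)] unfolding z_def by blast
  have "insert z (ger z ta c)<=seg z ta c" using c(1) ger_seg[of z ta c] unfolding seg_def by auto
  hence "fn a ` (ger x t d' Int {0..1})<=seg z ta c" using d'(3) ger_seg[of x t d'] by blast
  hence "Cl (fn a ` (ger x t d' Int {0..1}))<=Cl (seg z ta c)" by (intro closure_mono orb_mono)
  thus ?thesis using dense[OF d'(1), of a] inv c by (intro exI[of _ c]) auto
 qed
 thus False using trapped_contradiction[OF I inf r(2,1) ta GM_seg[OF gh'] gh(1)] by blast
qed
qed

lemma outer_enters_basic: assumes I: "pint I m" and x: "x:Orb I" and t: "side t" and e0: "e0>0" "seg x t e0<={0..1}"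
 and dense: "!!e k. 0<e ==> Orb I<=Cl (fn k ` (ger x t e Int {0..1}))" and ent: "e>0" "fn k ` ger x t e<=Orb I" shows "fn k x:Bs I"
proof (rule B_setI)
show "fn k x:Orb I" using pint_fpow_orb[OF I, of k] x by blast
show "closed (Orb I)" by (rule cyc_closed[OF I])
show "f ` Orb I<=Orb I" by (rule f_orb)
fix r::real assume r: "r>0"
obtain d where d: "d>0" "d<=e0" "!!y. 0<=y ==> y<=d ==> abs (fn k (x + t * y) - fn k x)<r" using germ_continuity[OF t e0(2,1) r, of k] by blast
define c where "c = min d e"
have c: "c>0" "c<=d" "c<=e" unfolding c_def using d(1) ent(1) by auto
have "fn k ` (ger x t c Int {0..1})<=Orb I Int ball (fn k x) r"
proof
 fix w assume "w:fn k ` (ger x t c Int {0..1})"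
 then obtain v where v: "v:ger x t c" "w = fn k v" by blast
 then obtain a where a: "0<a" "a<c" "v = x + t * a" using ger_coord[OF t] by blast
 have "abs (w - fn k x)<r" using d(3)[of a] a c(2) v(2) by simp
 moreover have "v:ger x t e" using v(1) ger_mono[OF c(3), of x t] by blast
 hence "w:Orb I" using ent(2) v(2) by blast
 ultimately show "w:Orb I Int ball (fn k x) r" by (simp add: dist_real_def abs_minus_commute)
qed
hence "Cl (fn k ` (ger x t c Int {0..1}))<=Cl (Orb I Int ball (fn k x) r)" by (intro closure_mono orb_mono)
thus "Orb I<=Cl (Orb I Int ball (fn k x) r)" using dense[OF c(1), of k] by (rule subset_trans[rotated])
qed

text \<open>If \<open>fn k\<close> is constant near \<open>x\<close> on the outer side, the orbit of
  \<open>y\<close> is dense in the cycle and consists of points of \<open>Bs I\<close>. Otherwise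
  the outer germ covers a dense germ at \<open>y\<close>; if \<open>y\<close> is periodic, the
  nonperiodic point \<open>x\<close> above it is homoclinic.\<close>

lemma outer_enters_infinite: assumes I: "pint I m" and inf: "infinite (Orb I)"
 and x: "x:Orb I" "x~:Per f" and t: "side t" and e0: "e0>0" "seg x t e0<={0..1}"
 and dense: "!!e k. 0<e ==> Orb I<=Cl (fn k ` (ger x t e Int {0..1}))" and ent: "e>0" "fn k ` ger x t e<=Orb I" shows "infinite (Bs I)"
proof -
define y where "y = fn k x"
define M where "M = Orb I"
have yB: "y:B_set M f" unfolding y_def M_def by (rule outer_enters_basic[OF I x(1) t e0 dense ent])
obtain e1 s where e1: "e1>0" "e1<=e0" "GM k x t s e1" using GM_exists[OF t e0(2,1)] by blast
have s: "side s" using e1(3) unfolding GM_def by blast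
define e2 where "e2 = min e e1"
have e2: "e2>0" "e2<=e" "e2<=e1" unfolding e2_def using ent(1) e1(1) by auto
show ?thesis
proof (cases "ALL d>0. EX v:ger x t d. fn k v~=y")
 case False
 then obtain d where d: "d>0" "!!v. v:ger x t d ==> fn k v = y" by blast
 have "fn k ` (ger x t d Int {0..1})<={y}" using d(2) by blast
 hence "Cl (fn k ` (ger x t d Int {0..1}))<=Cl {y}" by (intro closure_mono orb_mono)
 hence M: "M<=Cl {y}" using dense[OF d(1), of k] M_def by blast
 have "Orb {y}<=B_set M f" by (rule orb_least) (use yB B_set_invariant[OF I] M_def in auto)
 moreover have "infinite (Orb {y})"
 proof
  assume "finite (Orb {y})"
  hence "finite M" using M finite_subset by (metis closure_closed finite_imp_closed)
  thus False using inf M_def by simp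
 qed
 ultimately show ?thesis using finite_subset M_def by blast
next
 case True
 have cov: "EX q>0. ger y s q<=fn k ` ger x t d" if d: "0<d" "d<=e1" for d
 proof -
  obtain v where "v:ger x t d" "fn k v~=fn k x" using True d(1) y_def by blast
  thus ?thesis using GM_covers[OF e1(3) d, of v] ger_seg y_def by blast
 qed
 obtain q where q: "q>0" "ger y s q<=fn k ` ger x t e2" using cov[OF e2(1,3)] by blast
 have qM: "ger y s q<=M" using q(2) ent(2) ger_mono[OF e2(2), of x t] unfolding M_def by blast
 have d: "DG M y s"
 proof (rule DG_I[OF s q(1) qM])
  fix r assume r: "0<r" "r<=q"
  obtain d where d: "d>0" "d<=e1" "fn k ` seg x t d<=insert y (ger y s r)" using GM_image[OF e1(3) r(1)] unfolding y_def by blast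
  have "y:closure (ger y s r)" using closure_ger[OF s r(1), of y] r(1) unfolding seg_def by simp
  hence 1: "insert y (ger y s r)<=Cl (ger y s r)" using closure_mono[OF sub_orb[of "ger y s r"]] closure_subset[of "ger y s r"] by auto
  have u: "ger y s r<={0..1}" using qM ger_mono[OF r(2), of y s] cyc_unit[OF I] M_def by blast
  have "fn k ` (ger x t d Int {0..1})<=Cl (ger y s r)" using d(3) 1 ger_seg[of x t d] by blast
  hence "Cl (fn k ` (ger x t d Int {0..1}))<=Cl (ger y s r)" by (rule closure_orb_trans[OF u])
  thus "M<=Cl (ger y s r)" using dense[OF d(1), of k] M_def by blast
 qed
 show ?thesis
 proof (cases "y:Per f")
  case True
  thus ?thesis using homoclinic_infinite[OF I _ True x] d M_def y_def by blast
 next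
  case False
  thus ?thesis using DG_nonper_inf[OF I _ False] d M_def by blast
 qed
qed
qed

text \<open>The cores of the balls around \<open>x\<close> shrink to a solenoidal set or to a cycle
  \<open>M\<close>. If no germ at \<open>x\<close> is dense in \<open>M\<close>, then
  \<open>M\<close> is covered by the orbit closures of the two sides together. Either the side
  \<open>s\<close> returns without help of the other one (\<open>good\<close>), or the outer side
  alone has a dense orbit and makes \<open>x\<close> exceptional.\<close>

theorem nonwandering_cases: assumes x: "x:nonwandering f" "x~:Per f" shows "in_solenoid x | in_basic x | omega_exceptional x"
proof -
have xu: "x:{0..1}" using x unfolding nonwandering_def by blast
define U where "U e = ball x e Int {0..1}" for e
have Uu: "U e<={0..1}" for e unfolding U_def by blast
have Uc: "connected (U e)" for e unfolding U_def by (simp add: is_interval_Int is_interval_ball_real flip: is_interval_connected_1)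
have Umono: "U d<=U e" if "d<=e" for d e unfolding U_def using that by auto
have late: "EX n>=N. EX y:U e. fn n y:U e" if e: "e>0" for e N
proof -
 obtain n y where n: "n>=N" "y:{0..1}" "abs (y - x)<e" "abs (fn n y - x)<e" using nonwandering_late[OF x e] by blast
 thus ?thesis unfolding U_def using fpow_maps[OF n(2), of n] by (intro exI[of _ n] conjI bexI[of _ y]) (auto simp: dist_real_def)
qed
have Uret: "EX n>=1. fn n ` U e Int U e~={}" if "e>0" for e using late[OF that, of 1] by blast
have xcore: "x:core (U e)" if e: "e>0" for e
proof (rule in_core_of_limits[OF Uu])
 fix k
 show "x:closure (fn k ` Orb (U e))" unfolding closure_approachable
 proof (intro allI impI)
  fix d::real assume d: "d>0"
  define c where "c = min d e"
  have c: "c>0" "c<=d" "c<=e" unfolding c_def using d e by auto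
  obtain n y where n: "n>=k" "y:U c" "fn n y:U c" using late[OF c(1)] by blast
  have "fn n y = fn k (fn (n - k) y)" using n(1) by (simp flip: fpow_add)
  moreover have "fn (n - k) y:Orb (U e)" using Umono[OF c(3)] n(2) fpow_sub_orb[of "n - k" "U e"] by blast
  ultimately have "fn n y:fn k ` Orb (U e)" by blast
  moreover have "dist (fn n y) x<d" using n(3) c(2) unfolding U_def by (simp add: dist_commute)
  ultimately show "EX w:fn k ` Orb (U e). dist w x<d" by blast
 qed
qed
define E where "E n = 1 / real (Suc n)" for n
have E: "0<E n" "E (Suc n)<=E n" for n unfolding E_def by (auto simp: field_simps)
have "EX I m. pint I m & Orb I = core (U (E n))" for n using Uret[OF E(1), of n] core_cycle[OF Uc Uu] by blast
then obtain I0 m0 where I0: "!!n. pint (I0 n) (m0 n)" "!!n. Orb (I0 n) = core (U (E n))" by metis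
have "solen (QQ I0) | (EX K p. pint K p & Orb K = QQ I0)" by (rule decreasing_cycles[OF I0(1)])
   (use core_mono'[OF Umono[OF E(2)] Uu] xcore[OF E(1)] I0(2) in auto)
thus ?thesis
proof
 assume "solen (QQ I0)"
 thus ?thesis using xcore[OF E(1)] I0(2) unfolding in_solenoid_def by (intro disjI1 exI[of _ "QQ I0"]) auto
next
 assume "EX K p. pint K p & Orb K = QQ I0"
 then obtain I m where I: "pint I m" "Orb I = QQ I0" by blast
 define M where "M = Orb I"
 have fM: "fn k ` M = M" for k unfolding M_def by (rule pint_fpow_orb[OF I(1)])
 note fM1 = pint_f_orb[OF I(1), folded M_def]
 note cl = cyc_closed[OF I(1), folded M_def]
 note Mu = cyc_unit[OF I(1), folded M_def]
 have xM: "x:M" unfolding M_def I(2) using I0(2) xcore[OF E(1)] by simp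
 have Einv: "EX n. E n<=e" if "e>0" for e
 proof -
  obtain n where "1 / e<real (Suc n)" using reals_Archimedean2[of "1 / e"] by (metis less_trans lessI of_nat_less_iff)
  thus ?thesis unfolding E_def using that by (intro exI[of _ n]) (simp add: field_simps)
 qed
 have MU: "M<=core (U e)" if e: "e>0" for e
 proof -
  obtain n where "E n<=e" using Einv[OF e] by blast
  hence "core (U (E n))<=core (U e)" using core_mono'[OF Umono Uu] by blast
  thus ?thesis unfolding M_def I(2) using I0(2) by blast
 qed
 have UM: "A<=M" if A: "!!e'. 0<e' ==> e'<=e ==> A<=core (U e')" and e: "e>0" for A e
 proof -
  have "A<=core (U (E n))" for n
  proof -
   have "A<=core (U (min e (E n)))" using A[of "min e (E n)"] e E(1)[of n] by auto
   also have "...<=core (U (E n))" by (rule core_mono'[OF Umono Uu]) simp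
   finally show ?thesis .
  qed
  thus ?thesis unfolding M_def I(2) using I0(2) by blast
 qed
 have inf: "infinite M"
 proof
  assume "finite M"
  hence "M<=Per f" using finite_inv_Per[of M] fM1 Mu by simp
  thus False using xM x(2) by blast
 qed
 have inforb: "infinite (Orb I)" using inf M_def by simp
 obtain s e1 where s: "side s" "e1>0" "ger x s e1<=M" using piece_germ[OF I(1)] inf xM M_def by blast
 show ?thesis
 proof (cases "EX t. DG M x t")
  case True
  then obtain t where t: "DG M x t" by blast
  have "infinite (B_set M f)" using DG_nonper_inf[OF I(1) _ x(2)] t M_def by blast
  moreover have "x:B_set M f" using DG_in_B[OF t cl] fM1 by simp
  ultimately show ?thesis unfolding in_basic_def using I(1) M_def by blast
 next
  case False
  hence noDG: "~ DG M x t" for t by blast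
  define N where "N t e = Cl (ger x t e Int {0..1})" for t e
  have gu: "ger x t e Int {0..1}<={0..1}" for t e by blast
  have Ninv: "fn k ` N t e<=N t e" for t e k unfolding N_def by (rule inv_fpow[OF f_cl_orb_sub[OF gu]])
  have Nmono: "N t d<=N t e" if "d<=e" for t d e unfolding N_def using ger_mono[OF that, of x t] by (intro closure_mono orb_mono) blast
  have Nsub: "N t d<=N t' e" if "ger x t d<=N t' e" for t d t' e unfolding N_def by (rule closure_orb_trans[OF gu]) (use that N_def in blast)
  have Nin: "N t e = Cl (ger x t e)" if "ger x t e<=M" for t e
  proof -
   have "ger x t e Int {0..1} = ger x t e" using that Mu by blast
   thus ?thesis unfolding N_def by simp
  qed
  have NM: "N t e<=M" if "ger x t e<=M" for t e unfolding Nin[OF that] using cl_orb_least[OF that _ cl] fM1 by simp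
  have cover: "M<=fn k ` N s e Un fn k ` N (-s) e'" if e: "0<e" "0<e'" for e e' k
  proof -
   define d where "d = min (min e e') e1"
   have d: "d>0" "d<=e" "d<=e'" "d<=e1" unfolding d_def using e s(2) by auto
   have gd: "ger x s d<={0..1}" using s(3) ger_mono[OF d(4), of x s] Mu by blast
   have "x:closure (ger x s d)" using closure_ger[OF s(1) d(1), of x] d(1) unfolding seg_def by simp
   hence "x:N s d" unfolding N_def using closure_mono[OF sub_orb[of "ger x s d Int {0..1}"]] gd by (auto simp: inf.absorb1)
   moreover have "ger x t d Int {0..1}<=N t d" for t unfolding N_def using sub_orb closure_subset by (meson subset_trans)
   ultimately have "U d<=N s d Un N (-s) d" unfolding U_def ball_split'[OF s(1) d(1)] using xu by blast
   hence "Cl (U d)<=N s d Un N (-s) d"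
   proof (rule cl_orb_least)
    show "f ` (N s d Un N (-s) d)<=N s d Un N (-s) d" using Ninv[of 1 s d] Ninv[of 1 "-s" d] by auto
    show "closed (N s d Un N (-s) d)" unfolding N_def by (intro closed_Un closed_closure)
   qed
   also have "...<=N s e Un N (-s) e'" using Nmono[OF d(2), of s] Nmono[OF d(3), of "-s"] by blast
   finally have "Cl (U d)<=N s e Un N (-s) e'" .
   hence "fn k ` Cl (U d)<=fn k ` (N s e Un N (-s) e')" by (rule image_mono)
   moreover have "M<=fn k ` Cl (U d)" using MU[OF d(1)] unfolding core_def by blast
   ultimately show ?thesis by (auto simp: image_Un)
  qed
  \<comment> \<open>Points of the germ on side \<open>s\<close> that are not reached from the other
    side must be reached from side \<open>s\<close> itself. As they accumulate at \<open>x\<close>,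
    the germ returns and \<open>x\<close> lies in its core.\<close>
  have good: "in_solenoid x | in_basic x"
   if e2: "e2>0" "!!e'. e'>0 ==> ~ ger x s e'<=N (-s) e2" and ea: "ea>0" "ea<=e1" and opp: "!!e'. e'>0 ==> ~ ger x (-s) e'<=N s ea" for e2 ea
  proof (rule good_germ[OF xu x(2) s(1) ea(1)])
   have gM: "ger x s e<=M" if "e<=ea" for e using s(3) ger_mono[of e e1 x s] ea(2) that by (meson order_trans subset_trans)
   show "ger x s ea<={0..1}" using gM[of ea] Mu by blast
   show "~ ger x (-s) e<=Cl (ger x s ea)" if "e>0" for e using opp[OF that] Nin[OF gM[of ea]] by simp
   fix e assume e: "0<e" "e<=ea"
   have gMe: "ger x s e<=M" by (rule gM[OF e(2)])
   have geu: "ger x s e<={0..1}" using gMe Mu by blast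
   have sub: "ger x s e - N (-s) e2<=fn k ` N s e" for k using cover[OF e(1) e2(1), of k] Ninv[of k "-s" e2] gMe by blast
   have acc: "EX w. w:ger x s d & w:ger x s e - N (-s) e2" if d: "0<d" for d
   proof -
    have "~ ger x s (min d e)<=N (-s) e2" using e2(2) d e(1) by simp
    then obtain w where "w:ger x s (min d e)" "w~:N (-s) e2" by blast
    moreover have "ger x s (min d e)<=ger x s d" "ger x s (min d e)<=ger x s e" by (intro ger_mono; simp)+
    ultimately show ?thesis by blast
   qed
   have fk: "fn k ` N s e = closure (fn k ` Orb (ger x s e))" for k unfolding Nin[OF gMe] by (rule fpow_closure[OF orb_unit[OF geu]])
   have "x:core (ger x s e)"
   proof (rule in_core_of_limits[OF geu])
    fix k
    have "x:closure (closure (fn k ` Orb (ger x s e)))" unfolding closure_approachable[of x "closure _"]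
    proof (intro allI impI)
     fix d::real assume "d>0"
     then obtain w where w: "w:ger x s d" "w:ger x s e - N (-s) e2" using acc by blast
     hence "w:closure (fn k ` Orb (ger x s e))" using sub[of k] fk by blast
     moreover have "dist w x<d" using w(1) ger_ball[OF s(1), of x d] by (auto simp: dist_commute)
     ultimately show "EX y:closure (fn k ` Orb (ger x s e)). dist y x<d" by blast
    qed
    thus "x:closure (fn k ` Orb (ger x s e))" by simp
   qed
   moreover have "EX n>=1. fn n ` ger x s e Int ger x s e~={}"
   proof -
    define P where "P = ger x s e - N (-s) e2"
    have "open P" unfolding P_def N_def by (intro open_Diff ger_open[OF s(1)] closed_closure)
    moreover have "P~={}" using acc[of 1] unfolding P_def by auto
    moreover have "P<=closure (fn 1 ` Orb (ger x s e))" using sub[of 1] fk[of 1] unfolding P_def by simp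
    ultimately have "P Int fn 1 ` Orb (ger x s e)~={}" using open_Int_closure_eq_empty[of P] by (metis inf.absorb1)
    then obtain w where "w:P" "w:Orb (fn 1 ` ger x s e)" unfolding fpow_orb by blast
    then obtain k where "w:ger x s e" "w:fn k ` fn 1 ` ger x s e" unfolding P_def orb_def by blast
    thus ?thesis unfolding img_add by (intro exI[of _ "k + 1"]) auto
   qed
   ultimately show "(EX n>=1. fn n ` ger x s e Int ger x s e~={}) & x:core (ger x s e)" by blast
  qed
  have notdense: "EX e>0. e<=e0 & ~ M<=N t e" if t: "side t" "e0>0" "ger x t e0<=M" for t e0
  proof -
   obtain e where e: "e>0" "e<=e0" "~ M<=Cl (ger x t e)" using not_DG[OF noDG t] by blast
   have "ger x t e<=M" using t(3) ger_mono[OF e(2), of x t] by blast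
   hence "~ M<=N t e" using e(3) Nin[of t e] by simp
   thus ?thesis using e(1,2) by blast
  qed
  obtain es where es: "es>0" "es<=e1" "~ M<=N s es" using notdense[OF s] by blast
  have M2: "M<=N s e Un N (-s) e'" if "0<e" "0<e'" for e e' using cover[OF that, of 0] by simp
  have s': "side (-s)" using s by simp
  show ?thesis
  proof (cases "EX e>0. ger x (-s) e<=M")
   case True
   then obtain e3 where e3: "e3>0" "ger x (-s) e3<=M" by blast
   obtain e2 where e2: "e2>0" "e2<=e3" "~ M<=N (-s) e2" using notdense[OF s' e3] by blast
   have "~ ger x s e'<=N (-s) e2" if "e'>0" for e' using Nsub[of s e' "-s" e2] M2[OF that e2(1)] e2(3) by blast
   moreover have "~ ger x (-s) e'<=N s es" if "e'>0" for e' using Nsub[of "-s" e' s es] M2[OF es(1) that] es(3) by blast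
   ultimately show ?thesis using good[OF e2(1) _ es(1,2)] by blast
  next
   case out: False
   have opp: "~ ger x (-s) e'<=N s e1" if "e'>0" for e' using out that NM[OF s(3)] by blast
   show ?thesis
   proof (cases "EX e2>0. ALL e'>0. ~ ger x s e'<=N (-s) e2")
    case True
    thus ?thesis using good[OF _ _ s(2) _ opp] by blast
   next
    case False
    \<comment> \<open>A germ on side \<open>s\<close> inside the closed orbit of the outer side
      makes that closed orbit contain all of \<open>M\<close>.\<close>
    have MN: "M<=N (-s) e2" if e2: "e2>0" for e2
    proof -
     obtain e' where e': "e'>0" "ger x s e'<=N (-s) e2" using False e2 by blast
     show ?thesis using Nsub[OF e'(2)] M2[OF e'(1) e2] by blast
    qed
    have dense: "Orb I<=closure (Orb (fn k ` (ger x (-s) e Int {0..1})))" if e: "0<e" for e k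
    proof -
     have "fn k ` M<=fn k ` N (-s) e" by (intro image_mono MN[OF e])
     hence "M<=fn k ` Cl (ger x (-s) e Int {0..1})" unfolding fM N_def .
     thus ?thesis unfolding f_cl_orb[OF gu] M_def .
    qed
    have "EX e0>0. seg x (-s) e0<={0..1}"
    proof -
     have "ger x (-s) e Int {0..1}~={}" if "e>0" for e using MN[OF that] inf unfolding N_def orb_def by auto
     then obtain e0 where e0: "e0>0" "ger x (-s) e0<={0..1}" using connected_contains_ger[OF s' connected_Icc[of 0 "1::real"]] by (metis Int_commute)
     have "closure (ger x (-s) e0)<={0..1}" using e0(2) by (rule closure_minimal) simp
     thus ?thesis using e0(1) closure_ger[OF s' e0(1)] by auto
    qed
    then obtain e0 where e0: "e0>0" "seg x (-s) e0<={0..1}" by blast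
    have xI: "x:Orb I" using xM M_def by simp
    have coreI: "A<=Orb I" if "0<e" "e<=e0" "!!e'. 0<e' ==> e'<=e ==> A<=core (ball x e' Int {0..1})" for e A
     using UM[of e A] that unfolding U_def M_def by blast
    have "EX k e. e>0 & fn k ` ger x (-s) e<=Orb I"
    proof (rule outer_germ_enters[OF I(1) inforb xI s' e0])
     show "Orb I<=closure (Orb (fn k ` (ger x (-s) e Int {0..1})))" if "0<e" for e k using that by (rule dense)
     show "A<=Orb I" if "0<e" "e<=e0" "!!e'. 0<e' ==> e'<=e ==> A<=core (ball x e' Int {0..1})" for e A using that by (rule coreI)
    qed
    then obtain k e where ke: "e>0" "fn k ` ger x (-s) e<=Orb I" by blast
    have Binf: "infinite (Bs I)" by (rule outer_enters_infinite[OF I(1) inforb xI x(2) s' e0 dense ke])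
    have kB: "fn k x:Bs I" by (rule outer_enters_basic[OF I(1) xI s' e0 dense ke])
    have intB: "fn i x:Bs I" if i: "fn i x:interior (Orb I)" for i
    proof -
     obtain r where r: "r>0" "ball (fn i x) r<=Orb I" using i mem_interior by blast
     obtain d where d: "d>0" "!!y. 0<=y ==> y<=d ==> abs (fn i (x + (-s) * y) - fn i x)<r" using germ_continuity[OF s' e0(2,1) r(1), of i] by blast
     have "fn i ` ger x (-s) d<=Orb I"
     proof
      fix w assume "w:fn i ` ger x (-s) d"
      then obtain v where v: "v:ger x (-s) d" "w = fn i v" by blast
      then obtain a where a: "0<a" "a<d" "v = x + (-s) * a" using ger_coord[OF s'] by blast
      have "abs (w - fn i x)<r" using d(2)[of a] a v(2) by simp
      thus "w:Orb I" using r(2) by (auto simp: dist_real_def abs_minus_commute)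
     qed
     from outer_enters_basic[OF I(1) xI s' e0 dense d(1) this] show ?thesis .
    qed
    have "x:A_set f I (Bs I)"
    proof -
     obtain i where i: "x:fn i ` I" using xI unfolding orb_def by blast
     obtain a b where ab: "a<b" "fn i ` I = {a..b}" using pint_nondegenerate[OF I(1) inforb] by metis
     have abM: "{a..b}<=M" using ab(2) fpow_sub_orb[of i I] M_def by simp
     have "x = a | x = b"
     proof (rule ccontr)
      assume "~ ?thesis"
      hence "a<x" "x<b" using i ab by auto
      hence "ger x (-s) (min (x - a) (b - x))<={a..b}" using s(1) unfolding side_def ger_def by auto
      thus False using out abM `a < x` `x < b` by (meson diff_gt_0_iff_gt min_less_iff_conj subset_trans)
     qed
     moreover define l where "l = (LEAST l. fn l x:Bs I)"
     have "fn l x:Bs I" unfolding l_def using kB by (rule LeastI)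
     moreover have nl: "ALL i<l. fn i x~:Bs I" unfolding l_def using not_less_Least by blast
     moreover have "ALL i<l. fn i x~:interior (Orb I)" using intB nl by blast
     ultimately show ?thesis unfolding A_set_def using x(1) ab(2) by blast
    qed
    moreover define ee where "ee = min e e1"
    have "ee>0" "ger x s ee<=Orb I" "ger x (-s) ee<=ger x (-s) e"
     unfolding ee_def using ke(1) s(2,3) ger_mono[of "min e e1" e1 x s] M_def by (auto intro!: ger_mono)
    moreover from this have "fn k ` (ger x (-s) ee Int {0..1})<=Orb I" using ke(2) by blast
    moreover have "ALL e'>0. ~ ger x (-s) e'<=Orb I" using out M_def by blast
    ultimately have "omega_exceptional x" unfolding omega_exceptional_def using I(1) Binf s(1)
     by (intro exI[of _ I] exI[of _ m] exI[of _ s] exI[of _ k] exI[of _ ee] conjI)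
    thus ?thesis by blast
   qed
  qed
 qed
qed
qed

lemma closure_Per_unit: "closure (Per f)<={0..1}" by (rule closure_minimal) (auto simp: Per_def)

lemma clPer_nonwand: "closure (Per f)<=nonwandering f"
proof
fix x assume x: "x:closure (Per f)"
have xu: "x:{0..1}" using x closure_Per_unit by blast
have "EX n>=1. fn n ` U Int U~={}" if U: "openin (top_of_set {0..1}) U" "x:U" for U
proof -
 obtain e where e: "e>0" "ball x e Int {0..1}<=U" using openin_ball[OF U] by blast
 obtain p where p: "p:Per f" "dist p x<e" using x e(1) unfolding closure_approachable by blast
 have "p:U" using p e(2) unfolding Per_def by (auto simp: dist_commute)
 moreover obtain n where "n>=1" "fn n p = p" using p unfolding Per_def by blast
 ultimately show ?thesis by (metis IntI empty_iff imageI)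
qed
thus "x:nonwandering f" unfolding nonwandering_def using xu by blast
qed

text \<open>A periodic point on the outer side of an exceptional point would be carried into the
  cycle and could not leave it again. So the periodic points accumulate from the inner side, which
  gives the returns for \<open>good_germ\<close>.\<close>

theorem closure_Per_cases: assumes x: "x:closure (Per f)" "x~:Per f" shows "in_solenoid x | in_basic x"
proof -
have xO: "x:nonwandering f" using x clPer_nonwand by blast
have xu: "x:{0..1}" using x closure_Per_unit by blast
have "in_solenoid x | in_basic x" if ex: "omega_exceptional x"
proof -
 obtain I m s k e where I: "pint I m" "infinite (Bs I)"
  "x:A_set f I (Bs I)" "side s" "e>0" "ger x s e<=Orb I"
  "!!e'. e'>0 ==> ~ ger x (-s) e'<=Orb I" "fn k ` (ger x (-s) e Int {0..1})<=Orb I"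
  using ex unfolding omega_exceptional_def by (elim exE conjE) meson
 define M where "M = Orb I"
 note cl = cyc_closed[OF I(1), folded M_def]
 have fM: "f ` M<=M" unfolding M_def by (rule f_orb)
 note Mu = cyc_unit[OF I(1), folded M_def]
 have s': "side (-s)" using I(4) by simp
 obtain e1 where e1: "e1>0" "ger x (-s) e1 Int M = {}" using inner_or_outer[OF _ cl s', of x] pint_bdry[OF I(1)] I(7) M_def by blast
 have near: "EX p:Per f. p:ger x s d" if d: "d>0" for d
 proof -
  define c where "c = min d (min e e1)"
  have c: "c>0" "c<=d" "c<=e" "c<=e1" unfolding c_def using d I(5) e1(1) by auto
  obtain p where p: "p:Per f" "dist p x<c" using x(1) c(1) unfolding closure_approachable by blast
  have "p:ball x c" using p(2) by (simp add: dist_commute)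
  hence "p = x | p:ger x s c | p:ger x (-s) c" using ball_split'[OF I(4) c(1)] by blast
  moreover have "p~=x" using p x(2) by blast
  moreover have "p~:ger x (-s) c"
  proof
   assume pg: "p:ger x (-s) c"
   hence "p:ger x (-s) e" "p:ger x (-s) e1" using ger_mono[OF c(3), of x "-s"] ger_mono[OF c(4), of x "-s"] by auto
   moreover have "p:{0..1}" using p(1) unfolding Per_def by blast
   ultimately have pk: "fn k p:M" using I(8) M_def by blast
   obtain n where n: "n>=1" "fn n p = p" using p(1) unfolding Per_def by blast
   have "fn (k * n - k) (fn k p) = p" using mult_fix[OF n(2), of k] n(1) by (simp flip: fpow_add)
   hence "p:M" using inv_fpow[OF fM, of "k * n - k"] pk by (metis image_subset_iff)
   thus False using e1(2) `p:ger x (-s) e1` by blast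
  qed
  ultimately show ?thesis using p(1) ger_mono[OF c(2), of x s] by blast
 qed
 show ?thesis
 proof (rule good_germ[OF xu x(2) I(4,5)])
  show "ger x s e<={0..1}" using I(6) Mu M_def by blast
  show "~ ger x (-s) d<=Cl (ger x s e)" if "d>0" for d using cl_orb_least[OF I(6)[folded M_def] fM cl] I(7)[OF that] M_def by blast
  fix d assume d: "0<d" "d<=e"
  have gu: "ger x s d<={0..1}" using I(6) Mu M_def ger_mono[OF d(2), of x s] by blast
  obtain p where p: "p:Per f" "p:ger x s d" using near[OF d(1)] by blast
  obtain n where "n>=1" "fn n p = p" using p(1) unfolding Per_def by blast
  hence "EX n>=1. fn n ` ger x s d Int ger x s d~={}" using p(2) by (metis IntI empty_iff imageI)
  moreover have "x:core (ger x s d)"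
  proof (rule in_core_of_limits[OF gu])
   fix j
   show "x:closure (fn j ` Orb (ger x s d))" unfolding closure_approachable
   proof (intro allI impI)
    fix r::real assume "r>0"
    then obtain q where q: "q:Per f" "q:ger x s (min r d)" using near[of "min r d"] d(1) by auto
    obtain n where n: "n>=1" "fn n q = q" using q(1) unfolding Per_def by blast
    have qd: "q:ger x s d" "q:ger x s r" using q(2) ger_mono[of "min r d" d x s] ger_mono[of "min r d" r x s] by auto
    have "q = fn (j * n) q" using mult_fix[OF n(2)] by simp
    also have "... = fn j (fn (j * n - j) q)" using n(1) by (simp flip: fpow_add)
    finally have "q:fn j ` Orb (ger x s d)" using fpow_sub_orb[of "j * n - j" "ger x s d"] qd(1) by blast
    moreover have "dist q x<r" using qd(2) ger_ball[OF I(4), of x r] by (auto simp: dist_commute)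
    ultimately show "EX y:fn j ` Orb (ger x s d). dist y x<r" by blast
   qed
  qed
  ultimately show "(EX n>=1. fn n ` ger x s d Int ger x s d~={}) & x:core (ger x s d)" by blast
 qed
qed
thus ?thesis using nonwandering_cases[OF xO x(2)] by blast
qed

end

section \<open>Solenoidal sets\<close>

context interval_map
begin

lemma pint_at_ex:
"pint I m ==> x:Orb I ==> EX J. pint J m & Orb J = Orb I & x:J" by (erule (1) pint_at) blast

lemma gen_pint: "gen I m ==> pint (I j) (m j)" unfolding gen_def by blast

lemma gen_dec: "gen I m ==> i<=j ==> I j<=I i" unfolding gen_def using lift_Suc_antimono_le[of I] by blast

lemma gen_orb_dec: "gen I m ==> i<=j ==> Orb (I j)<=Orb (I i)" by (intro orb_mono gen_dec)

lemma gen_large: "gen I m ==> EX n. ALL k>=n. B<=m k" unfolding gen_def filterlim_at_top eventually_sequentially by blast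

lemma gen_largeE: assumes "gen I m" obtains n where "B<=m n" using gen_large[OF assms, of B] by blast

lemma gen_shift: assumes "gen I m" shows "gen (%j. I (j + k)) (%j. m (j + k))"
 "(INT j. Orb (I (j + k))) = QQ I"
proof -
have "filterlim (%j. m (j + k)) at_top sequentially"
 using assms filterlim_compose[OF _ filterlim_add_const_nat_at_top[of k], of m] unfolding gen_def by simp
thus "gen (%j. I (j + k)) (%j. m (j + k))" using assms unfolding gen_def by simp
show "(INT j. Orb (I (j + k))) = QQ I"
proof
 show "(INT j. Orb (I (j + k)))<=QQ I"
 proof
  fix x assume "x:(INT j. Orb (I (j + k)))"
  hence "x:Orb (I (j + k))" for j by blast
  thus "x:QQ I" using gen_orb_dec[OF assms le_add1] by blast
 qed
 show "(QQ I)<=(INT j. Orb (I (j + k)))" by blast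
qed
qed

lemma gen_Q_unit: "gen I m ==> (QQ I)<={0..1}" using cyc_unit[OF gen_pint, of I m 0] by blast

lemma gen_Q_closed: "gen I m ==> closed (QQ I)" using cyc_closed[OF gen_pint] by blast

lemma gen_f_Q: assumes "gen I m" shows "f ` (QQ I) = QQ I"
proof -
have "fn 1 ` (QQ I) = (INT j. fn 1 ` Orb (I j))" by (rule fpow_INT_decreasing)
   (use assms cyc_compact[OF gen_pint] cyc_unit[OF gen_pint] gen_orb_dec[of I m] in auto)
also have "... = QQ I" using pint_fpow_orb[OF gen_pint[OF assms], of 1] by simp
finally show ?thesis by simp
qed

lemma gen_fpow_Q: "gen I m ==> x:QQ I ==> fn k x:QQ I" using inv_fpow_eq[OF gen_f_Q, of I m k] by blast

lemma compact_nest_in_open: assumes "!!n. compact (K n::real set)" "!!i j. i<=j ==> K j<=K (i::nat)" "open V" "(INT n. K n)<=V" shows "EX n. K n<=V"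
proof (rule ccontr)
assume "~ ?thesis"
hence "K n - V~={}" for n by blast
moreover have "compact (K n - V)" for n using assms(1,3) by (simp add: compact_diff)
moreover have "K j - V<=K i - V" if "i<=j" for i j using assms(2)[OF that] by blast
ultimately have "(INT n. K n - V)~={}" by (intro compact_nest)
thus False using assms(4) by blast
qed

lemma gen_pieces_distinct: assumes g: "gen I m" and x: "x:Orb (I n)" and ij: "i~=j" "i<m n" "j<m n" and J: "pint J p" "Orb J = Orb (I n)" "fn i x:J"
shows "fn j x~:J"
proof
assume jJ: "fn j x:J"
note In = gen_pint[OF g, of n]
have "p = m n" using pint_nested_dvd[OF J(1) In] pint_nested_dvd[OF In J(1)] J(2) by (simp add: dvd_antisym)
obtain K where K: "pint K (m n)" "Orb K = Orb (I n)" "x:K" using pint_at[OF In x] .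
obtain l where l: "J Int fn l ` K~={}"
proof -
 have "J<=Orb K" using J(2) K(2) sub_orb by blast
 thus ?thesis using that J(3) unfolding orb_def by blast
qed
have sh: "pint (fn l ` K) (m n)" "Orb (fn l ` K) = Orb K" using pint_shift[OF K(1)] shift_orb[OF K(1)] by auto
have JK: "J<=fn l ` K" using l pint_nested[OF sh(1) J(1)] sh(2) K(2) J(2) by blast
have "fn i x:fn i ` K Int fn l ` K" "fn j x:fn j ` K Int fn l ` K" using K(3) J(3) jJ JK by blast+
hence "i mod m n = l mod m n" "j mod m n = l mod m n" using pint_disjoint[OF K(1)] by blast+
thus False using ij by simp
qed

text \<open>Two equal iterates would lie in one piece of a cycle whose period exceeds both
  times.\<close>

lemma gen_orbit_inj: assumes g: "gen I m" and x: "x:QQ I" shows "inj (%i. fn i x)"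
proof (rule injI, rule ccontr)
fix i j::nat assume eq: "fn i x = fn j x" "i~=j"
obtain n where n: "max i j + 1<=m n" by (rule gen_largeE[OF g])
have ij: "i<m n" "j<m n" using n by auto
have xn: "x:Orb (I n)" using x by blast
have "fn i x:Orb (I n)" using gen_fpow_Q[OF g x] by blast
then obtain J where "pint J (m n)" "Orb J = Orb (I n)" "fn i x:J" using pint_at[OF gen_pint[OF g]] by metis
thus False using gen_pieces_distinct[OF g xn eq(2) ij] eq(1) by metis
qed

lemma gen_no_Per: assumes "gen I m" "x:QQ I" shows "x~:Per f"
proof
assume "x:Per f"
then obtain n where "n>=1" "fn n x = fn 0 x" unfolding Per_def by auto
thus False using gen_orbit_inj[OF assms] unfolding inj_def by (metis not_one_le_zero)
qed

lemma gen_leave_finite: assumes g: "gen I m" and x: "x:QQ I" and X: "finite X" shows "EX k. fn k x~:X"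
proof (rule ccontr)
assume "~ ?thesis"
hence "range (%i. fn i x)<=X" by blast
thus False using gen_orbit_inj[OF g x] X finite_subset by (metis finite_imageD infinite_UNIV_nat)
qed

text \<open>The pieces around the iterates of \<open>x\<close> shrink to pairwise disjoint intervals
  \<open>Z k\<close>, and only finitely many of these can meet the finite boundary of
  \<open>M\<close>. One that does not lies in the interior, and by compactness so does a piece of
  some generating cycle.\<close>

lemma solenoid_enters: assumes g: "gen I m" and x: "x:QQ I" "x:M" and M: "closed M" "f ` M<=M" "finite (M - interior M)" shows "EX n. Orb (I n)<=M"
proof -
have "EX i. fn k x:fn i ` I n" for k n using gen_fpow_Q[OF g x(1), of k] unfolding orb_def by blast
then obtain i where i: "!!k n. fn k x:(f ^^ i k n) ` I n" by metis
define P where "P k n = (f ^^ i k n) ` I n" for k n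
have P: "pint (P k n) (m n)" "Orb (P k n) = Orb (I n)" "fn k x:P k n" for k n
 unfolding P_def using pint_shift[OF gen_pint[OF g]] shift_orb[OF gen_pint[OF g]] i by auto
have Pdec: "P k n'<=P k n" if "n<=n'" for k n n' using pint_nested[OF P(1) P(1), of k n' k n] P(2,3) gen_orb_dec[OF g that] by metis
have Pcomp: "compact (P k n)" for k n using pint_compact[OF P(1), of 0] by simp
define Z where "Z k = (INT n. P k n)" for k
have Zx: "fn k x:Z k" for k unfolding Z_def using P(3) by blast
have Zconn: "connected (Z k)" for k unfolding Z_def by (rule conn_INT) (use pint_conn[OF P(1), of 0] in "simp add: is_interval_connected_1")
have Zdisj: "Z k Int Z l = {}" if "k~=l" for k l
proof (rule ccontr)
 assume "Z k Int Z l~={}"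
 obtain n where n: "max k l + 1<=m n" by (rule gen_largeE[OF g])
 have "P k n Int P l n~={}" using `Z k Int Z l ~= {}` unfolding Z_def by blast
 then obtain u where u: "u:P k n" "u:P l n" by blast
 have "P k n<=P l n" by (rule pint_nested[OF P(1) P(1) _ u(2,1)]) (simp only: P(2) order_refl)
 hence "fn k x:P l n" using P(3) by blast
 moreover have "x:Orb (I n)" using x(1) by blast
 moreover have "k<m n" "l<m n" using n by auto
 ultimately show False using gen_pieces_distinct[OF g _ that _ _ P(1)[of l n] P(2)] P(3)[of l n] by blast
qed
have "EX k. Z k Int (M - interior M) = {}"
proof (rule ccontr)
 assume "~ ?thesis"
 hence "EX b. b:Z k Int (M - interior M)" for k by blast
 then obtain b where b: "!!k. b k:Z k Int (M - interior M)" by metis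
 have "inj b" unfolding inj_def using b Zdisj by (metis IntE disjoint_iff)
 moreover have "range b<=M - interior M" using b by blast
 ultimately show False using M(3) by (meson finite_imageD finite_subset infinite_UNIV_nat)
qed
then obtain k where k: "Z k Int (M - interior M) = {}" by blast
have xk: "fn k x:M" using inv_fpow[OF M(2), of k] x(2) by blast
have "Z k<=interior M"
proof -
 have cov: "Z k<=interior M Un - M" using k by blast
 have dis: "interior M Int - M Int Z k = {}" using interior_subset[of M] by blast
 have "interior M Int Z k = {} | - M Int Z k = {}" by (rule connectedD[OF Zconn open_interior open_Compl[OF M(1)] dis cov])
 moreover have "fn k x:interior M Int Z k" using Zx[of k] xk k by blast
 ultimately show ?thesis using cov by blast
qed
hence "EX n. P k n<=interior M" unfolding Z_def using compact_nest_in_open[of "P k" "interior M", OF Pcomp Pdec] by simp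
then obtain n where "P k n<=M" using interior_subset by blast
hence "Orb (P k n)<=M" by (rule orb_least[OF _ M(2)])
thus ?thesis using P(2) by auto
qed

lemma solen_enters_cyc: assumes g: "gen I m" and x: "x:QQ I" "x:Orb K" and K: "pint K p" shows "EX n. Orb (I n)<=Orb K"
using solenoid_enters[OF g x cyc_closed[OF K] f_orb pint_bdry[OF K]] .

theorem solen_disjoint: assumes Q: "solen Q" and X: "solen X" and ne: "Q Int X~={}" shows "Q = X"
proof -
have "Q'<=X'" if Q': "solen Q'" and X': "solen X'" and ne': "Q' Int X'~={}" for Q' X'
proof -
 obtain I m where I: "gen I m" "Q' = QQ I" using Q' unfolding solenoidal_Q_def by blast
 obtain K p where K: "gen K p" "X' = QQ K" using X' unfolding solenoidal_Q_def by blast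
 obtain x where x: "x:Q'" "x:X'" using ne' by blast
 have "Q'<=Orb (K j)" for j
 proof -
  have "x:Orb (K j)" using x K by blast
  hence "EX n. Orb (I n)<=Orb (K j)" using solen_enters_cyc[OF I(1) _ _ gen_pint[OF K(1)], of x j] x(1) I(2) by simp
  then obtain n where n: "Orb (I n)<=Orb (K j)" ..
  have "Q'<=Orb (I n)" unfolding I(2) by (rule INT_lower) simp
  thus ?thesis using n by (rule subset_trans)
 qed
 thus ?thesis unfolding K(2) by (rule INT_greatest)
qed
from this[OF Q X ne] this[OF X Q] ne show ?thesis by (simp add: Int_commute subset_antisym)
qed

text \<open>The interval around the middle point is confined between the two other points.\<close>

lemma middle_piece:
fixes w::"nat => real" assumes J: "!!i. i<(3::nat) ==> is_interval (J i) & w i:J i & w i:ball z e"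
 and dis: "!!i j. i<3 ==> j<3 ==> i~=j ==> w j~:J i" shows "EX i<3. J i<=ball z e"
proof -
have ne: "w 0~=w 1" "w 0~=w 2" "w 1~=w 2" using J[of 0] J[of 1] dis[of 0 1] dis[of 0 2] dis[of 1 2] by auto
have mid: "EX i<3. J i<=ball z e" if abc: "a<3" "b<3" "c<3" "w a<w b" "w b<w c" for a b c
proof -
 have "J b<=ball z e"
 proof
  fix y assume y: "y:J b"
  have int: "is_interval (J b)" "w b:J b" using J[OF abc(2)] by auto
  have "w a~:J b" "w c~:J b" using dis abc by fastforce+
  hence "w a<y" "y<w c" using int y abc(4,5) unfolding is_interval_1 by (meson less_imp_le not_less)+
  moreover have "abs (w a - z)<e" "abs (w c - z)<e" using J abc by (auto simp: dist_real_def abs_minus_commute)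
  ultimately show "y:ball z e" by (auto simp: dist_real_def abs_if split: if_splits)
 qed
 thus ?thesis using abc by blast
qed
consider "w 0<w 1" "w 1<w 2" | "w 0<w 2" "w 2<w 1" | "w 1<w 0" "w 0<w 2"
 | "w 1<w 2" "w 2<w 0" | "w 2<w 0" "w 0<w 1" | "w 2<w 1" "w 1<w 0" using ne by linarith
thus ?thesis by cases (rule mid[of 0 1 2] mid[of 0 2 1] mid[of 1 0 2] mid[of 1 2 0] mid[of 2 0 1] mid[of 2 1 0]; simp)+
qed

text \<open>The shrinking pieces need not contain \<open>z\<close>. This property picks out the
  common limit set from \<open>Q\<close>, whose components may be nondegenerate.\<close>

definition small_pieces::"(nat => real set) => (nat => nat) => real => bool" where
"small_pieces I m z <-> (ALL e>0. EX n J. pint J (m n) & Orb J = Orb (I n) & J<=ball z e)"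

lemma interval_fixed_point: assumes "a<=b" "continuous_on {a..b} g" "g ` {a..b}<={a..b::real}" shows "EX x:{a..b}. g x = x"
proof -
have "EX z:{a..b}. g z - z = 0"
proof (rule connected_zero[of _ _ b a])
 show "continuous_on {a..b} (%z. g z - z)" using assms(2) by (intro continuous_intros)
 show "g b - b<=0" "0<=g a - a" using assms(1,3) by (auto simp: image_subset_iff)
qed (use assms(1) in auto)
thus ?thesis by auto
qed

lemma pint_has_periodic: assumes "pint J p" shows "EX x:J. x:Per f"
proof -
obtain a b where ab: "0<=a" "a<=b" "b<=1" "J = {a..b}" using pint_obtain[OF assms] .
have "fn p ` J = J" using assms unfolding pint_def by blast
hence "EX x:{a..b}. fn p x = x" by (intro interval_fixed_point[OF ab(2)] fpow_cont') (use ab in auto)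
thus ?thesis using ab pint_pos[OF assms] unfolding Per_def by auto
qed

text \<open>An orbit in the solenoidal set passes through each piece once per period, hence
  arbitrarily late.\<close>

lemma small_pieces_omega: assumes g: "gen I m" and z: "small_pieces I m z" and y: "y:QQ I" shows "z:om y" unfolding om_iff
proof (intro allI impI)
fix e::real and N assume "e>0"
then obtain n J where J: "pint J (m n)" "Orb J = Orb (I n)" "J<=ball z e" using z unfolding small_pieces_def by blast
have "y:Orb J" using y J(2) by blast
then obtain i where i: "y:fn i ` J" unfolding orb_def by blast
define t where "t = (i + N + 1) * m n - i"
have mn: "m n>=1" by (rule pint_pos[OF J(1)])
have ge: "i + N + 1<=(i + N + 1) * m n" using mult_le_mono2[OF mn, of "i + N + 1"] by simp
have "fn t y:fn t ` fn i ` J" using i by blast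
also have "... = fn (0 + (i + N + 1) * m n) ` J" unfolding img_add t_def using ge by simp
also have "... = J" using pint_return[OF J(1), of 0 "i + N + 1"] by simp
finally have "fn t y:ball z e" using J(3) by blast
moreover have "t>=N" unfolding t_def using ge by linarith
ultimately show "EX n>=N. abs (fn n y - z)<e" by (auto simp: dist_real_def abs_minus_commute)
qed

lemma small_pieces_closure_Per: assumes z: "small_pieces I m z" shows "z:closure (Per f)" unfolding closure_approachable
proof (intro allI impI)
fix e::real assume "e>0"
then obtain n J where J: "pint J (m n)" "J<=ball z e" using z unfolding small_pieces_def by blast
then obtain x where "x:J" "x:Per f" using pint_has_periodic by blast
thus "EX y:Per f. dist y z<e" using J(2) by (intro bexI[of _ x]) (auto simp: dist_commute)
qed

lemma small_pieces_Q: assumes g: "gen I m" and z: "z:QQ I" and three: "!!e. e>0 ==> EX w n. (ALL i<(3::nat). w i:Orb (I n) & w i:ball z e) &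
  (ALL i<3. ALL j<3. ALL J. i~=j & pint J (m n) & Orb J = Orb (I n) & w i:J --> w j~:J)" shows "small_pieces I m z" unfolding small_pieces_def
proof (intro allI impI)
fix e::real assume "e>0"
obtain w n where w0: "(ALL i<(3::nat). w i:Orb (I n) & w i:ball z e) &
  (ALL i<3. ALL j<3. ALL J. i~=j & pint J (m n) & Orb J = Orb (I n) & w i:J --> w j~:J)" using three[OF `e > 0`] by (elim exE) (rule that)
have w: "w i:Orb (I n) & w i:ball z e" if "i<3" for i using w0 that by simp
have "EX J. i<3 --> pint J (m n) & Orb J = Orb (I n) & w i:J" for i using pint_at_ex[OF gen_pint[OF g], of "w i" n] w[of i] by blast
then obtain J where J: "!!i. i<3 ==> pint (J i) (m n) & Orb (J i) = Orb (I n) & w i:J i"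
 using choice[of "%i J. i<3 --> pint J (m n) & Orb J = Orb (I n) & w i:J"] by blast
have "EX i<3. J i<=ball z e"
proof (rule middle_piece)
 show "is_interval (J i) & w i:J i & w i:ball z e" if "i<3" for i
  using J[OF that] w[OF that] pint_conn[of "J i" "m n" 0] by (simp add: is_interval_connected_1)
 show "w j~:J i" if "i<3" "j<3" "i~=j" for i j using J[OF that(1)] w0 that by blast
qed
thus "EX n J. pint J (m n) & Orb J = Orb (I n) & J<=ball z e" using J by blast
qed

text \<open>Three iterates close to \<open>z\<close> lie in different pieces of a cycle whose period
  exceeds their times, so \<open>small_pieces_Q\<close> applies.\<close>

lemma omega_small_pieces: assumes g: "gen I m" and x: "x:QQ I" and z: "z:om x" shows "small_pieces I m z"
proof (rule small_pieces_Q[OF g])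
show "z:QQ I" using om_least[OF gen_Q_closed[OF g], of 0 x] gen_f_Q[OF g] x z by auto
fix e::real assume e: "e>0"
obtain t0 where t0: "abs (fn t0 x - z)<e" using omD[OF z e] by blast
obtain t1 where t1: "t1>=Suc t0" "abs (fn t1 x - z)<e" using omD[OF z e] by blast
obtain t2 where t2: "t2>=Suc t1" "abs (fn t2 x - z)<e" using omD[OF z e] by blast
define t where "t i = (if i = 0 then t0 else if i = 1 then t1 else t2)" for i::nat
obtain n where n: "Suc t2<=m n" by (rule gen_largeE[OF g])
have tn: "t i<m n" for i unfolding t_def using n t1 t2 by auto
have tne: "t i~=t j" if "i<3" "j<3" "i~=j" for i j using that t1(1) t2(1) unfolding t_def by auto
have xn: "x:Orb (I n)" using x by blast
show "EX w n. (ALL i<(3::nat). w i:Orb (I n) & w i:ball z e) &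
  (ALL i<3. ALL j<3. ALL J. i~=j & pint J (m n) & Orb J = Orb (I n) & w i:J --> w j~:J)"
proof (intro exI[of _ "%i. (f ^^ t i) x"] exI[of _ n] conjI allI impI)
 fix i::nat assume "i<3"
 show "(f ^^ t i) x:Orb (I n)" using gen_fpow_Q[OF g x] by blast
 show "(f ^^ t i) x:ball z e" using t0 t1 t2 unfolding t_def by (auto simp: dist_real_def abs_minus_commute)
next
 fix i j::nat and J assume "i<3" "j<3" "i~=j & pint J (m n) & Orb J = Orb (I n) & (f ^^ t i) x:J"
 thus "(f ^^ t j) x~:J" using gen_pieces_distinct[OF g xn tne tn tn] by blast
qed
qed

theorem solenoid_omega: assumes Q: "solen Q" and x: "x:Q" "y:Q" shows "om x = om y" "om x<=closure (Per f)"
 "om x<=Q" "infinite (om x)" "x:{0..1}"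
proof -
obtain I m where I: "gen I m" "Q = QQ I" using Q unfolding solenoidal_Q_def by blast
have sp: "small_pieces I m z" if "u:Q" "z:om u" for u z using omega_small_pieces[OF I(1), of u z] that unfolding I(2) .
have sub: "om u<=om v" if "u:Q" "v:Q" for u v by (rule subsetI, rule small_pieces_omega[OF I(1) sp[OF that(1)]]) (use that(2) I(2) in simp_all)
thus "om x = om y" using x by blast
show "om x<=closure (Per f)" using small_pieces_closure_Per[OF sp[OF x(1)]] by (rule subsetI)
show xu: "x:{0..1}" using gen_Q_unit[OF I(1)] x I(2) by blast
show oQ: "om x<=Q" using om_least[OF gen_Q_closed[OF I(1)], of 0 x] gen_f_Q[OF I(1)] x I(2) by simp
show "infinite (om x)"
proof
 assume "finite (om x)"
 hence "om x<=Per f" using finite_inv_Per[of "om x"] om_image[OF xu] om_unit[OF xu] by simp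
 then obtain z where "z:Per f" "z:Q" using om_nonempty[OF xu] oQ by blast
 thus False using gen_no_Per[OF I(1), of z] I(2) by simp
qed
qed

lemma solen_ne: "solen Q ==> Q~={}"
proof -
assume "solen Q"
then obtain I m where I: "gen I m" "Q = QQ I" unfolding solenoidal_Q_def by blast
have "(QQ I)~={}"
proof (rule compact_nest)
 show "compact (Orb (I j))" for j by (rule cyc_compact[OF gen_pint[OF I(1)]])
 show "Orb (I j)~={}" for j using pint_nonempty[OF gen_pint[OF I(1)]] sub_orb by blast
 show "Orb (I j)<=Orb (I i)" if "i<=j" for i j by (rule gen_orb_dec[OF I(1) that])
qed
thus ?thesis using I(2) by simp
qed

lemma solenoid_no_Per: "solen Q ==> Q Int Per f = {}" unfolding solenoidal_Q_def using gen_no_Per by blast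

end

section \<open>Tight generating intervals\<close>

lemma cpt_Inf_Sup:
fixes A::"real set" assumes "compact A" "A~={}" shows "Inf A:A" "Sup A:A" "x:A ==> Inf A<=x" "x:A ==> x<=Sup A"
proof -
have bd: "bdd_below A" "bdd_above A" using compact_imp_bounded[OF assms(1)] by (simp_all add: bounded_imp_bdd_below bounded_imp_bdd_above)
show "Inf A:A" "Sup A:A" using closed_contains_Inf[OF assms(2) bd(1)] closed_contains_Sup[OF assms(2) bd(2)] compact_imp_closed[OF assms(1)] by auto
show "x:A ==> Inf A<=x" "x:A ==> x<=Sup A" using cInf_lower[OF _ bd(1)] cSup_upper[OF _ bd(2)] by auto
qed

lemma gap_around:
fixes A::"real set" assumes A: "compact A" and t: "t~:A" and p: "p:A" "p<=t" and q: "q:A" "t<=q"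
shows "EX u:A. EX v:A. u<t & t<v & {u<..<v} Int A = {}"
proof -
define u where "u = Sup (A Int {..t})"
define v where "v = Inf (A Int {t..})"
have cl: "compact (A Int {..t})" "compact (A Int {t..})" using A by (auto intro: compact_Int_closed)
have ne: "A Int {..t}~={}" "A Int {t..}~={}" using p q by auto
have uv: "u:A Int {..t}" "v:A Int {t..}" unfolding u_def v_def by (rule cpt_Inf_Sup(2)[OF cl(1) ne(1)]) (rule cpt_Inf_Sup(1)[OF cl(2) ne(2)])
have "w<=u | v<=w" if "w:A" for w unfolding u_def v_def using cpt_Inf_Sup(4)[OF cl(1) ne(1), of w] cpt_Inf_Sup(3)[OF cl(2) ne(2), of w] that by force
hence "{u<..<v} Int A = {}" by force
moreover have "u~=t" "v~=t" using uv t by blast+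
ultimately show ?thesis using uv by (intro bexI[of _ u] bexI[of _ v]) auto
qed

definition mlap::"(real => real) => real set => bool" where
"mlap g A <-> mono_on A g | antimono_on A g"

lemma mlap_between: assumes "mlap g {u..v}" "u<=t" "t<=v" shows "min (g u) (g v)<=g t & g t<=max (g u) (g v)"
proof -
have m: "u:{u..v}" "v:{u..v}" "t:{u..v}" using assms by auto
from assms(1) show ?thesis unfolding mlap_def
proof
 assume "mono_on {u..v} g"
 hence "g u<=g t" "g t<=g v" using m assms(2,3) by (auto simp: monotone_on_def)
 thus ?thesis by auto
next
 assume "antimono_on {u..v} g"
 hence "g t<=g u" "g v<=g t" using m assms(2,3) by (auto simp: monotone_on_def)
 thus ?thesis by auto
qed
qed

lemma mlap_comp: "mlap g A ==> mlap h (g ` A) ==> mlap (h \<circ> g) A" unfolding mlap_def monotone_on_def by auto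

lemma mlap_subset: "mlap g A ==> B<=A ==> mlap g B" unfolding mlap_def by (meson monotone_on_subset)

context pm_system
begin

lemma lap': "0<=u ==> v<=1 ==> {u<..<v} Int C = {} ==> mlap f {u..v}"
using lap[of u v] unfolding mlap_def monotone_lap_def by (cases "u<=v") (auto simp: monotone_on_def)

lemma mlap_iterate: assumes "!!i. i<k ==> mlap f (fn i ` A)" shows "mlap (fn k) A" using assms
proof (induction k)
case 0
thus ?case unfolding mlap_def by (simp add: monotone_on_def)
next
case (Suc k)
hence "mlap (fn k) A" by simp
hence "mlap (f \<circ> fn k) A" using Suc.prems[of k] by (intro mlap_comp) auto
thus ?case by (simp add: comp_def)
qed

text \<open>The point of this form: a gap of \<open>Q\<close> inside a piece has both ends in
  \<open>Q\<close> and contains no turning point, so \<open>f\<close> is monotone on it.\<close>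

definition tight::"real set => real set => nat => bool" where
"tight Q H p <-> pint H p & Q<=Orb H & Orb H Int C<=Q &
  (ALL i. EX a b. fn i ` H = {a..b} & a:Q & b:Q)"

text \<open>Each piece is replaced by the convex hull of its part of \<open>Q\<close>. A point of
  the hull outside \<open>Q\<close> lies in a gap of \<open>Q\<close> without turning points, so its
  image is between the images of the two ends of the gap; hence hulls are mapped onto hulls.\<close>

lemma tighten: assumes I: "pint I m" and Q: "closed Q" "f ` Q = Q" "Q<=Orb I" "Q~={}" and CQ: "Orb I Int C<=Q"
shows "EX H. H<=I & tight Q H m & Q Int I<=H"
proof -
define P where "P i = fn i ` I" for i
define h where "h i = {Inf (Q Int P i)..Sup (Q Int P i)}" for i
have Pint: "EX a b. 0<=a & a<=b & b<=1 & P i = {a..b}" for i unfolding P_def by (rule pint_piece[OF I])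
have Pcomp: "compact (Q Int P i)" for i unfolding P_def by (intro closed_Int_compact Q pint_compact[OF I])
have PSuc: "P (Suc i) = f ` P i" for i unfolding P_def by (simp only: fpow_Suc_image)
have surj: "f ` (Q Int P i) = Q Int P (Suc i)" for i
proof
 show "f ` (Q Int P i)<=Q Int P (Suc i)" using Q(2) PSuc by blast
 show "Q Int P (Suc i)<=f ` (Q Int P i)"
 proof
  fix q assume q: "q:Q Int P (Suc i)"
  then obtain q' where q': "q':Q" "f q' = q" using Q(2) by (metis IntD1 imageE)
  then obtain j where j: "q':P j" using Q(3) unfolding orb_def P_def by blast
  hence "q:P (Suc j)" using q'(2) PSuc by blast
  hence "Suc j mod m = Suc i mod m" using pint_disjoint[OF I] q unfolding P_def by blast
  hence "[j + 1 = i + 1] (mod m)" unfolding cong_def by simp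
  hence "j mod m = i mod m" using cong_add_rcancel_nat unfolding cong_def by blast
  hence "P j = P i" unfolding P_def using pint_mod[OF I] by metis
  thus "q:f ` (Q Int P i)" using j q' by blast
 qed
qed
have surjk: "fn i ` (Q Int P 0) = Q Int P i" for i
proof (induction i)
 case (Suc i)
 have "(f ^^ Suc i) ` (Q Int P 0) = f ` fn i ` (Q Int P 0)" by (rule fpow_Suc_image[symmetric])
 thus ?case using Suc surj by simp
qed simp
have ne: "Q Int P i~={}" for i
proof -
 obtain q where "q:Q" using Q(4) by blast
 then obtain j where "q:Q Int P j" using Q(3) unfolding orb_def P_def by blast
 hence "Q Int P 0~={}" using surjk[of j] by blast
 thus ?thesis using surjk[of i] by blast
qed
have ends: "Inf (Q Int P i):Q Int P i" "Sup (Q Int P i):Q Int P i" for i using cpt_Inf_Sup(1,2)[OF Pcomp ne] .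
have hin: "Q Int P i<=h i" for i
proof
 fix q assume q: "q:Q Int P i"
 show "q:h i" unfolding h_def using cpt_Inf_Sup(3,4)[OF Pcomp ne q] by simp
qed
have hP: "h i<=P i" for i
proof -
 obtain a b where "P i = {a..b}" using Pint[of i] by blast
 thus ?thesis unfolding h_def using ends[of i] by auto
qed
have fh: "f ` h i = h (Suc i)" for i
proof
 show "f ` h i<=h (Suc i)"
 proof
  fix y assume "y:f ` h i"
  then obtain t where t: "t:h i" "y = f t" by blast
  show "y:h (Suc i)"
  proof (cases "t:Q")
   case True
   thus ?thesis using surj[of i] hin[of "Suc i"] hP[of i] t by blast
  next
   case False
   have "t~:Q Int P i" using False by simp
   moreover have "Inf (Q Int P i)<=t" "t<=Sup (Q Int P i)" using t(1) unfolding h_def by auto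
   ultimately obtain u v where u: "u:Q Int P i" and v: "v:Q Int P i" and uv': "u<t" "t<v"
    and gap: "{u<..<v} Int (Q Int P i) = {}" using gap_around[OF Pcomp _ ends(1) _ ends(2)] by meson
   have uv: "u<=t" "t<=v" using uv' by auto
   obtain a b where ab: "0<=a" "b<=1" "P i = {a..b}" using Pint[of i] by (elim exE conjE, intro that)
   have "u:{a..b}" "v:{a..b}" using u v unfolding ab(3) by simp_all
   hence sub: "{u<..<v}<=P i" "0<=u" "v<=1" unfolding ab(3) using ab(1,2) by auto
   have "c:{u<..<v} Int (Q Int P i)" if "c:{u<..<v}" "c:C" for c using that sub(1) CQ fpow_sub_orb[of i I] unfolding P_def[symmetric] by blast
   hence "{u<..<v} Int C = {}" using gap by blast
   hence "mlap f {u..v}" by (intro lap' sub)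
   hence "min (f u) (f v)<=y & y<=max (f u) (f v)" unfolding t(2) using uv by (intro mlap_between)
   moreover have "f u:Q Int P (Suc i)" "f v:Q Int P (Suc i)" using u v surj[of i] by blast+
   hence "f u:h (Suc i)" "f v:h (Suc i)" using hin[of "Suc i"] by blast+
   ultimately show ?thesis unfolding h_def by auto
  qed
 qed
 obtain a b where "0<=a" "b<=1" "P i = {a..b}" using Pint[of i] by blast
 hence "P i<={0..1}" by auto
 hence hu: "h i<={0..1}" using hP[of i] by (rule subset_trans[rotated])
 have "connected (f ` h i)" using fpow_conn[OF _ hu, of 1] by (simp add: h_def)
 moreover have "Inf (Q Int P (Suc i)):f ` h i" "Sup (Q Int P (Suc i)):f ` h i" using ends[of "Suc i"] surj[of i] hin[of i] by blast+
 ultimately show "h (Suc i)<=f ` h i" unfolding h_def[of "Suc i"] by (rule connected_contains_Icc)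
qed
have fkh: "fn i ` h 0 = h i" for i
proof (induction i)
 case (Suc i)
 have "(f ^^ Suc i) ` h 0 = f ` fn i ` h 0" by (rule fpow_Suc_image[symmetric])
 thus ?case using Suc fh by simp
qed simp
have P0: "P 0 = I" unfolding P_def by simp
have Pm: "P m = P 0" unfolding P_def using I unfolding pint_def by simp
have "Inf (Q Int P 0)<=Sup (Q Int P 0)" using hin[of 0] ne[of 0] unfolding h_def by auto
moreover have "h 0<={0..1}" using hP[of 0] P0 pint_unit[OF I] by blast
ultimately have "EX a b. 0<=a & a<=b & b<=1 & h 0 = {a..b}" unfolding h_def by (intro exI[of _ "Inf (Q Int P 0)"] exI[of _ "Sup (Q Int P 0)"]) auto
moreover have "disjoint_family_on (%i. fn i ` h 0) {..<m}"
proof -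
 have "disjoint_family_on P {..<m}" unfolding P_def using I unfolding pint_def by blast
 thus ?thesis unfolding disjoint_family_on_def fkh using hP by (meson disjoint_iff subsetD)
qed
moreover have "fn m ` h 0 = h 0" unfolding fkh unfolding h_def Pm ..
ultimately have H: "pint (h 0) m" unfolding pint_def using pint_pos[OF I] by (intro conjI)
have "Q<=Orb (h 0)"
proof
 fix q assume q: "q:Q"
 then obtain i where "q:Q Int P i" using Q(3) unfolding orb_def P_def by blast
 hence "q:fn i ` h 0" using hin[of i] fkh[of i] by blast
 thus "q:Orb (h 0)" using fpow_sub_orb by blast
qed
moreover have "Orb (h 0)<=Orb I" using hP[of 0] P0 orb_mono by metis
moreover have "EX a b. fn i ` h 0 = {a..b} & a:Q & b:Q" for i using fkh[of i] ends[of i] unfolding h_def[of i] by blast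
ultimately have "tight Q (h 0) m" unfolding tight_def using H CQ by blast
thus ?thesis using hP[of 0] hin[of 0] P0 by blast
qed

lemma tight_system: assumes "solen Q" shows "EX H p. gen H p & Q = QQ H & (ALL j. tight Q (H j) (p j))"
proof -
obtain I m where I: "gen I m" "Q = QQ I" using assms unfolding solenoidal_Q_def by blast
have fQ: "f ` Q = Q" unfolding I(2) by (rule gen_f_Q[OF I(1)])
have cQ: "closed Q" unfolding I(2) by (rule gen_Q_closed[OF I(1)])
\<comment> \<open>The finitely many turning points outside \<open>Q\<close> are left behind from
  some level on.\<close>
have "EX N. ALL n>=N. c:C --> c:Orb (I n) --> c:Q" for c
proof (cases "c:Q")
 case False
 then obtain N where "c~:Orb (I N)" using I(2) by blast
 hence "c~:Orb (I n)" if "n>=N" for n using gen_orb_dec[OF I(1) that] by blast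
 thus ?thesis by blast
qed simp
then obtain N where N: "!!c n. n>=N c ==> c:C ==> c:Orb (I n) ==> c:Q" by metis
define N0 where "N0 = Max (insert 0 (N ` C))"
have N0: "N c<=N0" if "c:C" for c unfolding N0_def using finC that by (intro Max_ge) auto
have CQ: "Orb (I (j + N0)) Int C<=Q" for j
proof
 fix c assume c: "c:Orb (I (j + N0)) Int C"
 thus "c:Q" using N[of c "j + N0"] N0[of c] by auto
qed
have QI: "Q<=Orb (I j)" for j using I(2) by blast
obtain q where q: "q:Q" using solen_ne[OF assms] by blast
have "EX J. pint J (m (j + N0)) & Orb J = Orb (I (j + N0)) & q:J" for j using pint_at[OF gen_pint[OF I(1)]] QI q by (metis subsetD)
then obtain J where J: "!!j. pint (J j) (m (j + N0))" "!!j. Orb (J j) = Orb (I (j + N0))" "!!j. q:J j" by metis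
have "EX H. H<=J j & tight Q H (m (j + N0)) & Q Int J j<=H" for j by (rule tighten[OF J(1) cQ fQ]) (use QI J(2) CQ q in auto)
then obtain H where H: "!!j. H j<=J j" "!!j. tight Q (H j) (m (j + N0))" "!!j. Q Int J j<=H j" by metis
have Hp: "pint (H j) (m (j + N0))" "Q<=Orb (H j)" for j using H(2)[of j] unfolding tight_def by auto
have qH: "q:H j" for j using H(3) J(3) q by blast
have Jdec: "J (Suc j)<=J j" for j by (rule pint_nested[OF J(1) J(1) _ J(3) J(3)]) (simp add: J(2) gen_orb_dec[OF I(1)])
have Hdec: "H (Suc j)<=H j" for j
proof -
 obtain a b where ab: "fn 0 ` H (Suc j) = {a..b}" "a:Q" "b:Q" using H(2)[of "Suc j"] unfolding tight_def by blast
 have Hab: "H (Suc j) = {a..b}" using ab(1) by simp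
 hence "a<=b" using qH[of "Suc j"] by simp
 hence "a:H (Suc j)" "b:H (Suc j)" unfolding Hab by auto
 hence "a:Q Int J j" "b:Q Int J j" using ab(2,3) H(1)[of "Suc j"] Jdec[of j] by blast+
 hence "a:H j" "b:H j" using H(3) by blast+
 moreover have "connected (H j)" using pint_conn[OF Hp(1), of 0 j] by simp
 ultimately show ?thesis unfolding Hab by (intro connected_contains_Icc)
qed
have "filterlim (%j. m (j + N0)) at_top sequentially" using gen_shift(1)[OF I(1), of N0] unfolding gen_def by blast
hence gen: "gen H (%j. m (j + N0))" unfolding gen_def using Hp(1) Hdec by blast
have "Q = QQ H"
proof
 show "Q<=QQ H" using Hp(2) by blast
 have "(QQ H)<=Orb (I (j + N0))" for j using orb_mono[OF H(1)[of j]] J(2)[of j] by blast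
 hence "(QQ H)<=(INT j. Orb (I (j + N0)))" by blast
 thus "(QQ H)<=Q" unfolding gen_shift(2)[OF I(1)] I(2) .
qed
thus ?thesis using gen H(2) by blast
qed

section \<open>Points of a solenoidal set that are approached from outside of it\<close>

lemma omega_enters: assumes x: "x:{0..1}" and z: "z:om x" and M: "closed M" "f ` M<=M" "M<={0..1}" and k: "fn k z:interior M"
shows "EX N. ALL n>=N. fn n x:M"
proof -
have "fn k z:om x" using om_image[OF x] inv_fpow_eq[of "om x" k] z by blast
moreover obtain e where e: "e>0" "ball (fn k z) e<=M" using k by (auto simp: mem_interior)
ultimately obtain t where "abs (fn t x - fn k z)<e" using omD[of "fn k z" x e 0] by blast
hence t: "fn t x:M" using e(2) by (auto simp: dist_real_def abs_minus_commute)
have "fn n x:M" if "n>=t" for n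
proof -
 have "fn n x = fn (n - t) (fn t x)" using that by (simp flip: funpow_add comp_apply[of "f ^^ _" "f ^^ _"])
 thus ?thesis using inv_fpow[OF M(2), of "n - t"] t by auto
qed
thus ?thesis by blast
qed

lemma tight_piece_ends: assumes t: "tight Q H p" and x: "x:Orb H" shows "EX J a b. pint J p & Orb J = Orb H & x:J & J = {a..b} & a:Q & b:Q"
proof -
have H: "pint H p" and e: "!!i. EX a b. fn i ` H = {a..b} & a:Q & b:Q" using t unfolding tight_def by auto
obtain i where "x:fn i ` H" using x unfolding orb_def by blast
thus ?thesis using pint_shift[OF H, of i] shift_orb[OF H, of i] e[of i] by metis
qed

definition sep_at::"real set => nat => real => real => bool" where
"sep_at H p a b <-> (ALL J. pint J p & Orb J = Orb H & a:J --> b~:J)"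

lemma sep_at_sym: "sep_at H p a b ==> sep_at H p b a" unfolding sep_at_def by blast

lemma sep_at_mono: assumes g: "gen H p" and n: "n<=n'" and s: "sep_at (H n) (p n) a b" shows "sep_at (H n') (p n') a b" unfolding sep_at_def
proof (intro allI impI notI)
fix J assume J: "pint J (p n') & Orb J = Orb (H n') & a:J" and b: "b:J"
have sub: "Orb J<=Orb (H n)" using J gen_orb_dec[OF g n] by simp
hence "a:Orb (H n)" using J sub_orb[of J] by blast
then obtain K where K: "pint K (p n)" "Orb K = Orb (H n)" "a:K" using pint_at_ex[OF gen_pint[OF g]] by blast
have "J<=K" by (rule pint_nested[OF K(1) _ _ K(3)]) (use J K(2) sub in auto)
thus False using s K b unfolding sep_at_def by blast
qed

text \<open>Otherwise all points of \<open>Q\<close> within \<open>e\<close> of \<open>z\<close>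
  belong to the pieces \<open>P n\<close> around \<open>z\<close>, at every level. Points outside
  \<open>Q\<close> near \<open>z\<close> drop out of these pieces, and each loss freezes the end of
  the pieces on that side. Three successive losses on two sides are impossible.\<close>

lemma tight_near: assumes g: "gen H p" and Q: "Q = QQ H" and t: "!!j. tight Q (H j) (p j)" and z: "z:Q"
 and star: "!!n e. e>0 ==> EX x:Orb (H n). x~:Q & abs (x - z)<e" and e: "e>0" shows "EX q n. q:Q & abs (q - z)<e & sep_at (H n) (p n) z q"
proof (rule ccontr)
assume neg: "~ ?thesis"
have "EX P a b. pint P (p n) & Orb P = Orb (H n) & z:P & P = {a..b} & a:Q & b:Q" for n by (rule tight_piece_ends[OF t]) (use z Q in blast)
then obtain P a b where P0: "!!n. pint (P n) (p n) & Orb (P n) = Orb (H n) & z:P n & P n = {a n..b n} & a n:Q & b n:Q" by metis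
hence P: "pint (P n) (p n)" "Orb (P n) = Orb (H n)" "z:P n" "P n = {a n..b n}" "a n:Q" "b n:Q" for n using P0[of n] by blast+
have zab: "a n<=z" "z<=b n" for n using P(3)[of n] unfolding P(4) by auto
have dec: "P n'<=P n" if "n<=n'" for n n' by (rule pint_nested[OF P(1) P(1) _ P(3) P(3)]) (simp add: P(2) gen_orb_dec[OF g that])
have inP: "q:P n" if "q:Q" "abs (q - z)<e" for q n
proof (rule ccontr)
 assume q: "q~:P n"
 have "sep_at (H n) (p n) z q" unfolding sep_at_def
 proof (intro allI impI)
  fix J assume J: "pint J (p n) & Orb J = Orb (H n) & z:J"
  have "J<=P n" by (rule pint_nested[OF P(1) _ _ P(3)]) (use J P(2) in auto)
  thus "q~:J" using q by blast
 qed
 thus False using neg that by blast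
qed
\<comment> \<open>Another piece through \<open>x\<close> has its ends in \<open>Q\<close>, and the
  one that faces \<open>z\<close> is too close to \<open>z\<close> to lie outside of
  \<open>P n\<close>.\<close>
have A: "x:P n" if x: "x:Orb (H n)" "abs (x - z)<e" for x n
proof (rule ccontr)
 assume nx: "x~:P n"
 obtain J c d where J: "pint J (p n)" "Orb J = Orb (H n)" "x:J" "J = {c..d}" "c:Q" "d:Q"
  using tight_piece_ends[OF t x(1)] by (elim exE conjE) (rule that)
 have dis: "w~:P n" if "w:J" for w
 proof
  assume "w:P n"
  hence "J<=P n" using pint_nested[OF P(1)[of n] J(1) _ _ that] P(2) J(2) by simp
  thus False using J(3) nx by blast
 qed
 have cd: "c<=x" "x<=d" using J(3) unfolding J(4) by auto
 hence "c:J" "d:J" "z~:J" using dis[of z] P(3)[of n] unfolding J(4) by auto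
 hence "abs (c - z)<e | abs (d - z)<e" using cd x(2) unfolding J(4) by auto
 thus False using inP[of c n] inP[of d n] J(5,6) dis `c:J` `d:J` by blast
qed
\<comment> \<open>The end of \<open>P n\<close> between \<open>x\<close> and \<open>z\<close> is a
  point of \<open>Q\<close> within \<open>e\<close> of \<open>z\<close>, so it belongs to every
  \<open>P k\<close> and stays an end point from level \<open>n\<close> on.\<close>
have B: "(x<z & (ALL k. P k = {a n..b k} | ~ n<=k)) | (z<x & (ALL k. P k = {a k..b n} | ~ n<=k))" if x: "abs (x - z)<e" "x~:P n" for x n
proof (cases "x<z")
 case True
 hence "x<a n" using x(2) zab[of n] unfolding P(4) by auto
 hence "abs (a n - z)<e" using True zab[of n] x(1) by auto
 hence "a n:P k" for k using inP P(5) by blast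
 moreover have "a n<=a k" if "n<=k" for k using dec[OF that] zab[of k] unfolding P(4) by auto
 ultimately have eq: "a n = a k" if "n<=k" for k using that unfolding P(4) by (meson antisym atLeastAtMost_iff)
 have "P k = {a n..b k}" if "n<=k" for k unfolding eq[OF that] by (rule P(4))
 thus ?thesis using True by blast
next
 case False
 hence "z<x" using x(2) P(3)[of n] by (cases "x = z") auto
 moreover from this have "b n<x" using x(2) zab[of n] unfolding P(4) by auto
 hence "abs (b n - z)<e" using False zab[of n] x(1) by auto
 hence "b n:P k" for k using inP P(6) by blast
 moreover have "b k<=b n" if "n<=k" for k using dec[OF that] zab[of k] unfolding P(4) by auto
 ultimately have eq: "b n = b k" if "n<=k" for k using that unfolding P(4) by (meson antisym atLeastAtMost_iff)
 have "P k = {a k..b n}" if "n<=k" for k unfolding eq[OF that] by (rule P(4))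
 thus ?thesis using `z < x` by blast
qed
have step: "EX x k. k>=n & x:P n & x~:P k & abs (x - z)<e" for n
proof -
 obtain x where x: "x:Orb (H n)" "x~:Q" "abs (x - z)<e" using star[OF e, of n] by blast
 then obtain k where k: "x~:Orb (H k)" unfolding Q by blast
 have "P k<=Orb (H k)" using sub_orb[of "P k"] unfolding P(2) .
 hence "x~:P k" using k by blast
 hence "x~:P (max n k)" using dec[of k "max n k"] by auto
 thus ?thesis using A[OF x(1,3)] x(3) by (intro exI[of _ x] exI[of _ "max n k"]) auto
qed
obtain x0 n1 where 0: "x0~:P n1" "abs (x0 - z)<e" using step[of 0] by blast
obtain x1 n2 where 1: "n2>=n1" "x1:P n1" "x1~:P n2" "abs (x1 - z)<e" using step[of n1] by blast
obtain x2 n3 where 2: "n3>=n2" "x2:P n2" "x2~:P n3" "abs (x2 - z)<e" using step[of n2] by blast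
note B' = B[OF 0(2,1)] B[OF 1(4,3)] B[OF 2(4,3)]
have same: "~ (x<z & y<z) & ~ (z<x & z<y)"
 if xy: "(x<z & (ALL k. P k = {a n..b k} | ~ n<=k)) | (z<x & (ALL k. P k = {a k..b n} | ~ n<=k))" "y:P n" "y~:P m" "n<=m" for x y n m
proof (intro conjI notI)
 assume "x<z & y<z"
 hence "P m = {a n..b m}" "y<z" using xy(1,4) by auto
 thus False using xy(2,3) zab[of m] unfolding P(4)[of n] by auto
next
 assume "z<x & z<y"
 hence "P m = {a m..b n}" "z<y" using xy(1,4) by auto
 thus False using xy(2,3) zab[of m] unfolding P(4)[of n] by auto
qed
have "x2:P n1" using 2(2) dec[OF 1(1)] by blast
thus False using same[OF B'(1) 1(2,3,1)] same[OF B'(1) _ 2(3), of] same[OF B'(2) 2(2,3,1)] B' 1(1) 2(1) by auto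
qed

text \<open>\<open>tight_near\<close> is used twice, the second time closer to \<open>z\<close> than
  the piece of the first point, so that \<open>z\<close>, \<open>q1\<close> and \<open>q2\<close>
  lie in three different pieces.\<close>

lemma tight_small_pieces: assumes g: "gen H p" and Q: "Q = QQ H" and t: "!!j. tight Q (H j) (p j)" and z: "z:Q"
 and star: "!!n e. e>0 ==> EX x:Orb (H n). x~:Q & abs (x - z)<e" shows "small_pieces H p z"
proof (rule small_pieces_Q[OF g])
show "z:QQ H" using z Q by simp
fix e::real assume e: "e>0"
obtain q1 n1 where 1: "q1:Q" "abs (q1 - z)<e" "sep_at (H n1) (p n1) z q1" using tight_near[OF g Q t z star e] by blast
have "q1:Orb (H n1)" using 1(1) Q by blast
then obtain K where K: "pint K (p n1)" "Orb K = Orb (H n1)" "q1:K" using pint_at_ex[OF gen_pint[OF g]] by blast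
have "z:- K" using sep_at_sym[OF 1(3)] K unfolding sep_at_def by blast
moreover have "open (- K)" using pint_compact[OF K(1), of 0] by (simp add: compact_imp_closed open_Compl)
ultimately obtain d where d: "d>0" "ball z d <= - K" using open_contains_ball by blast
obtain q2 n2 where 2: "q2:Q" "abs (q2 - z)<min d e" "sep_at (H n2) (p n2) z q2" using tight_near[OF g Q t z star, of "min d e"] d(1) e by auto
have "q2:ball z d" using 2(2) by (auto simp: dist_real_def abs_minus_commute)
hence "q2~:K" using d(2) by blast
have s12: "sep_at (H n1) (p n1) q1 q2" unfolding sep_at_def
proof (intro allI impI)
 fix J assume J: "pint J (p n1) & Orb J = Orb (H n1) & q1:J"
 have "J<=K" by (rule pint_nested[OF K(1) _ _ K(3)]) (use J K(2) in auto)
 thus "q2~:J" using `q2~:K` by blast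
qed
define n where "n = max n1 n2"
define w where "w i = (if i = 0 then z else if i = 1 then q1 else q2)" for i::nat
have s: "sep_at (H n) (p n) z q1" "sep_at (H n) (p n) z q2" "sep_at (H n) (p n) q1 q2"
 using sep_at_mono[OF g _ 1(3)] sep_at_mono[OF g _ 2(3)] sep_at_mono[OF g _ s12] unfolding n_def by auto
have sw: "sep_at (H n) (p n) (w i) (w j)" if "i<3" "j<3" "i~=j" for i j
proof -
 have "i = 0 | i = 1 | i = 2" "j = 0 | j = 1 | j = 2" using that(1,2) by auto
 thus ?thesis unfolding w_def using that(3) s s[THEN sep_at_sym] by auto
qed
have wQ: "w i:Q & w i:ball z e" for i unfolding w_def using z 1(1,2) 2(1,2) e by (auto simp: dist_real_def abs_minus_commute)
show "EX w n. (ALL i<(3::nat). w i:Orb (H n) & w i:ball z e) &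
  (ALL i<3. ALL j<3. ALL J. i~=j & pint J (p n) & Orb J = Orb (H n) & w i:J --> w j~:J)"
proof (intro exI[of _ w] exI[of _ n] conjI allI impI)
 show "w i:Orb (H n)" "w i:ball z e" for i using wQ[of i] Q by auto
 show "w j~:J" if "i<3" "j<3" "i~=j & pint J (p n) & Orb J = Orb (H n) & w i:J" for i j J using sw[of i j] that unfolding sep_at_def by blast
qed
qed

lemma solenoid_orb_interior: assumes g: "gen H p" and z: "z:QQ H"
obtains k where "fn k z:interior (Orb (H n))"
proof -
obtain k where "fn k z~:Orb (H n) - interior (Orb (H n))" using gen_leave_finite[OF g z pint_bdry[OF gen_pint[OF g]]] by blast
thus thesis using gen_fpow_Q[OF g z, of k] that by blast
qed

text \<open>Periodic points close to \<open>z\<close> lie in each generating cycle, because an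
  iterate does and they come back, but never in \<open>Q\<close>. So \<open>z\<close> is approached
  from outside \<open>Q\<close>.\<close>

theorem solenoid_closure_Per: assumes Q: "solen Q" and y: "y:Q" and z: "z:Q" "z:closure (Per f)" shows "z:om y"
proof -
obtain H p where H: "gen H p" "Q = QQ H" "!!j. tight Q (H j) (p j)" using tight_system[OF Q] by blast
have zQ: "z:QQ H" and zu: "z:{0..1}" using z H(2) gen_Q_unit[OF H(1)] by auto
have "small_pieces H p z"
proof (rule tight_small_pieces[OF H z(1)])
 fix n and e::real assume e: "e>0"
 let ?M = "Orb (H n)"
 obtain k r where r: "r>0" "ball (fn k z) r<=?M" using solenoid_orb_interior[OF H(1) zQ, of n] by (metis mem_interior)
 have "continuous (at z within {0..1}) (fn k)" using fpow_cont[of k] zu by (simp add: continuous_on_eq_continuous_within)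
 then obtain d where d: "d>0" "!!x. x:{0..1} ==> dist x z<d ==> dist (fn k x) (fn k z)<r" unfolding continuous_within_eps_delta using r(1) by blast
 obtain x where x: "x:Per f" "dist x z<min d e" using z(2) e d(1) unfolding closure_approachable by (meson min_less_iff_conj)
 hence xu: "x:{0..1}" unfolding Per_def by blast
 hence "fn k x:?M" using d(2)[of x] x(2) r(2) by (auto simp: dist_commute)
 moreover obtain N where N: "N>=1" "fn N x = x" using x(1) unfolding Per_def by blast
 have "k<=k * N" using N(1) by simp
 hence "x = fn (k * N - k) (fn k x)" using mult_fix[OF N(2), of k] by (simp flip: funpow_add comp_apply[of "f ^^ _" "f ^^ _"])
 ultimately have "x:?M" using inv_fpow[OF f_orb, of "k * N - k"] by (metis imageI subsetD)
 moreover have "x~:Q" using x(1) solenoid_no_Per[OF Q] by blast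
 ultimately show "EX x:?M. x~:Q & abs (x - z)<e" using x(2) by (intro bexI[of _ x]) (auto simp: dist_real_def)
qed
thus ?thesis using small_pieces_omega[OF H(1), of z y] y H(2) by simp
qed

theorem solenoid_meets_omega: assumes Q: "solen Q" and y: "y:Q" and x: "x:{0..1}" "z:om x" and z: "z:Q" shows "z:om y"
proof (cases "EX t. fn t x:Q")
case True
then obtain t where t: "fn t x:Q" by blast
have "om x = om (fn t x)" using om_fpow[of t x] by simp
thus ?thesis using solenoid_omega(1)[OF Q t y] x(2) by simp
next
case False
obtain H p where H: "gen H p" "Q = QQ H" "!!j. tight Q (H j) (p j)" using tight_system[OF Q] by blast
have zQ: "z:QQ H" using z H(2) by auto
have "small_pieces H p z"
proof (rule tight_small_pieces[OF H z(1)])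
 fix n and e::real assume e: "e>0"
 let ?M = "Orb (H n)"
 obtain k where "fn k z:interior ?M" using solenoid_orb_interior[OF H(1) zQ] by blast
 then obtain N where N: "!!i. i>=N ==> fn i x:?M"
  using omega_enters[OF x cyc_closed[OF gen_pint[OF H(1)]] f_orb cyc_unit[OF gen_pint[OF H(1)]]] by blast
 obtain s where s: "s>=N" "abs (fn s x - z)<e" using omD[OF x(2) e] by blast
 thus "EX x:?M. x~:Q & abs (x - z)<e" using N[OF s(1)] False by blast
qed
thus ?thesis using small_pieces_omega[OF H(1), of z y] y H(2) by simp
qed

text \<open>\<open>f ^^ s\<close> is monotone on the sampled orbit, so \<open>f ^^ (2 * s)\<close>
  is increasing there. Every second sample gives a monotone sequence with some limit
  \<open>z\<close>, and the limit set consists of at most \<open>2 * s\<close> iterates of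
  \<open>z\<close>.\<close>

lemma finite_omegaI: assumes x: "x:{0..1}" and s: "s>=1" and m: "!!i. mlap f (fn i ` range (%j. fn (n + j * s) x))" shows "finite (om x)"
proof -
define O' where "O' = range (%j. fn (n + j * s) x)"
have "mlap (fn s) O'" by (rule mlap_iterate) (simp only: m O'_def)
moreover have O': "fn s t:O'" if "t:O'" for t
proof -
 obtain j where "t = fn (n + j * s) x" using `t:O'` unfolding O'_def by blast
 hence "fn s t = fn (n + Suc j * s) x" using fpow_add[of s "n + j * s" x] by (simp add: add_ac)
 thus ?thesis unfolding O'_def by blast
qed
ultimately have mono: "fn s (fn s u)<=fn s (fn s v)" if "u:O'" "v:O'" "u<=v" for u v using that unfolding mlap_def monotone_on_def by blast
define y where "y j = fn (n + j * (2 * s)) x" for j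
have yO: "y j:O'" for j unfolding y_def O'_def by (rule image_eqI[of _ _ "2 * j"]) (simp_all add: ac_simps)
have yS: "y (Suc j) = fn s (fn s (y j))" for j unfolding y_def by (simp flip: fpow_add add: algebra_simps)
have yM: "y i<=y k ==> y (Suc i)<=y (Suc k)" for i k unfolding yS by (intro mono yO)
have "y 0<=y 1 ==> y j<=y (Suc j)" "y 1<=y 0 ==> y (Suc j)<=y j" for j by (induction j) (simp_all add: yM)
hence "monoseq y" unfolding monoseq_Suc by (cases "y 0<=y 1") auto
moreover have yu: "y j:{0..1}" for j unfolding y_def by (rule fpow_maps[OF x])
hence "Bseq y" by (intro BseqI'[of _ 1]) auto
ultimately obtain z where z: "y \<longlonglongrightarrow> z" using Bseq_monoseq_convergent unfolding convergent_def by blast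
have zu: "z:{0..1}" by (rule closed_sequentially[OF _ yu z]) simp
define S where "S = (%i. fn i z) ` {..<2 * s}"
have finS: "finite S" unfolding S_def by simp
have "w:S" if w: "w:om x" for w
proof (rule ccontr)
 assume "w~:S"
 then obtain d where d: "d>0" "!!v. v:S ==> d<=dist w v" using finite_set_avoid[OF finS, of w] by metis
 have "ALL i:{..<2 * s}. \<forall>\<^sub>F j in sequentially. dist (fn i (y j)) (fn i z)<d / 2"
  using tendstoD[OF continuous_on_tendsto_compose[OF fpow_cont z zu], of "d / 2"] yu d(1) by simp
 hence "\<forall>\<^sub>F j in sequentially. ALL i:{..<2 * s}. dist (fn i (y j)) (fn i z)<d / 2" by (simp add: eventually_ball_finite)
 then obtain N where N: "!!j i. j>=N ==> i<2 * s ==> dist (fn i (y j)) (fn i z)<d / 2" unfolding eventually_sequentially by blast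
 obtain t where t: "t>=n + N * (2 * s)" "abs (fn t x - w)<d / 2" using omD[OF w, of "d / 2"] d(1) by auto
 define i j where "i = (t - n) mod (2 * s)" and "j = (t - n) div (2 * s)"
 have i: "i<2 * s" unfolding i_def using s by simp
 have "N = N * (2 * s) div (2 * s)" using s by simp
 also have "...<=j" unfolding j_def using t(1) by (intro div_le_mono) simp
 finally have j: "N<=j" .
 have "t = i + (n + j * (2 * s))" unfolding i_def j_def using t(1) mod_mult_div_eq[of "t - n" "2 * s"] by (simp add: mult.commute)
 hence "fn t x = fn i (y j)" unfolding y_def by (simp only: fpow_add)
 hence "dist w (fn i z)<d" using N[OF j i] t(2) unfolding dist_real_def by linarith
 moreover have "fn i z:S" unfolding S_def using i by blast
 ultimately show False using d(2) by fastforce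
qed
thus ?thesis using finS by (meson finite_subset subsetI)
qed

section \<open>Infinite limit sets force turning points\<close>

lemma mlap_interval: assumes A: "is_interval A" "A<={0..1}" "A Int C = {}" shows "mlap f A"
proof (cases "A = {}")
case False
have bd: "bdd_below A" "bdd_above A" using A(2) by (meson bdd_below_Icc bdd_below_mono bdd_above_Icc bdd_above_mono)+
have sub: "{Inf A<..<Sup A}<=A"
proof
 fix y assume y: "y:{Inf A<..<Sup A}"
 obtain u where "u:A" "u<y" using y cInf_lessD[OF False, of y] by auto
 moreover obtain v where "v:A" "y<v" using y less_cSupD[OF False, of y] by auto
 ultimately show "y:A" using A(1) unfolding is_interval_1 by (meson less_imp_le)
qed
have "0<=Inf A" "Sup A<=1" by (rule cInf_greatest[OF False], use A(2) in force) (rule cSup_least[OF False], use A(2) in force)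
hence "mlap f {Inf A..Sup A}" using sub A(3) by (intro lap') auto
thus ?thesis by (rule mlap_subset) (auto intro: cInf_lower[OF _ bd(1)] cSup_upper[OF _ bd(2)])
qed (simp add: mlap_def monotone_on_def)

lemma finite_omega_pieces: assumes H: "pint H m" and x: "x:{0..1}" "fn n x:Orb H" and A: "!!i. mlap f (fn i ` H - N)" and N: "!!k. k>=n ==> fn k x~:N"
shows "finite (om x)"
proof -
obtain i0 where i0: "fn n x:fn i0 ` H" using x(2) unfolding orb_def by blast
show ?thesis
proof (rule finite_omegaI[OF x(1) pint_pos[OF H], of n])
 fix i
 have "fn i (fn (n + j * m) x):fn (i + i0) ` H - N" for j
 proof -
  have e: "fn i (fn (n + j * m) x) = fn (i + j * m) (fn n x)" by (simp flip: fpow_add add: add_ac)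
  have "fn (i + j * m) (fn n x):fn (i + j * m) ` fn i0 ` H" using i0 by blast
  also have "... = fn (i + i0) ` H" using pint_return[OF H, of "i + i0" j] by (simp add: img_add ac_simps)
  moreover have "fn i (fn (n + j * m) x)~:N" using N[of "i + (n + j * m)"] by (simp add: fpow_add)
  ultimately show ?thesis using e by simp
 qed
 thus "mlap f (fn i ` range (%j. fn (n + j * m) x))" by (intro mlap_subset[OF A[of "i + i0"]]) blast
qed
qed

lemma no_C_finite_omega: assumes H: "pint H m" "Orb H Int C = {}" and x: "x:{0..1}" "fn n x:Orb H" shows "finite (om x)"
proof (rule finite_omega_pieces[OF H(1) x, of "{}"])
fix i
have "fn i ` H<=Orb H" "connected (fn i ` H)" using fpow_sub_orb pint_conn[OF H(1)] by auto
thus "mlap f (fn i ` H - {})" using H(2) cyc_unit[OF H(1)] by (intro mlap_interval) (auto simp: is_interval_connected_1)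
qed simp

text \<open>In a tight cycle without turning points all limit sets are finite, but those of points
  of a solenoidal set are infinite.\<close>

theorem solenoid_C: assumes Q: "solen Q" shows "Q Int C~={}"
proof
assume QC: "Q Int C = {}"
obtain H p where H: "gen H p" "Q = QQ H" "!!j. tight Q (H j) (p j)" using tight_system[OF Q] by blast
obtain x where x: "x:Q" using solen_ne[OF Q] by blast
have "Orb (H 0) Int C = {}" "x:Orb (H 0)" using H(3)[of 0] QC x unfolding tight_def by blast+
hence "finite (om x)" using no_C_finite_omega[OF gen_pint[OF H(1)], of 0 x 0] solenoid_omega(5)[OF Q x x] by simp
thus False using solenoid_omega(4)[OF Q x x] by simp
qed

section \<open>Basic sets and turning points\<close>

definition bas::"real set => nat => bool" where
"bas I m <-> pint I m & infinite (Bs I)"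

lemma basD: "bas I m ==> pint I m" "bas I m ==> infinite (Bs I)" unfolding bas_def by auto

lemma bas_iff: "basic_set_of f I m B <-> bas I m & B = Bs I" unfolding bas_def basic_set_of_def by auto

lemma bas_orbit: assumes b: "bas I m" shows "EX x:{0..1}. EX n. Bs I<=om x & infinite (om x) & (ALL k>=n. fn k x:Orb I)"
proof -
note I = basD(1)[OF b] and inf = basD(2)[OF b]
obtain x where x: "x:{0..1}" "Bs I<=om x" using basic_subset_omega_limit[OF I inf] by blast
obtain y where y: "y:Bs I" "y:interior (Orb I)" using infinite_interior[OF inf B_sub pint_bdry[OF I] finite.emptyI] by blast
have "EX N. ALL n>=N. fn n x:Orb I"
 by (rule omega_enters[OF x(1) subsetD[OF x(2) y(1)] cyc_closed[OF I] f_orb cyc_unit[OF I], of 0]) (use y(2) in simp)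
thus ?thesis using x inf finite_subset[OF x(2)] by blast
qed

lemma bas_C: "bas I m ==> Orb I Int C~={}" using bas_orbit[of I m] no_C_finite_omega[OF basD(1)] by (metis order_refl)

text \<open>An orbit dense in a basic set of a cycle cannot enter a cycle that does not contain the former; outside, the pieces are laps.\<close>

lemma same_trace_nested: assumes b: "bas I m" and I': "pint I' m'" and C: "Orb I Int C<=Orb I'" shows "Orb I<=Orb I' | Orb I'<=Orb I"
proof (rule ccontr)
assume "~ ?thesis"
hence nsub: "~ Orb I<=Orb I'" "~ Orb I'<=Orb I" by auto
note I = basD(1)[OF b]
obtain x n where x: "x:{0..1}" "Bs I<=om x" "infinite (om x)" and n: "!!k. k>=n ==> fn k x:Orb I" using bas_orbit[OF b] by blast
have out: "fn k x~:Orb I'" for k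
proof
 assume "fn k x:Orb I'"
 hence "Bs I<=Orb I'" using om_least[OF cyc_closed[OF I'] f_orb, of k x] x(2) by blast
 then obtain y where y: "y:Bs I" "y:interior (Orb I')" using infinite_interior[OF basD(2)[OF b] _ pint_bdry[OF I'] finite.emptyI] by blast
 show False using B_interior_inv[OF y cyc_closed[OF I'] f_orb] nsub(1) by simp
qed
have "mlap f (fn i ` I - Orb I')" for i
proof (rule mlap_interval)
 obtain l r where lr: "0<=l" "l<=r" "r<=1" "fn i ` I = {l..r}" using pint_piece[OF I, of i] by blast
 have PM: "{l..r}<=Orb I" using fpow_sub_orb[of i I] lr(4) by simp
 thus "(fn i ` I - Orb I') Int C = {}" "fn i ` I - Orb I'<={0..1}" using C lr by auto
 \<comment> \<open>A piece of the second cycle between two points outside of that cycle would lie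
   inside a piece of the first one, and the cycles would be nested.\<close>
 show "is_interval (fn i ` I - Orb I')" unfolding lr(4) is_interval_1
 proof (intro ballI allI impI)
  fix u v t assume uv: "u:{l..r} - Orb I'" "v:{l..r} - Orb I'" "u<=t & t<=v"
  have "t~:Orb I'"
  proof
   assume "t:Orb I'"
   then obtain K where K: "pint K m'" "Orb K = Orb I'" "t:K" using pint_at[OF I'] by metis
   obtain c d where cd: "K = {c..d}" using pint_obtain[OF K(1)] by metis
   have "K<=Orb I'" using K(2) sub_orb by blast
   hence "u~:K" "v~:K" using uv(1,2) by blast+
   hence "K<={l..r}" using K(3) uv unfolding cd by auto
   hence "Orb K<=Orb I" using PM by (intro orb_orb) blast
   thus False using nsub(2) K(2) by simp
  qed
  thus "t:{l..r} - Orb I'" using uv by auto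
 qed
qed
thus False using finite_omega_pieces[OF I x(1) n[OF order_refl], of "Orb I'"] out x(3) by blast
qed

definition ends::"real set => real set" where
"ends I = {x. EX i a b. fn i ` I = {a..b} & (x = a | x = b)}"

lemma finite_ends: assumes I: "pint I m" shows "finite (ends I)"
proof -
have "x:(%i. Inf (fn i ` I)) ` {..<m} Un (%i. Sup (fn i ` I)) ` {..<m}" if "x:ends I" for x
proof -
 obtain i a b where i: "fn i ` I = {a..b}" "x = a | x = b" using `x:ends I` unfolding ends_def by blast
 have "a<=b" using pint_piece[OF I, of i] i(1) by (auto simp: Icc_eq_Icc)
 hence "x = Inf (fn (i mod m) ` I) | x = Sup (fn (i mod m) ` I)" using i pint_mod[OF I, of i] by auto
 thus ?thesis using pint_mod_less[OF I, of i] by blast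
qed
hence "ends I<=(%i. Inf (fn i ` I)) ` {..<m} Un (%i. Sup (fn i ` I)) ` {..<m}" by blast
thus ?thesis by (rule finite_subset) simp
qed

text \<open>If an endpoint of a piece of the cycle \<open>M\<close> were not in \<open>M'\<close>, then the edges, i.e. the parts of the pieces of \<open>M\<close> on one side
 of all points of \<open>M'\<close>, could only be reached from edges; as \<open>f\<close> is monotone on each edge, a dense orbit would be finite.\<close>

lemma basic_ends: assumes b: "bas I m" and I': "pint I' m'" and sub: "Orb I'<=Orb I" and C: "Orb I Int C<=Orb I'" shows "ends I<=Orb I'"
proof (rule ccontr)
assume nsub: "~ ends I<=Orb I'"
note I = basD(1)[OF b]
define M M' where "M = Orb I" and "M' = Orb I'"
define P where "P i = fn i ` I" for i
define L where "L i = {t:P i. ALL w:M' Int P i. t<w}" for i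
define R where "R i = {t:P i. ALL w:M' Int P i. w<t}" for i
define \<G> where "\<G> = range L Un range R"
define W where "W = \<Union>\<G>"
have fP: "f ` P i = P (Suc i)" for i unfolding P_def by (simp only: fpow_Suc_image)
have PM: "P i<=M" for i unfolding P_def M_def by (rule fpow_sub_orb)
have MP: "EX i. t:P i" if "t:M" for t using that unfolding M_def P_def orb_def by blast
have Peq: "P i = P j" if "t:P i" "t:P j" for t i j using that pint_piece_eq[OF I] unfolding P_def by blast
have LR: "L i = L j" "R i = R j" if "P i = P j" for i j using that unfolding L_def R_def by auto
have Pmod: "P i = P (i mod m)" for i unfolding P_def by (rule pint_mod[OF I])
have fM': "f t:M'" if "t:M'" for t using that f_orb[of I'] unfolding M'_def by blast
have Pint: "EX l r. 0<=l & l<=r & r<=1 & P i = {l..r}" for i unfolding P_def by (rule pint_piece[OF I])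
have Pcomp: "compact (M' Int P i)" for i unfolding P_def M'_def by (intro closed_Int_compact cyc_closed[OF I'] pint_compact[OF I])
have M'P: "M' Int P i~={}" for i
proof -
 obtain z where "z:M'" using pint_nonempty[OF I'] sub_orb unfolding M'_def by blast
 then obtain j where j: "z:M'" "z:P j" using sub MP unfolding M_def M'_def by blast
 hence "fn (i + (m - 1) * j) z:P (i + (m - 1) * j + j)" unfolding P_def by (subst img_add[symmetric]) blast
 moreover have e: "i + (m - 1) * j + j = i + j * m" using pint_pos[OF I] by (cases m) (auto simp: algebra_simps)
 have "P (i + (m - 1) * j + j) = P i" unfolding e P_def by (rule pint_return[OF I])
 ultimately have "fn (i + (m - 1) * j) z:P i" by simp
 moreover have "fn (i + (m - 1) * j) z:M'" using inv_fpow[OF f_orb, of _ I'] j(1) unfolding M'_def by blast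
 ultimately show ?thesis by blast
qed
have lapC: "mlap f {u..v}" if "{u..v}<=P i" "{u<..<v} Int (M' Int P i) = {}" "u<=v" for u v i
proof (rule lap')
 obtain l r where lr: "0<=l" "r<=1" "P i = {l..r}" using Pint[of i] by blast
 have "{u..v}<={l..r}" using that(1) unfolding lr(3) .
 thus "0<=u" "v<=1" using lr(1,2) that(3) by auto
 have "c:{u<..<v} Int (M' Int P i)" if "c:{u<..<v}" "c:C" for c
 proof -
  have "c:P i" using that(1) `{u..v} <= P i` by auto
  thus ?thesis using that PM[of i] C unfolding M_def M'_def by blast
 qed
 thus "{u<..<v} Int C = {}" using that(2) by blast
qed
have edge: "EX A b0. mlap f A & insert b0 G<=A & b0:M' Int P i & ((ALL t:G. t<b0) | (ALL t:G. b0<t))" if "G = L i | G = R i" for G i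
proof -
 obtain l r where lr: "0<=l" "r<=1" "P i = {l..r}" using Pint[of i] by blast
 note IS = cpt_Inf_Sup[OF Pcomp[of i] M'P[of i]]
 have ir: "Inf (M' Int P i):{l..r}" "Sup (M' Int P i):{l..r}" using IS(1,2) unfolding lr(3) by auto
 have gaps: "{l<..<Inf (M' Int P i)} Int (M' Int P i) = {}" "{Sup (M' Int P i)<..<r} Int (M' Int P i) = {}" using IS(3,4) by fastforce+
 have tP: "l<=t & t<=r" if "t:P i" for t using that unfolding lr(3) by simp
 show ?thesis
 proof (cases "G = L i")
  case True
  have "{l..Inf (M' Int P i)}<={l..r}" using ir(1) by simp
  hence "{l..Inf (M' Int P i)}<=P i" by (simp only: lr(3))
  hence m: "mlap f {l..Inf (M' Int P i)}" by (rule lapC[OF _ gaps(1)]) (use ir in simp)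
  have G: "l<=t & t<Inf (M' Int P i)" if "t:G" for t using that True IS(1) tP[of t] unfolding L_def by simp
  hence "insert (Inf (M' Int P i)) G<={l..Inf (M' Int P i)}" using ir(1) by fastforce
  thus ?thesis using m IS(1) G by blast
 next
  case False
  hence GR: "G = R i" using that by simp
  have "{Sup (M' Int P i)..r}<={l..r}" using ir(2) by simp
  hence "{Sup (M' Int P i)..r}<=P i" by (simp only: lr(3))
  hence m: "mlap f {Sup (M' Int P i)..r}" by (rule lapC[OF _ gaps(2)]) (use ir in simp)
  have G: "t<=r & Sup (M' Int P i)<t" if "t:G" for t using that GR IS(2) tP[of t] unfolding R_def by simp
  hence "insert (Sup (M' Int P i)) G<={Sup (M' Int P i)..r}" using ir(2) by fastforce
  thus ?thesis using m IS(2) G by blast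
 qed
qed
have Gp: "EX i. t:P i & (G = L i | G = R i)" if "G:\<G>" "t:G" for t G using that unfolding \<G>_def L_def R_def by auto
have side_of: "(G = L i & (ALL w:M' Int P i. t<w)) | (G = R i & (ALL w:M' Int P i. w<t))" if G: "G:\<G>" "t:G" "t:P i" for t G i
proof -
 obtain j where j: "t:P j" "G = L j | G = R j" using Gp[OF G(1,2)] by blast
 have "G = L i | G = R i" using j(2) LR[OF Peq[OF G(3) j(1)]] by auto
 thus ?thesis using G(2) unfolding L_def R_def by auto
qed
\<comment> \<open>A point of \<open>M\<close> outside the edges lies in \<open>M'\<close> or in a
  gap between two points of \<open>M'\<close>. On such a gap \<open>f\<close> is monotone, so the
  image lies between points of \<open>M'\<close> and not in an edge.\<close>
have W1: "t:W" if t: "t:M" "f t:W" for t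
proof (rule ccontr)
 assume nW: "t~:W"
 obtain i where i: "t:P i" using MP[OF t(1)] by blast
 obtain G where G: "G:\<G>" "f t:G" using t(2) unfolding W_def by blast
 have ft: "f t:P (Suc i)" using i fP by blast
 note s = side_of[OF G ft]
 have "t~:M'" using s fM'[of t] ft by blast
 hence tM: "t~:M' Int P i" by simp
 have "t~:L i" "t~:R i" using nW unfolding W_def \<G>_def by blast+
 then obtain w1 w2 where w: "w1:M' Int P i" "w1<=t" "w2:M' Int P i" "t<=w2" using i unfolding L_def R_def by (auto simp: not_less)
 obtain u v where uv: "u:M' Int P i" "v:M' Int P i" "u<t" "t<v" "{u<..<v} Int (M' Int P i) = {}"
  using gap_around[OF Pcomp tM w] by (elim bexE conjE) (rule that)
 have "{u..v}<=P i" using uv(1,2) pint_conn[OF I] unfolding P_def by (intro connected_contains_Icc) auto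
 hence "mlap f {u..v}" by (rule lapC[OF _ uv(5)]) (use uv in simp)
 hence "min (f u) (f v)<=f t & f t<=max (f u) (f v)" by (rule mlap_between) (use uv in auto)
 moreover have "f u:M' Int P (Suc i)" "f v:M' Int P (Suc i)" using uv fM' fP[of i] by blast+
 hence "(f t<f u & f t<f v) | (f u<f t & f v<f t)" using s by blast
 ultimately show False by auto
qed
\<comment> \<open>\<open>f\<close> is monotone on the edge together with the adjacent point
  \<open>b0\<close> of \<open>M'\<close>, so both images lie on the same side of
  \<open>f b0\<close>.\<close>
have W2: "EX G':\<G>. f t:G' & f u:G'" if G: "G:\<G>" "t:G" "u:G" and W: "f t:W" "f u:W" for G t u
proof -
 obtain i where i: "t:P i" "G = L i | G = R i" using Gp[OF G(1,2)] by blast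
 have u: "u:P i" using i(2) G(3) unfolding L_def R_def by auto
 obtain G1 G2 where G12: "G1:\<G>" "f t:G1" "G2:\<G>" "f u:G2" using W unfolding W_def by blast
 have ft: "f t:P (Suc i)" "f u:P (Suc i)" using i u fP by blast+
 note s = side_of[OF G12(1,2) ft(1)] side_of[OF G12(3,4) ft(2)]
 obtain A b0 where A: "mlap f A" "insert b0 G<=A" "b0:M' Int P i" "(ALL t:G. t<b0) | (ALL t:G. b0<t)" using edge[OF i(2)] by blast
 have fb: "f b0:M' Int P (Suc i)" using A(3) fM' fP[of i] by blast
 have m: "mono_on A f | antimono_on A f" "b0:A" "t:A" "u:A" using A(1,2) G unfolding mlap_def by auto
 have m': "((t<=b0 --> f t<=f b0) & (u<=b0 --> f u<=f b0) & (b0<=t --> f b0<=f t) & (b0<=u --> f b0<=f u)) |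
   ((t<=b0 --> f b0<=f t) & (u<=b0 --> f b0<=f u) & (b0<=t --> f t<=f b0) & (b0<=u --> f u<=f b0))" using m unfolding monotone_on_def by blast
 have tu: "(t<b0 & u<b0) | (b0<t & b0<u)" using A(4) G(2,3) by blast
 have s1: "(G1 = L (Suc i) & f t<f b0) | (G1 = R (Suc i) & f b0<f t)" using s(1) fb by blast
 have s2: "(G2 = L (Suc i) & f u<f b0) | (G2 = R (Suc i) & f b0<f u)" using s(2) fb by blast
 have "G1 = G2" using m' tu s1 s2 by (elim disjE conjE) simp_all
 thus ?thesis using G12 by blast
qed
obtain x n where x: "x:{0..1}" "B_set M f<=om x" "infinite (om x)" and n: "!!k. k>=n ==> fn k x:M" using bas_orbit[OF b] unfolding M_def by blast
have finG: "finite \<G>"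
proof -
 have "L i = L (i mod m)" "R i = R (i mod m)" for i using LR[OF Pmod] by auto
 hence "range L<=L ` {..<m}" "range R<=R ` {..<m}" using pint_mod_less[OF I] by blast+
 thus ?thesis unfolding \<G>_def by (meson finite_UnI finite_imageI finite_lessThan finite_subset)
qed
have Gconn: "connected G" if "G:\<G>" for G
proof -
 obtain i where i: "G = L i | G = R i" using `G:\<G>` unfolding \<G>_def by blast
 obtain l r where lr: "P i = {l..r}" using Pint[of i] by blast
 have "t:G" if ut: "u:G" "v:G" "u<=t & t<=v" for u v t
 proof -
  have uv: "u:P i" "v:P i" using i ut(1,2) unfolding L_def R_def by auto
  hence "t:P i" using ut(3) unfolding lr by auto
  thus ?thesis using i ut unfolding L_def R_def by (elim disjE) (simp_all, (meson le_less_trans less_le_trans)+)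
 qed
 hence "is_interval G" unfolding is_interval_1 by blast
 thus ?thesis by (simp add: is_interval_connected_1)
qed
obtain e where e: "e:ends I" "e~:M'" using nsub unfolding M'_def by blast
obtain i l r where lr: "P i = {l..r}" "e = l | e = r" using e(1) unfolding ends_def P_def by blast
have i: "e:P i" using Pint[of i] lr(2) unfolding lr(1) by (auto simp: Icc_eq_Icc)
have "EX d>0. M Int ball e d<=W"
proof -
 obtain d1 where d1: "d1>0" "ball e d1 Int M<=P i"
  using pint_local[OF pint_shift[OF I] i[unfolded P_def]] shift_orb[OF I] unfolding M_def P_def by auto
 have "open (- (M' Int P i))" "e:- (M' Int P i)" using open_Compl[OF compact_imp_closed[OF Pcomp]] e(2) by blast+
 then obtain d2 where d2: "d2>0" "ball e d2 <= - (M' Int P i)" using open_contains_ball by blast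
 have "t:W" if t: "t:M" "t:ball e (min d1 d2)" for t
 proof -
  have tP: "t:P i" using t d1(2) by auto
  have "d2<=abs (w - e)" if "w:M' Int P i" for w using d2(2) that by (force simp: dist_real_def)
  moreover have "abs (t - e)<d2" using t(2) by (simp add: dist_real_def abs_minus_commute)
  ultimately have tw: "abs (t - e)<abs (w - e)" if "w:M' Int P i" for w using that by fastforce
  have "l<=w & w<=r" if "w:P i" for w using that unfolding lr(1) by simp
  hence "t<w" if "w:M' Int P i" "e = l" for w using tw[OF that(1)] that tP by fastforce
  moreover have "w<t" if "w:M' Int P i" "e = r" for w using tw[OF that(1)] that tP `!!w. w:P i ==> l <= w & w <= r` by fastforce
  ultimately have "t:L i | t:R i" using lr(2) tP unfolding L_def R_def by blast
  thus ?thesis unfolding W_def \<G>_def by blast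
 qed
 thus ?thesis using d1(1) d2(1) by (intro exI[of _ "min d1 d2"]) auto
qed
then obtain d where d: "d>0" "M Int ball e d<=W" by blast
obtain b0 where b0: "b0:B_set M f" using basD(2)[OF b] unfolding M_def by (metis finite.emptyI ex_in_conv)
obtain s where s: "DG M b0 s" using basic_DG_exists[OF I basD(2)[OF b]] b0 unfolding M_def by blast
\<comment> \<open>Near the end point \<open>e\<close> the cycle consists of edges. A germ at
  \<open>b0\<close> without points of edges would never enter an edge, although its orbit is
  dense.\<close>
have meet: "(UN G:\<G>. G) Int ger b0 s q~={}" if q: "q>0" for q
proof
 assume emp: "(UN G:\<G>. G) Int ger b0 s q = {}"
 obtain q' where q': "q'>0" "q'<=q" "ger b0 s q'<=M" using DG_small[OF s q] by blast
 have fM: "f t:M" if "t:M" for t using that f_orb[of I] unfolding M_def by blast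
 have inv: "f ` (M - W)<=M - W" using fM W1 by (intro image_subsetI DiffI) auto
 have "(UN G:\<G>. G) = W" unfolding W_def by simp
 hence "ger b0 s q'<=M - W" using emp q'(3) ger_mono[OF q'(2), of b0 s] by blast
 hence o: "Orb (ger b0 s q')<=M - W" by (rule orb_least[OF _ inv])
 have "e:Cl (ger b0 s q')" using DG_dense[OF s q'(1)] i PM[of i] by blast
 then obtain y where "y:Orb (ger b0 s q')" "dist y e<d" using d(1) unfolding closure_approachable by blast
 thus False using d(2) o by (auto simp: dist_commute)
qed
obtain G q where G: "G:\<G>" "q>0" "ger b0 s q<=G" using finite_UN_ger[OF DG_side[OF s], of \<G> "%G. G", OF Gconn finG meet] by blast
obtain b' where b': "b':B_set M f" "b':ger b0 s q" using basic_perfect[OF I basD(2)[OF b]] s G(2) unfolding M_def by blast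
\<comment> \<open>The orbit visits edges arbitrarily late, and edges are reached only from edges; so
  it has been in edges ever since time \<open>n\<close>.\<close>
have yW: "fn k x:W" if k: "k>=n" for k
proof -
 obtain k' where k': "k'>=k" "fn k' x:ger b0 s q" using omega_visits[OF x(1) subsetD[OF x(2) b'(1)] ger_open[OF DG_side[OF s]] b'(2)] by blast
 hence "fn k' x:W" using G unfolding W_def by blast
 from k'(1) this show ?thesis
 proof (induction rule: inc_induct)
  case (step j)
  hence "f (fn j x):W" by simp
  thus ?case using W1 n[of j] step(1) k by simp
 qed
qed
define \<gamma> where "\<gamma> k = (SOME G. G:\<G> & fn k x:G)" for k
have \<gamma>: "\<gamma> k:\<G> & fn k x:\<gamma> k" if "k>=n" for k
 unfolding \<gamma>_def using someI_ex[of "%G. G:\<G> & fn k x:G"] yW[OF that] unfolding W_def by blast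
have uniq: "G1 = G2" if G: "G1:\<G>" "G2:\<G>" "t:G1" "t:G2" for G1 G2 t
proof -
 obtain i where ti: "t:P i" using Gp[OF G(1,3)] by blast
 obtain w where w: "w:M' Int P i" using M'P[of i] by blast
 have "(G1 = L i & t<w) | (G1 = R i & w<t)" using side_of[OF G(1,3) ti] w by blast
 moreover have "(G2 = L i & t<w) | (G2 = R i & w<t)" using side_of[OF G(2,4) ti] w by blast
 ultimately show ?thesis by auto
qed
\<comment> \<open>The edge of an iterate determines the edge of the next one. As there are finitely
  many edges, the sequence of edges is eventually periodic.\<close>
have step: "\<gamma> (Suc k) = \<gamma> (Suc j)" if eq: "\<gamma> k = \<gamma> j" "k>=n" "j>=n" for j k
proof -
 have "f (fn k x):W" "f (fn j x):W" using yW[of "Suc k"] yW[of "Suc j"] eq by auto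
 moreover have "fn j x:\<gamma> k" using \<gamma>[OF eq(3)] eq(1) by simp
 ultimately obtain G' where G': "G':\<G>" "(f ^^ Suc k) x:G'" "(f ^^ Suc j) x:G'"
  using W2[of "\<gamma> k" "fn k x" "fn j x"] \<gamma>[OF eq(2)] by auto
 show ?thesis using uniq[OF _ G'(1) _ G'(2), of "\<gamma> (Suc k)"] uniq[OF _ G'(1) _ G'(3), of "\<gamma> (Suc j)"]
  \<gamma>[of "Suc k"] \<gamma>[of "Suc j"] eq(2,3) by simp
qed
have "~ inj_on \<gamma> {n..}" using finite_imageD[of \<gamma> "{n..}"] finite_subset[OF _ finG, of "\<gamma> ` {n..}"] \<gamma> infinite_Ici by blast
then obtain j k where "j<k" "\<gamma> j = \<gamma> k" "n<=j" unfolding inj_on_def by (metis atLeast_iff linorder_neqE_nat)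
then obtain s' where s': "s'>=1" "\<gamma> j = \<gamma> (j + s')" "n<=j" by (metis add_diff_inverse_nat less_imp_not_less zero_less_diff Suc_leI One_nat_def)
have per: "\<gamma> (j + i + s') = \<gamma> (j + i)" for i
proof (induction i)
 case (Suc i)
 thus ?case using step[of "j + i + s'" "j + i"] s'(3) by simp
qed (simp add: s'(2))
have per': "\<gamma> (j + i + l * s') = \<gamma> (j + i)" for i l
proof (induction l)
 case (Suc l)
 thus ?case using per[of "i + l * s'"] by (simp add: ac_simps)
qed simp
have "finite (om x)"
proof (rule finite_omegaI[OF x(1) s'(1), of j])
 fix i
 have "fn i (fn (j + l * s') x):\<gamma> (j + i)" for l
  using \<gamma>[of "j + i + l * s'"] per'[of i l] s'(3) fpow_add[of i "j + l * s'" x] by (simp add: ac_simps)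
 hence sub: "fn i ` range (%l. fn (j + l * s') x)<=\<gamma> (j + i)" by auto
 obtain i' where "\<gamma> (j + i) = L i' | \<gamma> (j + i) = R i'"
  using Gp[of "\<gamma> (j + i)" "fn (j + i) x"] \<gamma>[of "j + i"] s'(3) by auto
 then obtain A where "mlap f A" "\<gamma> (j + i)<=A" using edge by (metis insert_subset)
 thus "mlap f (fn i ` range (%l. fn (j + l * s') x))" using sub by (meson mlap_subset subset_trans)
qed
thus False using x(3) by simp
qed

text \<open>With equal periods, a piece of the larger cycle would contain just one piece of the
  smaller one, and by \<open>basic_ends\<close> this would contain both its end points.\<close>

lemma basic_period_less: assumes b: "bas I m" and I': "pint I' m'" and sub: "Orb I' \<subset> Orb I" and C: "Orb I Int C<=Orb I'" shows "m<m'"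
proof (rule ccontr)
note I = basD(1)[OF b]
assume "~ m<m'"
hence m: "m' = m" using pint_nested_le[OF I I'] sub by auto
obtain z where z: "z:I'" using pint_nonempty[OF I'] by blast
hence "z:Orb I" using sub sub_orb[of I'] by blast
then obtain J where J: "pint J m" "Orb J = Orb I" "z:J" using pint_at[OF I] by metis
have I'J: "I'<=J" by (rule pint_nested[OF J(1) I' _ J(3) z]) (use sub J(2) in auto)
obtain c d where cd: "c<=d" "J = {c..d}" using pint_obtain[OF J(1)] by metis
have bJ: "bas J m" using b J(1,2) unfolding bas_def by simp
have "ends J<=Orb I'" by (rule basic_ends[OF bJ I']) (use sub C J(2) in auto)
moreover have "fn 0 ` J = {c..d}" using cd by simp
hence "c:ends J" "d:ends J" unfolding ends_def by blast+
ultimately have cdo: "c:Orb I'" "d:Orb I'" by auto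
have "w:I'" if w: "w:Orb I'" "w:J" for w
proof -
 obtain k where k: "w:fn k ` I'" using w(1) unfolding orb_def by blast
 hence "fn k ` J Int fn 0 ` J~={}" using I'J w(2) by auto
 hence "k mod m = 0 mod m" by (rule pint_disjoint[OF J(1)])
 thus ?thesis using k pint_mod[OF I', of k] m by simp
qed
hence "c:I'" "d:I'" using cdo cd by auto
hence "J<=I'" unfolding cd(2) using pint_conn[OF I', of 0] by (intro connected_contains_Icc) auto
thus False using orb_mono[of J I'] J(2) sub by auto
qed

section \<open>Intersections and chains of basic sets\<close>

lemma basic_avoids_interior: assumes I': "pint I' m'" and nsub: "~ Orb I<=Orb I'" shows "Bs I Int interior (Orb I') = {}"
using B_interior_inv[OF _ _ cyc_closed[OF I'] f_orb] nsub by blast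

lemma basic_finite_part: assumes I': "pint I' m'" and nsub: "~ Orb I<=Orb I'" shows "finite (Bs I Int Orb I')"
by (rule finite_subset[OF _ pint_bdry[OF I']]) (use basic_avoids_interior[OF assms] in blast)

lemma basic_inter_finite: assumes b: "bas I m" "bas I' m'" and ne: "Orb I~=Orb I'" shows "finite (Bs I Int B_set (Orb I') f)"
proof (cases "Orb I<=Orb I'")
case False
show ?thesis by (rule finite_subset[OF _ basic_finite_part[OF basD(1)[OF b(2)] False]]) (use B_sub in blast)
next
case True
hence nsub: "~ Orb I'<=Orb I" using ne by blast
show ?thesis by (rule finite_subset[OF _ basic_finite_part[OF basD(1)[OF b(1)] nsub]]) (use B_sub in blast)
qed

lemma basic_determines: "bas I m ==> bas I' m' ==> Bs I = B_set (Orb I') f ==> Orb I = Orb I'"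
using basic_inter_finite[of I m I' m'] basD(2)[of I m] by auto

lemma finite_A_set: "pint I m ==> finite (A_set f I B)" by (rule finite_subset[OF _ finite_ends]) (auto simp: A_set_def ends_def)

lemma B_local: assumes y: "y:B_set M f" "e>0" and N: "M Int ball y e<=N" "closed N" "f ` N<=N" shows "M<=N"
using B_setD[OF y(1), of "ball y e"] cl_orb_least[OF N(1,3,2)] y(2) by simp

lemma local_shape: assumes b: "bas I m" and y: "y:Orb I" shows "EX T e. T:{UNIV, {y..}, {..y}} & e>0 & Orb I Int ball y e = T Int ball y e"
proof -
note I = basD(1)[OF b]
obtain J where J: "pint J m" "Orb J = Orb I" "y:J" using pint_at[OF I y] by metis
have "infinite (Orb J)" unfolding J(2) by (rule B_set_infinite_orb[OF basD(2)[OF b]])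
then obtain l r where lr: "l<r" "fn 0 ` J = {l..r}" using pint_nondegenerate[OF J(1), of 0] by metis
hence Jlr: "J = {l..r}" by simp
obtain d where d: "d>0" "ball y d Int Orb I<=J" using pint_local[OF J(1,3)] unfolding J(2) by blast
have JI: "J<=Orb I" using sub_orb[of J] J(2) by simp
have eq: "Orb I Int ball y e = J Int ball y e" if "e<=d" for e using d(2) JI that by auto
consider "y = l" | "y = r" | "l<y" "y<r" using J(3) unfolding Jlr by fastforce
thus ?thesis
proof cases
 case 1
 have "Orb I Int ball y (min d (r - l)) = {y..} Int ball y (min d (r - l))" unfolding eq[OF min.cobounded1] Jlr using 1 by (auto simp: dist_real_def)
 thus ?thesis using d(1) lr(1) by (intro exI[of _ "{y..}"] exI[of _ "min d (r - l)"]) auto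
next
 case 2
 have "Orb I Int ball y (min d (r - l)) = {..y} Int ball y (min d (r - l))" unfolding eq[OF min.cobounded1] Jlr using 2 by (auto simp: dist_real_def)
 thus ?thesis using d(1) lr(1) by (intro exI[of _ "{..y}"] exI[of _ "min d (r - l)"]) auto
next
 case 3
 have "Orb I Int ball y (min d (min (y - l) (r - y))) = UNIV Int ball y (min d (min (y - l) (r - y)))"
  unfolding eq[OF min.cobounded1] Jlr by (auto simp: dist_real_def)
 thus ?thesis using d(1) 3 by (intro exI[of _ UNIV] exI[of _ "min d (min (y - l) (r - y))"]) auto
qed
qed

text \<open>Near a common point of three different cycles two of them would have to lie on different sides, and the third one would be
 their union.\<close>

lemma basic_triple: assumes b: "!!i. i<(3::nat) ==> bas (I i) (m i)" and ne: "!!i j. i<3 ==> j<3 ==> i~=j ==> Orb (I i)~=Orb (I j)"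
 and y: "!!i. i<3 ==> y:Bs (I i)" shows False
proof -
define M where "M i = Orb (I i)" for i
have cl: "closed (M i)" "f ` M i<=M i" if "i<3" for i unfolding M_def using cyc_closed[OF basD(1)[OF b[OF that]]] f_orb by auto
have yM: "y:B_set (M i) f" if "i<3" for i unfolding M_def by (rule y[OF that])
have "EX T e. T:{UNIV, {y..}, {..y}} & e>0 & M i Int ball y e = T Int ball y e" if "i<3" for i
 unfolding M_def by (rule local_shape[OF b[OF that]]) (use y[OF that] B_sub in blast)
then obtain T e where T: "!!i. i<3 ==> T i:{UNIV, {y..}, {..y}} & e i>0 & M i Int ball y (e i) = T i Int ball y (e i)" by metis
define d where "d = min (e 0) (min (e 1) (e 2))"
have d: "d>0" "d<=e i" if "i<3" for i
proof -
 have "i = 0 | i = 1 | i = 2" using that by auto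
 thus "d>0" "d<=e i" unfolding d_def using T[of 0] T[of 1] T[of 2] by auto
qed
have Td: "M i Int ball y d = T i Int ball y d" if "i<3" for i
proof -
 have "ball y d<=ball y (e i)" using d(2)[OF that] by auto
 thus ?thesis using T[OF that] by blast
qed
have sub: "M i<=M j" if "i<3" "j<3" "T i<=T j" for i j
 by (rule B_local[OF yM[OF that(1)] d(1)[OF that(1)] _ cl[OF that(2)]]) (use Td[OF that(1)] Td[OF that(2)] that(3) in blast)
have Tne: "T i~=T j" if "i<3" "j<3" "i~=j" for i j using sub[OF that(1,2)] sub[OF that(2,1)] ne[OF that] unfolding M_def by blast
have union: False if ijk: "i<3" "j<3" "k<3" "i~=j" "i~=k" "T i = UNIV" "T j Un T k = UNIV" for i j k
proof -
 have "M i<=M j Un M k"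
 proof (rule B_local[OF yM[OF ijk(1)] d(1)[OF ijk(1)]])
  show "M i Int ball y d<=M j Un M k" using Td[OF ijk(2)] Td[OF ijk(3)] ijk(7) by blast
 qed (use cl ijk in "auto simp: image_Un")
 moreover have "M j<=M i" "M k<=M i" using sub ijk by auto
 hence "~ M i<=M j" "~ M i<=M k" using ne[OF ijk(1,2,4)] ne[OF ijk(1,3,5)] unfolding M_def by blast+
 hence "finite (B_set (M i) f Int M j Un B_set (M i) f Int M k)"
  unfolding M_def using basic_finite_part[OF basD(1)[OF b[OF ijk(2)]]] basic_finite_part[OF basD(1)[OF b[OF ijk(3)]]] by simp
 ultimately have "finite (B_set (M i) f)" using B_sub[of "M i"] by (elim finite_subset[rotated]) blast
 thus False using basD(2)[OF b[OF ijk(1)]] unfolding M_def by simp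
qed
have cov: "{y..} Un {..y} = (UNIV::real set)" "{..y} Un {y..} = (UNIV::real set)" by auto
have "T 0:{UNIV, {y..}, {..y}}" "T 1:{UNIV, {y..}, {..y}}" "T 2:{UNIV, {y..}, {..y}}" using T by auto
thus False using union[of 0 1 2, simplified] union[of 1 0 2, simplified] union[of 2 0 1, simplified]
  Tne[of 0 1, simplified] Tne[of 0 2, simplified] Tne[of 1 2, simplified] by (elim insertE emptyE) (simp_all add: cov)
qed

text \<open>The orbit of a common point gets into the interior of every generating cycle, so all of
  \<open>Orb I\<close> would lie in \<open>Q\<close>. But a periodic interval contains a periodic
  point.\<close>

lemma solenoid_basic_disjoint: assumes Q: "solen Q" and b: "bas I m" shows "Q Int Bs I = {}"
proof (rule ccontr)
assume "~ ?thesis"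
then obtain x where x: "x:Q" "x:Bs I" by blast
obtain K p where K: "gen K p" "Q = QQ K" using Q unfolding solenoidal_Q_def by blast
have xK: "x:QQ K" using x K by simp
have "Orb I<=Orb (K n)" for n
proof -
 obtain k where "fn k x~:Orb (K n) - interior (Orb (K n))" using gen_leave_finite[OF K(1) xK pint_bdry[OF gen_pint[OF K(1)]]] by blast
 hence "fn k x:interior (Orb (K n))" using gen_fpow_Q[OF K(1) xK, of k] by blast
 moreover have "fn k x:Bs I" by (induction k) (use x(2) B_set_invariant[OF basD(1)[OF b]] in auto)
 ultimately show ?thesis using basic_avoids_interior[OF gen_pint[OF K(1)]] by blast
qed
hence "Orb I<=Q" unfolding K(2) by blast
moreover obtain z where "z:I" "z:Per f" using pint_has_periodic[OF basD(1)[OF b]] by blast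
ultimately show False using solenoid_no_Per[OF Q] sub_orb[of I] by blast
qed

lemma G_iff: "B:G_family f C D <-> (EX I m. bas I m & Orb I Int C = D & B = Bs I)" unfolding G_family_def bas_iff by blast

lemma same_period_equal: assumes b: "bas I m" "bas I' m" and D: "Orb I Int C = Orb I' Int C" shows "Orb I = Orb I'"
using same_trace_nested[OF b(1) basD(1)[OF b(2)]] basic_period_less[OF b(1) basD(1)[OF b(2)]] basic_period_less[OF b(2) basD(1)[OF b(1)]] D by blast

text \<open>Cycles with the same trace and period coincide, so the family is indexed by its set
  \<open>T\<close> of periods, and enumerating \<open>T\<close> increasingly gives the chain. A
  turning point \<open>c\<close> of the trace selects nested pieces from the nested cycles.\<close>

lemma chain_exists: assumes inf: "infinite (G_family f C D)"
shows "EX I p. (ALL n. bas (I n) (p n) & Orb (I n) Int C = D & Orb (I (Suc n)) \<subset> Orb (I n)) & strict_mono p &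
 gen I p & G_family f C D = range (%n. Bs (I n))"
proof -
define T where "T = {m. EX I. bas I m & Orb I Int C = D}"
obtain B where "B:G_family f C D" using inf by (metis finite.emptyI ex_in_conv)
then obtain c where c: "c:D" using bas_C unfolding G_iff by blast
have "EX J. bas J m & Orb J Int C = D & c:J" if mT: "m:T" for m
proof -
 obtain I where I: "bas I m" "Orb I Int C = D" using mT unfolding T_def by blast
 hence "c:Orb I" using c by blast
 then obtain J where "pint J m" "Orb J = Orb I" "c:J" using pint_at[OF basD(1)[OF I(1)]] by metis
 thus ?thesis using I unfolding bas_def by (intro exI[of _ J]) simp
qed
then obtain J where J: "!!m. m:T ==> bas (J m) m & Orb (J m) Int C = D & c:J m" by metis
have G: "G_family f C D = (%m. Bs (J m)) ` T"
proof
 show "G_family f C D<=(%m. Bs (J m)) ` T"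
 proof
  fix B assume "B:G_family f C D"
  then obtain I m where I: "bas I m" "Orb I Int C = D" "B = Bs I" unfolding G_iff by blast
  hence "m:T" unfolding T_def by blast
  moreover from this have "Orb I = Orb (J m)" using same_period_equal[OF I(1)] J I(2) by metis
  ultimately show "B:(%m. Bs (J m)) ` T" using I(3) by simp
 qed
 show "(%m. Bs (J m)) ` T<=G_family f C D" using J G_iff by blast
qed
hence infT: "infinite T" using inf by auto
define p where "p = enumerate T"
define I where "I n = J (p n)" for n
have pT: "p n:T" for n unfolding p_def by (rule enumerate_in_set[OF infT])
have I: "bas (I n) (p n)" "Orb (I n) Int C = D" "c:I n" for n using J[OF pT] unfolding I_def by auto
have sm: "strict_mono p" unfolding p_def by (rule strict_mono_enumerate[OF infT])
have less: "p n<p (Suc n)" for n using sm by (simp add: strict_mono_Suc_iff)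
have sub: "Orb (I (Suc n)) \<subset> Orb (I n)" for n
proof -
 have n: "~ Orb (I n)<=Orb (I (Suc n))" using pint_nested_le[OF basD(1)[OF I(1)[of "Suc n"]] basD(1)[OF I(1)[of n]]] less[of n] by auto
 thus ?thesis using same_trace_nested[OF I(1)[of n] basD(1)[OF I(1)[of "Suc n"]]] I(2)[of n] I(2)[of "Suc n"] by blast
qed
have "I (Suc n)<=I n" for n by (rule pint_nested[OF basD(1)[OF I(1)] basD(1)[OF I(1)] _ I(3) I(3)]) (use sub in blast)
hence "gen I p" unfolding gen_def using basD(1)[OF I(1)] filterlim_subseq[OF sm] by simp
moreover have "G_family f C D = range (%n. Bs (I n))" unfolding G I_def p_def by (subst range_enumerate[OF infT, symmetric]) (simp only: image_image)
ultimately show ?thesis using I sub sm by (intro exI[of _ I] exI[of _ p]) simp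
qed

lemma chain_solenoid: assumes "gen I p" "!!n. Orb (I n) Int C = D" shows "solen (QQ I)" "(QQ I) Int C = D"
proof -
show "solen (QQ I)" unfolding solenoidal_Q_def using assms(1) by blast
show "(QQ I) Int C = D" using assms(2) by blast
qed

lemma chain_Q: assumes "infinite (G_family f C D)" shows "EX Q. solen Q & Q Int C = D"
proof -
obtain I p where I: "(ALL n. bas (I n) (p n) & Orb (I n) Int C = D & Orb (I (Suc n)) \<subset> Orb (I n)) & strict_mono p &
 gen I p & G_family f C D = range (%n. Bs (I n))" using chain_exists[OF assms] by (elim exE) (rule that)
hence "gen I p" "!!n. Orb (I n) Int C = D" by simp_all
from chain_solenoid[OF this] show ?thesis by blast
qed

text \<open>A common turning point lies in the solenoidal sets of both chains, so these sets
  coincide, and with them their traces.\<close>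

lemma chains_disjoint: assumes inf: "infinite (G_family f C D)" "infinite (G_family f C D')" and meet: "D Int D'~={}" shows "D = D'"
proof -
obtain Q where Q: "solen Q" "Q Int C = D" using chain_Q[OF inf(1)] by blast
obtain Q' where Q': "solen Q'" "Q' Int C = D'" using chain_Q[OF inf(2)] by blast
have "Q Int Q'~={}" using Q Q' meet by blast
from solen_disjoint[OF Q(1) Q'(1) this] show ?thesis using Q(2) Q'(2) by simp
qed

lemma succ_trace: assumes "basic_succ f B B'" "B:G_family f C D" "B':G_family f C D'" shows "D'<=D"
proof -
obtain I m I' m' where I: "bas I m" "B = Bs I" "bas I' m'" "B' = B_set (Orb I') f" "Orb I'<=Orb I"
 using assms(1) unfolding basic_succ_def bas_iff by blast
obtain J n J' n' where J: "bas J n" "Orb J Int C = D" "B = Bs J" "bas J' n'" "Orb J' Int C = D'" "B' = B_set (Orb J') f"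
 using assms(2,3) unfolding G_iff by blast
have "Orb I = Orb J" "Orb I' = Orb J'" using basic_determines[OF I(1) J(1)] basic_determines[OF I(3) J(4)] I J by auto
thus ?thesis using I(5) J(2,5) by blast
qed

end

section \<open>Symbolic dynamics\<close>

lemma no_three_card: assumes "!!x y z. x:X ==> y:X ==> z:X ==> x<y ==> y<z ==> False" shows "finite X & card (X::real set)<=2"
proof (rule ccontr)
assume "~ ?thesis"
hence "EX T<=X. card T = 3 & finite T" by (metis infinite_arbitrarily_large obtain_subset_with_card_n not_less_eq_eq numeral_2_eq_2 numeral_3_eq_3)
then obtain a b c where "a:X" "b:X" "c:X" "a~=b" "b~=c" "a~=c" by (auto simp: card_3_iff)
thus False using assms by (metis linorder_neqE_linordered_idom)
qed

text \<open>The inner cycle contains all turning points and all end points of the outer one. This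
  serves two situations: consecutive cycles of a chain, and a generating cycle deep inside a tight
  one.\<close>

locale gap_system = pm_system +
fixes I I' m m' assumes I: "periodic_interval f I m" and I': "periodic_interval f I' m'" and sub: "orb f I'<=orb f I"
 and CN: "orb f I Int C<=orb f I'" and EN: "ends I<=orb f I'" and inf: "infinite (orb f I')"
begin

definition "M = Orb I"
definition "N = Orb I'"
definition "\<K> = {G. EX u v. G = {u..v} & u<v & u:N & v:N & {u<..<v} Int N = {} & {u..v}<=M}"

lemma clM: "closed M" "f ` M<=M" "M<={0..1}" unfolding M_def using cyc_closed[OF I] f_orb cyc_unit[OF I] by auto

lemma clN: "closed N" "f ` N<=N" unfolding N_def using cyc_closed[OF I'] f_orb by auto

lemma KD: "EX u v. G = {u..v} & u<v & u:N & v:N & {u<..<v} Int N = {} & {u..v}<=M" if "G:\<K>" for G using that unfolding \<K>_def by blast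

lemma Kcl: "closed G" if "G:\<K>" for G using KD[OF that] by (elim exE conjE) simp

lemma noint: "w~:interior N" if gap: "u<v" "{u<..<v} Int N = {}" "w = u | w = v" for u v w
proof
assume "w:interior N"
then obtain e where e: "e>0" "ball w e<=N" by (auto simp: mem_interior)
define q where "q = min (e / 2) ((v - u) / 2)"
have "0<q" "q<e" "q<v - u" unfolding q_def using e(1) gap(1) by (auto simp: min_def)
hence "(if w = u then u + q else v - q):ball w e Int {u<..<v}" using gap by (auto simp: dist_real_def)
thus False using e(2) gap(2) by blast
qed

lemma finK: "finite \<K>"
proof (rule finite_subset)
show "\<K><=(%(u, v). {u..v}) ` ((N - interior N) \<times> (N - interior N))"
proof
 fix G assume "G:\<K>"
 then obtain u v where uv: "G = {u..v}" "u<v" "u:N" "v:N" "{u<..<v} Int N = {}" using KD by blast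
 thus "G:(%(u, v). {u..v}) ` ((N - interior N) \<times> (N - interior N))" using noint[OF uv(2,5)] by (intro image_eqI[of _ _ "(u, v)"]) auto
qed
show "finite ((%(u, v). {u..v}) ` ((N - interior N) \<times> (N - interior N)))" unfolding N_def using pint_bdry[OF I'] by simp
qed

lemma Npt: "EX c d. c<d & {c..d}<=N & w:{c..d}" if w: "w:N" for w
proof -
obtain J where J: "pint J m'" "Orb J = N" "w:J" using pint_at[OF I'] w unfolding N_def by metis
have "infinite (Orb J)" using inf J(2) unfolding N_def by simp
then obtain c d where "c<d" "fn 0 ` J = {c..d}" using pint_nondegenerate[OF J(1), of 0] by metis
thus ?thesis using J sub_orb[of J] by auto
qed

text \<open>The pieces of the inner cycle are nondegenerate, so \<open>N\<close> has no isolated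
  points. Hence two gaps never share an end point.\<close>

lemma nside: "EX e>0. ALL q. 0<q & q<e --> w + q:N | w - q:N" if w: "w:N" for w
proof -
obtain c d where cd: "c<d" "{c..d}<=N" "w:{c..d}" using Npt[OF w] by blast
have "w + q:{c..d} | w - q:{c..d}" if "0<q" "q<(d - c) / 2" for q using that cd(3) by auto
hence "ALL q. 0<q & q<(d - c) / 2 --> w + q:N | w - q:N" using cd(2) by blast
thus ?thesis using cd(1) by (intro exI[of _ "(d - c) / 2"]) simp
qed

lemma Kdis: "G = G'" if G: "G:\<K>" "G':\<K>" "w:G" "w:G'" for G G' w
proof -
obtain u v where uv: "G = {u..v}" "u<v" "u:N" "v:N" "{u<..<v} Int N = {}" using KD[OF G(1)] by blast
obtain a d where ad: "G' = {a..d}" "a<d" "a:N" "d:N" "{a<..<d} Int N = {}" using KD[OF G(2)] by blast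
have out: "t<=u | v<=t" "t<=a | d<=t" if "t:N" for t
proof -
 have "t~:{u<..<v}" "t~:{a<..<d}" using uv(5) ad(5) that by blast+
 thus "t<=u | v<=t" "t<=a | d<=t" by auto
qed
have no: False if vu: "r:N" "p<r" "{p<..<r} Int N = {}" "r<t" "{r<..<t} Int N = {}" for p r t
proof -
 obtain e where e: "e>0" "!!q. 0<q & q<e ==> r + q:N | r - q:N" using nside[OF vu(1)] by blast
 define q where "q = min (e / 2) (min ((r - p) / 2) ((t - r) / 2))"
 have "0<q" "q<e" "q<r - p" "q<t - r" unfolding q_def using e(1) vu(2,4) by (auto simp: min_def)
 hence "r + q:{r<..<t}" "r - q:{p<..<r}" by auto
 thus False using e(2)[of q] `0 < q` `q < e` vu(3,5) by blast
qed
have w: "u<=w" "w<=v" "a<=w" "w<=d" using G(3,4) unfolding uv(1) ad(1) by auto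
have "v~=a" using no[OF uv(4,2,5)] ad by blast
moreover have "d~=u" using no[OF ad(4,2,5)] uv by blast
ultimately have "u = a & v = d" using out(1)[OF ad(3)] out(1)[OF ad(4)] out(2)[OF uv(3)] out(2)[OF uv(4)] w uv(2) ad(2) by linarith
thus ?thesis using uv(1) ad(1) by simp
qed

lemma cov: "EX G:\<K>. x:G" if x: "x:M" "x~:N" for x
proof -
obtain i where i: "x:fn i ` I" using x(1) unfolding M_def orb_def by blast
obtain l r where lr: "l<=r" "fn i ` I = {l..r}" using pint_piece[OF I, of i] by blast
have "ends I<=N" unfolding N_def by (rule EN)
hence lrN: "l:N" "r:N" using lr(2) unfolding ends_def by blast+
have "compact (N Int {l..r})" using clN(1) by (simp add: closed_Int_compact)
then obtain u v where uv: "u:N Int {l..r}" "v:N Int {l..r}" "u<x" "x<v" "{u<..<v} Int (N Int {l..r}) = {}"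
 using gap_around[of "N Int {l..r}" x l r] lrN lr i x(2) by auto
have "{u..v}<=M" using uv(1,2) lr(2) fpow_sub_orb[of i I] unfolding M_def by auto
moreover have "{u<..<v} Int N = {}" using uv(1,2,5) by auto
ultimately show ?thesis using uv unfolding \<K>_def by (intro bexI[of _ "{u..v}"]) auto
qed

lemma lapK: "mlap f G" if G: "G:\<K>" for G
proof -
obtain u v where uv: "G = {u..v}" "u<v" "{u<..<v} Int N = {}" "{u..v}<=M" using KD[OF G] by blast
have "{u..v}<={0..1}" using uv(4) clM(3) by (rule subset_trans)
hence "0<=u" "v<=1" using uv(2) by auto
moreover have "{u<..<v}<=M" using uv(4) by auto
hence "{u<..<v} Int C = {}" using uv(3) CN unfolding M_def N_def by blast
ultimately show ?thesis unfolding uv(1) by (intro lap')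
qed

text \<open>The ends of \<open>G\<close> are mapped into \<open>N\<close>, hence not into the open
  gap. By monotonicity the value \<open>f x\<close> inside this gap lies between their images, so
  the image of \<open>G\<close> covers all of \<open>G'\<close>.\<close>

lemma mark: "G'<=f ` G" if x: "G:\<K>" "x:G" "G':\<K>" "f x:G'" "f x~:N" for G G' x
proof -
obtain u v where uv: "G = {u..v}" "u<v" "u:N" "v:N" "{u..v}<=M" using KD[OF x(1)] by blast
obtain a d where ad: "G' = {a..d}" "{a<..<d} Int N = {}" "a:N" "d:N" using KD[OF x(3)] by blast
have fx: "a<f x" "f x<d" using x(4,5) ad unfolding ad(1) by (auto simp: le_less)
have fuv: "f u:N" "f v:N" using uv(3,4) clN(2) by auto
hence "f u~:{a<..<d}" "f v~:{a<..<d}" using ad(2) by blast+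
hence "f u<=a | d<=f u" "f v<=a | d<=f v" by auto
moreover have "min (f u) (f v)<=f x & f x<=max (f u) (f v)" by (rule mlap_between) (use lapK[OF x(1)] x(2) in "auto simp: uv(1)")
ultimately have ct: "min (f u) (f v)<=a" "d<=max (f u) (f v)" using fx by auto
have "connected (f ` {u..v})" using fpow_conn[OF _ subset_trans[OF uv(5) clM(3)], of 1] by simp
moreover have "min (f u) (f v):f ` {u..v}" "max (f u) (f v):f ` {u..v}" using uv(2) by (auto simp: min_def max_def)
ultimately have "{min (f u) (f v)..max (f u) (f v)}<=f ` {u..v}" by (rule connected_contains_Icc)
thus ?thesis unfolding uv(1) ad(1) using ct by auto
qed

end

context pm_system
begin

text \<open>A transition between gaps is allowed if the image of the first covers the second. A
  point of the basic set is coded by the gaps that its orbit visits; distinct gaps are disjoint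
  closed sets, which makes the code continuous.\<close>

theorem basic_markov: assumes b: "bas I m" and b': "bas I' m'" and psub: "Orb I' \<subset> Orb I" and CN: "Orb I Int C<=Orb I'"
shows "EX E \<phi>. finite E & semiconjugation \<phi> (Bs I) f (markov_chain E) shift & at_most_2_to_1 \<phi> (Bs I)"
proof -
note I = basD(1)[OF b] and I' = basD(1)[OF b']
interpret gap_system f C I I' m m' by unfold_locales (use I I' psub CN basic_ends[OF b I' _ CN] B_set_infinite_orb[OF basD(2)[OF b']] in auto)
define B where "B = Bs I"
have BM: "B<=M" unfolding B_def M_def by (rule B_sub)
have fB: "f x:B" if "x:B" for x using that B_set_invariant[OF I] unfolding B_def by blast
have fkB: "fn k x:B" if "x:B" for k x by (induction k) (use that fB in auto)
have Bcl: "closed B" unfolding B_def using B_set_closed clM unfolding M_def by blast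
\<comment> \<open>No neighborhood in \<open>M\<close> of a point of \<open>B\<close> lies in
  \<open>N\<close>. So \<open>B\<close> is in the closure of \<open>M - N\<close>, and the finitely
  many closed gaps cover this closure.\<close>
have BK: "EX G:\<K>. x:G" if x: "x:B" for x
proof -
 have "x:closure (M - N)" unfolding closure_approachable
 proof (intro allI impI)
  fix e::real assume e: "e>0"
  have "~ M Int ball x e<=N" using B_local[of x M e N] x e clN psub unfolding B_def M_def N_def by blast
  thus "EX y:M - N. dist y x<e" by (auto simp: dist_commute)
 qed
 also have "...<=\<Union>\<K>" by (rule closure_minimal) (use cov finK Kcl in auto)
 finally show ?thesis by blast
qed
have near: "EX e>0. ALL y:B. abs (y - x)<e --> y:G" if x: "x:G" "G:\<K>" for x G
proof -
 have "closed (\<Union>(\<K> - {G}))" using finK Kcl by (intro closed_Union) auto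
 moreover have "x~:\<Union>(\<K> - {G})" using Kdis x by blast
 ultimately obtain e where e: "e>0" "ball x e <= - \<Union>(\<K> - {G})" by (metis ComplI open_Compl open_contains_ball)
 have "y:G" if "y:B" "abs (y - x)<e" for y
 proof -
  have "y:ball x e" using that(2) by (simp add: dist_real_def abs_minus_commute)
  thus ?thesis using e(2) BK[OF that(1)] by blast
 qed
 thus ?thesis using e(1) by blast
qed
have Bger: "EX e>0. ger x s e<=G" if x: "x:G" "G:\<K>" and s: "DG M x s" for x G s
proof -
 obtain e where e: "e>0" "!!y. y:B ==> abs (y - x)<e ==> y:G" using near[OF x] by blast
 obtain y where y: "y:B" "y:ger x s e" using basic_perfect[OF I basD(2)[OF b] _ e(1)] s unfolding M_def B_def by blast
 have y': "abs (y - x)<e" "0<s * (y - x)" using y(2) mem_ger_abs[OF DG_side[OF s]] by auto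
 hence yG: "y:G" using e(2) y(1) by blast
 obtain u v where uv: "G = {u..v}" using KD[OF x(2)] by blast
 have "ger x s (abs (y - x))<=G"
 proof
  fix z assume "z:ger x s (abs (y - x))"
  thus "z:G" using x(1) yG y'(2) DG_side[OF s] unfolding uv ger_def side_def by (auto simp: abs_if split: if_splits)
 qed
 thus ?thesis using y'(2) by (intro exI[of _ "abs (y - x)"]) auto
qed
\<comment> \<open>The case that \<open>mark\<close> leaves open is that \<open>f x\<close> is an end
  of \<open>G'\<close>. Then \<open>x\<close> is replaced by a point \<open>y\<close> of
  \<open>B\<close> close by on a dense germ in \<open>G\<close>; as \<open>f\<close> is not constant
  along it, \<open>f y\<close> lies in the open gap.\<close>
have gapB: "G'<=f ` G" if x: "x:B" "G:\<K>" "x:G" "G':\<K>" "f x:G'" for x G G'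
proof (cases "f x:N")
 case False
 thus ?thesis using mark x by blast
next
 case True
 obtain s where s: "DG M x s" using basic_DG_exists[OF I basD(2)[OF b]] x(1) unfolding M_def B_def by blast
 obtain a d where ad: "G' = {a..d}" "a<d" "{a<..<d} Int N = {}" using KD[OF x(4)] by blast
 obtain e1 where e1: "e1>0" "!!y. y:B ==> abs (y - f x)<e1 ==> y:G'" using near[OF x(5,4)] by blast
 have "continuous (at x within {0..1}) f" using cont x(1) BM clM(3) by (simp add: continuous_on_eq_continuous_within subset_iff)
 moreover have "min e1 (d - a)>0" using e1(1) ad(2) by simp
 ultimately obtain q where q: "q>0" "!!y. y:{0..1} ==> dist y x<q ==> dist (f y) (f x)<min e1 (d - a)" unfolding continuous_within_eps_delta by blast
 obtain e2 where e2: "e2>0" "ger x s e2<=G" using Bger[OF x(3,2) s] by blast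
 have "min q e2>0" using q(1) e2(1) by simp
 then obtain y where y: "y:B" "y:ger x s (min q e2)" using basic_perfect[OF I basD(2)[OF b]] s unfolding M_def B_def by blast
 have yG: "y:G" using y(2) e2(2) ger_mono[of "min q e2" e2 x s] by auto
 have y': "abs (y - x)<q" "0<s * (y - x)" using y(2) mem_ger_abs[OF DG_side[OF s]] by auto
 obtain u v where uv: "G = {u..v}" using KD[OF x(2)] by blast
 have "f y~=f x"
 proof
  assume eq: "f y = f x"
  obtain w where w: "w:ger x s (abs (y - x))" "f w~=f x"
   using DG_not_constant[OF I B_set_infinite_orb[OF basD(2)[OF b]], of x s "abs (y - x)"] s y'(2) unfolding M_def by force
  have "(x<w & w<y) | (y<w & w<x)" using w(1) y'(2) DG_side[OF s] unfolding ger_def side_def by (auto simp: abs_if split: if_splits)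
  moreover have "mlap f {min x y..max x y}" using lapK[OF x(2)] by (rule mlap_subset) (use x(3) yG in "auto simp: uv")
  ultimately have "f w = f x" using mlap_between[of f "min x y" "max x y" w] eq by (auto simp: min_def max_def split: if_splits)
  thus False using w(2) by simp
 qed
 moreover have fy: "abs (f y - f x)<e1" "abs (f y - f x)<d - a" using q(2)[of y] y'(1) y(1) BM clM(3) by (auto simp: dist_real_def)
 hence "f y:G'" using e1(2) fB[OF y(1)] by blast
 moreover have "f x = a | f x = d" using True x(5) ad(3) unfolding ad(1) by force
 ultimately have "f y:{a<..<d}" using fy(2) unfolding ad(1) by auto
 hence "f y~:N" using ad(3) by blast
 thus ?thesis using mark[OF x(2) yG x(4) `f y:G'`] by blast
qed
define \<V> where "\<V> = {G:\<K>. G Int B~={}}"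
have VK: "\<V><=\<K>" unfolding \<V>_def by blast
obtain h::"real set => nat" where h: "inj_on h \<V>" using finite_imp_inj_to_nat_seg[OF finite_subset[OF VK finK]] by blast
define \<gamma> where "\<gamma> x = (THE G. G:\<K> & x:G)" for x
have \<gamma>eq: "\<gamma> x = G" if "G:\<K>" "x:G" for x G unfolding \<gamma>_def using that Kdis by (intro the_equality) auto
have \<gamma>: "\<gamma> x:\<V>" "x:\<gamma> x" if x: "x:B" for x
proof -
 obtain G where G: "G:\<K>" "x:G" using BK[OF x] by blast
 thus "\<gamma> x:\<V>" "x:\<gamma> x" using \<gamma>eq[OF G] x unfolding \<V>_def by auto
qed
define \<phi> where "\<phi> x n = h (\<gamma> (fn n x))" for x n
define E where "E = (%(G, G'). (h G, h G')) ` {(G, G'):\<V> \<times> \<V>. G'<=f ` G}"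
have "finite (\<V> \<times> \<V>)" using finite_subset[OF VK finK] by simp
hence "finite {(G, G'):\<V> \<times> \<V>. G'<=f ` G}" by (rule finite_subset[rotated]) auto
hence "finite E" unfolding E_def by simp
have path: "EX g. ALL n. g n:\<V> & h (g n) = \<sigma> n & g (Suc n)<=f ` g n" if \<sigma>: "\<sigma>:markov_chain E" for \<sigma>
proof -
 have ex: "EX G:\<V>. EX G':\<V>. G'<=f ` G & h G = \<sigma> n & h G' = \<sigma> (Suc n)" for n
 proof -
  have "(\<sigma> n, \<sigma> (Suc n)):E" using \<sigma> unfolding markov_chain_def by blast
  then obtain G G' where "G:\<V>" "G':\<V>" "G'<=f ` G" "\<sigma> n = h G" "\<sigma> (Suc n) = h G'" unfolding E_def by auto
  thus ?thesis by (intro bexI[of _ G] bexI[of _ G']) simp_all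
 qed
 define g where "g n = the_inv_into \<V> h (\<sigma> n)" for n
 have "g n:\<V> & h (g n) = \<sigma> n & g (Suc n)<=f ` g n" for n
 proof -
  obtain G G' where G: "G:\<V>" "G':\<V>" "G'<=f ` G" "h G = \<sigma> n" "h G' = \<sigma> (Suc n)" using ex[of n] by blast
  hence "g n = G" "g (Suc n) = G'" unfolding g_def using the_inv_into_f_f[OF h G(1)] the_inv_into_f_f[OF h G(2)] G(4,5) by simp_all
  thus ?thesis using G by simp
 qed
 thus ?thesis by blast
qed
\<comment> \<open>Finite paths are realized backwards with dense germs, so that the realizing point
  belongs to \<open>B\<close> and not merely to the first gap.\<close>
have reach: "EX y t. DG M y t & (EX e>0. ger y t e<=g 0) & y:g 0 & (ALL i<=n. fn i y:g i)"
 if g: "!!n. g n:\<V> & g (Suc n)<=f ` g n" for n g using g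
proof (induction n arbitrary: g)
 case 0
 then obtain y where y: "y:B" "y:g 0" "g 0:\<K>" unfolding \<V>_def by blast
 obtain t where t: "DG M y t" using basic_DG_exists[OF I basD(2)[OF b]] y(1) unfolding M_def B_def by blast
 show ?case using t Bger[OF y(2,3) t] y(2) by auto
next
 case (Suc n)
 have "EX y t. DG M y t & (EX e>0. ger y t e<=g (Suc 0)) & y:g (Suc 0) & (ALL i<=n. fn i y:g (Suc i))"
  using Suc.IH[of "%i. g (Suc i)"] Suc.prems by simp
 then obtain y t e where y: "DG M y t" "e>0" "ger y t e<=g (Suc 0)" "!!i. i<=n ==> fn i y:g (Suc i)" by blast
 obtain u v where uv: "g 0 = {u..v}" "{u..v}<=M" using KD[of "g 0"] Suc.prems[of 0] VK by blast
 have gM: "g 0<=M" using uv by simp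
 have "ger y t e<=fn 1 ` g 0" using y(3) Suc.prems[of 0] by auto
 then obtain z s where z: "z:g 0" "DG M z s" "gimg 1 z s y t" "EX e>0. ger z s e<=g 0" using DG_lift[OF uv(1) gM clM(3) y(1,2), where k = 1] by blast
 have fz: "f z = y" using z(3) unfolding gimg_def by simp
 have "fn i z:g i" if "i<=Suc n" for i
 proof (cases i)
  case (Suc j)
  thus ?thesis using y(4)[of j] that fz by (simp add: funpow_swap1)
 qed (use z(1) in simp)
 thus ?case using z by blast
qed
have semi: "semiconjugation \<phi> B f (markov_chain E) shift" unfolding semiconjugation_def
proof (intro conjI ballI)
 show "f ` B<=B" using fB by blast
 show "shift ` markov_chain E<=markov_chain E" unfolding markov_chain_def shift_def by auto
 show "\<phi> (f x) = shift (\<phi> x)" for x unfolding \<phi>_def shift_def by (simp add: funpow_swap1)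
 have ch: "continuous_on B (%x. h (\<gamma> x))"
 proof -
  have "continuous_on (UN G:\<K>. G Int B) (%x. h (\<gamma> x))"
  proof (rule continuous_on_closed_Union)
   show "continuous_on (G Int B) (%x. h (\<gamma> x))" if "G:\<K>" for G
    by (rule continuous_on_eq[OF continuous_on_const[of _ "h G"]]) (use \<gamma>eq[OF that] in auto)
  qed (use finK Kcl Bcl in auto)
  moreover have "(UN G:\<K>. G Int B) = B" using BK by blast
  ultimately show ?thesis by simp
 qed
 show "continuous_on B \<phi>"
 proof (rule continuous_on_coordinatewise_then_product)
  fix n
  have "continuous_on B (fn n)" using BM clM(3) by (intro fpow_cont') blast
  moreover have "continuous_on (fn n ` B) (%x. h (\<gamma> x))" by (rule continuous_on_subset[OF ch]) (use fkB in blast)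
  ultimately show "continuous_on B (%x. \<phi> x n)" unfolding \<phi>_def using continuous_on_compose[of B "f ^^ n" "%x. h (\<gamma> x)"] by (simp add: comp_def)
 qed
 show "\<phi> ` B = markov_chain E"
 proof
  show "\<phi> ` B<=markov_chain E"
  proof
   fix \<sigma> assume "\<sigma>:\<phi> ` B"
   then obtain x where x: "x:B" "\<sigma> = \<phi> x" by blast
   have "(\<sigma> n, \<sigma> (Suc n)):E" for n
   proof -
    define y where "y = fn n x"
    have y: "y:B" unfolding y_def by (rule fkB[OF x(1)])
    have "\<gamma> (f y)<=f ` \<gamma> y" using gapB[OF y _ \<gamma>(2)[OF y] _ \<gamma>(2)[OF fB[OF y]]] \<gamma>(1)[OF y] \<gamma>(1)[OF fB[OF y]] VK by blast
    hence "(h (\<gamma> y), h (\<gamma> (f y))):E" unfolding E_def using \<gamma>(1)[OF y] \<gamma>(1)[OF fB[OF y]] by (intro image_eqI[of _ _ "(\<gamma> y, \<gamma> (f y))"]) auto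
    thus ?thesis unfolding x(2) \<phi>_def y_def by simp
   qed
   thus "\<sigma>:markov_chain E" unfolding markov_chain_def by blast
  qed
  show "markov_chain E<=\<phi> ` B"
  proof
   fix \<sigma> assume "\<sigma>:markov_chain E"
   then obtain g where g: "!!n. g n:\<V> & h (g n) = \<sigma> n & g (Suc n)<=f ` g n" using path by blast
   hence g': "!!n. g n:\<V> & g (Suc n)<=f ` g n" by blast
   have "EX y. y:B & (ALL i<=n. fn i y:g i)" for n
   proof -
    obtain y t where y: "DG M y t" "ALL i<=n. fn i y:g i" using reach[of g n, OF g'] by blast
    thus ?thesis using DG_in_B[OF y(1) clM(1,2)] unfolding B_def M_def by blast
   qed
   then obtain y where y: "!!n. y n:B" "!!n i. i<=n ==> fn i (y n):g i" by metis
   have "compact B" using Bcl BM clM(3) by (intro compact_sub) auto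
   then obtain x r where x: "x:B" "strict_mono r" "(y \<circ> r) \<longlonglongrightarrow> x" using y(1) unfolding compact_def by metis
   have xg: "fn i x:g i" for i
   proof (rule Lim_in_closed_set)
    have "B<={0..1}" using BM clM(3) by blast
    hence xu: "x:{0..1}" "(y \<circ> r) k:{0..1}" for k using x(1) y(1)[of "r k"] by (auto simp del: atLeastAtMost_iff)
    show "(%k. fn i ((y \<circ> r) k)) \<longlonglongrightarrow> fn i x"
     by (rule continuous_on_tendsto_compose[OF fpow_cont x(3) xu(1)]) (use xu(2) in auto)
    have "i<=r k" if "i<=k" for k using seq_suble[OF x(2), of k] that by linarith
    hence "fn i ((y \<circ> r) k):g i" if "i<=k" for k using y(2)[of i "r k"] that by simp
    thus "\<forall>\<^sub>F k in sequentially. fn i ((y \<circ> r) k):g i" unfolding eventually_sequentially by blast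
    show "closed (g i)" using g VK Kcl by blast
   qed simp
   have "\<sigma> = \<phi> x"
   proof
    fix n
    have "\<gamma> (fn n x) = g n" by (rule \<gamma>eq[OF _ xg]) (use g VK in blast)
    thus "\<sigma> n = \<phi> x n" unfolding \<phi>_def using g[of n] by simp
   qed
   thus "\<sigma>:\<phi> ` B" using x(1) by blast
  qed
 qed
qed
\<comment> \<open>If \<open>x<y<z\<close> had the same code, monotonicity on the gaps would keep the
  orbit of everything between \<open>x\<close> and \<open>z\<close> in the gaps. This neighborhood
  of \<open>y\<close> has a dense orbit, so the gaps would cover \<open>M\<close>, including the
  interior of \<open>N\<close>.\<close>
have "at_most_2_to_1 \<phi> B" unfolding at_most_2_to_1_def
proof (intro allI no_three_card)
 fix \<sigma> x y z assume xyz: "x:{x:B. \<phi> x = \<sigma>}" "y:{x:B. \<phi> x = \<sigma>}" "z:{x:B. \<phi> x = \<sigma>}" "x<y" "y<z"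
 define G where "G n = \<gamma> (fn n x)" for n
 have Gz: "\<gamma> (fn n z) = G n" for n
 proof -
  have "h (\<gamma> (fn n z)) = h (G n)" using xyz(1,3) unfolding G_def \<phi>_def by (auto dest: fun_cong)
  thus ?thesis using h \<gamma>(1)[OF fkB] xyz(1,3) unfolding G_def inj_on_def by blast
 qed
 have GK: "G n:\<K>" and xG: "fn n x:G n" and zG: "fn n z:G n" for n
  using \<gamma>[OF fkB, of x n] \<gamma>[OF fkB, of z n] Gz[of n] xyz(1,3) VK unfolding G_def by auto
 have bound: "fn n w:{min (fn n x) (fn n z)..max (fn n x) (fn n z)}" if w: "w:{x..z}" for n w
 proof (induction n)
  case (Suc n)
  obtain u v where uv: "G n = {u..v}" using KD[OF GK[of n]] by blast
  let ?a = "min (fn n x) (fn n z)" and ?c = "max (fn n x) (fn n z)"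
  have "mlap f {?a..?c}" using lapK[OF GK[of n]] by (rule mlap_subset) (use xG[of n] zG[of n] in "auto simp: uv")
  hence "min (f ?a) (f ?c)<=f (fn n w) & f (fn n w)<=max (f ?a) (f ?c)" by (rule mlap_between) (use Suc in auto)
  thus ?case by (auto simp: min_def max_def split: if_splits)
 qed (use w in auto)
 have wG: "fn n w:G n" if w: "w:{x..z}" for n w
 proof -
  obtain u v where uv: "G n = {u..v}" using KD[OF GK[of n]] by blast
  show ?thesis using bound[OF w, of n] xG[of n] zG[of n] unfolding uv by auto
 qed
 have "Orb (M Int {x<..<z})<=\<Union>\<K>"
 proof
  fix t assume "t:Orb (M Int {x<..<z})"
  then obtain n w where "w:M Int {x<..<z}" "t = fn n w" unfolding in_orb_iff by blast
  hence "w:{x..z}" "t = fn n w" by auto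
  thus "t:\<Union>\<K>" using wG GK by blast
 qed
 hence "Cl (M Int {x<..<z})<=\<Union>\<K>" using finK Kcl by (intro closure_minimal) auto
 moreover have "Cl (M Int {x<..<z}) = M" using B_setD[of y M "{x<..<z}"] xyz unfolding B_def M_def by auto
 ultimately have MK: "M<=\<Union>\<K>" by simp
 obtain w where "w:N" using pint_nonempty[OF I'] sub_orb unfolding N_def by blast
 then obtain c d where cd: "c<d" "{c..d}<=N" using Npt by blast
 have mN: "(c + d) / 2:N" using cd by auto
 moreover have "(c + d) / 2:interior N" using interior_maximal[of "{c<..<d}" N] cd by (auto simp: subset_iff)
 moreover have "(c + d) / 2:M" using mN sub unfolding M_def N_def by blast
 then obtain G' where G': "G':\<K>" "(c + d) / 2:G'" using MK by blast
 obtain u v where uv: "G' = {u..v}" "u<v" "{u<..<v} Int N = {}" using KD[OF G'(1)] by blast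
 have "(c + d) / 2 = u | (c + d) / 2 = v" using G'(2) mN uv(3) unfolding uv(1) by force
 ultimately show False using noint[OF uv(2,3)] by blast
qed
thus ?thesis using `finite E` semi unfolding B_def by blast
qed

end

section \<open>Solenoidal sets without basic sets nearby\<close>

context interval_map
begin

text \<open>\<open>z\<close> is an accumulation point of the iterates at the times
  \<open>t n\<close>. Continuity hands closed conditions on their further iterates over to
  \<open>z\<close>.\<close>

lemma om_point: assumes x: "x:{0..1}" and t: "!!n. n<=t n" shows "EX z:om x. ALL i F n0. closed F --> (ALL n>=n0. fn i ((f ^^ t n) x):F) --> fn i z:F"
proof -
have xu: "fn k x:{0..1}" for k by (rule fpow_maps[OF x])
obtain z r where z: "z:{0..1}" "strict_mono r" "((%n. (f ^^ t n) x) \<circ> r) \<longlonglongrightarrow> z"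
 using compact_Icc[of 0 "1::real"] xu unfolding compact_def by meson
have "z:om x" unfolding om_iff
proof (intro allI impI)
 fix e::real and K assume "e>0"
 then obtain n where n: "!!k. k>=n ==> dist ((f ^^ t (r k)) x) z<e" using z(3) unfolding lim_sequentially by auto
 have "K<=t (r (max n K))" using seq_suble[OF z(2), of "max n K"] t[of "r (max n K)"] by linarith
 thus "EX n>=K. abs (fn n x - z)<e" using n[of "max n K"] by (auto simp: dist_real_def)
qed
moreover have "fn i z:F" if F: "closed F" "ALL n>=n0. fn i ((f ^^ t n) x):F" for i F n0
proof (rule Lim_in_closed_set[OF F(1)])
 show "(%k. fn i (((%n. (f ^^ t n) x) \<circ> r) k)) \<longlonglongrightarrow> fn i z"
  by (rule continuous_on_tendsto_compose[OF fpow_cont z(3,1)]) (use xu in simp)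
 have "n0<=r k" if "n0<=k" for k using seq_suble[OF z(2), of k] that by linarith
 thus "\<forall>\<^sub>F k in sequentially. fn i (((%n. (f ^^ t n) x) \<circ> r) k):F"
  unfolding eventually_sequentially using F(2) by (intro exI[of _ n0]) simp
qed simp
ultimately show ?thesis by (intro bexI[of _ z] allI impI)
qed

end

context gap_system
begin

section \<open>Paths of gaps and horseshoes\<close>

definition gpath::"(nat => real set) => nat => bool" where
"gpath g k <-> (ALL i<=k. g i:\<K>) & (ALL i<k. g (Suc i)<=f ` g i)"

lemma gap_of: "x:M ==> x~:N ==> EX G. G:\<K> & x:G" using cov by blast

text \<open>As \<open>N\<close> is forward invariant, an orbit segment that ends outside
  \<open>N\<close> was outside \<open>N\<close> all along, and \<open>mark\<close> applies at each
  step.\<close>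

lemma gpath_exists: assumes G: "G:\<K>" "t:G" "G':\<K>" "fn k t:G'" "fn k t~:N" shows "EX g. gpath g k & g 0 = G & g k = G'" using G
proof (induction k arbitrary: G' )
case 0
hence "G = G'" using Kdis[of G G' t] by simp
thus ?case using 0 unfolding gpath_def by (intro exI[of _ "%_. G"]) simp
next
case (Suc k)
have nN: "fn k t~:N" using Suc.prems(5) clN(2) by auto
have tM: "t:M" using KD[OF Suc.prems(1)] Suc.prems(2) by blast
hence "fn k t:M" using inv_fpow[OF clM(2), of k] by blast
then obtain G1 where G1: "G1:\<K>" "fn k t:G1" using gap_of nN by blast
then obtain g where g: "gpath g k" "g 0 = G" "g k = G1" using Suc.IH[OF Suc.prems(1,2) G1 nN] by blast
have e: "G'<=f ` G1" using mark[OF G1 Suc.prems(3)] Suc.prems(4,5) by simp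
have "gpath (g(Suc k := G')) (Suc k)" unfolding gpath_def
proof (intro conjI allI impI)
 show "(g(Suc k := G')) i:\<K>" if "i<=Suc k" for i using g(1) Suc.prems(3) that unfolding gpath_def by (cases "i = Suc k") auto
 show "(g(Suc k := G')) (Suc i)<=f ` (g(Suc k := G')) i" if "i<Suc k" for i using g(1,3) e that unfolding gpath_def by (cases "i = k") auto
qed
moreover have "(g(Suc k := G')) 0 = G" "(g(Suc k := G')) (Suc k) = G'" using g(2) by simp_all
ultimately show ?case by blast
qed

lemma gpath_realize: assumes "gpath g k" "w:g k" shows "EX t. fn k t = w & (ALL i<=k. fn i t:g i)" using assms
proof (induction k arbitrary: w)
case (Suc k)
then obtain w' where w': "w':g k" "f w' = w" unfolding gpath_def by blast
moreover have "gpath g k" using Suc.prems(1) unfolding gpath_def by auto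
ultimately obtain t where "fn k t = w'" "ALL i<=k. fn i t:g i" using Suc.IH by blast
thus ?case using w' Suc.prems(2) by (intro exI[of _ t]) (auto simp: le_Suc_eq)
qed auto

lemma gpath_append: assumes "gpath g k" "gpath h l" "g k = h 0" shows "gpath (%i. if i<=k then g i else h (i - k)) (k + l)" unfolding gpath_def
proof (intro conjI allI impI)
show "(if i<=k then g i else h (i - k)):\<K>" if "i<=k + l" for i using assms that unfolding gpath_def by auto
show "(if Suc i<=k then g (Suc i) else h (Suc i - k))<=f ` (if i<=k then g i else h (i - k))" if "i<k + l" for i
proof -
 consider "i<k" | "i = k" | "i>k" by linarith
 thus ?thesis
 proof cases
  case 2
  thus ?thesis using assms(2,3) that unfolding gpath_def by auto
 next
  case 3
  hence "Suc i - k = Suc (i - k)" "i - k<l" using that by auto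
  thus ?thesis using assms(2) 3 unfolding gpath_def by auto
 qed (use assms(1) in "auto simp: gpath_def")
qed
qed

lemma gpath_loop: assumes a: "gpath a p" "a 0 = G" "a p = G" and p: "p>=1" shows "gpath (%i. a (i mod p)) (n * p)" unfolding gpath_def
proof (intro conjI allI impI)
show "a (i mod p):\<K>" for i using a(1) p unfolding gpath_def by (simp add: less_imp_le)
show "a (Suc i mod p)<=f ` a (i mod p)" for i
proof -
 have "a (Suc (i mod p))<=f ` a (i mod p)" using a(1) p unfolding gpath_def by simp
 moreover have "a (Suc i mod p) = a (Suc (i mod p))" using a(2,3) by (cases "Suc (i mod p) = p") (auto simp: mod_Suc)
 ultimately show ?thesis by simp
qed
qed

text \<open>An orbit that follows the first loop for longer and longer times, and the second one in between, accumulates at a periodic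
 orbit but has an infinite limit set.\<close>

lemma horseshoe: assumes a: "gpath a p" "a 0 = G" "a p = G" "p>=1" and b: "gpath b q" "b 0 = G" "b q = G" "p dvd q" and j: "j<q" "b j~=a (j mod p)"
shows "EX K k. bas K k & Orb K<=M"
proof -
have G: "G:\<K>" using a(1,2) unfolding gpath_def by auto
hence GM: "G<=M" "closed G" "G~={}" using KD Kcl by fastforce+
have unit: "G<={0..1}" using GM(1) clM(3) by blast
\<comment> \<open>Block \<open>n\<close> runs \<open>n\<close> times through the loop
  \<open>a\<close> and then once through the loop \<open>b\<close>.\<close>
define al where "al n i = (if i<=n * p then a (i mod p) else b (i - n * p))" for n i
have al: "gpath (al n) (n * p + q)" for n unfolding al_def using gpath_append[OF gpath_loop[OF a, of n] b(1)] a(2) b(2) by simp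
have al_b: "al n (n * p + i) = b i" for n i unfolding al_def using a(2) b(2) by (cases i) auto
define X where "X n = {y:G. ALL i<=n * p + q. fn i y:al n i}" for n
have clal: "closed (al n i)" if "i<=n * p + q" for n i using al[of n] that Kcl unfolding gpath_def by blast
have XG: "fn (n * p + q) ` X n = G" for n
proof
 show "fn (n * p + q) ` X n<=G" unfolding X_def using al_b[of n q] b(3) by auto
 show "G<=fn (n * p + q) ` X n"
 proof
  fix w assume "w:G"
  hence "w:al n (n * p + q)" using al_b b(3) by simp
  then obtain t where t: "fn (n * p + q) t = w" "ALL i<=n * p + q. fn i t:al n i" using gpath_realize[OF al] by blast
  have "t:G" using t(2)[rule_format, of 0] a(2) unfolding al_def by simp
  thus "w:fn (n * p + q) ` X n" using t unfolding X_def by blast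
 qed
qed
have Xne: "X n~={}" for n using XG[of n] GM(3) by blast
have Xcomp: "compact (X n)" for n
proof -
 have "X n = G Int (INT i:{..n * p + q}. {y:G. fn i y:al n i})" unfolding X_def by auto
 moreover have "closed {y:G. fn i y:al n i}" if "i<=n * p + q" for i
  using continuous_closed_preimage[OF fpow_cont'[OF unit] GM(2) clal[OF that], of i] by (simp add: vimage_def Int_def)
 ultimately have "closed (X n)" using GM(2) by (auto intro!: closed_Int closed_INT)
 thus ?thesis using unit unfolding X_def by (intro compact_sub) auto
qed
obtain x where x: "x:X 0" "!!i. fn (SUM j<i. j * p + q) x:X i"
 using realize_orbit[of X "%n. n * p + q", OF Xcomp _ Xne _ Xne] XG unit unfolding X_def by blast
have xG: "x:G" using x(1) unfolding X_def by blast
hence xu: "x:{0..1}" using unit by blast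
define T where "T i = (SUM j<i. j * p + q)" for i
have q: "q>=1" using j(1) by simp
have T: "i<=T i" for i unfolding T_def by (induction i) (use q in auto)
have TX: "fn i ((f ^^ T n) x):al n i" if "i<=n * p + q" for i n using x(2)[of n] that unfolding T_def X_def by blast
have cla: "closed (a (i mod p))" "closed (b i)" "a (i mod p):\<K>" if "i<=q" for i
 using a(1,4) b(1) that Kcl unfolding gpath_def by (auto simp: less_imp_le)
have cla': "closed (a (i mod p))" "a (i mod p):\<K>" for i using a(1,4) Kcl unfolding gpath_def by (auto simp: less_imp_le)
obtain z where z: "z:om x"
 "ALL i F n0. closed F --> (ALL n>=n0. fn i ((f ^^ T n) x):F) --> fn i z:F" using om_point[OF xu T] by (elim bexE) (rule that)
\<comment> \<open>At the beginning of the blocks the orbit follows \<open>a\<close> for longer and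
  longer, so the accumulation point \<open>z\<close> follows \<open>a\<close> forever and has a
  finite limit set.\<close>
have za: "fn i z:a (i mod p)" for i
proof (rule z(2)[rule_format, OF cla'(1)])
 fix n assume "n>=i"
 hence "i<=n * p" using a(4) by (metis le_trans mult.right_neutral mult_le_mono2)
 thus "fn i ((f ^^ T n) x):a (i mod p)" using TX[of i n] unfolding al_def by simp
qed
have zu: "z:{0..1}" using z(1) om_unit[OF xu] by blast
have "finite (om z)"
proof (rule finite_omegaI[OF zu a(4), of 0])
 fix i
 have "fn i (fn (0 + j * p) z):a (i mod p)" for j using za[of "i + j * p"] by (simp add: fpow_add)
 thus "mlap f (fn i ` range (%j. fn (0 + j * p) z))" by (intro mlap_subset[OF lapK[OF cla'(2)[of i]]]) blast
qed
hence "om z<=Per f" using finite_inv_Per om_image[OF zu] om_unit[OF zu] by blast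
then obtain w where w: "w:Per f" "w:om x" using om_nonempty[OF zu] om_in_orb_closure[OF xu z(1)] by blast
\<comment> \<open>An accumulation point \<open>y\<close> of the starts of the passages through
  \<open>b\<close> follows \<open>b\<close> once and then \<open>a\<close> forever. If
  \<open>y\<close> were periodic, it would follow \<open>a\<close> at all times, as \<open>p\<close>
  divides \<open>q\<close>; this contradicts the choice of \<open>j\<close>.\<close>
have inf: "infinite (om x)"
proof
 assume fin: "finite (om x)"
 have T': "n<=T n + n * p" for n using T[of n] by simp
 obtain y where y: "y:om x"
  "ALL i F n0. closed F --> (ALL n>=n0. fn i (fn (T n + n * p) x):F) --> fn i y:F" using om_point[OF xu T'] by (elim bexE) (rule that)
 have s: "fn i (fn (T n + n * p) x) = fn (n * p + i) ((f ^^ T n) x)" for i n by (simp flip: fpow_add add: ac_simps)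
 have yb: "fn i y:b i" if "i<=q" for i
 proof (rule y(2)[rule_format, OF cla(2)[OF that]])
  show "fn i (fn (T n + n * p) x):b i" for n using TX[of "n * p + i" n] that al_b[of n i] s[of i n] by simp
 qed
 have ya: "fn (q + i) y:a (i mod p)" for i
 proof (rule y(2)[rule_format, OF cla'(1)])
  fix n assume "n>=i"
  hence "i<=Suc n * p" using a(4) by (metis le_SucI le_trans mult.right_neutral mult_le_mono2)
  moreover have "fn (q + i) (fn (T n + n * p) x) = fn i ((f ^^ T (Suc n)) x)" unfolding s T_def by (simp flip: fpow_add add: ac_simps)
  ultimately show "fn (q + i) (fn (T n + n * p) x):a (i mod p)" using TX[of i "Suc n"] unfolding al_def by simp
 qed
 have "y:Per f" using finite_inv_Per[OF fin] om_image[OF xu] om_unit[OF xu] y(1) by blast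
 then obtain l where l: "l>=1" "fn l y = y" unfolding Per_def by blast
 define L where "L = q * l - q"
 have ge: "q<=q * l" using l(1) by simp
 have pL: "p dvd L" unfolding L_def using b(4) by (simp add: dvd_diff_nat)
 have "fn j y = fn j (fn (q * l) y)" using mult_fix[OF l(2), of q] by simp
 also have "... = fn (j + q * l) y" by (simp only: fpow_add)
 also have "j + q * l = q + (L + j)" unfolding L_def using ge by linarith
 finally have "fn j y:a ((L + j) mod p)" using ya[of "L + j"] by simp
 moreover have "(L + j) mod p = j mod p" using pL by (auto elim!: dvdE)
 ultimately have "fn j y:a (j mod p)" "fn j y:b j" using yb[of j] j(1) by auto
 moreover have "b j:\<K>" using b(1) j(1) unfolding gpath_def by simp
 ultimately show False using Kdis cla'(2) j(2) by blast
qed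
have xM: "om x<=M" using om_least[OF clM(1,2), of 0 x] xG GM(1) by auto
\<comment> \<open>The limit set contains the periodic point \<open>w\<close>, which leaves only the
  alternative of a basic set.\<close>
have "~ (EX Q. solen Q & om x<=Q)" using w solenoid_no_Per by blast
then obtain K k where K: "bas K k" "om x<=Bs K" using om_cases[OF xu inf] unfolding bas_iff by blast
have "Orb K<=M"
proof (rule ccontr)
 assume "~ Orb K<=M"
 hence "finite (Bs K Int Orb I)" unfolding M_def by (rule basic_finite_part[OF I])
 thus False using inf K(2) xM unfolding M_def by (meson finite_subset le_inf_iff)
qed
thus ?thesis using K(1) by blast
qed

end

context pm_system
begin

lemma tight_pieces_onto: assumes t: "tight Q H m" and fQ: "f ` Q = Q" shows "fn i ` (Q Int H) = Q Int fn i ` H"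
proof
show "fn i ` (Q Int H)<=Q Int fn i ` H" using inv_fpow_eq[OF fQ, of i] by blast
have H: "pint H m" "Q<=Orb H" using t unfolding tight_def by auto
show "Q Int fn i ` H<=fn i ` (Q Int H)"
proof
 fix q assume q: "q:Q Int fn i ` H"
 then obtain q' where q': "q':Q" "fn i q' = q" using inv_fpow_eq[OF fQ, of i] by (metis IntD1 imageE)
 obtain j where j: "q':fn j ` H" using H(2) q'(1) unfolding orb_def by blast
 hence "q:fn (i + j) ` H" using q'(2) by (metis img_add imageI)
 hence "(i + j) mod m = (i + 0) mod m" using pint_disjoint[OF H(1), of "i + j" i] q by auto
 hence "[j + i = 0 + i] (mod m)" unfolding cong_def by (simp add: add.commute)
 hence "j mod m = 0" using cong_add_rcancel_nat unfolding cong_def by (metis mod_0)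
 hence "q':H" using j pint_mod[OF H(1), of j] by simp
 thus "q:fn i ` (Q Int H)" using q' by blast
qed
qed

lemma tight_invariant_piece: assumes t: "tight Q H m" and fQ: "f ` Q = Q" and q: "q:Q" "q:H" shows "EX q':Q. q':H & fn m q' = q"
proof -
have "fn m ` H = H" using t unfolding tight_def pint_def by blast
hence "q:fn m ` (Q Int H)" using tight_pieces_onto[OF t fQ, of m] q by blast
thus ?thesis by blast
qed

text \<open>The gap across which the last piece that moves to the right moves covers itself and, under iteration, every other gap of
 \<open>H\<close>. If another gap covered it, there would be a horseshoe. So \<open>f ^^ m\<close> interchanges the two sides of this gap.\<close>

lemma doubling: assumes Q: "solen Q" and t: "tight Q H m" and nb: "!!K k. bas K k ==> ~ Orb K<=Orb H" shows "EX H2. H2<=H & tight Q H2 (2 * m)"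
proof -
have H: "pint H m" and QH: "Q<=Orb H" and CQ: "Orb H Int C<=Q" using t unfolding tight_def by auto
have endsQ: "ends K<=Q" if t': "tight Q K k" for K k
proof
 fix x assume "x:ends K"
 then obtain i a b where i: "fn i ` K = {a..b}" "x = a | x = b" unfolding ends_def by blast
 obtain c d where c: "fn i ` K = {c..d}" "c:Q" "d:Q" using t' unfolding tight_def by blast
 have "c<=d" using pint_piece[of K k i] t' c(1) unfolding tight_def by (auto simp: Icc_eq_Icc)
 thus "x:Q" using i c by (auto simp: Icc_eq_Icc)
qed
obtain q0 where q0: "q0:Q" using solen_ne[OF Q] by blast
have infQ: "infinite Q" using solenoid_omega(3,4)[OF Q q0 q0] finite_subset by blast
obtain H' p where H': "gen H' p" "Q = (INT j. Orb (H' j))" "!!j. tight Q (H' j) (p j)" using tight_system[OF Q] by blast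
have fQ: "f ` Q = Q" unfolding H'(2) by (rule gen_f_Q[OF H'(1)])
have clQ: "closed Q" unfolding H'(2) by (rule gen_Q_closed[OF H'(1)])
obtain n0 where n0: "Orb (H' n0)<=Orb H" using solen_enters_cyc[OF H'(1) _ _ H, of q0] q0 QH H'(2) by blast
obtain n1 where n1: "!!k. k>=n1 ==> m + 1<=p k" using gen_large[OF H'(1)] by blast
define n where "n = max n0 n1"
define J R where "J = H' n" and "R = p n"
have J: "pint J R" "tight Q J R" "Q<=Orb J" unfolding J_def R_def using H'(3)[of n] unfolding tight_def by auto
have R: "m<R" unfolding R_def using n1[of n] unfolding n_def by simp
have JH: "Orb J<=Orb H" using gen_orb_dec[OF H'(1), of n0 n] n0 unfolding J_def n_def by auto
interpret gap_system f C H J m R by unfold_locales (use H J JH CQ endsQ[OF t] finite_subset[OF J(3)] infQ in blast)+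
obtain l r where lr: "0<=l" "l<=r" "r<=1" "H = {l..r}" using pint_obtain[OF H] by blast
have HM: "H<=M" unfolding M_def by (rule sub_orb)
have "fn 0 ` H = {l..r}" using lr(4) by simp
hence "l:ends H" "r:ends H" unfolding ends_def by blast+
hence lrQ: "l:Q" "r:Q" using endsQ[OF t] by auto
have QN: "Q<=N" unfolding N_def by (rule J(3))
define g where "g = f ^^ m"
have gH: "g ` H = H" unfolding g_def using H unfolding pint_def by blast
have gN: "g x:N" if "x:N" for x unfolding g_def using that inv_fpow[OF clN(2), of m] by blast
have gc: "continuous_on H g" unfolding g_def by (rule fpow_cont'[OF pint_unit[OF H]])
\<comment> \<open>Since \<open>0<m\<close> and \<open>m<R\<close>, the iterate \<open>g\<close>
  leaves no piece of the inner cycle in place.\<close>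
have nfix: "g w~=w" if w: "w:N" for w
proof
 assume "g w = w"
 obtain j where "w:fn j ` J" using w unfolding N_def orb_def by blast
 hence "fn (m + j) ` J Int fn j ` J~={}" using `g w = w` unfolding g_def by (metis disjoint_iff img_add imageI)
 hence "(m + j) mod R = (0 + j) mod R" using pint_disjoint[OF J(1)] by simp
 hence "m mod R = 0" by (metis mod_add_right_eq mod_mod_trivial add.commute cong_def cong_add_rcancel_nat mod_0)
 thus False using R pint_pos[OF H] by simp
qed
have cNH: "compact (N Int H)" unfolding lr(4) using clN(1) by (simp add: closed_Int_compact)
define A1 where "A1 = {w:N Int H. 0<=g w - w}"
define A2 where "A2 = {w:N Int H. g w - w<=0}"
have gcN: "continuous_on (N Int H) (%w. g w - w)" using gc by (intro continuous_intros continuous_on_subset[OF gc]) auto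
have cA: "compact A1" "compact A2"
proof -
 have "closed A1" "closed A2"
  using continuous_closed_preimage[OF gcN compact_imp_closed[OF cNH], of "{0..}"] continuous_closed_preimage[OF gcN compact_imp_closed[OF cNH], of "{..0}"]
  unfolding A1_def A2_def by (simp_all add: vimage_def Int_def)
 thus "compact A1" "compact A2" using lr unfolding A1_def A2_def by (auto intro!: compact_sub)
qed
have glr: "g l:H" "g r:H" using gH lr by (metis atLeastAtMost_iff imageI order_refl)+
hence lA: "l:A1" "r:A2" unfolding A1_def A2_def using lrQ QN lr by auto
\<comment> \<open>\<open>a\<close> is the last point of the inner cycle in \<open>H\<close> that
  \<open>g\<close> moves to the right, and \<open>b\<close> the next point of that cycle. So
  \<open>G\<close> is a gap whose ends are thrown across it.\<close>
define a where "a = Sup A1"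
have a: "a:A1" "!!w. w:A1 ==> w<=a" unfolding a_def using cpt_Inf_Sup[OF cA(1)] lA(1) by auto
hence aN: "a:N" "a:H" "a<g a" using nfix[of a] unfolding A1_def by force+
have cA2: "compact (A2 Int {a..})" using cA(2) by (rule compact_Int_closed) simp
define b where "b = Inf (A2 Int {a..})"
have rA: "r:A2 Int {a..}" using lA(2) aN(2) lr by auto
hence b0: "b:A2 Int {a..}" "!!w. w:A2 Int {a..} ==> b<=w" unfolding b_def using cpt_Inf_Sup[OF cA2] by auto
hence b: "b:N" "b:H" "g b<b" using nfix[of b] unfolding A2_def by force+
have ab: "a<b" using b0(1) aN(3) b(3) by (cases "a = b") auto
have gap: "{a<..<b} Int N = {}"
proof (rule ccontr)
 assume "~ ?thesis"
 then obtain w where w: "w:N" "a<w" "w<b" by auto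
 hence "w:H" using aN(2) b(2) unfolding lr(4) by auto
 hence "w:A1 | w:A2" using w(1) unfolding A1_def A2_def by auto
 thus False using a(2)[of w] b0(2)[of w] w by auto
qed
have gaN: "b<=g a" "g b<=a" using gap gN[OF aN(1)] gN[OF b(1)] aN(3) b(3) ab by (meson disjoint_iff greaterThanLessThan_iff not_le order_less_trans)+
define G where "G = {a..b}"
have GH: "G<=H" unfolding G_def lr(4) using aN(2) b(2) lr(4) by auto
have G: "G:\<K>" unfolding \<K>_def G_def using ab aN b gap GH HM G_def by blast
have Gun: "G<={0..1}" using GH pint_unit[OF H] by blast
have gconn: "connected (fn k ` G)" for k by (rule fpow_conn[OF _ Gun]) (simp add: G_def)
have mid: "(a + b) / 2:{a<..<b}" using ab by auto
have IVT: "EX s:S. g s = w" if "connected S" "S<=H" "u:S" "v:S" "g u<=w" "w<=g v" for S u v w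
proof -
 have "connected (g ` S)" using that(1,2) gc by (metis connected_continuous_image continuous_on_subset)
 hence "{g u..g v}<=g ` S" using that(3,4) by (intro connected_contains_Icc) auto
 thus ?thesis using that(5,6) by auto
qed
obtain s0 where s0: "s0:G" "g s0 = (a + b) / 2" using IVT[of G b a "(a + b) / 2"] GH gaN ab unfolding G_def by auto
have mN: "w~:N" if "w:{a<..<b}" for w using gap that by blast
have "fn m s0:G" "fn m s0~:N" using s0 mid mN unfolding g_def G_def by auto
then obtain al where al: "gpath al m" "al 0 = G" "al m = G" using gpath_exists[OF G s0(1) G] by blast
have grow: "G<=fn (k * m) ` G" for k
proof (induction k)
 case (Suc k)
 have "{g b..g a}<=fn m ` G" using gconn[of m] ab unfolding G_def g_def by (intro connected_contains_Icc) auto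
 hence "G<=fn m ` G" using gaN unfolding G_def by auto
 also have "...<=fn m ` fn (k * m) ` G" by (rule image_mono[OF Suc])
 finally show ?case by (simp add: img_add)
qed simp
\<comment> \<open>The orbit of \<open>a\<close> under \<open>g\<close> comes into the piece of every
  point \<open>w\<close> of the inner cycle in \<open>H\<close>. With an end of \<open>H\<close> as
  \<open>w\<close>, the growing images of \<open>G\<close> stretch past every gap on that
  side.\<close>
have visit: "EX k K. pint K R & Orb K = Orb J & w:K & fn (k * m) a:K" if w: "w:N" "w:H" for w
proof -
 obtain K where K: "pint K R" "Orb K = Orb J" "a:K" using pint_at[OF J(1)] aN(1) unfolding N_def by metis
 obtain i where i: "w:fn i ` K" using w(1) K(2) unfolding N_def orb_def by blast
 have "K<=H" by (rule pint_nested[OF H K(1) _ aN(2) K(3)]) (simp add: K(2) JH)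
 hence "fn i ` H Int fn 0 ` H~={}" using i w(2) by auto
 hence "i mod m = 0" using pint_disjoint[OF H, of i 0] by simp
 hence "i div m * m = i" using div_mult_mod_eq[of i m] by simp
 hence "fn (i div m * m) a:fn i ` K" using K(3) by simp
 thus ?thesis using i pint_shift[OF K(1), of i] shift_orb[OF K(1), of i] K(2) by (intro exI[of _ "i div m"] exI[of _ "fn i ` K"]) simp
qed
\<comment> \<open>Another gap with a point that \<open>g\<close> maps into the open gap would give a
  loop from \<open>G\<close> to that gap and back, besides the loop from \<open>G\<close> to
  itself.\<close>
have only: "G' = G" if G': "G':\<K>" "G'<=H" "s:G'" "g s:{a<..<b}" for G' s
proof (rule ccontr)
 assume ne: "G'~=G"
 obtain c d where cd: "G' = {c..d}" "c<d" "c:N" "d:N" "{c<..<d} Int N = {}" using KD[OF G'(1)] by blast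
 have "b<=c | d<=a"
 proof (rule ccontr)
  assume "~ ?thesis"
  hence "max a c:G Int G'" using ab cd(2) unfolding G_def cd(1) by auto
  thus False using Kdis[OF G'(1) G] ne by blast
 qed
 define w where "w = (if b<=c then r else l)"
 have w: "w:N" "w:H" unfolding w_def using lrQ QN lr by auto
 obtain k K where K: "pint K R" "Orb K = Orb J" "w:K" "fn (k * m) a:K" using visit[OF w] by blast
 have KN: "K<=N" unfolding N_def K(2)[symmetric] by (rule sub_orb)
 obtain u v where uv: "K = {u..v}" using pint_obtain[OF K(1)] by metis
 have "~ (y<=c & d<=y') & ~ (y'<=c & d<=y)" if "y:K" "y':K" for y y'
 proof -
  have "(c + d) / 2:{c<..<d}" using cd(2) by simp
  hence "(c + d) / 2~:K" using KN cd(5) by blast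
  thus ?thesis using that cd(2) unfolding uv by auto
 qed
 note K' = this[OF K(3,4)]
 have aK: "fn (k * m) a<=c | d<=fn (k * m) a" using KN K(4) cd(5) by (meson disjoint_iff greaterThanLessThan_iff not_le subsetD)
 have cdH: "l<=c" "d<=r" using G'(2) cd(2) unfolding cd(1) lr(4) by auto
 have e: "{min a (fn (k * m) a)..max b (fn (k * m) a)}<=fn (k * m) ` G"
 proof (rule connected_contains_Icc[OF gconn])
  have "a:fn (k * m) ` G" "b:fn (k * m) ` G" "fn (k * m) a:fn (k * m) ` G" using grow[of k] ab unfolding G_def by auto
  thus "min a (fn (k * m) a):fn (k * m) ` G" "max b (fn (k * m) a):fn (k * m) ` G" by (auto simp: min_def max_def)
 qed
 have "(c + d) / 2:{min a (fn (k * m) a)..max b (fn (k * m) a)}"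
 proof (cases "b<=c")
  case True
  thus ?thesis using K' aK cdH cd(2) ab unfolding w_def by auto
 next
  case False
  thus ?thesis using K' aK cdH cd(2) ab `b <= c | d <= a` unfolding w_def by auto
 qed
 then obtain s1 where s1: "s1:G" "fn (k * m) s1 = (c + d) / 2" using e by (metis imageE subsetD)
 have "(c + d) / 2:{c<..<d}" using cd(2) by simp
 hence "(c + d) / 2~:N" "(c + d) / 2:G'" using cd(5) unfolding cd(1) by (blast, simp)
 then obtain b1 where b1: "gpath b1 (k * m)" "b1 0 = G" "b1 (k * m) = G'" using gpath_exists[OF G s1(1) G'(1), of "k * m"] s1(2) by auto
 have "fn m s:G" "fn m s~:N" using G'(4) mN unfolding g_def G_def by auto
 then obtain b2 where b2: "gpath b2 m" "b2 0 = G'" "b2 m = G" using gpath_exists[OF G'(1,3) G] by blast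
 define be where "be i = (if i<=k * m then b1 i else b2 (i - k * m))" for i
 have "gpath be (k * m + m)" unfolding be_def using gpath_append[OF b1(1) b2(1)] b1 b2 by simp
 moreover have "be 0 = G" "be (k * m + m) = G" "be (k * m) = G'" unfolding be_def using b1 b2 pint_pos[OF H] by auto
 ultimately have "EX K k. bas K k & Orb K<=M" using horseshoe[OF al pint_pos[OF H], of be "k * m + m" "k * m"] ne al(2) pint_pos[OF H] by simp
 thus False using nb unfolding M_def by blast
qed
\<comment> \<open>So nothing outside the open gap is mapped into it, and each of the two halves of
  \<open>H\<close> beside it is mapped to one side.\<close>
have X: "s:{a<..<b}" if s: "s:H" "g s:{a<..<b}" for s
proof -
 have sN: "s~:N" using gN mN s(2) by blast
 then obtain G' where G': "G':\<K>" "s:G'" using gap_of s(1) HM by blast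
 have "G'<=H"
 proof (rule pint_connected_subset[OF H _ _ G'(2) s(1)])
  show "connected G'" "G'<=Orb H" using KD[OF G'(1)] unfolding M_def by auto
 qed
 hence "s:G" using only[OF G'(1) _ G'(2) s(2)] G'(2) by simp
 thus ?thesis using sN aN(1) b(1) unfolding G_def by (auto simp: le_less)
qed
have sides: "g s<=a | b<=g s" if "s:H" "s<=a | b<=s" for s
proof -
 have "g s~:{a<..<b}" using X[OF that(1)] that(2) by auto
 thus ?thesis by auto
qed
have left: "b<=g s" if s: "s:{l..a}" for s
proof (rule ccontr)
 assume "~ b<=g s"
 moreover have sub: "{l..a}<=H" using aN(2) unfolding lr(4) by auto
 ultimately have "g s<=a" using sides[of s] s by auto
 then obtain s' where "s':{l..a}" "g s' = (a + b) / 2" using IVT[OF _ sub s, of a "(a + b) / 2"] gaN(1) ab s by auto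
 thus False using X[of s'] sub mid by auto
qed
have right: "g s<=a" if s: "s:{b..r}" for s
proof (rule ccontr)
 assume "~ g s<=a"
 moreover have sub: "{b..r}<=H" using b(2) unfolding lr(4) by auto
 ultimately have "b<=g s" using sides[of s] s by auto
 then obtain s' where "s':{b..r}" "g s' = (a + b) / 2" using IVT[OF _ sub _ s, of b "(a + b) / 2"] gaN(2) ab s by auto
 thus False using X[of s'] sub mid by auto
qed
have abQ: "a:Q" "b:Q"
proof -
 obtain K c d where K: "a:K" "K = {c..d}" "d:Q" "Orb K = Orb J" using tight_piece_ends[OF J(2), of a] aN(1) unfolding N_def by blast
 have "~ a<d"
 proof
  assume "a<d"
  hence "min ((a + b) / 2) d:K Int {a<..<b}" using K(1) ab unfolding K(2) by (auto simp: min_def)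
  thus False using gap sub_orb[of K] K(4) unfolding N_def by blast
 qed
 thus "a:Q" using K(1-3) by auto
 obtain K c d where K: "b:K" "K = {c..d}" "c:Q" "Orb K = Orb J" using tight_piece_ends[OF J(2), of b] b(1) unfolding N_def by blast
 have "~ c<b"
 proof
  assume "c<b"
  hence "max ((a + b) / 2) c:K Int {a<..<b}" using K(1) ab unfolding K(2) by (auto simp: max_def)
  thus False using gap sub_orb[of K] K(4) unfolding N_def by blast
 qed
 thus "b:Q" using K(1-3) by auto
qed
have preQ: "(q:{l..a} --> q:g ` {b..r}) & (q:{b..r} --> q:g ` {l..a})" if q: "q:Q" "q:H" for q
proof -
 obtain q' where q': "q':Q" "q':H" "g q' = q" using tight_invariant_piece[OF t fQ q] unfolding g_def by blast
 have "q'~:{a<..<b}" using QN q'(1) mN by blast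
 hence "q':{l..a} | q':{b..r}" using q'(2) unfolding lr(4) by auto
 thus ?thesis using left right q'(3) ab by force
qed
have lar: "l<=a" "b<=r" using aN(2) b(2) unfolding lr(4) by auto
have gconn': "connected (g ` {u..v})" if "{u..v}<=H" for u v using gc that by (meson connected_Icc connected_continuous_image continuous_on_subset)
have subs: "{l..a}<=H" "{b..r}<=H" using lar aN(2) b(2) unfolding lr(4) by auto
have gin: "g s:H" if "s:H" for s using gH that by blast
have g1: "g ` {l..a} = {b..r}"
proof
 show "g ` {l..a}<={b..r}" using left gin subs(1) unfolding lr(4) by force
 have "b:g ` {l..a}" "r:g ` {l..a}" using preQ[of b] preQ[of r] abQ lrQ lar b(2) lr by auto
 thus "{b..r}<=g ` {l..a}" by (rule connected_contains_Icc[OF gconn'[OF subs(1)]])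
qed
have g2: "g ` {b..r} = {l..a}"
proof
 show "g ` {b..r}<={l..a}" using right gin subs(2) unfolding lr(4) by force
 have "l:g ` {b..r}" "a:g ` {b..r}" using preQ[of l] preQ[of a] abQ lrQ lar aN(2) lr by auto
 thus "{l..a}<=g ` {b..r}" by (rule connected_contains_Icc[OF gconn'[OF subs(2)]])
qed
have fm: "fn (m + i) ` {l..a} = fn i ` {b..r}" for i using g1 unfolding g_def by (metis add.commute img_add)
have fmi: "fn (m + i) ` {b..r} = fn i ` {l..a}" for i using g2 unfolding g_def by (metis add.commute img_add)
have piece: "fn i ` {l..a}<=fn i ` H" "fn i ` {b..r}<=fn i ` H" for i using subs by (auto intro: image_mono)
\<comment> \<open>A common point at time \<open>i\<close> would lead to a common point at time
  \<open>m\<close>, when the two halves have merely been exchanged.\<close>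
have halves: "fn i ` {l..a} Int fn i ` {b..r} = {}" if "i<=m" for i
proof (rule ccontr)
 assume "~ ?thesis"
 then obtain x where "x:fn i ` {l..a}" "x:fn i ` {b..r}" by blast
 moreover have e: "fn (m - i) ` fn i ` S = fn (m + 0) ` S" for S using `i <= m` by (simp add: img_add)
 ultimately have "fn (m - i) x:fn (m + 0) ` {l..a} Int fn (m + 0) ` {b..r}" using e[of "{l..a}"] e[of "{b..r}"] by blast
 thus False unfolding fm fmi using ab by auto
qed
have A: "pint {l..a} (2 * m)" unfolding pint_def
proof (intro conjI)
 show "EX c d. 0<=c & c<=d & d<=1 & {l..a} = {c..d}" using lr lar ab by (intro exI[of _ l] exI[of _ a]) auto
 show "2 * m>=1" using pint_pos[OF H] by simp
 show "fn (2 * m) ` {l..a} = {l..a}" using fm[of m] fmi[of 0] by (simp add: mult_2)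
 have no: "fn i ` {l..a} Int fn j ` {l..a} = {}" if ij: "i<j" "j<2 * m" for i j
 proof (cases "j = m + i")
  case True
  thus ?thesis using halves[of i] fm[of i] ij by simp
 next
  case False
  have "i mod m~=j mod m"
  proof
   assume e: "i mod m = j mod m"
   hence "m dvd j - i" using ij(1) by (metis mod_eq_dvd_iff_nat less_imp_le)
   then obtain k where "j - i = m * k" by (elim dvdE)
   thus False using ij False by (cases k; cases "k - 1") (auto simp: algebra_simps)
  qed
  hence "fn i ` H Int fn j ` H = {}" using pint_disjoint[OF H, of i j] by blast
  thus ?thesis using piece(1)[of i] piece(1)[of j] by blast
 qed
 show "disjoint_family_on (%i. fn i ` {l..a}) {..<2 * m}" unfolding disjoint_family_on_def
  using no by (metis Int_commute lessThan_iff linorder_neqE_nat)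
qed
have "Q<=Orb {l..a}"
proof
 fix q assume q: "q:Q"
 then obtain i where i: "q:fn i ` H" using QH unfolding orb_def by blast
 have "fn i ` (Q Int H) = Q Int fn i ` H" by (rule tight_pieces_onto[OF t fQ])
 then obtain q' where q': "q':Q" "q':H" "q = fn i q'" using q i by blast
 have "q'~:{a<..<b}" using QN q'(1) mN by blast
 hence "q':{l..a} | q':{b..r}" using q'(2) unfolding lr(4) by auto
 hence "q:fn i ` {l..a} | q:fn (m + i) ` {l..a}" using q'(3) unfolding fm by blast
 thus "q:Orb {l..a}" using fpow_sub_orb by blast
qed
moreover have "Orb {l..a} Int C<=Q" using orb_mono[OF subs(1)] CQ by blast
moreover have "Q~={}" using q0 by blast
ultimately have "EX H2. H2<={l..a} & tight Q H2 (2 * m) & Q Int {l..a}<=H2" by (intro tighten[OF A clQ fQ])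
thus ?thesis using subs(1) by blast
qed

section \<open>Entropy\<close>

text \<open>A lap index that is defined everywhere: a turning point is counted to the lap on its
  left.\<close>

definition rnk::"real => nat" where "rnk x = card {c:C. c<x}"

definition code::"nat => real => nat list" where "code n x = map (%j. rnk (fn j x)) [0..<n]"

lemma rnk_le: "rnk x<=card C" unfolding rnk_def using finC by (intro card_mono) auto

lemma rnk_eq: assumes "rnk x = rnk y" "x<=y" shows "{x<..<y} Int C = {}"
proof -
have "{c:C. c<x} = {c:C. c<y}" by (rule card_subset_eq) (use assms finC in "auto simp: rnk_def")
hence "c<x" if "c:C" "c<y" for c using that by blast
thus ?thesis by force
qed

lemma rnk_const: assumes A: "is_interval A" "A Int C = {}" and x: "x:A" "y:A" shows "rnk x = rnk y"
proof -
have "c<x <-> c<y" if "c:C" for c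
proof -
 have "~ (u<=c & c<=v)" if "u:A" "v:A" for u v using A that `c:C` unfolding is_interval_1 by blast
 from this[OF x] this[OF x(2,1)] show ?thesis by linarith
qed
thus ?thesis unfolding rnk_def by (metis (mono_tags, lifting))
qed

lemma code_nth: "j<n ==> code n x ! j = rnk (fn j x)" unfolding code_def by simp

lemma length_code [simp]: "length (code n x) = n" unfolding code_def by simp

lemma finite_codes: "finite (code n ` S)"
proof -
have "code n ` S<={xs. set xs<={..card C} & length xs = n}" unfolding code_def using rnk_le by auto
thus ?thesis by (rule finite_subset) (simp add: finite_lists_length_eq)
qed

text \<open>On points with the same code all iterates before time \<open>n\<close> are monotone, so
  at each time the distance from the leftmost point \<open>x0\<close> grows along the set. The sum
  \<open>F\<close> of these distances lies between \<open>0\<close> and \<open>n\<close> and grows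
  by more than \<open>e\<close> from each point to the next.\<close>

lemma separated_class: assumes E: "finite E" "E<={0..1}" "separated f n e E" "e>0" and same: "!!x y. x:E ==> y:E ==> code n x = code n y"
shows "real (card E)<=real n / e + 1"
proof (cases "E = {}")
case True
thus ?thesis using E(4) by simp
next
case False
have lapE: "mlap f (fn i ` E)" if "i<n" for i
proof -
 let ?A = "fn i ` E"
 have fin: "finite ?A" "?A~={}" using E(1) False by auto
 have rk: "rnk u = rnk v" if uv: "u:?A" "v:?A" for u v
 proof -
  obtain x y where "x:E" "u = fn i x" "y:E" "v = fn i y" using uv by blast
  thus ?thesis using code_nth[OF `i < n`, of x] code_nth[OF `i < n`, of y] same[of x y] by simp
 qed
 have mm: "Min ?A:?A" "Max ?A:?A" "Min ?A<=Max ?A" using fin by auto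
 moreover have "?A<={0..1}" using E(2) by (rule fpow_unit)
 ultimately have "0<=Min ?A" "Max ?A<=1" by (meson atLeastAtMost_iff subsetD)+
 hence "mlap f {Min ?A..Max ?A}" using rnk_eq[OF rk[OF mm(1,2)] mm(3)] by (intro lap')
 thus ?thesis by (rule mlap_subset) (use fin(1) in auto)
qed
have lapk: "mlap (fn j) E" if "j<n" for j using lapE that by (intro mlap_iterate) auto
define x0 where "x0 = Min E"
define d where "d j x = abs (fn j x - fn j x0)" for j x
define F where "F x = (SUM j<n. d j x)" for x
have x0: "x0:E" "!!x. x:E ==> x0<=x" unfolding x0_def using E(1) False by auto
have dd: "d j y - d j x = abs (fn j y - fn j x)" if "x:E" "y:E" "x<=y" "j<n" for x y j
proof -
 have "(fn j x0<=fn j x & fn j x<=fn j y) | (fn j x0>=fn j x & fn j x>=fn j y)"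
  using lapk[OF that(4)] x0 that(1-3) unfolding mlap_def monotone_on_def by blast
 thus ?thesis unfolding d_def by auto
qed
have gap: "F x + e<F y" if xy: "x:E" "y:E" "x<y" for x y
proof -
 obtain i where i: "i<n" "dist (fn i x) (fn i y)>e" using E(3) xy unfolding separated_def by (metis less_irrefl)
 have "F y - F x = (SUM j<n. abs (fn j y - fn j x))" unfolding F_def sum_subtractf[symmetric] by (rule sum.cong) (use dd xy in auto)
 also have "...>=abs (fn i y - fn i x)" by (rule member_le_sum) (use i(1) in auto)
 finally show ?thesis using i(2) by (simp add: dist_real_def abs_minus_commute)
qed
have Fb: "0<=F x & F x<=real n" if x: "x:E" for x
proof -
 have "d j x<=1" for j using fpow_maps[of x j] fpow_maps[of x0 j] x x0(1) E(2) unfolding d_def by force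
 hence "F x<=(SUM j<n. 1)" unfolding F_def by (intro sum_mono)
 thus ?thesis unfolding F_def d_def by (simp add: sum_nonneg)
qed
define h where "h x = nat \<lfloor>F x / e\<rfloor>" for x
have "inj_on h E"
proof (rule linorder_inj_onI)
 fix x y assume "x<y" "x:E" "y:E"
 hence "(F x + e) / e<=F y / e" and 0: "0<=F x / e" using gap[of x y] Fb[of x] E(4) by (auto intro!: divide_right_mono)
 hence "F x / e + 1<=F y / e" using E(4) by (simp add: add_divide_distrib)
 hence "\<lfloor>F x / e\<rfloor> + 1<=\<lfloor>F y / e\<rfloor>" "0<=\<lfloor>F x / e\<rfloor>" using floor_mono[of "F x / e + 1" "F y / e"] 0 by simp_all
 thus "h x~=h y" unfolding h_def by linarith
qed auto
moreover have "h ` E<={..nat \<lfloor>real n / e\<rfloor>}" unfolding h_def using Fb E(4) by (auto intro!: nat_mono floor_mono divide_right_mono)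
ultimately have "card E<=card {..nat \<lfloor>real n / e\<rfloor>}" by (intro card_inj_on_le) auto
hence "real (card E)<=real (nat \<lfloor>real n / e\<rfloor>) + 1" by simp
also have "...<=real n / e + 1" using E(4) by (simp add: of_nat_nat)
finally show ?thesis .
qed

lemma separated_codes: assumes E: "finite E" "E<=S" "S<={0..1}" "separated f n e E" "e>0"
shows "real (card E)<=real (card (code n ` S)) * (real n / e + 1)"
proof -
have "card E = (SUM v:code n ` S. card {x:E. code n x = v})"
proof -
 have "E = (UN v:code n ` S. {x:E. code n x = v})" using E(2) by auto
 also have "card ... = (SUM v:code n ` S. card {x:E. code n x = v})" using E(1) finite_codes by (intro card_UN_disjoint) auto
 finally show ?thesis .
qed
also have "real ...<=(SUM v:code n ` S. real n / e + 1)" unfolding of_nat_sum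
 by (intro sum_mono separated_class) (use E in "auto simp: separated_def")
finally show ?thesis by simp
qed

text \<open>For a given starting piece the code is free only at the times \<open>F\<close> when its
  image contains a turning point. During one period a turning point lies in at most one image, so
  there are at most \<open>card C * (n div m + 1)\<close> such times.\<close>

lemma codes_base: assumes H: "pint H m" shows "card (code n ` Orb H)<=m * (card C + 1) ^ (card C * (n div m + 1))"
proof -
have m: "m>=1" by (rule pint_pos[OF H])
define P where "P i = fn i ` H" for i
have "card (code n ` P i)<=(card C + 1) ^ (card C * (n div m + 1))" for i
proof -
 define F where "F = {j:{..<n}. P (i + j) Int C~={}}"
 have "EX c. j:F --> c:P (i + j) Int C" for j unfolding F_def by auto
 then obtain c where c: "!!j. j:F ==> c j:P (i + j) Int C" by metis
 have "inj_on (%j. (c j, j div m)) F"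
 proof (rule inj_onI)
  fix j k assume jk: "j:F" "k:F" "(c j, j div m) = (c k, k div m)"
  hence "P (i + j) Int P (i + k)~={}" using c[of j] c[of k] by auto
  hence "(i + j) mod m = (i + k) mod m" unfolding P_def by (rule pint_disjoint[OF H])
  hence "j mod m = k mod m" using cong_add_lcancel_nat[of i j k m] unfolding cong_def by simp
  moreover have "j div m = k div m" using jk(3) by simp
  ultimately show "j = k" by (metis div_mult_mod_eq)
 qed
 moreover have "(%j. (c j, j div m)) ` F<=C \<times> {..n div m}"
 proof (intro image_subsetI)
  fix j assume j: "j:F"
  hence "j<=n" unfolding F_def by simp
  thus "(c j, j div m):C \<times> {..n div m}" using c[OF j] by (simp add: div_le_mono)
 qed
 ultimately have "card F<=card (C \<times> {..n div m})" using finC by (intro card_inj_on_le) auto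
 hence cF: "card F<=card C * (n div m + 1)" by (simp add: card_cartesian_product)
 have "inj_on (%v. restrict (nth v) F) (code n ` P i)"
 proof (rule inj_onI)
  fix v w assume "v:code n ` P i" "w:code n ` P i" and eq: "restrict (nth v) F = restrict (nth w) F"
  then obtain x y where xy: "x:P i" "y:P i" "v = code n x" "w = code n y" by blast
  show "v = w"
  proof (rule nth_equalityI)
   show "v ! j = w ! j" if "j<length v" for j
   proof (cases "j:F")
    case True
    thus ?thesis using eq by (metis restrict_apply')
   next
    case False
    have j: "j<n" using that xy(3) by simp
    have "fn j x:P (i + j)" "fn j y:P (i + j)" using xy(1,2) img_add[of j i H] unfolding P_def by (auto simp: add.commute)
    moreover have "P (i + j) Int C = {}" using False j unfolding F_def by auto
    moreover have "is_interval (P (i + j))" unfolding P_def using pint_conn[OF H] by (simp add: is_interval_connected_1)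
    ultimately show ?thesis using xy(3,4) j by (simp add: code_nth) (metis rnk_const)
   qed
  qed (use xy in simp)
 qed
 moreover have "(%v. restrict (nth v) F) ` code n ` P i<=F \<rightarrow>\<^sub>E {..card C}"
 proof (intro image_subsetI)
  fix v assume "v:code n ` P i"
  then obtain x where x: "v = code n x" by blast
  show "restrict (nth v) F:F \<rightarrow>\<^sub>E {..card C}" unfolding restrict_PiE_iff x F_def by (simp add: code_nth rnk_le)
 qed
 moreover have "finite F" unfolding F_def by simp
 ultimately have "card (code n ` P i)<=card (F \<rightarrow>\<^sub>E {..card C})" by (intro card_inj_on_le) (auto intro: finite_PiE)
 also have "... = (card C + 1) ^ card F" using `finite F` by (simp add: card_PiE)
 also have "...<=(card C + 1) ^ (card C * (n div m + 1))" using cF by (intro power_increasing) auto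
 finally show ?thesis .
qed
hence "(SUM i<m. card (code n ` P i))<=(SUM i<m. (card C + 1) ^ (card C * (n div m + 1)))" by (intro sum_mono)
moreover have "code n ` Orb H = (UN i<m. code n ` P i)" unfolding P_def pint_orb[OF H] by blast
hence "card (code n ` Orb H)<=(SUM i<m. card (code n ` P i))" using card_UN_le[of "{..<m}"] by simp
ultimately show ?thesis by simp
qed

text \<open>Up to its first entry into the smaller cycle, at time \<open>t\<close>, an orbit has a
  code that depends only on the starting piece; from then on the code is that of a point of the
  smaller cycle. So piece, \<open>t\<close> and the latter code determine everything.\<close>

lemma codes_step: assumes H: "pint H m" and H': "pint H' m'"
 and const: "!!i x y. x:fn i ` H ==> y:fn i ` H ==> x~:Orb H' ==> y~:Orb H' ==> rnk x = rnk y"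
shows "card (code n ` Orb H)<=m * (n + 1) * card (code n ` Orb H')"
proof -
let ?N = "Orb H'"
define gw where "gw i j = rnk (SOME x. x:fn (j + i) ` H & x~:?N)" for i j
define glue where "glue = (%((i, t), v). map (%j. if j<t then gw i j else v ! (j - t)) [0..<n])"
have "code n ` Orb H<=glue ` (({..<m} \<times> {..n}) \<times> code n ` ?N)"
proof
 fix v assume "v:code n ` Orb H"
 then obtain x where x: "x:Orb H" "v = code n x" by blast
 then obtain i where i: "i<m" "x:fn i ` H" unfolding pint_orb[OF H] by blast
 define t where "t = (LEAST t. fn t x:?N | t = n)"
 have t: "fn t x:?N | t = n" unfolding t_def by (rule LeastI[of _ n]) simp
 have tn: "t<=n" unfolding t_def by (rule Least_le) simp
 have before: "fn j x~:?N" if "j<t" for j using not_less_Least[of j "%t. fn t x:?N | t = n"] that unfolding t_def by blast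
 \<comment> \<open>If the orbit does not enter before time \<open>n\<close>, any point serves as
   \<open>y\<close>, since \<open>glue\<close> then never looks at its code.\<close>
 obtain y where y: "y:?N" "t<n ==> y = fn t x"
 proof (cases "t = n")
  case True
  obtain y where "y:H'" using pint_nonempty[OF H'] by blast
  thus ?thesis using that[of y] True sub_orb[of H'] by blast
 next
  case False
  thus ?thesis using that[of "fn t x"] t by blast
 qed
 have "v = glue ((i, t), code n y)"
 proof (rule nth_equalityI)
  show "v ! j = glue ((i, t), code n y) ! j" if "j<length v" for j
  proof (cases "j<t")
   case True
   have "fn j x:fn (j + i) ` H & fn j x~:?N" using i(2) before[OF True] img_add[of j i H] by blast
   hence "gw i j = rnk (fn j x)" unfolding gw_def by (rule someI2) (use const `fn j x:_ & _` in blast)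
   thus ?thesis using True that x(2) unfolding glue_def by (simp add: code_nth)
  next
   case False
   hence "fn (j - t) y = fn j x" using y(2) that x(2) by (simp flip: fpow_add)
   thus ?thesis using False that x(2) unfolding glue_def by (simp add: code_nth)
  qed
 qed (use x(2) in "simp add: glue_def")
 thus "v:glue ` (({..<m} \<times> {..n}) \<times> code n ` ?N)" using i(1) tn y(1) by blast
qed
hence "card (code n ` Orb H)<=card (({..<m} \<times> {..n}) \<times> code n ` ?N)"
 using finite_codes by (meson card_image_le card_mono finite_SigmaI finite_atMost finite_imageI finite_lessThan order_trans)
thus ?thesis by (simp add: card_cartesian_product)
qed

text \<open>At most two pieces of the cycle of \<open>H'\<close> lie in a piece of the cycle of
  \<open>H\<close>, and they contain its end points, which are in \<open>Q\<close>. What remains is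
  an interval without turning points, as those are in \<open>Q\<close>, too.\<close>

lemma two_pieces_const: assumes t: "tight Q H m" and t': "tight Q H' (2 * m)" and HH: "H'<=H" and x: "x:fn i ` H" "y:fn i ` H" "x~:Orb H'" "y~:Orb H'"
shows "rnk x = rnk y"
proof (rule rnk_const[of "fn i ` H - Orb H'"])
have H: "pint H m" "Orb H Int C<=Q" and H': "pint H' (2 * m)" "Q<=Orb H'" using t t' unfolding tight_def by auto
obtain l r where lr: "fn i ` H = {l..r}" "l:Q" "r:Q" using t unfolding tight_def by blast
have "l<=r" using x(1) unfolding lr(1) by simp
show "(fn i ` H - Orb H') Int C = {}" using H(2) H'(2) fpow_sub_orb[of i H] by blast
have pc: "EX j. w:fn j ` H' & (j mod (2 * m) = i mod (2 * m) | j mod (2 * m) = (m + i) mod (2 * m))"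
 if w: "w:{l..r}" "w:Orb H'" for w
proof -
 obtain j where j: "w:fn j ` H'" using w(2) unfolding orb_def by blast
 hence "fn j ` H Int fn i ` H~={}" using HH w(1) lr(1) by blast
 hence "j mod m = i mod m" by (rule pint_disjoint[OF H(1)])
 hence "j mod (2 * m) = i mod m | j mod (2 * m) = m + i mod m" "i mod (2 * m) = i mod m | i mod (2 * m) = m + i mod m"
  using mod_mult2_eq[of j m 2] mod_mult2_eq[of i m 2] by (auto simp: mult.commute mod2_eq_if)
 moreover have "(m + i) mod (2 * m) = (m + i mod (2 * m)) mod (2 * m)" by (simp add: mod_simps)
 moreover have m: "i mod m<m" using pint_pos[OF H(1)] by simp
 have "m + (m + i mod m) = i mod m + 2 * m" by simp
 hence "(m + (m + i mod m)) mod (2 * m) = i mod m" "(m + i mod m) mod (2 * m) = m + i mod m" using m by (simp_all only: mod_add_self2) simp_all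
 ultimately show ?thesis using j by (intro exI[of _ j]) auto
qed
show "is_interval (fn i ` H - Orb H')" unfolding lr(1) is_interval_1
proof (intro ballI allI impI)
 fix u v w assume u: "u:{l..r} - Orb H'" "v:{l..r} - Orb H'" "u<=w & w<=v"
 have out: "~ (EX j. z:fn j ` H' & z':fn j ` H' & s:{u, v} & z<=s & s<=z')" for z z' s
 proof
  assume "EX j. z:fn j ` H' & z':fn j ` H' & s:{u, v} & z<=s & s<=z'"
  then obtain j where j: "z:fn j ` H'" "z':fn j ` H'" "s:{u, v}" "z<=s" "s<=z'" by blast
  hence "s:fn j ` H'" using connected_contains_Icc[OF pint_conn[OF H'(1)] j(1,2)] by auto
  thus False using fpow_sub_orb[of j H'] j(3) u(1,2) by blast
 qed
 have "w~:Orb H'"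
 proof
  assume w: "w:Orb H'"
  have meq: "fn j ` H' = fn k ` H'" if "j mod (2 * m) = k mod (2 * m)" for j k using that pint_mod[OF H'(1)] by metis
  obtain j where j: "w:fn j ` H'" "j mod (2 * m) = i mod (2 * m) | j mod (2 * m) = (m + i) mod (2 * m)" using pc[of w] w u by auto
  obtain jl where jl: "l:fn jl ` H'" "jl mod (2 * m) = i mod (2 * m) | jl mod (2 * m) = (m + i) mod (2 * m)"
   using pc[of l] lr(2) H'(2) `l <= r` by auto
  obtain jr where jr: "r:fn jr ` H'" "jr mod (2 * m) = i mod (2 * m) | jr mod (2 * m) = (m + i) mod (2 * m)"
   using pc[of r] lr(3) H'(2) `l <= r` by auto
  have "fn j ` H' = fn jl ` H' | fn j ` H' = fn jr ` H' | fn jl ` H' = fn jr ` H'" using j(2) jl(2) jr(2) meq by metis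
  hence "l:fn j ` H' | r:fn j ` H' | r:fn jl ` H'" using jl(1) jr(1) by blast
  thus False using out[of l w u] out[of w r v] out[of l r u] j(1) jl(1) u by auto
 qed
 thus "w:{l..r} - Orb H'" using u by auto
qed
qed (use x in auto)

lemma doubling_sequence: assumes Q: "solen Q" and t: "tight Q K N" and nb: "!!K' k. bas K' k ==> ~ Orb K'<=Orb K"
shows "EX H. H 0 = K & (ALL n. tight Q (H n) (2 ^ n * N) & H (Suc n)<=H n)"
proof -
define Pr where "Pr n X <-> tight Q X (2 ^ n * N) & X<=K & (n = 0 --> X = K)" for n X
have "EX H. ALL n. Pr n (H n) & H (Suc n)<=H n"
proof (rule dependent_nat_choice)
 show "EX X. Pr 0 X" using t unfolding Pr_def by auto
 fix X n assume X: "Pr n X"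
 have "~ Orb K'<=Orb X" if "bas K' k" for K' k using nb[OF that] orb_mono[of X K] X unfolding Pr_def by blast
 then obtain Y where "Y<=X" "tight Q Y (2 * (2 ^ n * N))" using doubling[OF Q, of X "2 ^ n * N"] X unfolding Pr_def by blast
 thus "EX Y. Pr (Suc n) Y & Y<=X" using X unfolding Pr_def by (intro exI[of _ Y]) (auto simp: mult.assoc)
qed
then obtain H where H: "ALL n. Pr n (H n) & H (Suc n)<=H n" ..
have "Pr 0 (H 0)" using H[THEN spec, of 0] by simp
hence "H 0 = K" unfolding Pr_def by simp
moreover have "ALL n. tight Q (H n) (2 ^ n * N) & H (Suc n)<=H n" using H unfolding Pr_def by simp
ultimately show ?thesis by (intro exI[of _ H] conjI)
qed

lemma codes_bound: assumes H: "!!n. tight Q (H n) (2 ^ n * N) & H (Suc n)<=H n"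
shows "real (card (code n ` Orb (H 0)))<=(PROD j<k. real (2 ^ j * N)) * (real n + 1) ^ k * real (card (code n ` Orb (H k)))"
proof (induction k)
case (Suc k)
have P: "pint (H j) (2 ^ j * N)" for j using H[of j] unfolding tight_def by simp
have "tight Q (H k) (2 ^ k * N)" "tight Q (H (Suc k)) (2 * (2 ^ k * N))" "H (Suc k)<=H k" using H[of k] H[of "Suc k"] by (simp_all add: mult.assoc)
from codes_step[OF P P two_pieces_const[OF this]]
have "card (code n ` Orb (H k))<=2 ^ k * N * (n + 1) * card (code n ` Orb (H (Suc k)))" .
hence "real (card (code n ` Orb (H k)))<=real (2 ^ k * N * (n + 1) * card (code n ` Orb (H (Suc k))))" by (simp only: of_nat_le_iff)
moreover have "0<=(PROD j<k. real (2 ^ j * N)) * (real n + 1) ^ k" by (intro mult_nonneg_nonneg prod_nonneg) auto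
ultimately have "(PROD j<k. real (2 ^ j * N)) * (real n + 1) ^ k * real (card (code n ` Orb (H k))) <=
 (PROD j<k. real (2 ^ j * N)) * (real n + 1) ^ k * real (2 ^ k * N * (n + 1) * card (code n ` Orb (H (Suc k))))" by (rule mult_left_mono)
also have "... = (PROD j<Suc k. real (2 ^ j * N)) * (real n + 1) ^ Suc k * real (card (code n ` Orb (H (Suc k))))"
 unfolding prod.lessThan_Suc power_Suc of_nat_mult[of "_ * _" "card _"] of_nat_mult[of "_ * _" "_ + _"] by (simp add: mult_ac)
finally show ?case using Suc by linarith
qed simp

text \<open>Descending \<open>k\<close> levels costs a factor polynomial in \<open>n\<close>. At
  level \<open>k\<close> the codes grow at most exponentially, with rate
  \<open>card C * ln (card C + 1)\<close> divided by the period \<open>2 ^ k * N\<close>; this tends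
  to zero as \<open>k\<close> grows.\<close>

lemma entropy_zero: assumes Q: "solen Q" and t: "tight Q K N" and nb: "!!K' k. bas K' k ==> ~ Orb K'<=Orb K" shows "entropy_on f (Orb K) = 0"
proof -
obtain H where H0: "H 0 = K & (ALL n. tight Q (H n) (2 ^ n * N) & H (Suc n)<=H n)" using doubling_sequence[OF assms] ..
have H: "H 0 = K" "tight Q (H n) (2 ^ n * N) & H (Suc n)<=H n" for n using H0 by simp_all
have P: "pint (H j) (2 ^ j * N)" for j using H(2)[of j] unfolding tight_def by simp
have N: "N>=1" using pint_pos[OF P[of 0]] by simp
define S where "S e n = (SUP E\<in>{E. finite E & E<=Orb K & separated f n e E}. ereal (ln (real (card E))))" for e n
define c where "c = real (card C) * ln (real (card C) + 1)"
have c: "c>=0" unfolding c_def by simp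
have lim: "limsup (%n. S e n / ereal (real n))<=ereal (c / real (2 ^ k * N))" if e: "e>0" for e k
proof -
 define M where "M = real (2 ^ k * N)"
 define A where "A = (PROD j<k. real (2 ^ j * N))"
 have M: "M>0" "A>0" unfolding M_def A_def using N by (auto intro!: prod_pos)
 define b where "b n = (ln A + real k * ln (real n + 1) + ln M + c * (real n / M + 1) + ln (real n / e + 1)) / real n" for n
 have le: "S e n / ereal (real n)<=ereal (b n)" if n: "n>=1" for n
 proof -
  have "ereal (ln (real (card E)))<=ereal (b n * real n)" if E: "finite E" "E<=Orb K" "separated f n e E" for E
  proof -
   have pos: "0<real n / e + 1" "(0::real)<(real n + 1) ^ k" using e by (auto intro: add_nonneg_pos)
   have "real (n div (2 ^ k * N)) * M<=real n" unfolding M_def by (metis div_times_less_eq_dividend of_nat_le_iff of_nat_mult)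
   hence cd: "real (n div (2 ^ k * N))<=real n / M" using M(1) by (simp add: pos_le_divide_eq)
   have cb: "real (card (code n ` Orb (H k)))<=M * (real (card C) + 1) ^ (card C * (n div (2 ^ k * N) + 1))"
    using of_nat_mono[OF codes_base[OF P[of k], of n], where 'a = real] unfolding M_def of_nat_mult[of _ "_ ^ _"] of_nat_power of_nat_add of_nat_1 .
   have "real (card E)<=real (card (code n ` Orb K)) * (real n / e + 1)"
    by (rule separated_codes[OF E(1,2) _ E(3) e]) (use cyc_unit[OF P[of 0]] H(1) in simp)
   also have "...<=A * (real n + 1) ^ k * (M * (real (card C) + 1) ^ (card C * (n div (2 ^ k * N) + 1))) * (real n / e + 1)"
   proof (rule mult_right_mono)
    have "real (card (code n ` Orb K))<=A * (real n + 1) ^ k * real (card (code n ` Orb (H k)))"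
     using codes_bound[OF H(2), of n k] H(1) unfolding A_def by simp
    also have "...<=A * (real n + 1) ^ k * (M * (real (card C) + 1) ^ (card C * (n div (2 ^ k * N) + 1)))"
     using cb M pos by (intro mult_left_mono) auto
    finally show "real (card (code n ` Orb K))<=..." .
   qed (use pos in simp)
   finally have bd: "real (card E)<=A * (real n + 1) ^ k * (M * (real (card C) + 1) ^ (card C * (n div (2 ^ k * N) + 1))) * (real n / e + 1)" .
   have "ln (real (card E))<=ln A + real k * ln (real n + 1) + ln M + real (card C * (n div (2 ^ k * N) + 1)) * ln (real (card C) + 1) + ln (real n / e + 1)"
   \<comment> \<open>For empty \<open>E\<close> the convention \<open>ln 0 = 0\<close> does no harm,
     because the bound is nonnegative: \<open>A\<close> and \<open>M\<close> are at least
     \<open>1\<close>.\<close>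
   proof (cases "card E = 0")
    case False
    hence "ln (real (card E))<=ln (A * (real n + 1) ^ k * (M * (real (card C) + 1) ^ (card C * (n div (2 ^ k * N) + 1))) * (real n / e + 1))"
     using bd by simp
    also have "... = ln A + real k * ln (real n + 1) + ln M + real (card C * (n div (2 ^ k * N) + 1)) * ln (real (card C) + 1) + ln (real n / e + 1)"
     using M pos by (simp add: ln_mult ln_realpow add_pos_nonneg)
    finally show ?thesis .
   next
    case True
    have "1<=real (2 ^ j * N)" for j using of_nat_mono[OF pint_pos[OF P[of j]], where 'a = real] unfolding of_nat_1 .
    hence "M>=1" "A>=1" unfolding M_def A_def by (blast, blast intro: prod_ge_1)
    thus ?thesis using True e by simp
   qed
   also have "real (card C * (n div (2 ^ k * N) + 1)) * ln (real (card C) + 1)<=c * (real n / M + 1)"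
   proof -
    have "real (card C * (n div (2 ^ k * N) + 1)) * ln (real (card C) + 1) = c * (real (n div (2 ^ k * N)) + 1)" unfolding c_def by (simp add: algebra_simps)
    also have "...<=c * (real n / M + 1)" using cd c by (intro mult_left_mono) auto
    finally show ?thesis .
   qed
   finally show ?thesis unfolding b_def using n by simp
  qed
  hence "S e n<=ereal (b n * real n)" unfolding S_def by (intro SUP_least) auto
  hence "S e n / ereal (real n)<=ereal (b n * real n) / ereal (real n)" using n by (intro ereal_divide_right_mono) auto
  thus ?thesis using n by simp
 qed
 have "b \<longlonglongrightarrow> c * inverse M" unfolding b_def using e M by real_asymp
 hence "b \<longlonglongrightarrow> c / M" by (simp add: divide_inverse)
 hence "limsup (%n. ereal (b n)) = ereal (c / M)" by (intro lim_imp_Limsup) auto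
 moreover have "limsup (%n. S e n / ereal (real n))<=limsup (%n. ereal (b n))"
  by (rule Limsup_mono) (use le in "auto simp: eventually_sequentially intro!: exI[of _ 1]")
 ultimately show ?thesis unfolding M_def by simp
qed
have le0: "limsup (%n. S e n / ereal (real n))<=0" if e: "e>0" for e
proof (rule LIMSEQ_le_const)
 have "(%k. c / real (2 ^ k * N)) \<longlonglongrightarrow> 0" using N by real_asymp
 thus "(%k. ereal (c / real (2 ^ k * N))) \<longlonglongrightarrow> 0" by (simp add: zero_ereal_def)
qed (use lim[OF e] in auto)
have ge0: "0<=limsup (%n. S 1 n / ereal (real n))"
proof -
 have "0<=S 1 n / ereal (real n)" for n
 proof -
  have "ereal (ln (real (card ({}::real set))))<=S 1 n" unfolding S_def by (rule SUP_upper) (simp add: separated_def)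
  thus ?thesis by (simp add: zero_ereal_def[symmetric])
 qed
 thus ?thesis by (intro le_Limsup) auto
qed
have "entropy_on f (Orb K) = (SUP e\<in>{0<..}. limsup (%n. S e n / ereal (real n)))" unfolding entropy_on_def S_def ..
also have "... = 0"
proof (rule antisym)
 show "(SUP e\<in>{0<..}. limsup (%n. S e n / ereal (real n)))<=0" using le0 by (intro SUP_least) auto
 show "0<=(SUP e\<in>{0<..}. limsup (%n. S e n / ereal (real n)))" by (rule SUP_upper2[of 1]) (use ge0 in auto)
qed
finally show ?thesis .
qed

text \<open>If every tight cycle around \<open>Q\<close> contained the cycle of a basic set, all
  these would have the trace \<open>Q Int C\<close>. By finiteness one of them would occur at
  infinitely many levels and thus lie in \<open>Q\<close>, but it contains a periodic point.\<close>

lemma cycle_without_basic: assumes Q: "solen Q" and fin: "finite (G_family f C (Q Int C))"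
shows "EX K N. tight Q K N & (ALL K' k. bas K' k --> ~ Orb K'<=Orb K)"
proof (rule ccontr)
assume neg: "~ ?thesis"
obtain H p where H: "gen H p" "Q = QQ H" "!!j. tight Q (H j) (p j)" using tight_system[OF Q] by blast
have "EX K k. bas K k & Orb K<=Orb (H n)" for n using neg H(3)[of n] by blast
then obtain K k where K: "!!n. bas (K n) (k n)" "!!n. Orb (K n)<=Orb (H n)" by metis
have "Orb (K n) Int C = Q Int C" for n
proof -
 have s: "Orb (K n) Int C<=Q" using K(2)[of n] H(3)[of n] unfolding tight_def by blast
 obtain x where x: "x:Orb (K n)" "x:Q" using bas_C[OF K(1)[of n]] s by blast
 hence "EX j. Orb (H j)<=Orb (K n)" using solen_enters_cyc[OF H(1) _ x(1) basD(1)[OF K(1)]] H(2) by simp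
 hence "Q<=Orb (K n)" using H(2) by blast
 thus ?thesis using s by blast
qed
hence "Bs (K n):G_family f C (Q Int C)" for n unfolding G_iff using K(1)[of n] by blast
hence "range (%n. Bs (K n))<=G_family f C (Q Int C)" by (rule image_subsetI)
then obtain n0 where n0: "infinite {n. Bs (K n) = Bs (K n0)}" using pigeonhole_infinite[of UNIV "%n. Bs (K n)"] finite_subset[OF _ fin] by auto
have "Orb (K n0)<=Orb (H j)" for j
proof -
 obtain n where n: "n>=j" "Bs (K n) = Bs (K n0)" using n0 unfolding infinite_nat_iff_unbounded_le by blast
 hence "Orb (K n0) = Orb (K n)" using basic_determines[OF K(1) K(1)] by metis
 also have "...<=Orb (H n)" by (rule K(2))
 also have "...<=Orb (H j)" by (rule gen_orb_dec[OF H(1) n(1)])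
 finally show ?thesis .
qed
hence "Orb (K n0)<=Q" unfolding H(2) by blast
moreover obtain z where "z:K n0" "z:Per f" using pint_has_periodic[OF basD(1)[OF K(1)]] by blast
ultimately show False using solenoid_no_Per[OF Q] sub_orb[of "K n0"] by blast
qed

theorem nonchain_solenoid: assumes Q: "solen Q" and fin: "finite (G_family f C (Q Int C))"
shows "EX K N. pint K N & Q<=Orb K & (ALL X. solen X & X<=Orb K --> X = Q) &
 entropy_on f (Orb K) = 0 & Orb K Int C = Q Int C & corresponding_group f Q (H_group (%n. 2 ^ n * N))"
proof -
obtain K N where K: "tight Q K N" and nb: "!!K' k. bas K' k ==> ~ Orb K'<=Orb K" using cycle_without_basic[OF assms] by blast
have K': "pint K N" "Q<=Orb K" "Orb K Int C<=Q" using K unfolding tight_def by auto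
obtain H where H0: "H 0 = K & (ALL n. tight Q (H n) (2 ^ n * N) & H (Suc n)<=H n)" using doubling_sequence[OF Q K nb] ..
have H: "H 0 = K" "tight Q (H n) (2 ^ n * N) & H (Suc n)<=H n" for n using H0 by simp_all
have "filterlim (%n. 2 ^ n * N) at_top sequentially"
proof (rule filterlim_at_top_mono[OF filterlim_ident])
 have "n<=2 ^ n * N" for n using pint_pos[OF K'(1)] less_exp[of n] by (metis le_trans less_imp_le mult.right_neutral mult_le_mono2)
 thus "\<forall>\<^sub>F n in sequentially. n<=2 ^ n * N" by simp
qed
hence g: "gen H (%n. 2 ^ n * N)" using H(2) unfolding gen_def tight_def by blast
have s: "solen (QQ H)" unfolding solenoidal_Q_def using g by blast
have "Q<=QQ H" using H(2) unfolding tight_def by blast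
hence "Q = QQ H" using solen_disjoint[OF Q s] solen_ne[OF Q] by blast
hence "corresponding_group f Q (H_group (%n. 2 ^ n * N))" unfolding corresponding_group_def using g by blast
\<comment> \<open>A solenoidal set contains a turning point, and the turning points of
  \<open>Orb K\<close> all belong to \<open>Q\<close>.\<close>
moreover have "X = Q" if X: "solen X" "X<=Orb K" for X by (rule solen_disjoint[OF X(1) Q]) (use solenoid_C[OF X(1)] X(2) K'(3) in blast)
moreover have "entropy_on f (Orb K) = 0" by (rule entropy_zero[OF Q K nb])
moreover have "Orb K Int C = Q Int C" using K'(2,3) by blast
ultimately show ?thesis using K'(1,2) by (intro exI[of _ K] exI[of _ N]) blast
qed

section \<open>Cycles of intervals containing the periodic points\<close>

definition hul::"nat => real => real => real set" where
"hul i p q = {min (fn i p) (fn i q)..max (fn i p) (fn i q)}"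

text \<open>Equivalence of periodic points whose iterates are never strictly separated by a turning
  point; \<open>f\<close> is then monotone on the hull of the iterates at every time. The hulls of
  the classes will be the intervals of the cover.\<close>

definition sim::"real => real => bool" where
"sim p q <-> p:{0..1} & q:{0..1} & (EX n>=1. fn n p = p & fn n q = q) & (ALL i. interior (hul i p q) Int C = {})"

lemma sim_period: "sim p q ==> EX n>=1. fn n p = p & fn n q = q" unfolding sim_def by blast

lemma sim_Per: "sim p q ==> p:Per f & q:Per f" unfolding sim_def Per_def by blast

lemma hul_sym: "hul i p q = hul i q p" unfolding hul_def by (simp add: min.commute max.commute)

lemma sim_sym: "sim p q ==> sim q p" unfolding sim_def hul_sym[of _ q p] by blast

lemma hul_mlap: "sim p q ==> mlap f (hul i p q)" unfolding hul_def sim_def using fpow_maps[of p i] fpow_maps[of q i] by (intro lap') auto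

lemma hul_step: "sim p q ==> t:hul i p q ==> f t:hul (Suc i) p q"
using hul_mlap[of p q i] mlap_between[of f "min (fn i p) (fn i q)" "max (fn i p) (fn i q)" t]
unfolding hul_def by (auto simp: min_def max_def split: if_splits)

lemma hul_iter: "sim p q ==> t:hul i p q ==> fn k t:hul (k + i) p q" by (induction k) (use hul_step in auto)

lemma hul_shift: "hul i (fn k p) (fn k q) = hul (i + k) p q" unfolding hul_def by (simp add: fpow_add)

lemma sim_shift: "sim p q ==> sim (fn k p) (fn k q)" unfolding sim_def hul_shift using fpow_maps by (metis add.commute fpow_add)

text \<open>A turning point between \<open>f ^^ i\<close> of two points could only be \<open>f ^^ i\<close> of the third one. As \<open>f\<close> folds there, the next images
 of the outer points are nested and an iterate of \<open>f\<close> would carry one of them into the wrong half.\<close>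

lemma sim_trans_aux: assumes pq: "sim p q" and qr: "sim q r" and C: "q:C" and o: "p<q" "q<r" shows False
proof -
obtain n1 n2 where n: "n1>=1" "fn n1 p = p" "fn n1 q = q" "n2>=1" "fn n2 q = q" "fn n2 r = r" using sim_period[OF pq] sim_period[OF qr] by blast
define N where "N = n1 * n2"
have N: "N>=1" "fn N p = p" "fn N q = q" "fn N r = r"
 unfolding N_def using n mult_fix[OF n(2), of n2] mult_fix[OF n(3), of n2] mult_fix[OF n(6), of n1] by (auto simp: mult.commute)
obtain k where k: "N = k + 1" using N(1) by (metis le_add_diff_inverse2)
have kf: "fn k (f x) = x" if "fn N x = x" for x using that unfolding k by (simp add: funpow_swap1)
have kN: "hul (k + 1) x y = {min x y..max x y}" if "fn N x = x" "fn N y = y" for x y using that unfolding hul_def k by simp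
have "{p<..<q} Int C = {}" "{q<..<r} Int C = {}" "0<=p" "r<=1"
proof -
 have "interior (hul 0 p q) Int C = {}" "interior (hul 0 q r) Int C = {}" "0<=p" "r<=1" using pq qr unfolding sim_def by auto
 thus "{p<..<q} Int C = {}" "{q<..<r} Int C = {}" "0<=p" "r<=1" using o unfolding hul_def by simp_all
qed
hence "(f p<=f q & f r<=f q) | (f q<=f p & f q<=f r)" using turn[OF C, of p r] o by simp
hence "f r:hul 1 p q | f p:hul 1 q r" unfolding hul_def by auto
thus False
proof
 assume "f r:hul 1 p q"
 hence "fn k (f r):hul (k + 1) p q" by (rule hul_iter[OF pq])
 thus False using kf[OF N(4)] kN[OF N(2,3)] o by auto
next
 assume "f p:hul 1 q r"
 hence "fn k (f p):hul (k + 1) q r" by (rule hul_iter[OF qr])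
 thus False using kf[OF N(2)] kN[OF N(3,4)] o by auto
qed
qed

lemma sim_trans: assumes pq: "sim p q" and qr: "sim q r" shows "sim p r" unfolding sim_def
proof (intro conjI allI)
show "p:{0..1}" "r:{0..1}" using pq qr unfolding sim_def by auto
obtain n1 n2 where n: "n1>=1" "fn n1 p = p" "n2>=1" "fn n2 r = r" using sim_period[OF pq] sim_period[OF qr] by blast
thus "EX n>=1. fn n p = p & fn n r = r"
 using mult_fix[OF n(2), of n2] mult_fix[OF n(4), of n1] by (intro exI[of _ "n1 * n2"]) (auto simp: mult.commute)
fix i
show "interior (hul i p r) Int C = {}"
proof (rule ccontr)
 assume "~ ?thesis"
 then obtain c where c: "c:C" "min (fn i p) (fn i r)<c" "c<max (fn i p) (fn i r)" unfolding hul_def by auto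
 have no: "c~:interior (hul i p q)" "c~:interior (hul i q r)" using pq qr c(1) unfolding sim_def by blast+
 have "c = fn i q" using c(2,3) no unfolding hul_def by (auto simp: min_def max_def split: if_splits)
 moreover note sim_shift[OF pq, of i] sim_shift[OF qr, of i]
 moreover from this have "sim (fn i r) (fn i q)" "sim (fn i q) (fn i p)" using sim_sym by blast+
 ultimately show False using sim_trans_aux[of "fn i p" "fn i q" "fn i r"] sim_trans_aux[of "fn i r" "fn i q" "fn i p"] c
  by (auto simp: min_def max_def split: if_splits)
qed
qed

lemma sim_refl: "p:Per f ==> sim p p" unfolding sim_def Per_def hul_def by auto

lemma sim_mid: "sim p q ==> t:Per f ==> t:hul 0 p q ==> sim p t" unfolding sim_def[of p t]
proof (intro conjI allI)
assume pq: "sim p q" and t: "t:Per f" "t:hul 0 p q"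
show "p:{0..1}" "t:{0..1}" using pq t(1) unfolding sim_def Per_def by auto
obtain n1 n2 where n: "n1>=1" "fn n1 p = p" "n2>=1" "fn n2 t = t" using sim_period[OF pq] t(1) unfolding Per_def by blast
thus "EX n>=1. fn n p = p & fn n t = t"
 using mult_fix[OF n(2), of n2] mult_fix[OF n(4), of n1] by (intro exI[of _ "n1 * n2"]) (auto simp: mult.commute)
fix i
have "fn i t:hul i p q" using hul_iter[OF pq t(2), of i] by simp
hence "hul i p t<=hul i p q" unfolding hul_def by auto
thus "interior (hul i p t) Int C = {}" using interior_mono pq unfolding sim_def by blast
qed

lemma hul_mlap_iterate: "sim p q ==> mlap (fn n) (hul 0 p q)" using hul_iter[of p q _ 0] by (intro mlap_iterate mlap_subset[OF hul_mlap[of p q]]) auto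

text \<open>\<open>f ^^ (2 * n)\<close> is increasing on the iterates of \<open>q\<close> at
  multiples of \<open>n\<close>, and a periodic point of an increasing map is fixed. This common
  period in a class is what makes the class closed.\<close>

lemma sim_fixed: assumes pq: "sim p q" and n: "fn n p = p" shows "fn (2 * n) q = q"
proof -
obtain N where N: "N>=1" "fn N q = q" using sim_period[OF pq] by blast
define O' where "O' = range (%k. fn (k * n) q)"
have "O'<=Orb {q}" unfolding O'_def orb_def by blast
hence fin: "finite O'" "O'~={}" using finite_subset[OF _ finite_orb[OF N(2,1)]] unfolding O'_def by auto
have "sim p t" if "t:O'" for t using that sim_shift[OF pq, of "_ * n"] mult_fix[OF n] unfolding O'_def by auto
hence "sim (Min O') (Max O')" using fin sim_trans[OF sim_sym] by (meson Max_in Min_in)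
hence "mlap (fn n) (hul 0 (Min O') (Max O'))" by (rule hul_mlap_iterate)
hence mO: "mlap (fn n) O'" by (rule mlap_subset) (use fin in "auto simp: hul_def")
have O1: "fn n t:O'" if "t:O'" for t
proof -
 obtain k where "t = fn (k * n) q" using `t:O'` unfolding O'_def by blast
 hence "fn n t = fn (Suc k * n) q" by (simp add: fpow_add)
 thus ?thesis unfolding O'_def by blast
qed
define G where "G t = fn n (fn n t)" for t
have mono: "G u<=G v" if "u:O'" "v:O'" "u<=v" for u v using mO that O1 unfolding mlap_def monotone_on_def G_def by blast
have qO: "q:O'" unfolding O'_def by (rule image_eqI[of _ _ 0]) simp_all
have GO: "(G ^^ k) q:O'" for k by (induction k) (use qO O1 in "auto simp: G_def")
have up: "q<=G q ==> (G ^^ k) q<=(G ^^ Suc k) q" "G q<=q ==> (G ^^ Suc k) q<=(G ^^ k) q" for k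
proof (induction k)
 case (Suc k)
 { case 1 thus ?case using Suc(1) mono[OF GO[of k] GO[of "Suc k"]] by simp next
  case 2 thus ?case using Suc(2) mono[OF GO[of "Suc k"] GO[of k]] by simp }
qed simp_all
have far: "q<=G q ==> G q<=(G ^^ Suc k) q" "G q<=q ==> (G ^^ Suc k) q<=G q" for k
proof (induction k)
 case (Suc k)
 { case 1 thus ?case using Suc(1) up(1)[of "Suc k"] by (meson order_trans) next
  case 2 thus ?case using Suc(2) up(2)[of "Suc k"] by (meson order_trans) }
qed simp_all
have G: "G = f ^^ (2 * n)" unfolding G_def by (simp add: mult_2 funpow_add fun_eq_iff)
have "(G ^^ N) q = fn (2 * n * N) q" unfolding G by (simp add: funpow_mult)
also have "... = q" by (rule mult_fix[OF N(2)])
finally have "(G ^^ Suc (N - 1)) q = q" using N(1) by simp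
hence "G q = q" using far[of "N - 1"] by (cases "q<=G q") auto
thus ?thesis unfolding G .
qed

section \<open>Hulls of the classes of periodic points\<close>

definition cls::"real => real set" where "cls p = {q. sim p q}"

definition L::"real => real set" where "L p = {Inf (cls p)..Sup (cls p)}"

lemma cls_compact: assumes p: "p:Per f" shows "compact (cls p)"
proof -
obtain n where n: "n>=1" "fn n p = p" using p unfolding Per_def by blast
have pu: "p:{0..1}" using p unfolding Per_def by blast
have "closed (cls p)" unfolding closed_sequential_limits
proof (intro allI impI, elim conjE)
 fix x e assume x: "ALL k. x k:cls p" "x \<longlonglongrightarrow> e"
 have s: "sim p (x k)" for k using x(1) unfolding cls_def by blast
 hence xu: "x k:{0..1}" for k unfolding sim_def by blast
 hence eu: "e:{0..1}" by (intro closed_sequentially[OF _ _ x(2)]) auto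
 have lim: "(%k. fn i (x k)) \<longlonglongrightarrow> fn i e" for i by (rule continuous_on_tendsto_compose[OF fpow_cont x(2) eu]) (use xu in auto)
 have "(%k. fn (2 * n) (x k)) = x" using sim_fixed[OF s n(2)] by (simp add: fun_eq_iff)
 hence "fn (2 * n) e = e" using LIMSEQ_unique[OF lim[of "2 * n"]] x(2) by simp
 moreover have "fn (2 * n) p = p" using mult_fix[OF n(2), of 2] by simp
 ultimately have per: "EX n>=1. fn n p = p & fn n e = e" using n(1) by (intro exI[of _ "2 * n"]) auto
 have "c~:interior (hul i p e)" if c: "c:C" for c i
 proof
  assume "c:interior (hul i p e)"
  hence "(fn i p<c & c<fn i e) | (fn i e<c & c<fn i p)" unfolding hul_def by (auto simp: min_def max_def split: if_splits)
  hence "\<forall>\<^sub>F k in sequentially. (fn i p<c & c<fn i (x k)) | (fn i (x k)<c & c<fn i p)"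
   using order_tendstoD[OF lim[of i], of c] by (auto elim: eventually_mono)
  then obtain k where "(fn i p<c & c<fn i (x k)) | (fn i (x k)<c & c<fn i p)" unfolding eventually_sequentially by blast
  hence "c:interior (hul i p (x k))" unfolding hul_def by auto
  thus False using s[of k] c unfolding sim_def by blast
 qed
 thus "e:cls p" unfolding cls_def sim_def using pu eu per by blast
qed
moreover have "cls p<={0..1}" unfolding cls_def sim_def by blast
ultimately show ?thesis by (rule compact_sub)
qed

lemma cls_ends: assumes p: "p:Per f"
shows "sim p (Inf (cls p))" "sim p (Sup (cls p))" "sim p q ==> q:L p" "sim (Inf (cls p)) (Sup (cls p))" "L p = hul 0 (Inf (cls p)) (Sup (cls p))"
proof -
have ne: "cls p~={}" using sim_refl[OF p] unfolding cls_def by blast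
note c = cpt_Inf_Sup[OF cls_compact[OF p] ne]
show s: "sim p (Inf (cls p))" "sim p (Sup (cls p))" using c(1,2) unfolding cls_def by auto
show "q:L p" if "sim p q" for q using c(3,4)[of q] that unfolding L_def cls_def by auto
show "sim (Inf (cls p)) (Sup (cls p))" using sim_trans[OF sim_sym[OF s(1)] s(2)] .
have "Inf (cls p)<=Sup (cls p)" using c(3)[OF c(2)] .
thus "L p = hul 0 (Inf (cls p)) (Sup (cls p))" unfolding L_def hul_def by simp
qed

lemma L_eq: assumes "sim p q" shows "L p = L q"
proof -
have "sim p t <-> sim q t" for t using sim_trans[OF sim_sym[OF assms], of t] sim_trans[OF assms, of t] by blast
hence "cls p = cls q" unfolding cls_def by blast
thus ?thesis unfolding L_def by simp
qed

text \<open>When two hulls meet, the left end of one of them lies in the other. It is itself a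
  periodic point, so \<open>sim_mid\<close> makes it equivalent to the ends of that hull.\<close>

lemma L_meet: assumes p: "p:Per f" and q: "q:Per f" and ne: "L p Int L q~={}" shows "L p = L q"
proof -
have aux: "L p = L q" if pq: "p:Per f" "q:Per f" "Inf (cls q):L p" for p q
proof -
 note P = cls_ends[OF pq(1)] and Q' = cls_ends[OF pq(2)]
 have "Inf (cls q):Per f" using sim_Per[OF Q'(1)] by blast
 hence "sim (Inf (cls p)) (Inf (cls q))" using sim_mid[OF P(4)] pq(3) P(5) by simp
 hence "sim p q" using sim_trans[OF sim_trans[OF P(1)]] sim_sym[OF Q'(1)] by blast
 thus ?thesis by (rule L_eq)
qed
have "Inf (cls q):L p | Inf (cls p):L q" using ne unfolding L_def by auto
thus ?thesis using aux[OF p q] aux[OF q p] by auto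
qed

lemma L_unit: "p:Per f ==> L p<={0..1}" using cls_ends(1,2)[of p] unfolding sim_def L_def by auto

text \<open>The image of the hull lies between points equivalent to \<open>f p\<close>. Conversely,
  such a point is the image of its own iterate at time \<open>N * n - 1\<close>, which is equivalent
  to \<open>p\<close>.\<close>

lemma L_image: assumes p: "p:Per f" shows "f ` L p = L (f p)"
proof -
note P = cls_ends[OF p]
have fp: "f p:Per f" using Per_orbit[OF p, of 1] by simp
note F = cls_ends[OF fp]
obtain n where n: "n>=1" "fn n p = p" using p unfolding Per_def by blast
have ends: "f t:L (f p)" if "sim p t" for t using F(3) sim_shift[OF that, of 1] by simp
have "f ` L p<=hul 1 (Inf (cls p)) (Sup (cls p))" using hul_step[OF P(4)] unfolding P(5) by auto
also have "...<=L (f p)" using ends[OF P(1)] ends[OF P(2)] unfolding hul_def L_def[of "f p"] by auto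
finally have "f ` L p<=L (f p)" .
moreover have onto: "t:f ` L p" if t: "sim (f p) t" for t
proof -
 obtain N where N: "N>=1" "fn N (f p) = f p" "fn N t = t" using sim_period[OF t] by blast
 define k where "k = N * n - 1"
 have k: "Suc k = N * n" unfolding k_def using N(1) n(1) by simp
 have "f (fn k t) = fn (N * n) t" unfolding k[symmetric] by simp
 also have "... = t" using mult_fix[OF N(3), of n] by (simp add: mult.commute)
 finally have ft: "f (fn k t) = t" .
 have "fn k (f p) = fn (N * n) p" unfolding k[symmetric] by (simp add: funpow_swap1)
 also have "... = p" by (rule mult_fix[OF n(2)])
 finally have "sim p (fn k t)" using sim_shift[OF t, of k] by simp
 thus ?thesis using P(3) ft by (metis imageI)
qed
have "connected (f ` L p)" using fpow_conn[OF _ L_unit[OF p], of 1] by (simp add: L_def)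
hence "L (f p)<=f ` L p" unfolding L_def[of "f p"] by (rule connected_contains_Icc) (rule onto[OF F(1)], rule onto[OF F(2)])
ultimately show ?thesis by blast
qed

lemma L_fpow: "p:Per f ==> fn k ` L p = L (fn k p)"
proof (induction k)
case (Suc k)
have "(f ^^ Suc k) ` L p = f ` fn k ` L p" by (rule fpow_Suc_image[symmetric])
thus ?case using Suc L_image[OF Per_orbit[OF Suc.prems]] by simp
qed simp

lemma L_pint: assumes p: "p:Per f" shows "EX m. pint (L p) m"
proof -
obtain n where n: "n>=1" "fn n p = p" using p unfolding Per_def by blast
define R where "R m <-> m>=1 & fn m ` L p = L p" for m
have Rn: "R n" unfolding R_def L_fpow[OF p] using n by simp
define m where "m = (LEAST m. R m)"
have m: "R m" unfolding m_def by (rule LeastI[of R, OF Rn])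
have no: "fn i ` L p Int fn j ` L p = {}" if ij: "i<j" "j<m" for i j
proof (rule ccontr)
 assume "~ ?thesis"
 hence "L (fn i p) = L (fn j p)" using L_meet[OF Per_orbit[OF p] Per_orbit[OF p]] unfolding L_fpow[OF p] by blast
 hence "fn (m - i) ` fn i ` L p = fn (m - i) ` fn j ` L p" unfolding L_fpow[OF p] by simp
 hence "fn m ` L p = fn (j - i + m) ` L p" unfolding img_add using ij by (simp add: add.commute)
 also have "... = fn (j - i) ` L p" using m unfolding R_def by (metis img_add)
 finally have "R (j - i)" using m ij unfolding R_def by simp
 thus False using not_less_Least[of "j - i" R] ij unfolding m_def[symmetric] by simp
qed
have "pint (L p) m" unfolding pint_def
proof (intro conjI)
 show "EX a b. 0<=a & a<=b & b<=1 & L p = {a..b}" using L_unit[OF p] cls_ends(3)[OF p sim_refl[OF p]] unfolding L_def by (auto intro!: exI)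
 show "disjoint_family_on (%i. fn i ` L p) {..<m}" unfolding disjoint_family_on_def using no by (metis Int_commute lessThan_iff linorder_neqE_nat)
qed (use m in "auto simp: R_def")
thus ?thesis ..
qed

lemma L_interior: assumes p: "p:Per f" shows "C Int interior (Orb (L p)) = {}"
proof (rule ccontr)
obtain m where m: "pint (L p) m" using L_pint[OF p] by blast
assume "~ ?thesis"
then obtain c where c: "c:C" "c:interior (Orb (L p))" by blast
then obtain i where i: "c:fn i ` L p" using interior_subset[of "Orb (L p)"] unfolding orb_def by blast
obtain e where e: "e>0" "ball c e Int Orb (L p)<=fn i ` L p" using pint_local[OF pint_shift[OF m] i] shift_orb[OF m] by auto
obtain d where d: "d>0" "ball c d<=Orb (L p)" using c(2) by (auto simp: mem_interior)
have "ball c (min e d)<=ball c e" "ball c (min e d)<=ball c d" by auto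
hence "ball c (min e d)<=fn i ` L p" using e(2) d(2) by blast
hence "c:interior (fn i ` L p)" using e(1) d(1) unfolding mem_interior by (intro exI[of _ "min e d"]) simp
hence "c:interior (hul 0 (Inf (cls (fn i p))) (Sup (cls (fn i p))))" unfolding L_fpow[OF p] cls_ends(5)[OF Per_orbit[OF p]] .
thus False using cls_ends(4)[OF Per_orbit[OF p], of i] c(1) unfolding sim_def by blast
qed

lemma L_orb_meet: assumes p: "p:Per f" and q: "q:Per f" and ne: "Orb (L p) Int Orb (L q)~={}" shows "Orb (L p) = Orb (L q)"
proof -
obtain i j where "fn i ` L p Int fn j ` L q~={}" using ne unfolding orb_def by blast
hence "fn i ` L p = fn j ` L q" using L_meet[OF Per_orbit[OF p] Per_orbit[OF q]] unfolding L_fpow[OF p] L_fpow[OF q] by blast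
moreover obtain m m' where "pint (L p) m" "pint (L q) m'" using L_pint[OF p] L_pint[OF q] by blast
ultimately show ?thesis using shift_orb by metis
qed

lemma code_sim: assumes p: "p:{0..1}" "fn n p = p" and q: "q:{0..1}" "fn n q = q" and n: "n>=1" and c: "code n p = code n q" shows "sim p q"
proof -
have "interior (hul i p q) Int C = {}" for i
proof -
 have r: "rnk (fn (i mod n) p) = rnk (fn (i mod n) q)" using code_nth[of "i mod n" n] c n by (metis mod_less_divisor One_nat_def Suc_le_lessD)
 have e: "fn i p = fn (i mod n) p" "fn i q = fn (i mod n) q" by (rule fpow_mod_fix[OF p(2)], rule fpow_mod_fix[OF q(2)])
 show ?thesis unfolding hul_def e using rnk_eq[OF r] rnk_eq[OF r[symmetric]] by (cases "fn (i mod n) p<=fn (i mod n) q") (auto simp: min_def max_def)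
qed
thus ?thesis unfolding sim_def using assms by blast
qed

text \<open>Countability holds because by \<open>code_sim\<close> the class of a periodic point is
  determined by one of its periods and the code of that length.\<close>

theorem periodic_cover:
"EX \<L> :: real set set. countable \<L> & disjoint \<L> &
  (ALL M:\<L>. (EX L m. pint L m & M = Orb L) & C Int interior M = {}) & Per f<=\<Union>\<L>"
proof (intro exI[of _ "(%p. Orb (L p)) ` Per f"] conjI ballI)
define n where "n p = (SOME n. n>=1 & fn n p = p)" for p
have n: "n p>=1 & (f ^^ n p) p = p" if "p:Per f" for p unfolding n_def by (rule someI_ex) (use that in "auto simp: Per_def")
define F where "F p = (n p, code (n p) p)" for p
define r where "r k = (SOME p. p:Per f & F p = k)" for k
have "L p = L (r (F p))" if p: "p:Per f" for p
proof -
 have r: "r (F p):Per f" "F (r (F p)) = F p" unfolding r_def using someI[of "%x. x:Per f & F x = F p" p] p by auto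
 have "sim p (r (F p))" by (rule code_sim[of _ "n p"]) (use n[OF p] n[OF r(1)] r p in "auto simp: F_def Per_def")
 thus ?thesis by (rule L_eq)
qed
hence "(%p. Orb (L p)) ` Per f<=range (%k. Orb (L (r k)))" by (intro image_subsetI) auto
thus "countable ((%p. Orb (L p)) ` Per f)" by (rule countable_subset) simp
show "disjoint ((%p. Orb (L p)) ` Per f)" unfolding disjoint_def using L_orb_meet by blast
show "Per f<=\<Union>((%p. Orb (L p)) ` Per f)"
proof
 fix p assume p: "p:Per f"
 hence "p:L p" using cls_ends(3) sim_refl by blast
 thus "p:\<Union>((%p. Orb (L p)) ` Per f)" using p sub_orb[of "L p"] by blast
qed
qed (use L_pint L_interior in blast)+

section \<open>The decomposition\<close>

lemma max_Per: "maximal_cycles f<=Per f" unfolding maximal_cycles_def using Per_orbit unfolding orb_def by auto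

lemma orb_Per: "p:Per f ==> Orb {p} = om p" unfolding Per_def using om_periodic[of _ p] by auto

text \<open>A cycle that is not maximal lies properly in a limit set. This is infinite, since a
  finite limit set is a single cycle, and it contains \<open>p\<close>, so it is not in a solenoidal
  set.\<close>

lemma Per_cases: assumes p: "p:Per f" shows "p:maximal_cycles f | in_basic p"
proof (cases "ALL x:{0..1}. Orb {p}<=om x --> om x = Orb {p}")
case True
thus ?thesis using p sub_orb[of "{p}"] unfolding maximal_cycles_def by blast
next
case False
then obtain x where x: "x:{0..1}" "Orb {p}<=om x" "om x~=Orb {p}" by blast
have px: "p:om x" using x(2) sub_orb[of "{p}"] by blast
hence "infinite (om x)" using om_finite_cycle[OF x(1)] x(3) by blast
thus ?thesis using om_cases[OF x(1)] px solenoid_no_Per p unfolding in_basic_def basic_set_of_def by blast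
qed

lemma in_basic_iff: "in_basic x <-> (EX I m. bas I m & x:Bs I)" unfolding in_basic_def bas_def by blast

lemma basic_fpow: "bas I m ==> x:Bs I ==> fn k x:Bs I" by (induction k) (use B_set_invariant[OF basD(1)] in auto)

text \<open>A cycle that meets \<open>Bs I\<close> lies in it and hence in an infinite limit set.
  The iterate \<open>fn k x\<close> is there because points of \<open>A_set\<close> reach the basic
  set only later.\<close>

lemma maximal_avoids_basic: assumes b: "bas I m" and x: "x:maximal_cycles f" shows "fn k x~:Bs I"
proof
assume k: "fn k x:Bs I"
obtain p where p: "p:Per f" "x:Orb {p}" and max: "ALL y:{0..1}. Orb {p}<=om y --> om y = Orb {p}" using x unfolding maximal_cycles_def by blast
obtain i where "x = fn i p" using p(2) unfolding in_orb_iff by blast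
hence "fn k x = fn (k + i) p" by (simp add: fpow_add)
hence "Orb {fn k x} = Orb {p}" using orb_Per[OF p(1)] orb_Per[OF Per_orbit[OF p(1), of "k + i"]] om_fpow by simp
moreover have "Orb {fn k x}<=Bs I" using k B_set_invariant[OF basD(1)[OF b]] by (intro orb_least) auto
moreover obtain y where y: "y:{0..1}" "Bs I<=om y" "infinite (om y)" using bas_orbit[OF b] by blast
ultimately have "om y = Orb {p}" using max by blast
moreover have "finite (Orb {p})" using p(1) finite_orb unfolding Per_def by blast
ultimately show False using y(3) by simp
qed

text \<open>All points of a solenoidal set have the same limit set, so the chosen one does not
  matter.\<close>

definition Sl::"real set => real set" where "Sl Q = om (SOME x. x:Q)"

lemma Sl: assumes Q: "solen Q" shows "x:Q ==> om x = Sl Q" "Sl Q = Q Int closure (Per f)" "Sl Q = Q Int omega f" "Sl Q<=Q Int nonwandering f"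
proof -
define y where "y = (SOME x. x:Q)"
have y: "y:Q" unfolding y_def using solen_ne[OF Q] by (simp add: some_in_eq)
have S: "Sl Q = om y" unfolding Sl_def y_def ..
note om = solenoid_omega[OF Q y y]
show "x:Q ==> om x = Sl Q" unfolding S using solenoid_omega(1)[OF Q _ y] .
show c: "Sl Q = Q Int closure (Per f)" unfolding S using om(2,3) solenoid_closure_Per[OF Q y] by blast
show "Sl Q = Q Int omega f" unfolding S omega_def using om(3,5) solenoid_meets_omega[OF Q y] by blast
show "Sl Q<=Q Int nonwandering f" unfolding c using clPer_nonwand by blast
qed

lemma omega_iff: "x:omega f <-> x:maximal_cycles f | (EX Q. solen Q & x:Sl Q) | in_basic x"
proof
assume "x:omega f"
then obtain y where y: "y:{0..1}" "x:om y" unfolding omega_def by blast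
show "x:maximal_cycles f | (EX Q. solen Q & x:Sl Q) | in_basic x"
proof (cases "finite (om y)")
 case True
 hence "x:Per f" using finite_inv_Per om_image[OF y(1)] om_unit[OF y(1)] y(2) by blast
 thus ?thesis using Per_cases by blast
next
 case False
 from om_cases[OF y(1) this] show ?thesis
 proof
  assume "EX Q. solen Q & om y<=Q"
  then obtain Q where "solen Q" "x:Q" using y(2) by blast
  hence "solen Q & x:Sl Q" using Sl(3) `x:omega f` by blast
  thus ?thesis by blast
 next
  assume "EX I m B. basic_set_of f I m B & om y<=B"
  thus ?thesis using y(2) unfolding in_basic_def basic_set_of_def by blast
 qed
qed
next
assume "x:maximal_cycles f | (EX Q. solen Q & x:Sl Q) | in_basic x"
thus "x:omega f"
proof (elim disjE exE conjE)
 assume "x:maximal_cycles f"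
 hence x: "x:Per f" using max_Per by blast
 hence "x:om x" using orb_Per sub_orb[of "{x}"] by auto
 thus ?thesis using x unfolding omega_def Per_def by blast
next
 fix Q assume "solen Q" "x:Sl Q" thus ?thesis using Sl(3) by blast
next
 assume "in_basic x"
 then obtain I m where "bas I m" "x:Bs I" unfolding in_basic_iff by blast
 thus ?thesis using bas_orbit[of I m] unfolding omega_def by blast
qed
qed

lemma omega_closure_Per: "omega f = closure (Per f)"
proof
show "omega f<=closure (Per f)"
proof
 fix x assume "x:omega f"
 thus "x:closure (Per f)" unfolding omega_iff
 proof (elim disjE exE conjE)
  assume "x:maximal_cycles f" thus ?thesis using max_Per closure_subset by blast
 next
  fix Q assume "solen Q" "x:Sl Q" thus ?thesis using Sl(2) by blast
 next
  assume "in_basic x"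
  thus ?thesis unfolding in_basic_def using basic_subset_closure_Per by blast
 qed
qed
show "closure (Per f)<=omega f"
proof
 fix x assume x: "x:closure (Per f)"
 have "x:maximal_cycles f | in_solenoid x | in_basic x" using Per_cases[of x] closure_Per_cases[OF x] by blast
 thus "x:omega f" unfolding omega_iff in_solenoid_def using Sl(2) x by blast
qed
qed

text \<open>A basic set determines its cycle, but not the interval that generates the cycle; the
  added end points must not depend on that choice.\<close>

lemma A_set_same: assumes "pint I m" "pint I' m'" "Orb I = Orb I'" shows "A_set f I B = A_set f I' B"
proof -
have "EX j. fn i ` K = fn j ` K'" if K: "pint K k" "pint K' k'" "Orb K = Orb K'" for K K' k k' i
proof -
 obtain x where x: "x:fn i ` K" using pint_nonempty[OF K(1)] by blast
 hence "x:Orb K'" using K(3) fpow_sub_orb[of i K] by blast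
 then obtain j where j: "x:fn j ` K'" unfolding orb_def by blast
 note S = pint_shift[OF K(1), of i] pint_shift[OF K(2), of j]
 have e: "Orb (fn i ` K) = Orb (fn j ` K')" using shift_orb[OF K(1)] shift_orb[OF K(2)] K(3) by simp
 have "fn i ` K = fn j ` K'" using pint_nested[OF S _ x j] pint_nested[OF S(2,1) _ j x] e by simp
 thus ?thesis ..
qed
note s1 = this[OF assms] and s2 = this[OF assms(2,1) assms(3)[symmetric]]
have e: "(EX i. fn i ` I = X) <-> (EX i. fn i ` I' = X)" for X using s1 s2 by metis
have "(EX i a b. fn i ` I = {a..b} & (x = a | x = b)) <-> (EX i a b. fn i ` I' = {a..b} & (x = a | x = b))" for x using e[of "{_.._}"] by metis
thus ?thesis unfolding A_set_def assms(3) by simp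
qed

lemma nonwandering_iff:
"x:nonwandering f <-> x:maximal_cycles f | (EX Q. solen Q & x:Q Int nonwandering f) |
  (EX I m. bas I m & x:Bs I Un A_set f I (Bs I))" (is "_ <-> ?R")
proof
assume x: "x:nonwandering f"
have "x:maximal_cycles f | in_solenoid x | in_basic x | omega_exceptional x" using Per_cases[of x] nonwandering_cases[OF x] by blast
thus ?R unfolding in_solenoid_def in_basic_iff omega_exceptional_def bas_def using x by blast
next
assume ?R
thus "x:nonwandering f"
proof (elim disjE exE conjE)
 assume "x:maximal_cycles f"
 thus ?thesis using max_Per closure_subset[of "Per f"] clPer_nonwand by blast
next
 fix I m assume b: "bas I m" and x: "x:Bs I Un A_set f I (Bs I)"
 have "Bs I<=nonwandering f" using basic_subset_closure_Per[OF basD[OF b]] clPer_nonwand by (rule subset_trans)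
 thus ?thesis using x unfolding A_set_def by blast
qed blast
qed

lemma B'_reaches:
"x:B Un A_set f I B ==> EX n. fn n x:B" unfolding A_set_def by (auto intro: exI[of _ 0])

text \<open>Solenoidal sets are pairwise disjoint, so choosing a turning point in each is
  injective.\<close>

lemma finite_solenoids: "finite {Q. solen Q}" "card {Q. solen Q}<=card C"
proof -
define c where "c Q = (SOME c. c:Q Int C)" for Q
have c: "c Q:Q Int C" if "solen Q" for Q     using someI_ex[of "%c. c:Q Int C"] solenoid_C[OF that] unfolding c_def by blast
have i: "inj_on c {Q. solen Q}" using solen_disjoint c by (intro inj_onI) (metis IntD1 IntI empty_iff mem_Collect_eq)
have s: "c ` {Q. solen Q}<=C" using c by blast
show "finite {Q. solen Q}" using inj_on_finite[OF i s finC] .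
show "card {Q. solen Q}<=card C" using card_inj_on_le[OF i s finC] .
qed

lemma basic_sets_G: "{X. basic_set f X} = (UN D:Pow C. G_family f C D)" unfolding basic_set_def G_family_def by blast

lemma countable_basic_sets: "countable {X. basic_set f X}" unfolding basic_sets_G
proof (rule countable_UN)
show "countable (Pow C)" using finC by (simp add: countable_finite)
show "countable (G_family f C D)" for D using chain_exists[of D] by (cases "finite (G_family f C D)") (auto simp: countable_finite)
qed

end

section \<open>From the partition to the locale, and assembly of the theorem\<close>

lemma finite_enum: assumes "finite A" shows "EX h. h ` {..<card A} = A & inj_on h {..<card A}"
using ex_bij_betw_nat_finite[OF assms] unfolding bij_betw_def atLeast0LessThan by blast

text \<open>Equal senses of monotonicity on both sides of a turning point would make
  \<open>f\<close> monotone across it; so the senses are opposite and the point is a weak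
  extremum.\<close>

lemma pm_system_turning_points: assumes pm: "pm_map f" and tp: "turning_points f C" shows "pm_system f C"
proof -
obtain n c where c: "pm_partition f n c" "ALL k:{1..n}. ~ monotone_lap f (c (k - 1)) (c (k + 1))" "C = c ` {1..n}"
 using tp unfolding turning_points_def by blast
have c0: "c 0 = 0" "c (n + 1) = 1" "!!k. k<=n ==> c k<c (k + 1)" "!!k. k<=n ==> monotone_lap f (c k) (c (k + 1))"
 using c(1) unfolding pm_partition_def by auto
have lsub: "monotone_lap f u v" if "monotone_lap f a b" "a<=u" "v<=b" for a b u v
 using that unfolding monotone_lap_def by (auto simp: monotone_on_def)
show ?thesis
proof unfold_locales
 show "continuous_on {0..1} f" "f ` {0..1}<={0..1}" using pm unfolding pm_map_def by auto
 show "finite C" unfolding c(3) by simp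
 show "monotone_lap f u v" if uv: "0<=u" "u<=v" "v<=1" "{u<..<v} Int C = {}" for u v
 proof -
  \<comment> \<open>The lap of \<open>u\<close>. Its right end is a turning point to the right of
    \<open>u\<close>, or \<open>1\<close>, so it is not before \<open>v\<close>.\<close>
  define k where "k = (GREATEST k. k<=n & c k<=u)"
  have k: "k<=n & c k<=u" unfolding k_def by (rule GreatestI_nat[of _ 0 n]) (use c0(1) uv in auto)
  have max: "j<=k" if "j<=n" "c j<=u" for j unfolding k_def by (rule Greatest_le_nat[of _ _ n]) (use that in auto)
  have "v<=c (k + 1)"
  proof (cases "k = n")
   case False
   hence "u<c (k + 1)" using max[of "k + 1"] k by force
   moreover have "c (k + 1):C" unfolding c(3) using k False by (intro image_eqI[of _ c "k + 1"]) auto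
   ultimately have "u<c (k + 1)" "c (k + 1):C" by auto
   thus ?thesis using uv(4) by force
  qed (use c0(2) uv(3) in auto)
  thus ?thesis using lsub[OF c0(4)] k by blast
 qed
 show "(f u<=f x & f v<=f x) | (f x<=f u & f x<=f v)"
  if x: "x:C" "0<=u" "u<x" "x<v" "v<=1" "{u<..<x} Int C = {}" "{x<..<v} Int C = {}" for x u v
 proof -
  obtain k where k: "k:{1..n}" "x = c k" using x(1) unfolding c(3) by blast
  define a b where "a = c (k - 1)" and "b = c (k + 1)"
  have ab: "a<x" "x<b" unfolding a_def b_def k(2) using c0(3)[of "k - 1"] c0(3)[of k] k(1) by auto
  have l: "monotone_lap f a x" "monotone_lap f x b" unfolding a_def b_def k(2) using c0(4)[of "k - 1"] c0(4)[of k] k(1) by auto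
  have "a<=u"
  proof (cases "k = 1")
   case False
   hence "a:C" unfolding a_def c(3) using k(1) by (intro image_eqI[of _ c "k - 1"]) auto
   thus ?thesis using x(6) ab(1) by force
  qed (use c0(1) x(2) in "simp add: a_def")
  moreover have "v<=b"
  proof (cases "k = n")
   case False
   hence "b:C" unfolding b_def c(3) using k(1) by (intro image_eqI[of _ c "k + 1"]) auto
   thus ?thesis using x(7) ab(2) by force
  qed (use c0(2) x(5) in "simp add: b_def")
  ultimately have m: "u:{a..x}" "v:{x..b}" "x:{a..x}" "x:{x..b}" using x(3,4) ab by auto
  have no: "~ monotone_lap f a b" unfolding a_def b_def using c(2) k(1) by blast
  have glue: "mono_on {a..b} g" if g: "mono_on {a..x} g" "mono_on {x..b} g" for g::"real => real"
  proof (rule monotone_onI)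
   fix s t assume st: "s:{a..b}" "t:{a..b}" "s<=t"
   show "g s<=g t"
   proof (cases "s<=x & x<=t")
    case True
    hence "g s<=g x" "g x<=g t" using g st unfolding monotone_on_def by auto
    thus ?thesis by simp
   qed (use g st in "auto simp: monotone_on_def")
  qed
  have neg: "antimono_on S f <-> mono_on S (%t. - f t)" for S unfolding monotone_on_def by auto
  from l show ?thesis unfolding monotone_lap_def
  proof (elim disjE)
   assume "mono_on {a..x} f" "mono_on {x..b} f"
   thus ?thesis using no glue[of f] unfolding monotone_lap_def by blast
  next
   assume "antimono_on {a..x} f" "antimono_on {x..b} f"
   thus ?thesis using no glue[of "%t. - f t"] unfolding monotone_lap_def neg by blast
  qed (use m x(3,4) in "auto simp: monotone_on_def")
 qed
qed
qed

theorem mainTheorem17: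
  fixes f :: "real \<Rightarrow> real" and C :: "real set"
  assumes "pm_map f" and "turning_points f C"
  shows "\<exists>(\<Lambda> :: nat set) (B :: nat \<Rightarrow> real set) (B' :: nat \<Rightarrow> real set)
          (A :: nat set) (S :: nat \<Rightarrow> real set) (S\<^sub>\<Omega> :: nat \<Rightarrow> real set) (Q :: nat \<Rightarrow> real set).
    \<comment> \<open>the pairs and the triples\<close>
    (\<forall>i\<in>\<Lambda>. Omega_basic_set f (B i) (B' i) \<and> B i \<subseteq> B' i) \<and>
    (\<forall>\<alpha>\<in>A. solenoidal_Q f (Q \<alpha>) \<and> S\<^sub>\<Omega> \<alpha> = Q \<alpha> \<inter> nonwandering f \<and>
            (\<forall>x\<in>Q \<alpha>. omega_limit f x = S \<alpha>) \<and> S \<alpha> \<subseteq> S\<^sub>\<Omega> \<alpha> \<and> S\<^sub>\<Omega> \<alpha> \<subseteq> Q \<alpha>) \<and>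
    \<comment> \<open>1\<close>
    nonwandering f = maximal_cycles f \<union> (\<Union>\<alpha>\<in>A. S\<^sub>\<Omega> \<alpha>) \<union> (\<Union>i\<in>\<Lambda>. B' i) \<and>
    \<comment> \<open>2\<close>
    omega f = closure (Per f) \<and>
    omega f = maximal_cycles f \<union> (\<Union>\<alpha>\<in>A. S \<alpha>) \<union> (\<Union>i\<in>\<Lambda>. B i) \<and>
    \<comment> \<open>3\<close>
    finite A \<and> card A \<le> card C \<and>
    \<comment> \<open>4\<close>
    (\<forall>\<alpha>\<in>A. S \<alpha> = Q \<alpha> \<inter> closure (Per f) \<and> S \<alpha> = Q \<alpha> \<inter> omega f) \<and>
    \<comment> \<open>5; the smaller sets are covered because of \<open>B \<subseteq> B'\<close> and \<open>S \<subseteq> S\<^sub>\<Omega> \<subseteq> Q\<close>\<close>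
    (\<forall>\<alpha>\<in>A. maximal_cycles f \<inter> Q \<alpha> = {}) \<and>
    (\<forall>i\<in>\<Lambda>. maximal_cycles f \<inter> B' i = {}) \<and>
    (\<forall>\<alpha>\<in>A. \<forall>\<beta>\<in>A. \<alpha> \<noteq> \<beta> \<longrightarrow> Q \<alpha> \<inter> Q \<beta> = {}) \<and>
    (\<forall>\<alpha>\<in>A. \<forall>i\<in>\<Lambda>. Q \<alpha> \<inter> B' i = {}) \<and>
    (\<forall>i\<in>\<Lambda>. \<forall>j\<in>\<Lambda>. i \<noteq> j \<longrightarrow> finite (B' i \<inter> B' j)) \<and>
    (\<forall>i\<in>\<Lambda>. \<forall>j\<in>\<Lambda>. \<forall>r\<in>\<Lambda>. i \<noteq> j \<and> j \<noteq> r \<and> i \<noteq> r \<longrightarrow> B' i \<inter> B' j \<inter> B' r = {}) \<and>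
    \<comment> \<open>6\<close>
    (\<exists>(k :: nat) (D :: nat \<Rightarrow> real set) (l :: nat) (F :: nat \<Rightarrow> real set)
       (R :: nat) (Bt :: nat \<Rightarrow> real set)
       (K :: nat \<Rightarrow> real set) (N :: nat \<Rightarrow> nat) (Qj :: nat \<Rightarrow> real set)
       (Bc :: nat \<Rightarrow> nat \<Rightarrow> real set) (I :: nat \<Rightarrow> nat \<Rightarrow> real set) (p :: nat \<Rightarrow> nat \<Rightarrow> nat).
      (\<forall>i<k. D i \<subseteq> C) \<and> (\<forall>j<l. F j \<subseteq> C) \<and>
      (\<forall>i<k. \<forall>j<k. i \<noteq> j \<longrightarrow> D i \<inter> D j = {}) \<and>
      (\<forall>i<l. \<forall>j<l. i \<noteq> j \<longrightarrow> F i \<inter> F j = {}) \<and>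
      (\<forall>i<k. \<forall>j<l. D i \<inter> F j = {}) \<and>
      (\<forall>r<R. basic_set f (Bt r)) \<and>
      \<comment> \<open>a\<close>
      (\<forall>i<k. G_family f C (D i) = range (Bc i) \<and>
             (\<forall>n. basic_set_of f (I i n) (p i n) (Bc i n)) \<and>
             (\<forall>n. basic_succ f (Bc i n) (Bc i (Suc n))) \<and>
             (\<forall>n. p i n < p i (Suc n)) \<and>
             solenoidal_Q f (\<Inter>n. orb f (I i n)) \<and>
             corresponding_group f (\<Inter>n. orb f (I i n)) (H_group (p i))) \<and>
      \<comment> \<open>b\<close>
      (\<forall>i<k. \<forall>n. \<exists>(E :: (nat \<times> nat) set) \<phi>. finite E \<and>
             semiconjugation \<phi> (Bc i n) f (markov_chain E) shift \<and>
             at_most_2_to_1 \<phi> (Bc i n)) \<and>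
      \<comment> \<open>c\<close>
      (\<forall>i<k. \<forall>j<k. i \<noteq> j \<longrightarrow>
         (\<forall>B\<^sub>1\<in>G_family f C (D i). \<forall>B\<^sub>2\<in>G_family f C (D j).
            \<not> basic_succ f B\<^sub>1 B\<^sub>2 \<and> \<not> basic_succ f B\<^sub>2 B\<^sub>1)) \<and>
      \<comment> \<open>d\<close>
      {X. basic_set f X} = Bt ` {..<R} \<union> (\<Union>i<k. range (Bc i)) \<and>
      \<comment> \<open>e\<close>
      (\<forall>j<l. periodic_interval f (K j) (N j) \<and>
             solenoidal_Q f (Qj j) \<and> Qj j \<subseteq> orb f (K j) \<and>
             (\<forall>X. solenoidal_Q f X \<and> X \<subseteq> orb f (K j) \<longrightarrow> X = Qj j) \<and>
             entropy_on f (orb f (K j)) = 0 \<and>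
             orb f (K j) \<inter> C = F j \<and> F j \<subseteq> Qj j \<and>
             corresponding_group f (Qj j) (H_group (\<lambda>n. 2 ^ n * N j))) \<and>
      \<comment> \<open>f\<close>
      (\<lambda>i. \<Inter>n. orb f (I i n)) ` {..<k} \<union> Qj ` {..<l} = Q ` A \<and>
      \<comment> \<open>g\<close>
      (\<exists>\<L> :: real set set. countable \<L> \<and> disjoint \<L> \<and>
         (\<forall>M\<in>\<L>. (\<exists>L m. periodic_interval f L m \<and> M = orb f L) \<and> C \<inter> interior M = {}) \<and>
         maximal_cycles f \<subseteq> \<Union> \<L>))"
proof -
interpret pm_system f C by (rule pm_system_turning_points[OF assms])
define q where "q = card {Q. solenoidal_Q f Q}"
obtain Q where Q0: "Q ` {..<q} = {Q. solenoidal_Q f Q} & inj_on Q {..<q}" using finite_enum[OF finite_solenoids(1)] unfolding q_def by blast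
have Q: "solenoidal_Q f (Q \<alpha>)" if "\<alpha>:{..<q}" for \<alpha> using Q0 that by blast
have Qex: "EX \<alpha>:{..<q}. Q \<alpha> = X" if "solenoidal_Q f X" for X
proof -
 have "X:Q ` {..<q}" using Q0 that by simp
 thus ?thesis by blast
qed
define S where "S \<alpha> = Sl (Q \<alpha>)" for \<alpha>
define SO where "SO \<alpha> = Q \<alpha> Int nonwandering f" for \<alpha>
define \<B> where "\<B> = {X. basic_set f X}"
have cB: "countable \<B>" unfolding \<B>_def by (rule countable_basic_sets)
\<comment> \<open>An injective enumeration, so that different subscripts stand for different basic
  sets and hence for different cycles.\<close>
define \<Lambda> where "\<Lambda> = to_nat_on \<B> ` \<B>"
define B where "B = from_nat_into \<B>"
have BL: "B ` \<Lambda> = \<B>"   proof -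
 have "B ` \<Lambda> = (%X. X) ` \<B>" unfolding \<Lambda>_def B_def image_image by (rule image_cong[OF refl]) (rule from_nat_into_to_nat_on[OF cB])
 thus ?thesis by simp
qed
have Binj: "inj_on B \<Lambda>"   proof (rule inj_onI)
 fix i j assume "i:\<Lambda>" "j:\<Lambda>" and e: "B i = B j"
 then obtain X Y where XY: "X:\<B>" "i = to_nat_on \<B> X" "Y:\<B>" "j = to_nat_on \<B> Y" unfolding \<Lambda>_def by blast
 hence "X = Y" using e unfolding B_def by (simp add: from_nat_into_to_nat_on[OF cB])
 thus "i = j" using XY by simp
qed
have "EX I m. i:\<Lambda> --> bas I m & B i = B_set (orb f I) f" for i using BL unfolding \<B>_def basic_set_def bas_iff by blast
then obtain J mJ where J0: "!!i. i:\<Lambda> --> bas (J i) (mJ i) & B i = B_set (orb f (J i)) f" by metis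
have J: "bas (J i) (mJ i)" "B i = B_set (orb f (J i)) f" if "i:\<Lambda>" for i using J0[of i] that by auto
define B' where "B' i = B i Un A_set f (J i) (B i)" for i
have Bex: "EX i:\<Lambda>. B i = B_set (orb f I) f & B' i = B_set (orb f I) f Un A_set f I (B_set (orb f I) f)" if b: "bas I m" for I m
proof -
 have "B_set (orb f I) f:\<B>" unfolding \<B>_def basic_set_def bas_iff using b by blast
 then obtain i where i: "i:\<Lambda>" "B i = B_set (orb f I) f" using BL by (metis imageE)
 hence "orb f (J i) = orb f I" using basic_determines[OF J(1)[OF i(1)] b] J(2)[OF i(1)] by simp
 hence "A_set f (J i) (B i) = A_set f I (B i)" by (rule A_set_same[OF basD(1)[OF J(1)[OF i(1)]] basD(1)[OF b]])
 thus ?thesis using i unfolding B'_def by (intro bexI[of _ i]) simp_all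
qed
have Bne: "orb f (J i)~=orb f (J j)" if "i:\<Lambda>" "j:\<Lambda>" "i~=j" for i j
 using Binj that J(2)[OF that(1)] J(2)[OF that(2)] unfolding inj_on_def by metis
have reach: "EX n. (f ^^ n) x:B i" if "x:B' i" for x i using B'_reaches that unfolding B'_def by blast
have late: "(f ^^ (n + k)) x:B i" if "i:\<Lambda>" "(f ^^ k) x:B i" for n k i x
 using basic_fpow[OF J(1)[OF that(1)]] that(2) J(2)[OF that(1)] by (simp add: fpow_add)

have pairs: "ALL i:\<Lambda>. Omega_basic_set f (B i) (B' i) & B i<=B' i" unfolding Omega_basic_set_def bas_iff B'_def using J by blast
have triples: "ALL \<alpha>:{..<q}. solenoidal_Q f (Q \<alpha>) & SO \<alpha> = Q \<alpha> Int nonwandering f &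
  (ALL x:Q \<alpha>. omega_limit f x = S \<alpha>) & S \<alpha><=SO \<alpha> & SO \<alpha><=Q \<alpha>"
 using Q Sl(1,4)[OF Q] unfolding S_def SO_def by blast
have i1: "nonwandering f = maximal_cycles f Un (UN \<alpha>:{..<q}. SO \<alpha>) Un (UN i:\<Lambda>. B' i)" (is "?l = ?r")
proof (rule Set.set_eqI)
 fix x
 have "(EX X. solenoidal_Q f X & x:X Int nonwandering f) <-> (EX \<alpha>:{..<q}. x:SO \<alpha>)" unfolding SO_def using Q Qex by metis
 moreover have "(EX I m. bas I m & x:B_set (orb f I) f Un A_set f I (B_set (orb f I) f)) <-> (EX i:\<Lambda>. x:B' i)"
  using Bex J unfolding B'_def by metis
 ultimately show "x:?l <-> x:?r" unfolding nonwandering_iff[of x] by simp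
qed
have i2: "omega f = maximal_cycles f Un (UN \<alpha>:{..<q}. S \<alpha>) Un (UN i:\<Lambda>. B i)" (is "?l = ?r")
proof (rule Set.set_eqI)
 fix x
 have "(EX X. solenoidal_Q f X & x:Sl X) <-> (EX \<alpha>:{..<q}. x:S \<alpha>)" unfolding S_def using Q Qex by metis
 moreover have "in_basic x <-> (EX i:\<Lambda>. x:B i)" unfolding in_basic_iff using Bex J by metis
 ultimately show "x:?l <-> x:?r" unfolding omega_iff by simp
qed
have i4: "ALL \<alpha>:{..<q}. S \<alpha> = Q \<alpha> Int closure (Per f) & S \<alpha> = Q \<alpha> Int omega f"
 unfolding S_def using Sl(2,3)[OF Q] by blast
have i5a: "ALL \<alpha>:{..<q}. maximal_cycles f Int Q \<alpha> = {}" using solenoid_no_Per[OF Q] max_Per by blast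
have i5b: "ALL i:\<Lambda>. maximal_cycles f Int B' i = {}"
proof (intro ballI)
 fix i assume i: "i:\<Lambda>"
 show "maximal_cycles f Int B' i = {}" using reach[of _ i] maximal_avoids_basic[OF J(1)[OF i]] J(2)[OF i] by blast
qed
have i5c: "ALL \<alpha>:{..<q}. ALL \<beta>:{..<q}. \<alpha>~=\<beta> --> Q \<alpha> Int Q \<beta> = {}"
proof (intro ballI impI)
 fix \<alpha> \<beta> assume a: "\<alpha>:{..<q}" "\<beta>:{..<q}" "\<alpha>~=\<beta>"
 have "Q \<alpha>~=Q \<beta>" using Q0 a unfolding inj_on_def by blast
 thus "Q \<alpha> Int Q \<beta> = {}" using solen_disjoint[OF Q[OF a(1)] Q[OF a(2)]] by blast
qed
have i5d: "ALL \<alpha>:{..<q}. ALL i:\<Lambda>. Q \<alpha> Int B' i = {}"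
proof (intro ballI)
 fix \<alpha> i assume a: "\<alpha>:{..<q}" "i:\<Lambda>"
 obtain I m where g: "generating_intervals f I m" "Q \<alpha> = (INT j. orb f (I j))" using Q[OF a(1)] unfolding solenoidal_Q_def by blast
 have "x~:B' i" if x: "x:Q \<alpha>" for x
 proof
  assume "x:B' i"
  then obtain n where "(f ^^ n) x:B i" using reach by blast
  moreover have "(f ^^ n) x:Q \<alpha>" using gen_fpow_Q[OF g(1), of x n] x unfolding g(2) .
  ultimately show False using solenoid_basic_disjoint[OF Q[OF a(1)] J(1)[OF a(2)]] J(2)[OF a(2)] by blast
 qed
 thus "Q \<alpha> Int B' i = {}" by blast
qed
have i5e: "ALL i:\<Lambda>. ALL j:\<Lambda>. i~=j --> finite (B' i Int B' j)"
proof (intro ballI impI)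
 fix i j assume ij: "i:\<Lambda>" "j:\<Lambda>" "i~=j"
 have "finite (B i Int B j Un A_set f (J i) (B i) Un A_set f (J j) (B j))"
  using basic_inter_finite[OF J(1)[OF ij(1)] J(1)[OF ij(2)] Bne[OF ij]] J(2)[OF ij(1)] J(2)[OF ij(2)]
   finite_A_set[OF basD(1)[OF J(1)[OF ij(1)]]] finite_A_set[OF basD(1)[OF J(1)[OF ij(2)]]] by simp
 thus "finite (B' i Int B' j)" by (rule finite_subset[rotated]) (auto simp: B'_def)
qed
have i5f: "ALL i:\<Lambda>. ALL j:\<Lambda>. ALL r:\<Lambda>. i~=j & j~=r & i~=r --> B' i Int B' j Int B' r = {}"
proof (intro ballI impI)
 fix i j r assume ijr: "i:\<Lambda>" "j:\<Lambda>" "r:\<Lambda>" "i~=j & j~=r & i~=r"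
 show "B' i Int B' j Int B' r = {}"
 proof (rule ccontr)
  assume "~ ?thesis"
  then obtain x where x0: "x:B' i" "x:B' j" "x:B' r" by blast
 obtain n1 n2 n3 where x: "(f ^^ n1) x:B i" "(f ^^ n2) x:B j" "(f ^^ n3) x:B r" using reach[OF x0(1)] reach[OF x0(2)] reach[OF x0(3)] by blast
  \<comment> \<open>The basic sets are invariant, so a late iterate of a common point lies in all
    three; this reduces the claim to \<open>basic_triple\<close>.\<close>
  define y where "y = (f ^^ (n1 + n2 + n3)) x"
  have y: "y:B i" "y:B j" "y:B r" unfolding y_def
   using late[OF ijr(1) x(1), of "n2 + n3"] late[OF ijr(2) x(2), of "n1 + n3"] late[OF ijr(3) x(3), of "n1 + n2"] by (simp_all add: ac_simps)
  define t where "t k = (if k = 0 then i else if k = 1 then j else r)" for k :: nat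
  have t: "t k:\<Lambda>" "y:B (t k)" for k unfolding t_def using ijr y by auto
  have "t k~=t l" if "k<3" "l<3" "k~=l" for k l unfolding t_def using that ijr(4) by auto
  hence "orb f (J (t k))~=orb f (J (t l))" if "k<3" "l<3" "k~=l" for k l using Bne[OF t(1) t(1)] that by blast
  from basic_triple[of "%k. J (t k)" "%k. mJ (t k)", OF J(1)[OF t(1)] this] t J(2)[OF t(1)] show False by blast
 qed
qed

\<comment> \<open>The traces that carry infinitely many basic sets. All other traces together carry
  finitely many, and these become the sets \<open>Bt\<close>.\<close>
define \<D> where "\<D> = {D. D<=C & infinite (G_family f C D)}"
define k where "k = card \<D>"
have finD: "finite \<D>" unfolding \<D>_def using finC by simp
obtain D where D0: "D ` {..<k} = \<D> & inj_on D {..<k}" using finite_enum[OF finD] unfolding k_def by blast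
have D: "D i<=C" "infinite (G_family f C (D i))" if "i<k" for i using D0 that unfolding \<D>_def by blast+
let ?P = "%i I p. i<k --> (ALL n. bas (I n) (p n) & orb f (I n) Int C = D i & orb f (I (Suc n)) \<subset> orb f (I n)) & strict_mono p &
  generating_intervals f I p & G_family f C (D i) = range (%n. B_set (orb f (I n)) f)"
have "EX I p. ?P i I p" for i using chain_exists[OF D(2)[of i]] by (cases "i<k") auto
then obtain I p where Ip0: "!!i. ?P i (I i) (p i)" by metis
have Ip: "bas (I i n) (p i n)" "orb f (I i n) Int C = D i" "orb f (I i (Suc n)) \<subset> orb f (I i n)" "strict_mono (p i)"
  "generating_intervals f (I i) (p i)" "G_family f C (D i) = range (%n. B_set (orb f (I i n)) f)" if "i<k" for i n using Ip0[of i] that by auto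
define Bc where "Bc i n = B_set (orb f (I i n)) f" for i n
define QD where "QD i = (INT n. orb f (I i n))" for i
have QD: "solenoidal_Q f (QD i)" "QD i Int C = D i" if "i<k" for i unfolding QD_def using chain_solenoid[OF Ip(5)[OF that] Ip(2)[OF that]] by auto
have Dne: "D i~={}" if "i<k" for i using bas_C[OF Ip(1)[OF that, of 0]] Ip(2)[OF that, of 0] by simp
have Dinj: "D i~=D j" if "i<k" "j<k" "i~=j" for i j using D0 that unfolding inj_on_def by blast
have Ddis: "D i Int D j = {}" if "i<k" "j<k" "i~=j" for i j using chains_disjoint[OF D(2)[OF that(1)] D(2)[OF that(2)]] Dinj[OF that] by blast

\<comment> \<open>A solenoidal set whose trace carries infinitely many basic sets meets the limit of
  that chain and equals it; the others are collected here.\<close>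
define \<N> where "\<N> = {X. solenoidal_Q f X & finite (G_family f C (X Int C))}"
define l where "l = card \<N>"
have finN: "finite \<N>" by (rule finite_subset[OF _ finite_solenoids(1)]) (auto simp: \<N>_def)
obtain Qj where Qj0: "Qj ` {..<l} = \<N> & inj_on Qj {..<l}" using finite_enum[OF finN] unfolding l_def by blast
have Qj: "solenoidal_Q f (Qj j)" "finite (G_family f C (Qj j Int C))" if "j<l" for j using Qj0 that unfolding \<N>_def by blast+
define F where "F j = Qj j Int C" for j
let ?P = "%j K N. periodic_interval f K N & solenoidal_Q f (Qj j) & Qj j<=orb f K & (ALL X. solenoidal_Q f X & X<=orb f K --> X = Qj j) &
  entropy_on f (orb f K) = 0 & orb f K Int C = F j & F j<=Qj j & corresponding_group f (Qj j) (H_group (%n. 2 ^ n * N))"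
have "EX K N. j<l --> ?P j K N" for j using nonchain_solenoid[OF Qj] Qj(1)[of j] unfolding F_def by (cases "j<l") auto
then obtain K N where e0: "!!j. j<l --> ?P j (K j) (N j)" by metis
hence e: "ALL j<l. ?P j (K j) (N j)" by blast
have Fdis: "F i Int F j = {}" if "i<l" "j<l" "i~=j" for i j
 unfolding F_def using solen_disjoint[OF Qj(1)[OF that(1)] Qj(1)[OF that(2)]] Qj0 that unfolding inj_on_def by blast
have DF: "D i Int F j = {}" if "i<k" "j<l" for i j
proof (rule ccontr)
 assume "D i Int F j~={}"
 hence "QD i Int Qj j~={}" unfolding F_def using QD(2)[OF that(1)] by blast
 hence "QD i = Qj j" by (rule solen_disjoint[OF QD(1)[OF that(1)] Qj(1)[OF that(2)]])
 thus False using Qj(2)[OF that(2)] QD(2)[OF that(1)] D(2)[OF that(1)] by simp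
qed

define \<T> where "\<T> = (UN D:{D. D<=C & finite (G_family f C D)}. G_family f C D)"
define R where "R = card \<T>"
have finT: "finite \<T>" unfolding \<T>_def using finC by auto
obtain Bt where Bt: "Bt ` {..<R} = \<T> & inj_on Bt {..<R}" using finite_enum[OF finT] unfolding R_def by blast

have a: "ALL i<k. G_family f C (D i) = range (Bc i) & (ALL n. basic_set_of f (I i n) (p i n) (Bc i n)) &
  (ALL n. basic_succ f (Bc i n) (Bc i (Suc n))) & (ALL n. p i n<p i (Suc n)) &
  solenoidal_Q f (INT n. orb f (I i n)) & corresponding_group f (INT n. orb f (I i n)) (H_group (p i))" (is "ALL i<k. ?A i")
proof (intro allI impI)
 fix i assume i: "i<k"
 have bs: "basic_set_of f (I i n) (p i n) (Bc i n)" for n unfolding bas_iff Bc_def using Ip(1)[OF i] by blast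
 moreover have "basic_succ f (Bc i n) (Bc i (Suc n))" for n unfolding basic_succ_def using bs[of n] bs[of "Suc n"] Ip(3)[OF i, of n] by blast
 moreover have "p i n<p i (Suc n)" for n using Ip(4)[OF i] by (simp add: strict_mono_Suc_iff)
 moreover have "corresponding_group f (INT n. orb f (I i n)) (H_group (p i))" unfolding corresponding_group_def using Ip(5)[OF i] by blast
 ultimately show "?A i" using Ip(6)[OF i] QD(1)[OF i] unfolding Bc_def QD_def by simp
qed
have b: "ALL i<k. ALL n. EX (E :: (nat \<times> nat) set) \<phi>. finite E & semiconjugation \<phi> (Bc i n) f (markov_chain E) shift &
  at_most_2_to_1 \<phi> (Bc i n)" (is "ALL i<k. ALL n. ?B i n")
proof (intro allI impI)
 fix i n assume i: "i<k"
 show "?B i n" unfolding Bc_def by (rule basic_markov[OF Ip(1)[OF i] Ip(1)[OF i] Ip(3)[OF i]]) (use Ip(2)[OF i] in blast)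
qed
have c: "ALL i<k. ALL j<k. i~=j --> (ALL B\<^sub>1:G_family f C (D i). ALL B\<^sub>2:G_family f C (D j).
  ~ basic_succ f B\<^sub>1 B\<^sub>2 & ~ basic_succ f B\<^sub>2 B\<^sub>1)"
proof (intro allI impI ballI)
 fix i j B1 B2 assume a: "i<k" "j<k" "i~=j" "B1:G_family f C (D i)" "B2:G_family f C (D j)"
 have "~ D j<=D i" "~ D i<=D j" using Ddis[OF a(1-3)] Dne[OF a(1)] Dne[OF a(2)] by blast+
 thus "~ basic_succ f B1 B2 & ~ basic_succ f B2 B1" using succ_trace[OF _ a(4,5)] succ_trace[OF _ a(5,4)] by blast
qed
have d: "{X. basic_set f X} = Bt ` {..<R} Un (UN i<k. range (Bc i))"
proof -
 have "(UN i<k. range (Bc i)) = (UN i<k. G_family f C (D i))" using a by simp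
 also have "... = (UN D:\<D>. G_family f C D)" using D0 by blast
 finally show ?thesis unfolding basic_sets_G using Bt unfolding \<T>_def \<D>_def by auto
qed

have ff: "(%i. INT n. orb f (I i n)) ` {..<k} Un Qj ` {..<l} = Q ` {..<q}"
proof -
 have "X:QD ` {..<k} Un Qj ` {..<l}" if X: "solenoidal_Q f X" for X
 proof (cases "finite (G_family f C (X Int C))")
  case True
  hence "X:\<N>" unfolding \<N>_def using X by blast
  thus ?thesis using Qj0 by blast
 next
  case False
  hence "X Int C:\<D>" unfolding \<D>_def by blast
  then obtain i where i: "i<k" "D i = X Int C" using D0 by (metis imageE lessThan_iff)
  hence "QD i Int X~={}" using QD(2)[OF i(1)] Dne[OF i(1)] by blast
  hence "QD i = X" by (rule solen_disjoint[OF QD(1)[OF i(1)] X])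
  thus ?thesis using i(1) by blast
 qed
 hence "QD ` {..<k} Un Qj ` {..<l} = {X. solenoidal_Q f X}" using QD(1) Qj(1) by auto
 thus ?thesis using Q0 unfolding QD_def by simp
qed
have g: "EX \<L> :: real set set. countable \<L> & disjoint \<L> &
  (ALL M:\<L>. (EX L m. periodic_interval f L m & M = orb f L) & C Int interior M = {}) & maximal_cycles f<=\<Union> \<L>"
 using periodic_cover max_Per by (meson subset_trans)
have "ALL r<R. basic_set f (Bt r)" using d by blast
moreover have "ALL i<k. D i<=C" "ALL j<l. F j<=C" using D(1) unfolding F_def by blast+
moreover have "ALL i<k. ALL j<k. i~=j --> D i Int D j = {}" "ALL i<l. ALL j<l. i~=j --> F i Int F j = {}" "ALL i<k. ALL j<l. D i Int F j = {}"
 using Ddis Fdis DF by blast+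
moreover have "finite {..<q}" "card {..<q}<=card C" using finite_solenoids(2) unfolding q_def by simp_all
ultimately show ?thesis using a b c d e ff g pairs triples i1 omega_closure_Per i2 i4 i5a i5b i5c i5d i5e i5f
 apply -
 apply (rule exI[of _ \<Lambda>], rule exI[of _ B], rule exI[of _ B'], rule exI[of _ "{..<q}"], rule exI[of _ S], rule exI[of _ SO], rule exI[of _ Q])
 apply (intro conjI)
 apply (assumption | rule exI[of _ k], rule exI[of _ D], rule exI[of _ l], rule exI[of _ F], rule exI[of _ R], rule exI[of _ Bt], rule exI[of _ K],
  rule exI[of _ N], rule exI[of _ Qj], rule exI[of _ Bc], rule exI[of _ I], rule exI[of _ p], intro conjI)+
 done
qed

end
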